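(* Let $g$ be an admissible probability weight, let $\mathcal H_0$ be an admissible energy, let $\ell>0$, $T>0$, $\sigma=\mathrm{diag}(\sigma_1,\dots,\sigma_n)$, and let $(F,h)$ be admissible costs. Assume moreover that there are constants $C_1,C_2>0$ such that for all $(\rho,x)\in\mathcal P^\circ(G)\times\mathbb R^n$ and $\mathbb V\in B_\ell$ $$\|D_x\mathcal H_0^{\mathbb V}(\rho,x)\|+\sum_{i=1}^n\Big|\frac{\partial^2\mathcal H_0^{\mathbb V}}{\partial x_i^2}(\rho,x)\Big|\le C_1\mathcal H_0^{\mathbb V}(\rho,x)+C_2 .$$ Then the value function $$U(t,\rho,x)=\inf_{\mathbb V\in\mathscr V_\ell[t,T]}\mathcal J(t,\rho,x;\mathbb V)$$ is a viscosity solution in $(0,T)\times\mathcal P^\circ(G)\times\mathbb R^n$ of the Hamilton--Jacobi--Bellman equation $$\frac{\partial U}{\partial t}+H(t,\rho,x,\partial_\rho U,D_xU,D_x^2U)=0,\qquad U(T,\rho,x)=h(\rho,x).$$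
   Context: **Graph and simplex.** $G=(V,E,\omega)$ is a finite undirected connected weighted graph, $V=\{1,\dots,n\}$, $\omega_{jl}=\omega_{lj}>0$ if $(j,l)\in E$ and $\omega_{jl}=0$ otherwise. $\mathcal P(G)=\{\rho\in[0,1]^n:\sum_i\rho_i=1\}$; $\mathcal P^\circ(G)$ is its (relative) interior. $\|\cdot\|$ is the Euclidean norm. $D_x,D_\rho,D_x^2$ are Euclidean gradients/Hessian (a function of $\rho\in\mathcal P^\circ(G)$ whose Euclidean $\rho$-gradient is taken is understood to be given as a function of $\rho$ on a neighbourhood in $\mathbb R^n$). **Admissible probability weight.** A symmetric function $g:[0,\infty)^2\to[0,\infty)$ such that: $g$ is continuous on $[0,\infty)^2$ and smooth on $(0,\infty)^2$; $\min\{t,r\}\le g(t,r)\le\max\{t,r\}$; $g(\lambda t,\lambda r)=\lambda g(t,r)$ for $\lambda,t,r\ge0$; $g$ is concave; $\int_0^1 g(r,1-r)^{-1/2}\,dr<\infty$. **Locally Lipschitz.** $f:\mathcal P^\circ(G)\times\mathbb R^n\to\mathbb R$ is locally Lipschitz if for all $R_1\in(0,\frac1n)$, $R_2>0$ there is $C=C(R_1,R_2)>0$ with $|f(\rho,x)-f(\mu,y)|\le C(\|\rho-\mu\|+\|x-y\|)$ whenever $\min_i\rho_i\wedge\min_i\mu_i\ge R_1$ and $\max_{(i,j)\in E}|x_i-x_j|\vee\max_{(i,j)\in E}|y_i-y_j|\le R_2$. **Class $(\mathrm{Pr})$.** $\eta\in(\mathrm{Pr})$ if: (i) $\eta\in C^1(\mathcal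 P^\circ(G)\times\mathbb R^n;\mathbb R)$ is bounded below; (ii) for each $R>0$ there are $c\in(0,1)$, $C_1,C_2>0$ depending on $R$ such that $\eta(\rho,x)\le R$ implies $\|D_\rho\eta\|\vee\|D_x\eta\|\le C_1$, $\min_i\rho_i\ge c$, $\sup_{(i,j)\in E}|x_i-x_j|\le C_2$; (iii) $\eta(\rho,x)\to+\infty$ as $\rho\to\partial\mathcal P(G)$ or $|x_i-x_j|\to+\infty$ with $(i,j)\in E$. **Admissible energy.** $\mathcal H_0\in(\mathrm{Pr})$ such that $\mathcal H_0$ and its Euclidean partial derivatives are locally Lipschitz. For a control value $\mathbb V\in\mathbb R^n$ put $\mathcal H_0^{\mathbb V}(\rho,x)=\mathcal H_0(\rho,x)+\sum_i\mathbb V_i\rho_i$. **State equation.** $W$ is a standard $n$-dimensional Brownian motion on a complete filtered probability space $(\Omega,\mathcal F,\{\mathcal F_t\},\mathbb P)$. With $\mathcal H_1(\rho,x)=\sigma\rho=(\sigma_1\rho_1,\dots,\sigma_n\rho_n)^\top$, the stochastic Wasserstein--Hamiltonian system is $d\rho=\frac{\partial}{\partial S}\mathcal H_0^{\mathbb V}\,dt+\frac{\partial}{\partial S}\mathcal H_1\circ dW$, $dS=-\frac{\partial}{\partial\rho}\mathcal H_0^{\mathbb V}\,dt-\frac{\partial}{\partial\rho}\mathcal H_1\circ dW$ (Stratonovich), i.e. $d\rho(s)=D_x\mathcal H_0(\rho(s),S(s))\,ds$, $dS(s)=-\big(D_\rho\mathcal H_0(\rho(s),S(s))+\mathbb V(s)\big)ds-\sigma\,dW(s)$.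 **Control problem.** $B_\ell=\{x\in\mathbb R^n:\|x\|\le\ell\}$; $\mathscr V_\ell[t,T]$ is the set of $\{\mathcal F_s\}$-adapted processes $\mathbb V:\Omega\times[t,T]\to B_\ell$. For $\mathbb V\in\mathscr V_\ell[t,T]$, $\mathcal J(t,\rho,x;\mathbb V)=\mathbb E\big[\int_t^TF(s,\rho(s),S(s),\mathbb V(s))\,ds+h(\rho(T),S(T))\,\big|\,\mathcal F_t\big]$, where $(\rho(\cdot),S(\cdot))$ solves the state equation with control $\mathbb V$ and $\rho(t)=\rho\in\mathcal P^\circ(G)$, $S(t)=x$. **Admissible costs.** $F:[0,T]\times\mathcal P^\circ(G)\times\mathbb R^n\times B_\ell\to\mathbb R$ and $h:\mathcal P^\circ(G)\times\mathbb R^n\to\mathbb R$ such that: (i) $F,h$ are nonnegative and continuous; (ii) for $s\in[0,T]$, $\mathbb V\in B_\ell$, $F(s,\cdot,\cdot,\mathbb V)$ and $h$ are locally Lipschitz; (iii) for $(\rho,x,\mathbb V)$, $F(\cdot,\rho,x,\mathbb V)$ is globally Lipschitz on $[0,T]$; (iv) there are $p_1\ge0$ and $C=C(T,p_1,\ell)>0$ with $F(s,\rho,x,\mathbb V)\vee h(\rho,x)\le C(|\mathcal H_0(\rho,x)|^{p_1}+1)$ for all $s,\rho,x,\mathbb V$. **Hamiltonian.** $H(t,\rho,x,p,q,Q)=\inf_{\mathbb V\in B_\ell}\{\langle p,D_x\mathcal H_0^{\mathbb V}(\rho,x)\rangle-\langle q,D_\rho\mathcal H_0^{\mathbb V}(\rho,x)\rangle+\frac12\mathrm{tr}(\sigma\sigma^\top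 Q)+F(t,\rho,x,\mathbb V)\}$ for $p,q\in\mathbb R^n$, $Q$ symmetric $n\times n$. **Fréchet derivative.** $f:\mathcal P(G)\to\mathbb R$ has Fréchet derivative $\partial_\rho f(\rho)=p$ at $\rho$ if $\sum_ip_i=0$ and $\lim_{s\to0}\frac{f((1-s)\rho+s\mu)-f(\rho)}{s}=\langle p,\mu-\rho\rangle$ for all $\mu\in\mathcal P(G)$; for smooth $f$, $\partial_\rho f=Df-\frac1n(Df^\top\mathbf 1)\mathbf 1$ with $\mathbf 1=(1,\dots,1)^\top$. **Viscosity solution.** A continuous $U$ (on $(0,T]\times\mathcal P^\circ(G)\times\mathbb R^n$) is a viscosity subsolution (resp. supersolution) if $U(T,\cdot)\le h$ (resp. $\ge h$) and for every $z_0=(t_0,\rho_0,x_0)\in(0,T)\times\mathcal P^\circ(G)\times\mathbb R^n$ and every $\varphi\in C^{1,1,2}((0,T)\times\mathcal P^\circ(G)\times\mathbb R^n)$ ($C^1$ in $t$, $C^1$ in $\rho$, $C^2$ in $x$) such that $U-\varphi$ has a local maximum (resp. minimum) at $z_0$, $\frac{\partial\varphi}{\partial t}(z_0)+H(z_0,\partial_\rho\varphi(z_0),D_x\varphi(z_0),D_x^2\varphi(z_0))\ge0$ (resp. $\le0$). A viscosity solution is both a sub- and a supersolution.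
   Formalization: Adds the assumption that the components of D_x H_0 sum to zero on P°(G)×R^n; without it (e.g. after adding sin(x_1+…+x_n) to an admissible H_0) ρ leaves the simplex, the state equation has no solution in P°(G), and U is undefined. *)

theory Defs
  imports "HOL-Analysis.Analysis" "HOL-Probability.Probability"
begin

text \<open>The vertex set \<open>{1,\<dots>,n}\<close> is the finite index type \<open>'n\<close>, so \<open>n = CARD('n)\<close>.\<close>

definition grad :: "('a::real_inner \<Rightarrow> real) \<Rightarrow> 'a \<Rightarrow> 'a" where
  "grad f x = (THE D. GDERIV f x :> D)"

definition hessian :: "(real^'n \<Rightarrow> real) \<Rightarrow> real^'n \<Rightarrow> real^'n^'n" where
  "hessian f x = jacobian (grad f) (at x)"

primrec C_k_on :: "nat \<Rightarrow> ('a::real_normed_vector \<Rightarrow> real) \<Rightarrow> 'a set \<Rightarrow> bool" where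
  "C_k_on 0 f U \<longleftrightarrow> continuous_on U f"
| "C_k_on (Suc k) f U \<longleftrightarrow>
     (\<forall>z\<in>U. f differentiable at z) \<and> (\<forall>v. C_k_on k (\<lambda>z. frechet_derivative f (at z) v) U)"

definition partial_on_line :: "'n \<Rightarrow> (real^'n \<Rightarrow> real) \<Rightarrow> real^'n \<Rightarrow> real \<Rightarrow> real" where
  "partial_on_line i f x = deriv (\<lambda>s. f (x + s *\<^sub>R axis i 1))"

definition second_partial :: "'n \<Rightarrow> (real^'n \<Rightarrow> real) \<Rightarrow> real^'n \<Rightarrow> real" where
  "second_partial i f x = deriv (partial_on_line i f x) 0"

definition has_second_partial :: "'n \<Rightarrow> (real^'n \<Rightarrow> real) \<Rightarrow> real^'n \<Rightarrow> bool" where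
  "has_second_partial i f x \<longleftrightarrow>
     (\<forall>s. (\<lambda>r. f (x + r *\<^sub>R axis i 1)) differentiable at s) \<and>
     partial_on_line i f x differentiable at 0"

definition weighted_graph :: "('n \<times> 'n) set \<Rightarrow> ('n \<Rightarrow> 'n \<Rightarrow> real) \<Rightarrow> bool" where
  "weighted_graph E w \<longleftrightarrow> sym E \<and> E\<^sup>* = UNIV \<and>
     (\<forall>j l. w j l = w l j) \<and> (\<forall>j l. (j, l) \<in> E \<longrightarrow> w j l > 0) \<and> (\<forall>j l. (j, l) \<notin> E \<longrightarrow> w j l = 0)"

definition simplex_P :: "(real^'n) set" where
  "simplex_P = {\<rho>. (\<forall>i. \<rho> $ i \<in> {0..1}) \<and> (\<Sum>i\<in>UNIV. \<rho> $ i) = 1}"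

abbreviation simplex_int :: "(real^'n) set" where
  "simplex_int \<equiv> rel_interior simplex_P"

definition admissible_weight :: "(real \<Rightarrow> real \<Rightarrow> real) \<Rightarrow> bool" where
  "admissible_weight g \<longleftrightarrow>
     (\<forall>t\<ge>0. \<forall>r\<ge>0. 0 \<le> g t r \<and> g t r = g r t) \<and>
     continuous_on ({0..} \<times> {0..}) (\<lambda>(t, r). g t r) \<and>
     (\<forall>k. C_k_on k (\<lambda>(t, r). g t r) ({0<..} \<times> {0<..})) \<and>
     (\<forall>t\<ge>0. \<forall>r\<ge>0. min t r \<le> g t r \<and> g t r \<le> max t r) \<and>
     (\<forall>c\<ge>0. \<forall>t\<ge>0. \<forall>r\<ge>0. g (c * t) (c * r) = c * g t r) \<and>
     concave_on ({0..} \<times> {0..}) (\<lambda>(t, r). g t r) \<and>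
     set_integrable lborel {0..1} (\<lambda>r. g r (1 - r) powr (-1/2))"

definition D_rho :: "(real^'n \<Rightarrow> real^'n \<Rightarrow> real) \<Rightarrow> real^'n \<Rightarrow> real^'n \<Rightarrow> real^'n" where
  "D_rho f \<rho> x = grad (\<lambda>r. f r x) \<rho>"

definition D_x :: "(real^'n \<Rightarrow> real^'n \<Rightarrow> real) \<Rightarrow> real^'n \<Rightarrow> real^'n \<Rightarrow> real^'n" where
  "D_x f \<rho> x = grad (f \<rho>) x"

definition locally_Lipschitz ::
  "('n \<times> 'n) set \<Rightarrow> (real^'n \<Rightarrow> real^'n \<Rightarrow> real) \<Rightarrow> bool" where
  "locally_Lipschitz E f \<longleftrightarrow>
     (\<forall>R1 R2. 0 < R1 \<and> R1 < 1 / real CARD('n) \<and> 0 < R2 \<longrightarrow>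
       (\<exists>C>0. \<forall>\<rho>\<in>simplex_int. \<forall>\<mu>\<in>simplex_int. \<forall>x y.
          (\<forall>i. R1 \<le> \<rho> $ i \<and> R1 \<le> \<mu> $ i) \<and>
          (\<forall>(i, j)\<in>E. \<bar>x $ i - x $ j\<bar> \<le> R2 \<and> \<bar>y $ i - y $ j\<bar> \<le> R2) \<longrightarrow>
          \<bar>f \<rho> x - f \<mu> y\<bar> \<le> C * (norm (\<rho> - \<mu>) + norm (x - y))))"

text \<open>Euclidean gradients in \<open>\<rho>\<close> require values off the simplex: the open set \<open>N\<close> is the
  neighbourhood of \<open>simplex_int\<close> on which the function is given.\<close>

definition Pr_class ::
  "('n \<times> 'n) set \<Rightarrow> (real^'n \<Rightarrow> real^'n \<Rightarrow> real) \<Rightarrow> bool" where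
  "Pr_class E \<eta> \<longleftrightarrow>
     (\<exists>N. open N \<and> simplex_int \<subseteq> N \<and> C_k_on 1 (\<lambda>(\<rho>, x). \<eta> \<rho> x) (N \<times> UNIV)) \<and>
     (\<exists>b. \<forall>\<rho>\<in>simplex_int. \<forall>x. b \<le> \<eta> \<rho> x) \<and>
     (\<forall>R>0. \<exists>c C1 C2. 0 < c \<and> c < 1 \<and> 0 < C1 \<and> 0 < C2 \<and>
        (\<forall>\<rho>\<in>simplex_int. \<forall>x. \<eta> \<rho> x \<le> R \<longrightarrow>
           norm (D_rho \<eta> \<rho> x) \<le> C1 \<and> norm (D_x \<eta> \<rho> x) \<le> C1 \<and>
           (\<forall>i. c \<le> \<rho> $ i) \<and> (\<forall>(i, j)\<in>E. \<bar>x $ i - x $ j\<bar> \<le> C2))) \<and>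
     (\<forall>K. \<exists>\<delta>>0. \<exists>L. \<forall>\<rho>\<in>simplex_int. \<forall>x.
        (\<exists>\<mu>\<in>rel_frontier simplex_P. dist \<rho> \<mu> < \<delta>) \<or> (\<exists>(i, j)\<in>E. L < \<bar>x $ i - x $ j\<bar>) \<longrightarrow>
        K < \<eta> \<rho> x)"

definition admissible_energy ::
  "('n \<times> 'n) set \<Rightarrow> (real^'n \<Rightarrow> real^'n \<Rightarrow> real) \<Rightarrow> bool" where
  "admissible_energy E H0 \<longleftrightarrow> Pr_class E H0 \<and> locally_Lipschitz E H0 \<and>
     (\<forall>i. locally_Lipschitz E (\<lambda>\<rho> x. D_rho H0 \<rho> x $ i)) \<and>
     (\<forall>i. locally_Lipschitz E (\<lambda>\<rho> x. D_x H0 \<rho> x $ i))"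

text \<open>The state equation \<open>d\<rho> = D_x H0 ds\<close> is an equation on the simplex, so the field \<open>D_x H0\<close>
  has to be tangent to it. Admissibility of the energy does not imply this: if \<open>H0 \<rho> x\<close> is an
  admissible energy depending on \<open>x\<close> only through the differences \<open>x_i - x_j\<close>, then adding
  \<open>sin (x_1 + \<dots> + x_n)\<close> keeps it admissible but drives \<open>\<rho>\<close> off the simplex, and the control
  problem has no state process.\<close>

definition tangent_to_simplex :: "(real^'n \<Rightarrow> real^'n \<Rightarrow> real) \<Rightarrow> bool" where
  "tangent_to_simplex H0 \<longleftrightarrow> (\<forall>\<rho>\<in>simplex_int. \<forall>x. (\<Sum>i\<in>UNIV. D_x H0 \<rho> x $ i) = 0)"

definition controlled_energy ::
  "(real^'n \<Rightarrow> real^'n \<Rightarrow> real) \<Rightarrow> real^'n \<Rightarrow> real^'n \<Rightarrow> real^'n \<Rightarrow> real" where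
  "controlled_energy H0 v \<rho> x = H0 \<rho> x + (\<Sum>i\<in>UNIV. v $ i * \<rho> $ i)"

text \<open>The filtration is indexed by all reals to match the locale \<open>filtration\<close>; only
  nonnegative times are used.\<close>

definition complete_filtered_prob_space :: "'w measure \<Rightarrow> (real \<Rightarrow> 'w measure) \<Rightarrow> bool" where
  "complete_filtered_prob_space M \<F> \<longleftrightarrow>
     prob_space M \<and> complete_measure M \<and> filtration (space M) \<F> \<and>
     (\<forall>s. subalgebra M (\<F> s)) \<and> null_sets M \<subseteq> sets (\<F> 0)"

definition standard_Brownian_motion ::
  "'w measure \<Rightarrow> (real \<Rightarrow> 'w measure) \<Rightarrow> (real \<Rightarrow> 'w \<Rightarrow> real^'n) \<Rightarrow> bool" where
  "standard_Brownian_motion M \<F> W \<longleftrightarrow>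
     (\<forall>s\<ge>0. W s \<in> borel_measurable (\<F> s)) \<and>
     (AE \<omega> in M. W 0 \<omega> = 0) \<and>
     (AE \<omega> in M. continuous_on {0..} (\<lambda>s. W s \<omega>)) \<and>
     (\<forall>s t. 0 \<le> s \<and> s < t \<longrightarrow>
        prob_space.indep_set M (sets (\<F> s))
          {(\<lambda>\<omega>. W t \<omega> - W s \<omega>) -` A \<inter> space M | A. A \<in> sets borel} \<and>
        distributed M lborel (\<lambda>\<omega>. W t \<omega> - W s \<omega>)
          (\<lambda>x. ennreal (\<Prod>i\<in>UNIV. normal_density 0 (sqrt (t - s)) (x $ i))))"

definition diag_matrix :: "real^'n \<Rightarrow> real^'n^'n" where
  "diag_matrix d = (\<chi> i j. if i = j then d $ i else 0)"

text \<open>Joint measurability is what gives the time integrals of an adapted control a meaning.\<close>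

definition controls ::
  "'w measure \<Rightarrow> (real \<Rightarrow> 'w measure) \<Rightarrow> real \<Rightarrow> real \<Rightarrow> real \<Rightarrow> (real \<Rightarrow> 'w \<Rightarrow> real^'n) set" where
  "controls M \<F> l t T = {V.
     (\<forall>s\<in>{t..T}. V s \<in> borel_measurable (\<F> s)) \<and>
     (\<lambda>(s, \<omega>). V s \<omega>) \<in> borel_measurable (restrict_space borel {t..T} \<Otimes>\<^sub>M M) \<and>
     (\<forall>s\<in>{t..T}. \<forall>\<omega>\<in>space M. V s \<omega> \<in> cball 0 l)}"

text \<open>With \<open>H1 \<rho> x = \<sigma> \<rho>\<close> the noise is additive and enters \<open>S\<close> only, so the Stratonovich system
  is the pathwise integral system below.\<close>

definition solves_state_equation ::
  "'w measure \<Rightarrow> (real \<Rightarrow> 'w measure) \<Rightarrow> (real \<Rightarrow> 'w \<Rightarrow> real^'n) \<Rightarrow> real^'n^'n \<Rightarrow>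
   (real^'n \<Rightarrow> real^'n \<Rightarrow> real) \<Rightarrow> real \<Rightarrow> real \<Rightarrow> real^'n \<Rightarrow> real^'n \<Rightarrow>
   (real \<Rightarrow> 'w \<Rightarrow> real^'n) \<Rightarrow> (real \<Rightarrow> 'w \<Rightarrow> real^'n) \<Rightarrow> (real \<Rightarrow> 'w \<Rightarrow> real^'n) \<Rightarrow> bool" where
  "solves_state_equation M \<F> W \<sigma> H0 T t \<rho> x V R S \<longleftrightarrow>
     (\<forall>s\<in>{t..T}. R s \<in> borel_measurable (\<F> s) \<and> S s \<in> borel_measurable (\<F> s)) \<and>
     (AE \<omega> in M.
        continuous_on {t..T} (\<lambda>s. R s \<omega>) \<and> continuous_on {t..T} (\<lambda>s. S s \<omega>) \<and>
        (\<forall>s\<in>{t..T}. R s \<omega> \<in> simplex_int \<and>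
           R s \<omega> = \<rho> + (LBINT r:{t..s}. D_x H0 (R r \<omega>) (S r \<omega>)) \<and>
           S s \<omega> = x - (LBINT r:{t..s}. D_rho H0 (R r \<omega>) (S r \<omega>) + V r \<omega>)
                     - \<sigma> *v (W s \<omega> - W t \<omega>)))"

definition admissible_costs ::
  "('n \<times> 'n) set \<Rightarrow> (real^'n \<Rightarrow> real^'n \<Rightarrow> real) \<Rightarrow> real \<Rightarrow> real \<Rightarrow>
   (real \<Rightarrow> real^'n \<Rightarrow> real^'n \<Rightarrow> real^'n \<Rightarrow> real) \<Rightarrow> (real^'n \<Rightarrow> real^'n \<Rightarrow> real) \<Rightarrow> bool" where
  "admissible_costs E H0 l T F h \<longleftrightarrow>
     (\<forall>s\<in>{0..T}. \<forall>\<rho>\<in>simplex_int. \<forall>x. \<forall>v\<in>cball 0 l. 0 \<le> F s \<rho> x v) \<and>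
     (\<forall>\<rho>\<in>simplex_int. \<forall>x. 0 \<le> h \<rho> x) \<and>
     continuous_on ({0..T} \<times> simplex_int \<times> UNIV \<times> cball 0 l) (\<lambda>(s, \<rho>, x, v). F s \<rho> x v) \<and>
     continuous_on (simplex_int \<times> UNIV) (\<lambda>(\<rho>, x). h \<rho> x) \<and>
     (\<forall>s\<in>{0..T}. \<forall>v\<in>cball 0 l. locally_Lipschitz E (\<lambda>\<rho> x. F s \<rho> x v)) \<and>
     locally_Lipschitz E h \<and>
     (\<forall>\<rho>\<in>simplex_int. \<forall>x. \<forall>v\<in>cball 0 l. \<exists>L. L-lipschitz_on {0..T} (\<lambda>s. F s \<rho> x v)) \<and>
     (\<exists>p\<ge>0. \<exists>C>0. \<forall>s\<in>{0..T}. \<forall>\<rho>\<in>simplex_int. \<forall>x. \<forall>v\<in>cball 0 l.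
        max (F s \<rho> x v) (h \<rho> x) \<le> C * (\<bar>H0 \<rho> x\<bar> powr p + 1))"

definition cost_functional ::
  "'w measure \<Rightarrow> (real \<Rightarrow> 'w measure) \<Rightarrow> (real \<Rightarrow> 'w \<Rightarrow> real^'n) \<Rightarrow> real^'n^'n \<Rightarrow>
   (real^'n \<Rightarrow> real^'n \<Rightarrow> real) \<Rightarrow> real \<Rightarrow>
   (real \<Rightarrow> real^'n \<Rightarrow> real^'n \<Rightarrow> real^'n \<Rightarrow> real) \<Rightarrow> (real^'n \<Rightarrow> real^'n \<Rightarrow> real) \<Rightarrow>
   real \<Rightarrow> real^'n \<Rightarrow> real^'n \<Rightarrow> (real \<Rightarrow> 'w \<Rightarrow> real^'n) \<Rightarrow> 'w \<Rightarrow> real" where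
  "cost_functional M \<F> W \<sigma> H0 T F h t \<rho> x V =
     (let (R, S) = (SOME (R, S). solves_state_equation M \<F> W \<sigma> H0 T t \<rho> x V R S)
      in real_cond_exp M (\<F> t)
           (\<lambda>\<omega>. (LBINT s:{t..T}. F s (R s \<omega>) (S s \<omega>) (V s \<omega>)) + h (R T \<omega>) (S T \<omega>)))"

definition is_ess_inf :: "'w measure \<Rightarrow> ('w \<Rightarrow> real) set \<Rightarrow> ('w \<Rightarrow> real) \<Rightarrow> bool" where
  "is_ess_inf M \<J> Y \<longleftrightarrow>
     Y \<in> borel_measurable M \<and> (\<forall>J\<in>\<J>. AE \<omega> in M. Y \<omega> \<le> J \<omega>) \<and>
     (\<forall>Z\<in>borel_measurable M. (\<forall>J\<in>\<J>. AE \<omega> in M. Z \<omega> \<le> J \<omega>) \<longrightarrow> (AE \<omega> in M. Z \<omega> \<le> Y \<omega>))"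

text \<open>Each cost is an \<open>\<F> t\<close>-measurable random variable determined up to null sets, so the
  infimum over controls is the essential infimum; the value function is the real number to
  which it is almost surely equal.\<close>

definition value_function ::
  "'w measure \<Rightarrow> (real \<Rightarrow> 'w measure) \<Rightarrow> (real \<Rightarrow> 'w \<Rightarrow> real^'n) \<Rightarrow> real^'n^'n \<Rightarrow>
   (real^'n \<Rightarrow> real^'n \<Rightarrow> real) \<Rightarrow> real \<Rightarrow> real \<Rightarrow>
   (real \<Rightarrow> real^'n \<Rightarrow> real^'n \<Rightarrow> real^'n \<Rightarrow> real) \<Rightarrow> (real^'n \<Rightarrow> real^'n \<Rightarrow> real) \<Rightarrow>
   real \<Rightarrow> real^'n \<Rightarrow> real^'n \<Rightarrow> real" where
  "value_function M \<F> W \<sigma> H0 l T F h t \<rho> x =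
     (THE u. is_ess_inf M (cost_functional M \<F> W \<sigma> H0 T F h t \<rho> x ` controls M \<F> l t T) (\<lambda>_. u))"

definition hamiltonian ::
  "(real^'n \<Rightarrow> real^'n \<Rightarrow> real) \<Rightarrow> real^'n^'n \<Rightarrow> real \<Rightarrow>
   (real \<Rightarrow> real^'n \<Rightarrow> real^'n \<Rightarrow> real^'n \<Rightarrow> real) \<Rightarrow>
   real \<Rightarrow> real^'n \<Rightarrow> real^'n \<Rightarrow> real^'n \<Rightarrow> real^'n \<Rightarrow> real^'n^'n \<Rightarrow> real" where
  "hamiltonian H0 \<sigma> l F t \<rho> x p q Q =
     (INF v\<in>cball 0 l. p \<bullet> D_x (controlled_energy H0 v) \<rho> x - q \<bullet> D_rho (controlled_energy H0 v) \<rho> x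
        + 1/2 * trace (\<sigma> ** transpose \<sigma> ** Q) + F t \<rho> x v)"

text \<open>The limit is one-sided because only the segment from \<open>\<rho>\<close> towards \<open>\<mu>\<close> is sure to stay
  inside the simplex.\<close>

definition has_simplex_derivative :: "(real^'n \<Rightarrow> real) \<Rightarrow> real^'n \<Rightarrow> real^'n \<Rightarrow> bool" where
  "has_simplex_derivative f \<rho> p \<longleftrightarrow>
     (\<Sum>i\<in>UNIV. p $ i) = 0 \<and>
     (\<forall>\<mu>\<in>simplex_P. ((\<lambda>s. (f ((1 - s) *\<^sub>R \<rho> + s *\<^sub>R \<mu>) - f \<rho>) / s) \<longlongrightarrow> p \<bullet> (\<mu> - \<rho>)) (at_right 0))"

definition simplex_derivative :: "(real^'n \<Rightarrow> real) \<Rightarrow> real^'n \<Rightarrow> real^'n" where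
  "simplex_derivative f \<rho> = (THE p. has_simplex_derivative f \<rho> p)"

definition test_function :: "real \<Rightarrow> (real \<Rightarrow> real^'n \<Rightarrow> real^'n \<Rightarrow> real) \<Rightarrow> bool" where
  "test_function T \<phi> \<longleftrightarrow> (\<exists>N. open N \<and> simplex_int \<subseteq> N \<and>
     (\<forall>t\<in>{0<..<T}. \<forall>\<rho>\<in>N. \<forall>x.
        (\<lambda>s. \<phi> s \<rho> x) differentiable at t \<and> (\<lambda>r. \<phi> t r x) differentiable at \<rho> \<and>
        \<phi> t \<rho> differentiable at x \<and> grad (\<phi> t \<rho>) differentiable at x) \<and>
     continuous_on ({0<..<T} \<times> N \<times> UNIV) (\<lambda>(t, \<rho>, x). deriv (\<lambda>s. \<phi> s \<rho> x) t) \<and>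
     continuous_on ({0<..<T} \<times> N \<times> UNIV) (\<lambda>(t, \<rho>, x). grad (\<lambda>r. \<phi> t r x) \<rho>) \<and>
     continuous_on ({0<..<T} \<times> N \<times> UNIV) (\<lambda>(t, \<rho>, x). grad (\<phi> t \<rho>) x) \<and>
     continuous_on ({0<..<T} \<times> N \<times> UNIV) (\<lambda>(t, \<rho>, x). hessian (\<phi> t \<rho>) x))"

definition local_max_on :: "('a::topological_space \<Rightarrow> real) \<Rightarrow> 'a set \<Rightarrow> 'a \<Rightarrow> bool" where
  "local_max_on f D z \<longleftrightarrow> z \<in> D \<and> (\<forall>\<^sub>F y in at z within D. f y \<le> f z)"

definition local_min_on :: "('a::topological_space \<Rightarrow> real) \<Rightarrow> 'a set \<Rightarrow> 'a \<Rightarrow> bool" where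
  "local_min_on f D z \<longleftrightarrow> z \<in> D \<and> (\<forall>\<^sub>F y in at z within D. f z \<le> f y)"

definition HJB_expression ::
  "(real \<Rightarrow> real^'n \<Rightarrow> real^'n \<Rightarrow> real^'n \<Rightarrow> real^'n \<Rightarrow> real^'n^'n \<Rightarrow> real) \<Rightarrow>
   (real \<Rightarrow> real^'n \<Rightarrow> real^'n \<Rightarrow> real) \<Rightarrow> real \<Rightarrow> real^'n \<Rightarrow> real^'n \<Rightarrow> real" where
  "HJB_expression H \<phi> t \<rho> x = deriv (\<lambda>s. \<phi> s \<rho> x) t +
     H t \<rho> x (simplex_derivative (\<lambda>r. \<phi> t r x) \<rho>) (grad (\<phi> t \<rho>) x) (hessian (\<phi> t \<rho>) x)"

definition viscosity_subsolution ::
  "(real \<Rightarrow> real^'n \<Rightarrow> real^'n \<Rightarrow> real^'n \<Rightarrow> real^'n \<Rightarrow> real^'n^'n \<Rightarrow> real) \<Rightarrow> real \<Rightarrow>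
   (real^'n \<Rightarrow> real^'n \<Rightarrow> real) \<Rightarrow> (real \<Rightarrow> real^'n \<Rightarrow> real^'n \<Rightarrow> real) \<Rightarrow> bool" where
  "viscosity_subsolution H T h U \<longleftrightarrow>
     continuous_on ({0<..T} \<times> simplex_int \<times> UNIV) (\<lambda>(t, \<rho>, x). U t \<rho> x) \<and>
     (\<forall>\<rho>\<in>simplex_int. \<forall>x. U T \<rho> x \<le> h \<rho> x) \<and>
     (\<forall>\<phi> t \<rho> x. test_function T \<phi> \<and>
        local_max_on (\<lambda>(t, \<rho>, x). U t \<rho> x - \<phi> t \<rho> x) ({0<..<T} \<times> simplex_int \<times> UNIV) (t, \<rho>, x) \<longrightarrow>
        HJB_expression H \<phi> t \<rho> x \<ge> 0)"

definition viscosity_supersolution ::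
  "(real \<Rightarrow> real^'n \<Rightarrow> real^'n \<Rightarrow> real^'n \<Rightarrow> real^'n \<Rightarrow> real^'n^'n \<Rightarrow> real) \<Rightarrow> real \<Rightarrow>
   (real^'n \<Rightarrow> real^'n \<Rightarrow> real) \<Rightarrow> (real \<Rightarrow> real^'n \<Rightarrow> real^'n \<Rightarrow> real) \<Rightarrow> bool" where
  "viscosity_supersolution H T h U \<longleftrightarrow>
     continuous_on ({0<..T} \<times> simplex_int \<times> UNIV) (\<lambda>(t, \<rho>, x). U t \<rho> x) \<and>
     (\<forall>\<rho>\<in>simplex_int. \<forall>x. U T \<rho> x \<ge> h \<rho> x) \<and>
     (\<forall>\<phi> t \<rho> x. test_function T \<phi> \<and>
        local_min_on (\<lambda>(t, \<rho>, x). U t \<rho> x - \<phi> t \<rho> x) ({0<..<T} \<times> simplex_int \<times> UNIV) (t, \<rho>, x) \<longrightarrow>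
        HJB_expression H \<phi> t \<rho> x \<le> 0)"

definition viscosity_solution ::
  "(real \<Rightarrow> real^'n \<Rightarrow> real^'n \<Rightarrow> real^'n \<Rightarrow> real^'n \<Rightarrow> real^'n^'n \<Rightarrow> real) \<Rightarrow> real \<Rightarrow>
   (real^'n \<Rightarrow> real^'n \<Rightarrow> real) \<Rightarrow> (real \<Rightarrow> real^'n \<Rightarrow> real^'n \<Rightarrow> real) \<Rightarrow> bool" where
  "viscosity_solution H T h U \<longleftrightarrow> viscosity_subsolution H T h U \<and> viscosity_supersolution H T h U"

end

theory Submission
 imports Defs
begin

text \<open>Along the drift the energy is conserved up to the control term, and the growth condition bounds
the second order terms produced by the noise. Hence powers of the energy are Lyapunov functions:
uniformly in the control, the state stays with high probability in a fixed part of the domain where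
all coefficients are Lipschitz. Truncating there gives bounded problems, whose values are the limits
of the dynamic programming recursion for the Euler scheme with Gaussian increments. Comparing this
recursion over one short step with a test function, at a point where the penalised difference is
almost maximal, yields both viscosity inequalities. Restricting the cost bounds to events of the
\<open>\<sigma>\<close>-algebra at the initial time shows that the essential infimum of the conditional costs is the
deterministic infimum of their means.\<close>

section \<open>Gaussian increments\<close>

text \<open>The energy blows up at the boundary and controls are merely adapted, so dynamic
  programming is done for Euler chains, where near-optimal feedback can be chosen by hand, and with
  the drift composed with the projection onto a closed convex set. A control enters a chain through
  averages over the preceding cell: they are adapted, and they converge almost everywhere by
  Lebesgue differentiation. The energy is only known to have pure second derivatives in the momenta,
  without continuity in the point. Expansions therefore use second differences along the axes,
  averaged over reflections of the increment; confining the increment to a cube costs O(d^2) in a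
  step of length d. The limits are separated by uniformity. The mesh tends to 0 at fixed truncation;
  the Lyapunov constant is fixed before the energy cap and the projection set; the cost cap N is
  fixed before the bad event, whose probability is multiplied by N. The penalised difference is
  maximised for the discrete value itself, over grid times, so that the discrete Bellman equation
  can be inserted at the near-maximiser.\<close>

definition gauss :: "real => (real^'n) measure" where
 "gauss d = density lborel (%x. ennreal (\<Prod>i\<in>UNIV. normal_density 0 (sqrt d) (x $ i)))"

lemma sets_gauss[simp, measurable_cong]: "sets (gauss d) = sets borel"
 and space_gauss[simp]: "space (gauss d) = UNIV" by (simp_all add: gauss_def)

lemma prod_Basis_vec: "(\<Prod>b\<in>(Basis :: (real^'n) set). g b) = (\<Prod>i\<in>UNIV. g (axis i 1))"
proof -
 have "inj (%i::'n. axis i (1::real))" by (auto simp: inj_on_def axis_eq_axis)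
 moreover have "(Basis :: (real^'n) set) = range (%i. axis i 1)" by (auto simp: Basis_vec_def)
 ultimately show ?thesis by (metis (no_types, lifting) comp_apply prod.cong prod.reindex)
qed

text \<open>Nonnegative integrals factor over the coordinates with no integrability condition; the
  total mass and all even moments are read off from this one product formula.\<close>

lemma nn_integral_gauss_prod:
 fixes h :: "'n::finite => real => real"
 assumes [measurable]: "!!i. h i \<in> borel_measurable borel" and nn: "!!i x. 0 <= h i x"
 shows "(\<integral>\<^sup>+y. ennreal (\<Prod>i\<in>UNIV. h i (y $ i)) \<partial>gauss d)
  = (\<Prod>i\<in>UNIV. \<integral>\<^sup>+x. ennreal (normal_density 0 (sqrt d) x * h i x) \<partial>lborel)"
proof -
 let ?ix = "inv (%i::'n. axis i (1::real))"
 have inj: "inj (%i::'n. axis i (1::real))" by (auto simp: inj_on_def axis_eq_axis)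
 define f where "f b x = ennreal (normal_density 0 (sqrt d) x * h (?ix b) x)" for b x
 have [measurable]: "f b \<in> borel_measurable borel" for b unfolding f_def by measurable
 have "(\<integral>\<^sup>+y. ennreal (\<Prod>i\<in>UNIV. h i (y $ i)) \<partial>gauss d)
   = (\<integral>\<^sup>+y. ennreal (\<Prod>i\<in>UNIV. normal_density 0 (sqrt d) (y $ i)) * ennreal (\<Prod>i\<in>UNIV. h i (y $ i)) \<partial>lborel)"
  unfolding gauss_def by (subst nn_integral_density) (auto)
 also have "... = (\<integral>\<^sup>+y. (\<Prod>b\<in>Basis. f b (y \<bullet> b)) \<partial>lborel)" by (intro nn_integral_cong)
   (simp add: prod_Basis_vec f_def inv_f_f[OF inj] inner_axis prod_ennreal ennreal_mult'[symmetric]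
    nn prod_nonneg prod.distrib)
 also have "... = (\<Prod>b\<in>Basis. \<integral>\<^sup>+x. f b x \<partial>lborel)" by (rule nn_integral_lborel_prod) auto
 finally show ?thesis by (simp add: prod_Basis_vec f_def inv_f_f[OF inj])
qed

section \<open>Total mass and even moments of the increment\<close>

lemma nn_integral_normal_density_1:
 assumes "0 < d"
 shows "(\<integral>\<^sup>+x. ennreal (normal_density 0 (sqrt d) x) \<partial>lborel) = 1" using assms by (subst nn_integral_eq_integral) auto

lemma prob_space_gauss: assumes "0 < d" shows "prob_space (gauss d :: (real^'n::finite) measure)"
proof
 have "(\<integral>\<^sup>+y. ennreal (\<Prod>i\<in>(UNIV::'n set). 1) \<partial>(gauss d :: (real^'n) measure)) = 1"
  using nn_integral_gauss_prod[where h="%(_::'n) _. 1" and d=d] by (simp add: nn_integral_normal_density_1 assms)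
 thus "emeasure (gauss d :: (real^'n) measure) (space (gauss d)) = 1" by (simp add: )
qed

lemma gauss_moment_even:
 fixes i :: "'n::finite"
 assumes "0 < d"
 shows "has_bochner_integral (gauss d) (%y. (y $ i) ^ (2 * k)) (fact (2 * k) / ((2 / d) ^ k * fact k))"
proof (rule has_bochner_integral_nn_integral)
 let ?h = "%j x. if j = i then x ^ (2 * k) else (1::real)"
 have eq: "(y $ i) ^ (2 * k) = (\<Prod>j\<in>UNIV. ?h j (y $ j))" for y :: "real^'n" using prod.delta[of UNIV i "%j. (y $ j) ^ (2 * k)"] by simp
 have "(\<integral>\<^sup>+y. ennreal ((y $ i) ^ (2 * k)) \<partial>gauss d)
  = (\<Prod>j\<in>UNIV. \<integral>\<^sup>+x. ennreal (normal_density 0 (sqrt d) x * ?h j x) \<partial>lborel)" unfolding eq by (rule nn_integral_gauss_prod) auto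
 also have "... = (\<Prod>j\<in>UNIV. if j = i then \<integral>\<^sup>+x. ennreal (normal_density 0 (sqrt d) x * x ^ (2 * k)) \<partial>lborel else 1)"
  by (intro prod.cong refl) (auto simp: nn_integral_normal_density_1 assms)
 also have "... = (\<integral>\<^sup>+x. ennreal (normal_density 0 (sqrt d) x * x ^ (2 * k)) \<partial>lborel)" by (subst prod.delta) auto
 also have "... = ennreal (fact (2 * k) / ((2 / d) ^ k * fact k))" using normal_moment_even[of "sqrt d" 0 k] assms by (subst nn_integral_eq_integral)
   (auto simp: has_bochner_integral_iff intro!: AE_I2 mult_nonneg_nonneg)
 finally show "(\<integral>\<^sup>+y. ennreal ((y $ i) ^ (2 * k)) \<partial>gauss d) = ennreal (fact (2 * k) / ((2 / d) ^ k * fact k))" .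
qed (use assms in auto)

lemma gauss_square:
 assumes "0 < d"
 shows "integrable (gauss d) (%y. (y $ i)\<^sup>2)" "(LINT y|gauss d. (y $ i)\<^sup>2) = d"
 using gauss_moment_even[OF assms, of i 1] assms by (auto simp: has_bochner_integral_iff)

lemma gauss_fourth:
 assumes "0 < d"
 shows "integrable (gauss d) (%y. (y $ i) ^ 4)" "(LINT y|gauss d. (y $ i) ^ 4) = 3 * d\<^sup>2" using gauss_moment_even[OF assms, of i 2] assms
 by (auto simp: has_bochner_integral_iff fact_numeral power2_eq_square)

text \<open>With factors of modulus 1 this is a product of coordinate reflections, which preserves
  \<open>gauss\<close>; with factors 0 and 1 it is a coordinate projection.
  \<open>gauss_symmetrize\<close> uses both.\<close>

definition flip :: "('n => real) => real^'n => real^'n" where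
 "flip c y = (\<chi> i. c i * y $ i)"

lemma flip_nth[simp]: "flip c y $ i = c i * y $ i" by (simp add: flip_def)

lemma borel_measurable_flip[measurable]: "flip c \<in> borel_measurable borel" unfolding flip_def by (intro borel_measurable_continuous_onI continuous_intros)

text \<open>The Jacobian has modulus 1, so Lebesgue measure is preserved, and the density depends on
  the coordinates only through their squares.\<close>

lemma distr_gauss_flip:
 fixes c :: "'n::finite => real"
 assumes c: "!!i. abs (c i) = 1"
 shows "distr (gauss d) borel (flip c) = gauss d"
proof -
 let ?ix = "inv (%i::'n. axis i (1::real))"
 let ?c = "%b. c (?ix b)"
 have inj: "inj (%i::'n. axis i (1::real))" by (auto simp: inj_on_def axis_eq_axis)
 have B: "(Basis :: (real^'n) set) = range (%i. axis i 1)" by (auto simp: Basis_vec_def)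
 have T: "(0 + (\<Sum>j\<in>Basis. (?c j * (x \<bullet> j)) *\<^sub>R j)) = flip c x" for x :: "real^'n"
 proof (subst B, subst sum.reindex[OF inj], simp add: inv_f_f[OF inj] inner_axis, rule vec_eq_iff[THEN iffD2], rule allI)
  fix i
  show "(\<Sum>xa\<in>UNIV. (c xa * x $ xa) *\<^sub>R axis xa 1) $ i = flip c x $ i" by (simp add: axis_def if_distrib cong: if_cong)
 qed
 have "c i ~= 0" for i using c[of i] by auto
 hence "lborel = density (distr lborel borel (flip c)) (%_. (\<Prod>j\<in>(Basis::(real^'n) set). abs (?c j)))"
  using lborel_affine_euclidean[of ?c 0] unfolding T by auto
 hence L: "distr lborel borel (flip c) = lborel" by (simp add: c density_1)
 let ?f = "%x::real^'n. ennreal (\<Prod>i\<in>UNIV. normal_density 0 (sqrt d) (x $ i))"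
 have inv: "?f (flip c x) = ?f x" for x
 proof -
  have "(c i * x $ i)\<^sup>2 = (x $ i)\<^sup>2" for i using c[of i] by (metis mult_1 power2_abs power_mult_distrib power_one)
  thus ?thesis by (simp add: normal_density_def)
 qed
 have "gauss d = density (distr lborel borel (flip c)) ?f" unfolding gauss_def L ..
 also have "... = distr (density lborel (%x. ?f (flip c x))) borel (flip c)" by (rule density_distr) auto
 finally show ?thesis unfolding inv by (simp add: gauss_def)
qed

lemma integral_gauss_flip:
 fixes f :: "real^'n => real"
 assumes "!!i. abs (c i) = 1" and [measurable]: "f \<in> borel_measurable borel"
 shows "(LINT y|gauss d. f (flip c y)) = (LINT y|gauss d. f y)"
 by (subst (2) distr_gauss_flip[OF assms(1), symmetric]) (simp_all add: integral_distr)

definition rbox :: "real => (real^'n) set" where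
 "rbox r = {y. ALL i. abs (y $ i) <= r}"

lemma rbox_measurable[measurable]: "(rbox r :: (real^'n::finite) set) \<in> sets borel"
proof -
 have "closed (rbox r :: (real^'n) set)" unfolding rbox_def by (intro closed_Collect_all closed_Collect_le continuous_intros)
 thus ?thesis by simp
qed

lemma flip_rbox: "(!!i. abs (c i) = 1) ==> flip c y \<in> rbox r \<longleftrightarrow> y \<in> rbox r" by (simp add: rbox_def abs_mult)

text \<open>Outside the cube some \<open>abs (y $ j)\<close> exceeds r, and Chebyshev's argument
  applies with fourth powers. Fourth moments are of order d^2, so both tails are negligible against
  a step of length d.\<close>

lemma rbox_tail_le:
 assumes "0 < r"
 shows "indicator (- rbox r) (y::real^'n) <= (\<Sum>j\<in>UNIV. (y $ j) ^ 4 / r ^ 4 :: real)"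
  and "indicator (- rbox r) y * (y $ i)\<^sup>2 <= (\<Sum>j\<in>UNIV. ((y $ i) ^ 4 + (y $ j) ^ 4) / r\<^sup>2 :: real)"
proof -
 { assume "y \<notin> rbox r"
  then obtain j where j: "r < abs (y $ j)" by (auto simp: rbox_def not_le)
  have "r ^ 4 <= (y $ j) ^ 4" using power_mono[of r "abs (y $ j)" 4] j assms by (simp add: power_even_abs)
  hence "1 <= (y $ j) ^ 4 / r ^ 4" using assms by (simp add: field_simps)
  also have "... <= (\<Sum>j\<in>UNIV. (y $ j) ^ 4 / r ^ 4)" by (rule member_le_sum) auto
  finally have 1: "1 <= (\<Sum>j\<in>UNIV. (y $ j) ^ 4 / r ^ 4)" .
  have "r\<^sup>2 <= (y $ j)\<^sup>2" using power_mono[of r "abs (y $ j)" 2] j assms by simp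
  hence "(y $ i)\<^sup>2 * r\<^sup>2 <= (y $ i)\<^sup>2 * (y $ j)\<^sup>2" by (intro mult_left_mono) auto
  also have "... <= (y $ i) ^ 4 + (y $ j) ^ 4"
  proof -
   have "0 <= ((y $ i)\<^sup>2 - (y $ j)\<^sup>2)\<^sup>2" by simp
   hence "2 * ((y $ i)\<^sup>2 * (y $ j)\<^sup>2) <= (y $ i) ^ 4 + (y $ j) ^ 4" by (simp add: power2_diff flip: power_mult)
   moreover have "0 <= (y $ i)\<^sup>2 * (y $ j)\<^sup>2" by simp
   ultimately show ?thesis by linarith
  qed
  finally have "(y $ i)\<^sup>2 <= ((y $ i) ^ 4 + (y $ j) ^ 4) / r\<^sup>2" using assms by (simp add: field_simps)
  also have "... <= (\<Sum>j\<in>UNIV. ((y $ i) ^ 4 + (y $ j) ^ 4) / r\<^sup>2)"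
   by (rule member_le_sum[where f="%j. ((y $ i) ^ 4 + (y $ j) ^ 4) / r\<^sup>2"]) (auto intro!: divide_nonneg_nonneg add_nonneg_nonneg)
  finally have "(y $ i)\<^sup>2 <= (\<Sum>j\<in>UNIV. ((y $ i) ^ 4 + (y $ j) ^ 4) / r\<^sup>2)" .
  note 1 this }
 moreover have "0 <= (\<Sum>j\<in>UNIV. (y $ j) ^ 4 / r ^ 4)" "0 <= (\<Sum>j\<in>UNIV. ((y $ i) ^ 4 + (y $ j) ^ 4) / r\<^sup>2)"
  by (intro sum_nonneg; auto intro!: divide_nonneg_nonneg add_nonneg_nonneg)+
 ultimately show "indicator (- rbox r) (y::real^'n) <= (\<Sum>j\<in>UNIV. (y $ j) ^ 4 / r ^ 4 :: real)"
  and "indicator (- rbox r) y * (y $ i)\<^sup>2 <= (\<Sum>j\<in>UNIV. ((y $ i) ^ 4 + (y $ j) ^ 4) / r\<^sup>2 :: real)" by (auto simp: indicator_def)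
qed

lemma measure_gauss_rbox_tail:
 fixes d r :: real
 assumes "0 < d" "0 < r"
 shows "measure (gauss d) (- rbox r :: (real^'n) set) <= 3 * real CARD('n) * d\<^sup>2 / r ^ 4"
proof -
 interpret prob_space "gauss d :: (real^'n) measure" by (rule prob_space_gauss) fact
 have "measure (gauss d) (- rbox r :: (real^'n) set) = (LINT y|gauss d. indicator (- rbox r) (y::real^'n))" by (simp add: Compl_eq_Diff_UNIV)
 also have "... <= (LINT y|gauss d. (\<Sum>j\<in>UNIV. ((y::real^'n) $ j) ^ 4 / r ^ 4))"
 proof (rule integral_mono)
  show "integrable (gauss d) (indicat_real (- rbox r :: (real^'n) set))" by (rule integrable_const_bound[where B=1]) (auto simp: Compl_eq_Diff_UNIV)
  show "integrable (gauss d) (%y::real^'n. \<Sum>j\<in>UNIV. (y $ j) ^ 4 / r ^ 4)"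
   using assms(1) by (auto simp: gauss_fourth intro!: Bochner_Integration.integrable_sum)
 qed (rule rbox_tail_le(1)[OF assms(2)])
 also have "... = 3 * real CARD('n) * d\<^sup>2 / r ^ 4" using assms(1) by (subst Bochner_Integration.integral_sum) (auto simp: gauss_fourth)
 finally show ?thesis .
qed

abbreviation box_var :: "real => real => 'n::finite => real" where
 "box_var d r i \<equiv> \<integral>y. indicator (rbox r) y * (y $ i)\<^sup>2 \<partial>gauss d"

lemma integrable_gauss_rbox_square:
 assumes "0 < d" shows "integrable (gauss d) (%y. indicator (rbox r) y * (y $ i)\<^sup>2 :: real)"
 using integrable_mult_indicator[OF _ gauss_square(1)[OF assms], of "rbox r" i] by simp

text \<open>Two forms for two uses: the viscosity step has coefficients of arbitrary sign and takes
  the two-sided O(d^2) error; the Lyapunov estimate has nonnegative coefficients and takes the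
  inequality.\<close>

lemma integral_gauss_rbox_square:
 fixes i :: "'n::finite"
 assumes d: "0 < d" and r: "0 < r"
 shows "abs (box_var d r i - d) <= 6 * real CARD('n) * d\<^sup>2 / r\<^sup>2"
  and "box_var d r i <= d"
proof -
 note i1 = integrable_gauss_rbox_square[OF d]
 have i2: "integrable (gauss d) (%y. indicator (- rbox r) y * (y $ i)\<^sup>2 :: real)"
  using integrable_mult_indicator[OF _ gauss_square(1)[OF d], of "- rbox r" i] by (simp add: Compl_eq_Diff_UNIV)
 have "d = (LINT y|gauss d. indicator (rbox r) y * (y $ i)\<^sup>2 + indicator (- rbox r) y * (y $ i)\<^sup>2)"
  by (subst gauss_square(2)[OF d, of i, symmetric], rule Bochner_Integration.integral_cong)
   (auto simp: indicator_def)
 also have "... = box_var d r i + (LINT y|gauss d. indicator (- rbox r) y * (y $ i)\<^sup>2)" by (rule Bochner_Integration.integral_add[OF i1 i2])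
 finally have eq: "d = box_var d r i + (LINT y|gauss d. indicator (- rbox r) y * (y $ i)\<^sup>2)" .
 have "(LINT y|gauss d. indicator (- rbox r) y * (y $ i)\<^sup>2) <= (LINT y|gauss d. (\<Sum>j\<in>UNIV. ((y $ i) ^ 4 + (y $ j) ^ 4) / r\<^sup>2))"
  using d r i2 by (intro integral_mono rbox_tail_le)
   (auto simp: gauss_fourth intro!: Bochner_Integration.integrable_sum)
 also have "... = 6 * real CARD('n) * d\<^sup>2 / r\<^sup>2" using d by (subst Bochner_Integration.integral_sum) (auto simp: gauss_fourth field_simps)
 finally have "(LINT y|gauss d. indicator (- rbox r) y * (y $ i)\<^sup>2) <= 6 * real CARD('n) * d\<^sup>2 / r\<^sup>2" .
 moreover have "0 <= (LINT y|gauss d. indicator (- rbox r) y * (y $ i)\<^sup>2)" by (intro integral_nonneg_AE) auto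
 ultimately show "abs (box_var d r i - d) <= 6 * real CARD('n) * d\<^sup>2 / r\<^sup>2"
  and "box_var d r i <= d" using eq by linarith+
qed

lemma integrable_gauss_norm:
 assumes d: "0 < d"
 shows "integrable (gauss d) (%y::real^'n. (norm y)\<^sup>2)" "(LINT y|gauss d. (norm (y::real^'n))\<^sup>2) = real CARD('n) * d"
  "integrable (gauss d) (%y::real^'n. y)"
proof -
 interpret prob_space "gauss d :: (real^'n) measure" by (rule prob_space_gauss) fact
 have eq: "(norm y)\<^sup>2 = (\<Sum>i\<in>UNIV. (y $ i)\<^sup>2)" for y :: "real^'n" by (simp add: norm_vec_def L2_set_def sum_nonneg)
 show 1: "integrable (gauss d) (%y::real^'n. (norm y)\<^sup>2)" and "(LINT y|gauss d. (norm (y::real^'n))\<^sup>2) = real CARD('n) * d"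
  unfolding eq using d by (auto simp: gauss_square)
 have "integrable (gauss d) (%y::real^'n. norm y)" by (rule square_integrable_imp_integrable[OF _ 1]) auto
 thus "integrable (gauss d) (%y::real^'n. y)" by (subst integrable_norm_iff[symmetric]) auto
qed

lemma integral_gauss_id: "(LINT y|gauss d. (y::real^'n)) = 0"
proof -
 have "(LINT y|gauss d. (y::real^'n)) = (LINT y|gauss d. flip (%_. -1) y)"
  by (subst distr_gauss_flip[where c="%_. -1", symmetric]) (simp_all add: integral_distr)
 also have "... = - (LINT y|gauss d. (y::real^'n))" by (subst Bochner_Integration.integral_minus[symmetric], rule Bochner_Integration.integral_cong)
   (auto simp: vec_eq_iff)
 finally have "(LINT y|gauss d. (y::real^'n)) = - (LINT y|gauss d. (y::real^'n))" .
 hence "2 *\<^sub>R (LINT y|gauss d. (y::real^'n)) = 0" by (simp add: scaleR_2)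
 thus ?thesis by (simp only: scaleR_eq_0_iff) simp
qed

section \<open>Bounded paths, Euler polygons and their limits\<close>

text \<open>The common class of continuous solutions, step paths and control paths. Its members are
  integrable over every subinterval, so time integrals carry no further side conditions.\<close>

definition bdm :: "real => real => (real => 'a::euclidean_space) => bool" where
 "bdm a b f \<longleftrightarrow> f \<in> borel_measurable (restrict_space borel {a..b}) & (EX K. \<forall>x\<in>{a..b}. norm (f x) <= K)"

lemma bdm_subset: "bdm a b f ==> {c..d} \<subseteq> {a..b} ==> bdm c d f" unfolding bdm_def by (meson measurable_restrict_mono subsetD)

lemma bdm_integrable:
 assumes "bdm a b f" "{c..d} \<subseteq> {a..b}"
 shows "set_integrable lborel {c..d} f"
proof -
 have f: "bdm c d f" by (rule bdm_subset[OF assms])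
 then obtain K where K: "!!x. x \<in> {c..d} ==> norm (f x) <= K" unfolding bdm_def by blast
 have "(%x. indicator {c..d} x *\<^sub>R f x) \<in> borel_measurable borel" using f by (simp add: bdm_def borel_measurable_restrict_space_iff)
 hence m: "(%x. indicator {c..d} x *\<^sub>R f x) \<in> borel_measurable lborel" by simp
 have "integrable lborel (%x. indicator {c..d} x * abs K)" by (intro integrable_mult_left integrable_real_indicator) (auto simp: emeasure_lborel_Icc_eq)
 from Bochner_Integration.integrable_bound[OF this m]
 show ?thesis unfolding set_integrable_def using K by (force simp: indicator_def intro!: AE_I2)
qed

lemma bdm_continuous: "continuous_on {a..b} f ==> bdm a b f"
 unfolding bdm_def using compact_continuous_image[of "{a..b}" f] compact_imp_bounded[of "f ` {a..b}"]
 by (auto intro!: borel_measurable_continuous_on_restrict simp: bounded_iff)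

lemma bdm_diff: "bdm a b f ==> bdm a b g ==> bdm a b (%x. f x - g x)"
 unfolding bdm_def by (auto intro!: borel_measurable_diff) (meson add_mono norm_triangle_le_diff)

lemma bdm_norm: "bdm a b f ==> bdm a b (%x. norm (f x))" unfolding bdm_def by auto

lemma bdm_lipschitz:
 assumes b: "L-lipschitz_on UNIV b" and f: "bdm a c f"
 shows "bdm a c (%x. b (f x))"
proof -
 obtain K where K: "!!x. x \<in> {a..c} ==> norm (f x) <= K" using f unfolding bdm_def by blast
 have "norm (b (f x)) <= norm (b 0) + L * K" if "x \<in> {a..c}" for x
 proof -
  have "norm (b (f x) - b 0) <= L * norm (f x - 0)" using lipschitz_onD[OF b, of "f x" 0] by (simp add: dist_norm)
  also have "... <= L * K" using K[OF that] lipschitz_on_nonneg[OF b] by (intro mult_left_mono) auto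
  finally show ?thesis using norm_triangle_sub[of "b (f x)" "b 0"] by simp
 qed
 moreover have "b \<in> borel_measurable borel" by (intro borel_measurable_continuous_onI lipschitz_on_continuous_on[OF b])
 ultimately show ?thesis using f unfolding bdm_def by (intro conjI exI[of _ "norm (b 0) + L * K"]) (auto intro: measurable_compose)
qed

section \<open>Time integrals of bounded paths\<close>

lemma LBINT_null: fixes a :: real shows "(LBINT r:{a..a}. f r) = 0" unfolding set_lebesgue_integral_def
proof (rule integral_eq_zero_AE)
 show "AE x in lborel. indicat_real {a..a} x *\<^sub>R f x = 0" using AE_lborel_singleton[of a] by eventually_elim (auto simp: indicator_def intro: antisym)
qed

lemma LBINT_split:
 assumes "bdm a b f" "a <= c" "c <= d" "d <= e" "e <= b"
 shows "(LBINT r:{c..e}. f r) = (LBINT r:{c..d}. f r) + (LBINT r:{d..e}. f r)"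
proof -
 have "{c..e} = {c..d} \<union> {d..e}" using assms by auto
 moreover have "AE x in lborel. \<not> (x \<in> {c..d} & x \<in> {d..e})" using AE_lborel_singleton[of d] by eventually_elim auto
 ultimately show ?thesis using assms by (simp only:) (intro set_integral_Un_AE bdm_integrable[OF assms(1)]; auto)
qed

lemma norm_LBINT_le:
 fixes f :: "real => 'a::euclidean_space"
 assumes "bdm a b f" "a <= c" "c <= d" "d <= b" "!!r. r \<in> {c..d} ==> norm (f r) <= K"
 shows "norm (LBINT r:{c..d}. f r) <= K * (d - c)"
proof -
 have "norm (LBINT r:{c..d}. f r) <= (LBINT r:{c..d}. K)" unfolding set_lebesgue_integral_def using assms(5) bdm_integrable[OF assms(1), of c d] assms(2-4)
  by (intro Bochner_Integration.integral_norm_bound_integral)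
   (auto simp: set_integrable_def split: split_indicator intro!: integrable_mult_left integrable_real_indicator)
 thus ?thesis using assms by (simp add: set_integral_const mult.commute)
qed

lemma LBINT_mono:
 fixes f g :: "real => real"
 assumes "bdm a b f" "bdm a b g" "{c..d} \<subseteq> {a..b}" "!!r. r \<in> {c..d} ==> f r <= g r"
 shows "(LBINT r:{c..d}. f r) <= (LBINT r:{c..d}. g r)" using assms by (intro set_integral_mono bdm_integrable[of a b]) auto

text \<open>The supremum \<open>m\<close> of \<open>f\<close> weighted by \<open>exp (- 2 L (s - a))\<close> satisfies \<open>m \<le> c + m / 2\<close>.\<close>
lemma gronwall_bounded:
 fixes f :: "real => real"
 assumes f: "bdm a b f" and L: "0 < L" and nn: "!!s. s \<in> {a..b} ==> 0 <= f s"
  and le: "!!s. s \<in> {a..b} ==> f s <= c + L * (LBINT r:{a..s}. f r)"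
  and s: "s \<in> {a..b}"
 shows "f s <= 2 * c * exp (2 * L * (s - a))"
proof -
 obtain K where K: "!!x. x \<in> {a..b} ==> norm (f x) <= K" using f unfolding bdm_def by blast
 let ?w = "%s. f s * exp (- (2 * L * (s - a)))"
 define m where "m = (SUP s\<in>{a..b}. ?w s)"
 have bd: "bdd_above (?w ` {a..b})"
 proof (rule bdd_aboveI2)
  fix x assume x: "x \<in> {a..b}"
  have "?w x <= f x * 1" using x nn L by (intro mult_left_mono) auto
  thus "?w x <= K" using K[OF x] by auto
 qed
 have m: "?w r <= m" if "r \<in> {a..b}" for r unfolding m_def by (rule cSUP_upper[OF that bd])
 have m0: "0 <= m" using m[OF s] nn[OF s] by (meson exp_ge_zero mult_nonneg_nonneg order_trans)
 have "?w s <= c + m / 2" if s: "s \<in> {a..b}" for s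
 proof -
  have cont: "continuous_on {a..b} (%r. m * exp (2 * L * (r - a)))" by (intro continuous_intros)
  have "(LBINT r:{a..s}. f r) <= (LBINT r:{a..s}. m * exp (2 * L * (r - a)))"
  proof (rule LBINT_mono[OF f bdm_continuous[OF cont]])
   fix r assume "r \<in> {a..s}"
   hence "r \<in> {a..b}" using s by auto
   from m[OF this] show "f r <= m * exp (2 * L * (r - a))" unfolding exp_minus by (simp add: field_simps)
  qed (use s in auto)
  also have "... = m * exp (2 * L * (s - a)) / (2 * L) - m * exp (2 * L * (a - a)) / (2 * L)" unfolding set_lebesgue_integral_def real_scaleR_def
   using s L by (subst mult.commute, intro integral_FTC_Icc_real[where F="%r. m * exp (2 * L * (r - a)) / (2 * L)"])
    (auto intro!: derivative_eq_intros continuous_intros)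
  also have "... <= m * exp (2 * L * (s - a)) / (2 * L)" using m0 L by simp
  finally have "L * (LBINT r:{a..s}. f r) <= L * (m * exp (2 * L * (s - a)) / (2 * L))" using L by (intro mult_left_mono) auto
  hence "f s <= c + m * exp (2 * L * (s - a)) / 2" using le[OF s] L by simp
  hence "?w s <= (c + m * exp (2 * L * (s - a)) / 2) * exp (- (2 * L * (s - a)))" by (intro mult_right_mono) auto
  also have "... = c * exp (- (2 * L * (s - a))) + m / 2" by (simp add: algebra_simps flip: exp_add)
  also have "... <= c + m / 2"
  proof -
   have "0 <= c"
   proof -
    have "(LBINT r:{a..a}. f r) = 0" by (rule LBINT_null)
    thus ?thesis using le[of a] nn[of a] s by auto
   qed
   thus ?thesis using s L by (auto intro: mult_left_le)
  qed
  finally show ?thesis .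
 qed
 hence "m <= c + m / 2" unfolding m_def using s by (intro cSUP_least) (auto simp flip: m_def)
 hence "m <= 2 * c" by simp
 have "f s = ?w s * exp (2 * L * (s - a))" unfolding exp_minus by (simp add: field_simps)
 also have "... <= 2 * c * exp (2 * L * (s - a))" using m[OF s] \<open>m <= 2 * c\<close> by (intro mult_right_mono) auto
 finally show ?thesis .
qed

section \<open>Integral equations with additive forcing\<close>

lemma LBINT_continuous:
 fixes f :: "real => 'a::euclidean_space"
 assumes f: "bdm t T f"
 shows "continuous_on {t..T} (%s. LBINT r:{t..s}. f r)"
proof -
 obtain K where K: "!!r. r \<in> {t..T} ==> norm (f r) <= K" using f unfolding bdm_def by blast
 have lip: "dist (LBINT r:{t..s}. f r) (LBINT r:{t..s'}. f r) <= abs K * abs (s - s')"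
  if "s \<in> {t..T}" "s' \<in> {t..T}" "s <= s'" for s s'
 proof -
  have "(LBINT r:{t..s'}. f r) = (LBINT r:{t..s}. f r) + (LBINT r:{s..s'}. f r)" using that by (intro LBINT_split[OF f]) auto
  hence "dist (LBINT r:{t..s}. f r) (LBINT r:{t..s'}. f r) = norm (LBINT r:{s..s'}. f r)" by (simp add: dist_norm)
  also have "... <= abs K * (s' - s)" using that K by (intro norm_LBINT_le[OF f]) (auto intro: order_trans[OF K])
  finally show ?thesis using that by simp
 qed
 have "\<bar>K\<bar>-lipschitz_on {t..T} (%s. LBINT r:{t..s}. f r)"
 proof (rule lipschitz_onI)
  fix s s' assume "s \<in> {t..T}" "s' \<in> {t..T}"
  thus "dist (LBINT r:{t..s}. f r) (LBINT r:{t..s'}. f r) <= abs K * dist s s'"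
   using lip[of s s'] lip[of s' s] by (cases "s <= s'") (auto simp: dist_real_def dist_commute abs_minus_commute)
 qed simp
 thus ?thesis by (rule lipschitz_on_continuous_on)
qed

text \<open>For a fixed sample point the state equation has this form: control and noise are both
  collected in the additive forcing \<open>A\<close>, and every integral is an ordinary one.\<close>

definition solves :: "('e => 'e) => real => real => 'e::euclidean_space => (real => 'e) => (real => 'e) => bool" where
 "solves b t T z A Z \<longleftrightarrow>
  continuous_on {t..T} Z & (\<forall>s\<in>{t..T}. Z s = z + (LBINT r:{t..s}. b (Z r)) + A s)"

text \<open>A solution up to a uniform defect \<open>e\<close>. The path may jump, so Euler step
  paths qualify.\<close>

definition approx :: "('e => 'e) => real => real => 'e::euclidean_space => (real => 'e) => real => (real => 'e) => bool" where
 "approx b t T z A e X \<longleftrightarrow> bdm t T X &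
  (\<forall>s\<in>{t..T}. norm (X s - (z + (LBINT r:{t..s}. b (X r)) + A s)) <= e)"

lemma solves_imp_approx: "solves b t T z A Z ==> approx b t T z A 0 Z" by (auto simp: solves_def approx_def bdm_continuous)

text \<open>Gronwall's inequality for the distance of two approximate solutions. Uniqueness,
  convergence of the Euler scheme and stability in the initial point are all instances of
  it.\<close>

lemma approx_close:
 assumes b: "L-lipschitz_on UNIV b" and L: "0 < L"
  and X: "approx b t T z A e X" and Y: "approx b t T z' A' ep' Y"
  and A: "!!s. s \<in> {t..T} ==> norm (A s - A' s) <= c" and s: "s \<in> {t..T}"
 shows "norm (X s - Y s) <= 2 * (norm (z - z') + c + e + ep') * exp (2 * L * (s - t))"
proof -
 have bX: "bdm t T X" "bdm t T Y" using X Y by (auto simp: approx_def)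
 note bdm = bX bdm_lipschitz[OF b bX(1)] bdm_lipschitz[OF b bX(2)]
 note bdm_d = bdm_norm[OF bdm_diff[OF bX]]
 show ?thesis
 proof (rule gronwall_bounded[OF bdm_d L _ _ s])
  fix s assume s: "s \<in> {t..T}"
  have sub: "{t..s} \<subseteq> {t..T}" using s by auto
  have "norm ((LBINT r:{t..s}. b (X r)) - (LBINT r:{t..s}. b (Y r)))
   = norm (LBINT r:{t..s}. b (X r) - b (Y r))" using bdm sub by (subst set_integral_diff) (auto intro: bdm_integrable)
  also have "... <= (LBINT r:{t..s}. L * norm (X r - Y r))" unfolding set_lebesgue_integral_def
  proof (rule Bochner_Integration.integral_norm_bound_integral)
   show "integrable lborel (%x. indicat_real {t..s} x *\<^sub>R (b (X x) - b (Y x)))"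
    using bdm_integrable[OF bdm_diff[OF bdm(3,4)] sub] by (simp add: set_integrable_def)
   show "integrable lborel (%x. indicat_real {t..s} x *\<^sub>R (L * norm (X x - Y x)))"
    using bdm_integrable[OF bdm_d sub] unfolding set_integrable_def[symmetric] by auto
   fix x show "norm (indicat_real {t..s} x *\<^sub>R (b (X x) - b (Y x))) <= indicat_real {t..s} x *\<^sub>R (L * norm (X x - Y x))"
    using lipschitz_onD[OF b, of "X x" "Y x"] by (auto simp: dist_norm indicator_def)
  qed
  also have "... = L * (LBINT r:{t..s}. norm (X r - Y r))" by simp
  finally have 1: "norm ((LBINT r:{t..s}. b (X r)) - (LBINT r:{t..s}. b (Y r))) <= L * (LBINT r:{t..s}. norm (X r - Y r))" .
  have "X s - Y s = (X s - (z + (LBINT r:{t..s}. b (X r)) + A s)) - (Y s - (z' + (LBINT r:{t..s}. b (Y r)) + A' s))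
   + (z - z') + (A s - A' s) + ((LBINT r:{t..s}. b (X r)) - (LBINT r:{t..s}. b (Y r)))" by simp
  hence "norm (X s - Y s) <= norm (X s - (z + (LBINT r:{t..s}. b (X r)) + A s)) + norm (Y s - (z' + (LBINT r:{t..s}. b (Y r)) + A' s))
   + norm (z - z') + norm (A s - A' s) + norm ((LBINT r:{t..s}. b (X r)) - (LBINT r:{t..s}. b (Y r)))" by (smt (verit) norm_triangle_ineq norm_triangle_ineq4)
  moreover have "norm (X s - (z + (LBINT r:{t..s}. b (X r)) + A s)) <= e" "norm (Y s - (z' + (LBINT r:{t..s}. b (Y r)) + A' s)) <= ep'"
   using X Y s by (auto simp: approx_def)
  ultimately show "norm (X s - Y s) <= (norm (z - z') + c + e + ep') + L * (LBINT r:{t..s}. norm (X r - Y r))" using 1 A[OF s] by linarith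
 qed auto
qed

text \<open>With zero defect the path equals the right-hand side of the equation, which is
  continuous in the upper limit of integration.\<close>

lemma approx_0_imp_solves:
 assumes b: "L-lipschitz_on UNIV b" and A: "continuous_on {t..T} A" and Z: "approx b t T z A 0 Z"
 shows "solves b t T z A Z"
proof -
 have Zs: "Z s = z + (LBINT r:{t..s}. b (Z r)) + A s" if "s \<in> {t..T}" for s using Z that by (auto simp: approx_def)
 have bZ: "bdm t T (%r. b (Z r))" using Z by (auto simp: approx_def intro: bdm_lipschitz[OF b])
 hence "continuous_on {t..T} (%s. z + (LBINT r:{t..s}. b (Z r)) + A s)" by (intro continuous_intros A LBINT_continuous)
 hence "continuous_on {t..T} Z" by (rule continuous_on_eq) (rule Zs[symmetric])
 thus ?thesis using Zs by (auto simp: solves_def)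
qed

text \<open>By \<open>approx_close\<close> the paths are uniformly Cauchy. The solution is written
  as a \<open>lim\<close> of explicit paths, so that measurability in the sample point passes to it
  later.\<close>

lemma approx_limit:
 fixes b :: "'e::euclidean_space => 'e"
 assumes b: "L-lipschitz_on UNIV b" and L: "0 < L" and A: "continuous_on {t..T} A"
  and X: "!!N. approx b t T z A (a N) (X N)" and a: "a \<longlonglongrightarrow> 0"
 defines "Z \<equiv> %s. lim (%N. X N s)"
 shows "solves b t T z A Z"
  and "!!N s. s \<in> {t..T} ==> norm (X N s - Z s) <= 2 * a N * exp (2 * L * (T - t))"
proof -
 have close: "norm (X N s - X M s) <= 2 * (a N + a M) * exp (2 * L * (T - t))" if s: "s \<in> {t..T}" for s N M
 proof -
  have "norm (X N s - X M s) <= 2 * (norm (z - z) + 0 + a N + a M) * exp (2 * L * (s - t))" by (rule approx_close[OF b L X X _ s]) auto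
  also have "... <= 2 * (a N + a M) * exp (2 * L * (T - t))"
  proof -
   have "0 <= a N" for N using X[of N] s norm_ge_zero order_trans unfolding approx_def by blast
   thus ?thesis using L s by (auto intro!: mult_left_mono add_nonneg_nonneg)
  qed
  finally show ?thesis .
 qed
 have lim: "(%N. X N s) \<longlonglongrightarrow> Z s" if s: "s \<in> {t..T}" for s
 proof -
  have "Cauchy (%N. X N s)"
  proof (rule CauchyI)
   fix e :: real assume e: "0 < e"
   define c where "c = exp (2 * L * (T - t))"
   have "c > 0" by (simp add: c_def)
   hence "eventually (%N. a N < e / (4 * c)) sequentially" using e by (intro order_tendstoD[OF a]) auto
   then obtain N0 where N0: "!!N. N >= N0 ==> a N < e / (4 * c)" by (auto simp: eventually_sequentially)
   have "norm (X N s - X M s) < e" if "N >= N0" "M >= N0" for N M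
   proof -
    have "norm (X N s - X M s) <= 2 * (a N + a M) * c" unfolding c_def by (rule close[OF s])
    also have "... < 2 * (e / (4 * c) + e / (4 * c)) * c" using N0[OF that(1)] N0[OF that(2)] \<open>c > 0\<close> by (intro mult_strict_right_mono) auto
    also have "... = e" using \<open>c > 0\<close> by (simp add: field_simps)
    finally show ?thesis .
   qed
   thus "EX M. \<forall>m\<ge>M. \<forall>n\<ge>M. norm (X m s - X n s) < e" by blast
  qed
  thus ?thesis unfolding Z_def using Cauchy_convergent convergent_LIMSEQ_iff by blast
 qed
 show bound: "norm (X N s - Z s) <= 2 * a N * exp (2 * L * (T - t))" if s: "s \<in> {t..T}" for N s
 proof (rule LIMSEQ_le)
  show "(%M. norm (X N s - X M s)) \<longlonglongrightarrow> norm (X N s - Z s)" by (intro tendsto_intros lim s)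
  have "(%M. 2 * (a N + a M) * exp (2 * L * (T - t))) \<longlonglongrightarrow> 2 * (a N + 0) * exp (2 * L * (T - t))"
   by (intro tendsto_intros a)
  thus "(%M. 2 * (a N + a M) * exp (2 * L * (T - t))) \<longlonglongrightarrow> 2 * a N * exp (2 * L * (T - t))" by simp
 qed (use close[OF s] in auto)
 have Z: "bdm t T Z" unfolding bdm_def
 proof
  show "Z \<in> borel_measurable (restrict_space borel {t..T})"
  proof (rule borel_measurable_LIMSEQ_metric)
   show "X N \<in> borel_measurable (restrict_space borel {t..T})" for N using X[of N] by (auto simp: approx_def bdm_def)
   show "!!x. x \<in> space (restrict_space borel {t..T}) ==> (%i. X i x) \<longlonglongrightarrow> Z x"
    by (auto intro!: lim simp: space_restrict_space)
  qed
  obtain K where K: "!!s. s \<in> {t..T} ==> norm (X 0 s) <= K" using X[of 0] unfolding approx_def bdm_def by blast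
  have "norm (Z s) <= K + 2 * a 0 * exp (2 * L * (T - t))" if "s \<in> {t..T}" for s
   using bound[OF that, of 0] K[OF that] norm_triangle_sub[of "Z s" "X 0 s"] norm_minus_commute[of "Z s" "X 0 s"] by linarith
  thus "EX K. \<forall>x\<in>{t..T}. norm (Z x) <= K" by blast
 qed
 have "norm (Z s - (z + (LBINT r:{t..s}. b (Z r)) + A s)) <= 0" if s: "s \<in> {t..T}" for s
 proof (rule LIMSEQ_le)
  have bb: "bdm t T (%r. b (X N r))" for N using X[of N] by (auto simp: approx_def intro: bdm_lipschitz[OF b])
  note bZ = bdm_lipschitz[OF b Z]
  have "(%N. LBINT r:{t..s}. b (X N r)) \<longlonglongrightarrow> (LBINT r:{t..s}. b (Z r))"
  proof (rule Lim_transform_bound[THEN Lim_null[THEN iffD2]])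
   show "eventually (%N. norm ((LBINT r:{t..s}. b (X N r)) - (LBINT r:{t..s}. b (Z r)))
    <= norm (L * (2 * a N * exp (2 * L * (T - t))) * (s - t))) sequentially"
   proof (intro always_eventually allI)
    fix N
    have "norm ((LBINT r:{t..s}. b (X N r)) - (LBINT r:{t..s}. b (Z r))) = norm (LBINT r:{t..s}. b (X N r) - b (Z r))"
     using s by (subst set_integral_diff) (auto intro!: bdm_integrable[OF bb] bdm_integrable[OF bZ])
    also have "... <= L * (2 * a N * exp (2 * L * (T - t))) * (s - t)"
    proof (rule norm_LBINT_le[OF bdm_diff[OF bb bZ]])
     fix r assume "r \<in> {t..s}"
     hence "norm (X N r - Z r) <= 2 * a N * exp (2 * L * (T - t))" using s by (intro bound) auto
     thus "norm (b (X N r) - b (Z r)) <= L * (2 * a N * exp (2 * L * (T - t)))" using lipschitz_onD[OF b, of "X N r" "Z r"] L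
      by (simp add: dist_norm) (smt (verit) mult_left_mono)
    qed (use s in auto)
    finally show "norm ((LBINT r:{t..s}. b (X N r)) - (LBINT r:{t..s}. b (Z r)))
     <= norm (L * (2 * a N * exp (2 * L * (T - t))) * (s - t))" by simp
   qed
   have "(%N. L * (2 * a N * exp (2 * L * (T - t))) * (s - t)) \<longlonglongrightarrow> L * (2 * 0 * exp (2 * L * (T - t))) * (s - t)"
    by (intro tendsto_intros a)
   thus "(%N. L * (2 * a N * exp (2 * L * (T - t))) * (s - t)) \<longlonglongrightarrow> 0" by simp
  qed
  thus "(%N. norm (X N s - (z + (LBINT r:{t..s}. b (X N r)) + A s)))
   \<longlonglongrightarrow> norm (Z s - (z + (LBINT r:{t..s}. b (Z r)) + A s))" by (intro tendsto_intros lim s)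
  show "a \<longlonglongrightarrow> 0" by fact
  show "EX N. \<forall>n\<ge>N. norm (X n s - (z + (LBINT r:{t..s}. b (X n r)) + A s)) <= a n" using X s by (auto simp: approx_def)
 qed
 hence "approx b t T z A 0 Z" using Z by (auto simp: approx_def)
 thus "solves b t T z A Z" by (rule approx_0_imp_solves[OF b A])
qed

lemma solves_unique:
 assumes "L-lipschitz_on UNIV b" "0 < L" "solves b t T z A Z" "solves b t T z A' Z'"
  "!!s. s \<in> {t..T} ==> A s = A' s" "s \<in> {t..T}"
 shows "Z s = Z' s" using approx_close[OF assms(1,2) solves_imp_approx[OF assms(3)] solves_imp_approx[OF assms(4)], of 0 s] assms(5,6) by auto

abbreviation step_ix :: "real => real => real => nat" where
 "step_ix t d s \<equiv> nat \<lfloor>(s - t) / d\<rfloor>"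

section \<open>Step functions and Euler polygons\<close>

lemma step_ix_eq:
 assumes "0 < d" "t + real k * d <= s" "s < t + real (Suc k) * d"
 shows "step_ix t d s = k"
proof -
 have "\<lfloor>(s - t) / d\<rfloor> = int k" using assms by (intro floor_unique) (auto simp: field_simps)
 thus ?thesis by simp
qed

lemma step_ix_bounds:
 assumes "0 < d" "t <= s"
 shows "t + real (step_ix t d s) * d <= s" "s < t + real (Suc (step_ix t d s)) * d"
proof -
 have "0 <= (s - t) / d" using assms by simp
 hence "real (step_ix t d s) = of_int \<lfloor>(s - t) / d\<rfloor>" by simp
 hence r: "real (step_ix t d s) <= (s - t) / d" "(s - t) / d < real (step_ix t d s) + 1" by linarith+
 have "(s - t) / d * d = s - t" using assms by simp
 hence "real (step_ix t d s) * d <= s - t" "s - t < (real (step_ix t d s) + 1) * d"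
  using mult_right_mono[OF r(1), of d] mult_strict_right_mono[OF r(2), of d] assms by auto
 thus "t + real (step_ix t d s) * d <= s" "s < t + real (Suc (step_ix t d s)) * d" using assms by (auto simp: field_simps)
qed

lemma bdm_step:
 fixes c :: "nat => 'a::euclidean_space"
 shows "bdm t T (%s. c (step_ix t d s))" unfolding bdm_def
proof
 have "(%s. c (step_ix t d s)) \<in> borel_measurable borel" by measurable
 thus "(%s. c (step_ix t d s)) \<in> borel_measurable (restrict_space borel {t..T})" by (rule measurable_restrict_space1)
 have "EX m. \<forall>s\<in>{t..T}. step_ix t d s <= m"
 proof (intro exI ballI)
  fix s assume "s \<in> {t..T}"
  hence "abs (s - t) <= abs (T - t)" by auto
  hence "abs (s - t) / abs d <= abs (T - t) / abs d" by (rule divide_right_mono) simp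
  hence "(s - t) / d <= abs (T - t) / abs d" using abs_ge_self[of "(s - t) / d"] unfolding abs_divide by linarith
  thus "step_ix t d s <= nat \<lfloor>abs (T - t) / abs d\<rfloor>" by (intro nat_mono floor_mono)
 qed
 then obtain m where m: "!!s. s \<in> {t..T} ==> step_ix t d s <= m" by blast
 have "norm (c (step_ix t d s)) <= (\<Sum>i\<le>m. norm (c i))" if "s \<in> {t..T}" for s using m[OF that] by (intro member_le_sum) auto
 thus "EX K. \<forall>x\<in>{t..T}. norm (c (step_ix t d x)) <= K" by blast
qed

lemma LBINT_step:
 fixes c :: "nat => 'a::euclidean_space"
 assumes d: "0 < d" and s: "t <= s"
 shows "(LBINT r:{t..s}. c (step_ix t d r))
  = (\<Sum>i<step_ix t d s. d *\<^sub>R c i) + (s - t - real (step_ix t d s) * d) *\<^sub>R c (step_ix t d s)"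
proof -
 have piece: "(LBINT r:{t + real k * d..s}. c (step_ix t d r)) = (s - t - real k * d) *\<^sub>R c k"
  if "t + real k * d <= s" "s <= t + real (Suc k) * d" for k s
 proof -
  have "(LBINT r:{t + real k * d..s}. c (step_ix t d r)) = (LBINT r:{t + real k * d..s}. c k)"
  proof (rule set_lebesgue_integral_cong_AE)
   \<comment> \<open>At the right end of a full cell the index is already \<open>Suc k\<close>; a
     single point is a null set.\<close>
   show "AE x\<in>{t + real k * d..s} in lborel. c (step_ix t d x) = c k" using AE_lborel_singleton[of s] by eventually_elim (use that step_ix_eq[OF d] in fastforce)
  qed auto
  thus ?thesis using that by (simp add: set_integral_const algebra_simps)
 qed
 have grid: "(LBINT r:{t..t + real k * d}. c (step_ix t d r)) = (\<Sum>i<k. d *\<^sub>R c i)" for k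
 proof (induction k)
  case 0
  thus ?case using piece[of 0 t] d by simp
 next
  case (Suc k)
  have "(LBINT r:{t..t + real (Suc k) * d}. c (step_ix t d r))
   = (LBINT r:{t..t + real k * d}. c (step_ix t d r)) + (LBINT r:{t + real k * d..t + real (Suc k) * d}. c (step_ix t d r))"
   using d by (intro LBINT_split[OF bdm_step[where T="t + real (Suc k) * d"]]) (auto simp: algebra_simps)
  also have "(LBINT r:{t + real k * d..t + real (Suc k) * d}. c (step_ix t d r)) = d *\<^sub>R c k"
   using piece[of k "t + real (Suc k) * d"] d by (simp add: algebra_simps)
  finally show ?case using Suc by simp
 qed
 note b = step_ix_bounds[OF d s]
 have "(LBINT r:{t..s}. c (step_ix t d r)) = (LBINT r:{t..t + real (step_ix t d s) * d}. c (step_ix t d r))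
  + (LBINT r:{t + real (step_ix t d s) * d..s}. c (step_ix t d r))" using d b by (intro LBINT_split[OF bdm_step[where T=s]]) auto
 thus ?thesis using grid[of "step_ix t d s"] piece[of "step_ix t d s" s] b by simp
qed

primrec euler :: "('e => 'e) => real => 'e => (nat => 'e) => nat => 'e::real_vector" where
 "euler b d z x 0 = z"
| "euler b d z x (Suc k) = euler b d z x k + d *\<^sub>R b (euler b d z x k) + x k"

lemma euler_sum: "euler b d z x k = z + (\<Sum>i<k. d *\<^sub>R b (euler b d z x i)) + (\<Sum>i<k. x i)" by (induction k) (auto simp: algebra_simps)

text \<open>By \<open>euler_sum\<close> and \<open>LBINT_step\<close> the polygon satisfies the
  integral equation except for the mismatch \<open>e\<close> of the forcing and the unfinished last
  cell, which costs at most \<open>d * K\<close>.\<close>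

lemma euler_approx:
 fixes b :: "'e::euclidean_space => 'e"
 assumes d: "0 < d" and K: "!!x. norm (b x) <= K"
  and A: "!!s. s \<in> {t..T} ==> norm ((\<Sum>i<step_ix t d s. a i) - A s) <= e"
 shows "approx b t T z A (e + d * K) (%s. euler b d z a (step_ix t d s))" unfolding approx_def
proof (intro conjI ballI bdm_step)
 fix s assume s: "s \<in> {t..T}"
 hence ts: "t <= s" by auto
 let ?k = "step_ix t d s"
 note bb = step_ix_bounds[OF d ts]
 have K0: "0 <= K" using K[of z] norm_ge_zero order_trans by blast
 have "euler b d z a ?k - (z + (LBINT r:{t..s}. b (euler b d z a (step_ix t d r))) + A s)
  = ((\<Sum>i<?k. a i) - A s) - (s - t - real ?k * d) *\<^sub>R b (euler b d z a ?k)" unfolding LBINT_step[OF d ts, of "%i. b (euler b d z a i)"]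
  by (subst (1) euler_sum) simp
 also have "norm ... <= norm ((\<Sum>i<?k. a i) - A s) + abs (s - t - real ?k * d) * norm (b (euler b d z a ?k))"
  by (rule order_trans[OF norm_triangle_ineq4]) simp
 also have "... <= e + d * K" using bb d K by (intro add_mono A s mult_mono) (auto simp: algebra_simps)
 finally show "norm (euler b d z a ?k - (z + (LBINT r:{t..s}. b (euler b d z a (step_ix t d r))) + A s)) <= e + d * K" .
qed

text \<open>Lebesgue differentiation over intervals to the left of s, obtained by reflecting time.
  Left intervals matter because a discretised control may only look at the past.\<close>

lemma lebesgue_left_average:
 fixes V :: "real => 'a::euclidean_space"
 assumes V: "!!a b. bdm a b V"
 shows "AE s in lborel. \<forall>e>0. \<exists>r>0. ALL h. 0 < h & h < r -->
  norm ((LBINT u:{s - h..s}. V u) - h *\<^sub>R V s) <= e * h"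
proof -
 have int: "(%x. V (- x)) integrable_on cbox a b" for a b :: real
 proof -
  have "V integrable_on {-b..-a}" by (rule set_borel_integral_eq_integral(1)) (rule bdm_integrable[OF V[of "-b" "-a"]], simp)
  thus ?thesis using Henstock_Kurzweil_Integration.integrable_reflect_real[of V "-a" "-b"] by simp
 qed
 obtain N where N: "negligible N" and
  lim: "!!x e. x \<notin> N ==> 0 < e ==> \<exists>d>0. ALL h. 0 < h & h < d -->
   norm (integral (cbox x (x + h *\<^sub>R One)) (%x. V (- x)) /\<^sub>R h ^ DIM(real) - V (- x)) < e"
  using integrable_ccontinuous_explicit[of "%x. V (- x)", OF int] by metis
 have "negligible (uminus ` N)" by (rule negligible_differentiable_image_negligible[OF _ N]) (auto simp: differentiable_on_def intro: derivative_intros)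
 hence "AE s in lebesgue. s \<notin> uminus ` N" by (auto simp: negligible_iff_null_sets intro: AE_not_in)
 hence "AE s in lborel. s \<notin> uminus ` N" by (simp add: AE_completion_iff)
 thus ?thesis
 proof eventually_elim
  fix s :: real assume "s \<notin> uminus ` N"
  hence s: "- s \<notin> N" by (metis image_eqI minus_minus)
  show "\<forall>e>0. \<exists>r>0. ALL h. 0 < h & h < r --> norm ((LBINT u:{s - h..s}. V u) - h *\<^sub>R V s) <= e * h"
  proof (intro allI impI)
   fix e :: real assume e: "0 < e"
   from lim[OF s e] obtain r where r: "0 < r" "!!h. 0 < h ==> h < r ==>
    norm (integral {- s..- s + h} (%x. V (- x)) /\<^sub>R h - V s) < e" by auto
   show "\<exists>r>0. ALL h. 0 < h & h < r --> norm ((LBINT u:{s - h..s}. V u) - h *\<^sub>R V s) <= e * h"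
   proof (intro exI[of _ r] conjI allI impI r(1))
    fix h assume h: "0 < h & h < r"
    have "integral {- s..- s + h} (%x. V (- x)) = integral {s - h..s} V" using Henstock_Kurzweil_Integration.integral_reflect_real[of "s" "s - h" V] by simp
    also have "... = (LBINT u:{s - h..s}. V u)" by (rule set_borel_integral_eq_integral(2)[symmetric]) (rule bdm_integrable[OF V[of "s - h" s]], simp)
    finally have "norm ((LBINT u:{s - h..s}. V u) /\<^sub>R h - V s) < e" using r(2)[of h] h by simp
    moreover have "(LBINT u:{s - h..s}. V u) - h *\<^sub>R V s = h *\<^sub>R ((LBINT u:{s - h..s}. V u) /\<^sub>R h - V s)" using h by (simp add: algebra_simps)
    ultimately show "norm ((LBINT u:{s - h..s}. V u) - h *\<^sub>R V s) <= e * h" using h by simp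
   qed
  qed
 qed
qed

text \<open>The delayed averages only look at values of \<open>V\<close> up to the beginning of the current step.\<close>
definition delayed_avg :: "(real => 'a::euclidean_space) => real => real => nat => 'a" where
 "delayed_avg V t d k = (if k = 0 then 0 else (LBINT u:{t + real (k - 1) * d..t + real k * d}. V u) /\<^sub>R d)"

text \<open>Entry 0 is zero and entry i is the average over the cell that ends at the i-th grid
  time, hence \<open>Suc k\<close> terms against k cells.\<close>

lemma delayed_avg_sum:
 assumes V: "bdm t T V" and d: "0 < d" and k: "t + real k * d <= T"
 shows "(\<Sum>i<Suc k. d *\<^sub>R delayed_avg V t d i) = (LBINT u:{t..t + real k * d}. V u)" using k
proof (induction k)
 case 0
 have "(LBINT u:{t..t}. V u) = 0" by (rule LBINT_null)
 thus ?case by (simp add: delayed_avg_def)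
next
 case (Suc k)
 have "t + real k * d <= T" using Suc(2) d by (auto simp: algebra_simps)
 note IH = Suc(1)[OF this]
 have "(LBINT u:{t..t + real (Suc k) * d}. V u) = (LBINT u:{t..t + real k * d}. V u) + (LBINT u:{t + real k * d..t + real (Suc k) * d}. V u)"
  using d Suc(2) by (intro LBINT_split[OF V]) (auto simp: algebra_simps)
 thus ?case using d IH by (subst sum.lessThan_Suc) (simp add: delayed_avg_def)
qed

lemma norm_delayed_avg:
 assumes V: "bdm t T V" and d: "0 < d" and k: "t + real k * d <= T" and l: "!!s. s \<in> {t..T} ==> norm (V s) <= l" "0 <= l"
 shows "norm (delayed_avg V t d k) <= l"
proof (cases "k = 0")
 case False
 hence kk: "real (k - 1) = real k - 1" by (simp add: of_nat_diff)
 have tk: "t <= t + real (k - 1) * d" using d by simp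
 have "norm (LBINT u:{t + real (k - 1) * d..t + real k * d}. V u) <= l * (t + real k * d - (t + real (k - 1) * d))" using d k kk tk
  by (intro norm_LBINT_le[OF V] l(1)) (auto simp del: One_nat_def simp: algebra_simps intro: order_trans[OF tk])
 hence "norm (LBINT u:{t + real (k - 1) * d..t + real k * d}. V u) <= l * d" using kk by (simp add: algebra_simps)
 thus ?thesis using False d by (simp add: delayed_avg_def field_simps)
qed (use l in \<open>auto simp: delayed_avg_def\<close>)

text \<open>The averaging cell does not end at s. Its integral is the difference of two integrals
  over intervals that do, of lengths at most \<open>2 * d N\<close> and \<open>d N\<close>; with
  tolerance \<open>e / 4\<close> in each, the total error stays below
  \<open>e * d N\<close>.\<close>

lemma delayed_avg_tendsto:
 fixes V :: "real => 'a::euclidean_space"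
 assumes V: "!!a b. bdm a b V" and d: "!!N. 0 < d N" "d \<longlonglongrightarrow> 0"
 shows "AE s in lborel. t < s --> (%N. delayed_avg V t (d N) (step_ix t (d N) s)) \<longlonglongrightarrow> V s" using lebesgue_left_average[OF V]
proof eventually_elim
 fix s assume avg: "\<forall>e>0. \<exists>r>0. ALL h. 0 < h & h < r --> norm ((LBINT u:{s - h..s}. V u) - h *\<^sub>R V s) <= e * h"
 show "t < s --> (%N. delayed_avg V t (d N) (step_ix t (d N) s)) \<longlonglongrightarrow> V s"
 proof (intro impI LIMSEQ_I)
  fix e :: real assume ts: "t < s" and e: "0 < e"
  from avg e obtain r where r: "0 < r" and
   avg: "!!h. 0 < h ==> h < r ==> norm ((LBINT u:{s - h..s}. V u) - h *\<^sub>R V s) <= e / 4 * h"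
   by (metis zero_less_divide_iff zero_less_numeral)
  have avg: "norm ((LBINT u:{s - h..s}. V u) - h *\<^sub>R V s) <= e / 4 * h" if "0 <= h" "h < r" for h
  proof (cases "h = 0")
   case True
   have "(LBINT u:{s..s}. V u) = 0" by (rule LBINT_null)
   thus ?thesis using True by simp
  qed (use avg that in auto)
  have "eventually (%N. d N < min (r / 2) (s - t)) sequentially" using r ts by (intro order_tendstoD[OF d(2)]) auto
  then obtain N0 where N0: "!!N. N >= N0 ==> d N < min (r / 2) (s - t)" by (auto simp: eventually_sequentially)
  show "EX no. \<forall>N\<ge>no. norm (delayed_avg V t (d N) (step_ix t (d N) s) - V s) < e"
  proof (intro exI[of _ N0] allI impI)
   fix N assume "N0 <= N"
   hence dN: "d N < r / 2" "d N < s - t" using N0[of N] by auto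
   note d0 = d(1)[of N]
   let ?k = "step_ix t (d N) s"
   note kb = step_ix_bounds[OF d0 less_imp_le[OF ts]]
   have k: "?k ~= 0" using kb(2) dN by (intro notI) auto
   hence kk: "real (?k - 1) = real ?k - 1" by (metis Suc_pred' diff_Suc_1 neq0_conv of_nat_Suc add_diff_cancel_left')
   let ?p = "t + real (?k - 1) * d N" and ?q = "t + real ?k * d N"
   have pq: "?p <= ?q" "?q <= s" "s - ?p < r" "s - ?q < r" "?q - ?p = d N" "s - ?q <= d N" "s - ?p <= 2 * d N"
    using kb dN d0 kk by (auto simp: algebra_simps)
   have "d N *\<^sub>R (delayed_avg V t (d N) ?k - V s) = (LBINT u:{?p..?q}. V u) - d N *\<^sub>R V s" using k d0 by (simp add: delayed_avg_def algebra_simps)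
   also have "(LBINT u:{?p..?q}. V u) = (LBINT u:{?p..s}. V u) - (LBINT u:{?q..s}. V u)" using pq by (subst LBINT_split[OF V[of ?p s], of ?p ?q s]) auto
   also have "... - d N *\<^sub>R V s = ((LBINT u:{s - (s - ?p)..s}. V u) - (s - ?p) *\<^sub>R V s) - ((LBINT u:{s - (s - ?q)..s}. V u) - (s - ?q) *\<^sub>R V s)"
    using kk by (simp add: algebra_simps)
   also have "norm ... <= e / 4 * (s - ?p) + e / 4 * (s - ?q)" using pq by (intro order_trans[OF norm_triangle_ineq4] add_mono avg) auto
   also have "... <= e / 4 * (2 * d N) + e / 4 * d N" using pq e by (intro add_mono mult_left_mono) auto
   also have "... < e * d N" using e d0 by simp
   finally show "norm (delayed_avg V t (d N) ?k - V s) < e" using d0 by (simp add: mult.commute)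
  qed
 qed
qed

section \<open>Filtrations, Brownian increments and controls\<close>

lemma restrict_lborel_finite: "finite_measure (restrict_space lborel {a..b::real})"
 by (rule finite_measureI) (simp add: space_restrict_space emeasure_restrict_space emeasure_lborel_Icc_eq)

lemma LBINT_restrict:
 fixes f :: "real => 'a::{banach, second_countable_topology}"
 assumes "{c..d} \<subseteq> {a..b}"
 shows "(LBINT r:{c..d}. f r) = (LINT r|restrict_space lborel {a..b}. indicator {c..d} r *\<^sub>R f r)" unfolding set_lebesgue_integral_def using assms
 by (subst integral_restrict_space) (auto intro!: Bochner_Integration.integral_cong simp: indicator_def)

locale brownian_basis =
 fixes M :: "'w measure" and \<F> :: "real => 'w measure" and W :: "real => 'w => real^'n::finite"
 assumes basis: "complete_filtered_prob_space M \<F>" and brownian: "standard_Brownian_motion M \<F> W"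
begin

sublocale prob_space M using basis by (simp add: complete_filtered_prob_space_def)

lemma subalgebra_F: "subalgebra M (\<F> s)" using basis by (simp add: complete_filtered_prob_space_def)

lemma space_F: "space (\<F> s) = space M" using subalgebra_F[of s] by (simp add: subalgebra_def)

lemma F_le_M: "f \<in> measurable (\<F> s) N ==> f \<in> measurable M N" by (rule measurable_from_subalg[OF subalgebra_F])

lemma sets_F_le: "A \<in> sets (\<F> s) ==> A \<in> sets M" using subalgebra_F[of s] by (auto simp: subalgebra_def)

lemma sets_F_mono: "s <= s' ==> A \<in> sets (\<F> s) ==> A \<in> sets (\<F> s')"
 using basis filtration.sets_F_mono[of "space M" \<F> s s'] by (auto simp: complete_filtered_prob_space_def)

lemma F_mono: "s <= s' ==> f \<in> measurable (\<F> s) N ==> f \<in> measurable (\<F> s') N"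
 by (rule measurable_from_subalg[of "\<F> s'" "\<F> s"]) (auto simp: subalgebra_def space_F intro: sets_F_mono)

lemma null_in_F: "0 <= s ==> N \<in> null_sets M ==> N \<in> sets (\<F> s)"
 using basis sets_F_mono[of 0 s] by (auto simp: complete_filtered_prob_space_def)

lemma null_subset: "N \<in> null_sets M ==> A \<subseteq> N ==> A \<in> null_sets M"
proof -
 interpret complete_measure M using basis by (simp add: complete_filtered_prob_space_def)
 show "N \<in> null_sets M ==> A \<subseteq> N ==> A \<in> null_sets M" by (rule complete2)
qed

text \<open>This is where completeness of the filtration enters: changing an adapted variable on a
  null set leaves it adapted.\<close>

lemma F_modification:
 assumes s: "0 <= s" and f: "f \<in> measurable (\<F> s) N" and g: "g \<in> space M \<rightarrow> space N" and ae: "AE w in M. f w = g w"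
 shows "g \<in> measurable (\<F> s) N"
proof (rule measurableI)
 show "g x \<in> space N" if "x \<in> space (\<F> s)" for x using that g by (auto simp: space_F)
 fix A assume A: "A \<in> sets N"
 obtain Z where Z: "Z \<in> null_sets M" "{w\<in>space M. f w ~= g w} \<subseteq> Z" using ae by (auto elim!: AE_E simp: null_sets_def)
 have "g -` A \<inter> space (\<F> s) = (f -` A \<inter> space (\<F> s) - Z) \<union> (g -` A \<inter> Z \<inter> space M)" using Z by (auto simp: space_F)
 moreover have "g -` A \<inter> Z \<inter> space M \<in> sets (\<F> s)" by (intro null_in_F s null_subset[OF Z(1)]) auto
 ultimately show "g -` A \<inter> space (\<F> s) \<in> sets (\<F> s)" using measurable_sets[OF f A] null_in_F[OF s Z(1)] by auto
qed

lemma M_modification: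
 assumes f: "f \<in> measurable M N" and g: "g \<in> space M \<rightarrow> space N" and ae: "AE w in M. f w = g w"
 shows "g \<in> measurable M N"
proof (rule measurableI)
 show "g x \<in> space N" if "x \<in> space M" for x using that g by auto
 fix A assume A: "A \<in> sets N"
 obtain Z where Z: "Z \<in> null_sets M" "{w\<in>space M. f w ~= g w} \<subseteq> Z" using ae by (auto elim!: AE_E simp: null_sets_def)
 have "g -` A \<inter> space M = (f -` A \<inter> space M - Z) \<union> (g -` A \<inter> Z \<inter> space M)" using Z by auto
 moreover have "g -` A \<inter> Z \<inter> space M \<in> sets M" using null_subset[OF Z(1), of "g -` A \<inter> Z \<inter> space M"] by auto
 ultimately show "g -` A \<inter> space M \<in> sets M" using measurable_sets[OF f A] Z(1) by auto
qed

section \<open>Brownian increments and frozen variables\<close>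

lemma W_measurable: "0 <= s ==> s <= s' ==> W s \<in> borel_measurable (\<F> s')"
 using brownian F_mono[of s s' "W s"] by (auto simp: standard_Brownian_motion_def)

lemma W_continuous: "AE w in M. continuous_on {0..} (%s. W s w)" using brownian by (simp add: standard_Brownian_motion_def)

lemma increment_distr:
 assumes "0 <= s" "s < s'"
 shows "distr M borel (%w. W s' w - W s w) = gauss (s' - s)"
proof -
 have "distributed M lborel (%w. W s' w - W s w)
     (%x. ennreal (\<Prod>i\<in>UNIV. normal_density 0 (sqrt (s' - s)) (x $ i)))" using brownian assms by (simp add: standard_Brownian_motion_def)
 hence "distr M lborel (%w. W s' w - W s w) = gauss (s' - s)" by (simp add: distributed_def gauss_def)
 thus ?thesis by (simp cong: distr_cong)
qed

lemma increment_measurable: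
 assumes "0 <= s" "s <= s'"
 shows "(%w. W s' w - W s w) \<in> borel_measurable (\<F> s')"
 using W_measurable[of s s'] W_measurable[of s' s'] assms by (intro borel_measurable_diff) auto

lemma increment_norm:
 assumes "0 <= s" "s <= s'"
 shows "integrable M (%w. norm (W s' w - W s w))"
  "expectation (%w. norm (W s' w - W s w)) <= sqrt (real CARD('n) * (s' - s))"
proof -
 note [measurable] = F_le_M[OF increment_measurable[OF assms]]
 have *: "integrable M (%w. (norm (W s' w - W s w))\<^sup>2) & expectation (%w. (norm (W s' w - W s w))\<^sup>2) = real CARD('n) * (s' - s)"
 proof (cases "s = s'")
  case False
  hence lt: "s < s'" "0 < s' - s" using assms by auto
  note d = increment_distr[OF assms(1) lt(1)]
  show ?thesis using integrable_gauss_norm(1,2)[OF lt(2), where 'n='n] unfolding d[symmetric] by (simp add: integral_distr integrable_distr_eq)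
 qed simp
 show i: "integrable M (%w. norm (W s' w - W s w))" by (rule square_integrable_imp_integrable) (use * in auto)
 \<comment> \<open>The first moment is bounded through the second one, because the variance of the
   norm is nonnegative.\<close>
 have "(expectation (%w. norm (W s' w - W s w)))\<^sup>2 <= real CARD('n) * (s' - s)"
  using variance_positive[of "%w. norm (W s' w - W s w)"] variance_eq[OF i] * by simp
 thus "expectation (%w. norm (W s' w - W s w)) <= sqrt (real CARD('n) * (s' - s))" by (rule real_le_rsqrt)
qed

text \<open>\<open>X\<close> is measurable at time s and the increment is independent of that past,
  so their joint law is a product measure. Fubini then integrates the increment out with
  \<open>X\<close> held fixed: this is the Markov property of the Euler chain.\<close>

lemma integral_freeze:
 fixes f :: "'x \<times> (real^'n) => real"
 assumes s: "0 <= s" "s < s'" and X: "X \<in> measurable (\<F> s) N"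
  and f[measurable]: "f \<in> borel_measurable (N \<Otimes>\<^sub>M borel)" and K: "!!x y. abs (f (x, y)) <= K"
 shows "(LINT w|M. f (X w, W s' w - W s w)) = (LINT w|M. (LINT y|gauss (s' - s). f (X w, y)))"
  and "(%w. \<integral>y. f (X w, y) \<partial>gauss (s' - s)) \<in> borel_measurable (\<F> s)"
proof -
 let ?D = "%w. W s' w - W s w" and ?g = "gauss (s' - s) :: (real^'n) measure"
 have [measurable]: "X \<in> measurable M N" by (rule F_le_M[OF X])
 have [measurable]: "?D \<in> borel_measurable M" using s by (intro F_le_M[OF increment_measurable]) auto
 interpret g: prob_space ?g using s by (intro prob_space_gauss) auto
 interpret X: prob_space "distr M N X" by (rule prob_space_distr) simp
 interpret P: pair_prob_space "distr M N X" ?g ..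
 have "f \<in> borel_measurable (N \<Otimes>\<^sub>M ?g)" by measurable
 from g.borel_measurable_lebesgue_integral[of "%x y. f (x, y)" N] this
 have meas: "(%x. \<integral>y. f (x, y) \<partial>?g) \<in> borel_measurable N" by simp
 show "(%w. \<integral>y. f (X w, y) \<partial>gauss (s' - s)) \<in> borel_measurable (\<F> s)" by (rule measurable_compose[OF X meas])
 have ind: "indep_set (sets (\<F> s)) {?D -` A \<inter> space M | A. A \<in> sets borel}" using brownian s by (simp add: standard_Brownian_motion_def)
 have "distr M N X \<Otimes>\<^sub>M ?g = distr M (N \<Otimes>\<^sub>M borel) (%w. (X w, ?D w))"
 proof (rule pair_measure_eqI)
  fix A B assume "A \<in> sets (distr M N X)" "B \<in> sets ?g"
  hence AB: "A \<in> sets N" "B \<in> sets borel" by auto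
  have "X -` A \<inter> space M \<in> sets (\<F> s)" using measurable_sets[OF X AB(1)] by (simp add: space_F)
  hence "prob ((X -` A \<inter> space M) \<inter> (?D -` B \<inter> space M)) = prob (X -` A \<inter> space M) * prob (?D -` B \<inter> space M)"
   using AB by (intro indep_setD[OF ind]) auto
  moreover have "(%w. (X w, ?D w)) -` (A \<times> B) \<inter> space M = (X -` A \<inter> space M) \<inter> (?D -` B \<inter> space M)" by auto
  ultimately show "emeasure (distr M N X) A * emeasure ?g B = emeasure (distr M (N \<Otimes>\<^sub>M borel) (%w. (X w, ?D w))) (A \<times> B)"
   unfolding increment_distr[OF s, symmetric] using AB by (simp add: emeasure_distr emeasure_eq_measure ennreal_mult'' )
 next
  show "sets (distr M N X \<Otimes>\<^sub>M ?g) = sets (distr M (N \<Otimes>\<^sub>M borel) (%w. (X w, ?D w)))"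
   by (simp cong: sets_pair_measure_cong)
 qed (rule X.sigma_finite_measure_axioms g.sigma_finite_measure_axioms)+
 note eq = this
 have int: "integrable (distr M N X \<Otimes>\<^sub>M ?g) f" by (rule P.integrable_const_bound[where B=K]) (use K in \<open>auto simp: split_beta' intro!: AE_I2\<close>)
 have "(LINT w|M. f (X w, ?D w)) = (LINT p|distr M (N \<Otimes>\<^sub>M borel) (%w. (X w, ?D w)). f p)"
  by (subst integral_distr) auto
 also have "... = (LINT x|distr M N X. (LINT y|?g. f (x, y)))" unfolding eq[symmetric] by (rule P.integral_fst'[symmetric, OF int])
 also have "... = (LINT w|M. (LINT y|?g. f (X w, y)))" by (rule integral_distr) (auto intro: meas)
 finally show "(LINT w|M. f (X w, ?D w)) = (LINT w|M. (LINT y|?g. f (X w, y)))" .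
qed

text \<open>An adapted, jointly measurable \<open>v\<close> need not be progressive, but \<open>I = \<integral> v dr\<close> is still adapted:
  \<open>I - E[I | \<F> s]\<close> is orthogonal to every \<open>v r\<close>, hence to \<open>I\<close>, hence vanishes.\<close>
lemma adapted_integral_real:
 fixes v :: "real => 'w => real"
 assumes t: "0 <= t" "t <= s" "s <= T"
  and ad: "!!r. r \<in> {t..s} ==> v r \<in> borel_measurable (\<F> s)"
  and joint: "(%(r, w). v r w) \<in> borel_measurable (restrict_space borel {t..T} \<Otimes>\<^sub>M M)"
  and K: "!!r w. r \<in> {t..T} ==> w \<in> space M ==> abs (v r w) <= K"
 shows "(%w. LBINT r:{t..s}. v r w) \<in> borel_measurable (\<F> s)"
proof -
 define L where "L = restrict_space lborel {t..T}"
 define I where "I w = (LINT r|L. indicator {t..s} r * v r w)" for w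
 have Ieq: "(LBINT r:{t..s}. v r w) = I w" for w unfolding I_def L_def using LBINT_restrict[of t s t T "%r. v r w"] t by simp
 interpret L: finite_measure L unfolding L_def by (rule restrict_lborel_finite)
 interpret P: pair_sigma_finite L M ..
 have setsL[measurable_cong]: "sets L = sets (restrict_space borel {t..T})" unfolding L_def by (simp cong: sets_restrict_space_cong)
 have spL: "space L = {t..T}" by (simp add: L_def space_restrict_space)
 have vj[measurable]: "(%x. v (fst x) (snd x)) \<in> borel_measurable (L \<Otimes>\<^sub>M M)"
  using joint by (simp add: split_beta' cong: measurable_cong_sets sets_pair_measure_cong[OF setsL refl])
 have [measurable]: "{t..s} \<in> sets L" using t by (simp add: L_def sets_restrict_space_iff)
 have K0: "0 <= K" using K[of t] t subprob_not_empty not_empty by (meson abs_ge_zero all_not_in_conv atLeastAtMost_iff order_refl order_trans)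
 interpret PF: finite_measure "L \<Otimes>\<^sub>M M" by (rule finite_measure_pair_measure) unfold_locales
 have mI[measurable]: "I \<in> borel_measurable M"
 proof -
  have "(%w. \<integral>r. indicator {t..s} r * v r w \<partial>L) \<in> borel_measurable M"
  proof (rule L.borel_measurable_lebesgue_integral)
   have "(%x. v (snd x) (fst x)) \<in> borel_measurable (M \<Otimes>\<^sub>M L)"
    using measurable_compose[OF measurable_pair_swap' vj] by (simp add: split_beta')
   thus "(%(w, r). indicator {t..s} r * v r w) \<in> borel_measurable (M \<Otimes>\<^sub>M L)" unfolding split_beta' by measurable
  qed
  thus ?thesis unfolding I_def .
 qed
 have Ib: "abs (I w) <= K * measure L (space L)" if "w \<in> space M" for w
 proof -
  have "abs (I w) <= (LINT r|L. abs (indicator {t..s} r * v r w))" unfolding I_def by (rule integral_abs_bound)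
  also have "... <= (LINT r|L. K)" using K K0 that by (intro integral_mono') (auto simp: indicator_def spL)
  finally show ?thesis by (simp add: mult.commute)
 qed
 define K' where "K' = K * measure L (space L)"
 have II: "integrable M I" by (rule integrable_const_bound[where B=K']) (use Ib in \<open>auto simp: K'_def\<close>)
 interpret sigma_finite_subalgebra M "\<F> s" by (intro finite_measure_subalgebra_is_sigma_finite finite_measure_subalgebra.intro
    finite_measure_subalgebra_axioms.intro subalgebra_F finite_measure_axioms)
 \<comment> \<open>Clipping gives a version of the conditional expectation that is bounded at every
   point, which makes all products below integrable.\<close>
 define J where "J = (%w. max (- K') (min K' (real_cond_exp M (\<F> s) I w)))"
 have mJ: "J \<in> borel_measurable (\<F> s)" unfolding J_def by measurable
 note [measurable] = F_le_M[OF mJ]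
 have "AE w in M. - K' <= real_cond_exp M (\<F> s) I w" "AE w in M. real_cond_exp M (\<F> s) I w <= K'"
  using Ib by (intro real_cond_exp_ge_c real_cond_exp_le_c II; force simp: K'_def abs_le_iff intro!: AE_I2)+
 hence aeJ: "AE w in M. J w = real_cond_exp M (\<F> s) I w" by eventually_elim (auto simp: J_def)
 have "0 <= K'" using K0 by (simp add: K'_def)
 hence Jb: "abs (J w) <= K'" for w by (auto simp: J_def abs_le_iff)
 have orth: "(LINT w|M. f w * (I w - J w)) = 0"
  if f: "f \<in> borel_measurable (\<F> s)" and fb: "!!w. w \<in> space M ==> abs (f w) <= c" for f c
 proof -
  note [measurable] = F_le_M[OF f]
  have c0: "0 <= c" using fb not_empty by fastforce
  have i1: "integrable M (%w. f w * I w)" by (rule integrable_const_bound[where B="c * K'"])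
    (auto simp: abs_mult K'_def c0 intro!: AE_I2 mult_mono fb Ib)
  have i2: "integrable M (%w. f w * J w)" by (rule integrable_const_bound[where B="c * K'"])
    (auto simp: abs_mult c0 intro!: AE_I2 mult_mono fb Jb)
  have "(LINT w|M. f w * J w) = (LINT w|M. f w * real_cond_exp M (\<F> s) I w)"
   using aeJ by (intro integral_cong_AE) (auto elim!: eventually_mono)
  also have "... = (LINT w|M. f w * I w)" by (rule real_cond_exp_intg(2)[OF i1 f]) simp
  finally show ?thesis using i1 i2 by (simp add: right_diff_distrib)
 qed
 have "(LINT w|M. I w * (I w - J w)) = (LINT w|M. (LINT r|L. indicator {t..s} r * v r w * (I w - J w)))"
  unfolding I_def by simp
 also have "... = (LINT r|L. (LINT w|M. indicator {t..s} r * v r w * (I w - J w)))"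
 proof (rule P.Fubini_integral)
  have "abs (indicator {t..s} r * v r w * (I w - J w)) <= K * (2 * K')" if "r \<in> {t..T}" "w \<in> space M" for r w
  proof -
   have "abs (indicator {t..s} r * v r w) <= K" using K[OF that] K0 by (auto simp: indicator_def)
   moreover have "abs (I w - J w) <= 2 * K'" using Ib[OF that(2)] Jb[of w] by (auto simp: K'_def)
   ultimately show ?thesis unfolding abs_mult[of _ "I w - J w"] using K0 by (intro mult_mono) auto
  qed
  thus "integrable (L \<Otimes>\<^sub>M M) (%(r, w). indicator {t..s} r * v r w * (I w - J w))"
   by (intro PF.integrable_const_bound[where B="K * (2 * K')"])
    (auto simp: split_beta' space_pair_measure spL intro!: AE_I2)
 qed
 also have "... = (LINT r|L. 0)"
 proof (rule Bochner_Integration.integral_cong[OF refl])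
  fix r assume "r \<in> space L"
  hence r: "r \<in> {t..T}" by (simp add: spL)
  show "(LINT w|M. indicator {t..s} r * v r w * (I w - J w)) = 0"
   using orth[OF ad, of r K] K[OF r] by (auto simp: indicator_def)
 qed
 finally have "(LINT w|M. I w * (I w - J w)) = 0" by simp
 moreover have "(LINT w|M. J w * (I w - J w)) = 0" by (rule orth[OF mJ]) (rule Jb)
 moreover have iI: "integrable M (%w. I w * (I w - J w))" and iJ: "integrable M (%w. J w * (I w - J w))"
 proof -
  have "abs (I w - J w) <= 2 * K'" if "w \<in> space M" for w using Ib[OF that] Jb[of w] by (auto simp: K'_def)
  thus "integrable M (%w. I w * (I w - J w))" "integrable M (%w. J w * (I w - J w))"
   using Ib Jb \<open>0 <= K'\<close>
   by (auto intro!: integrable_const_bound[where B="K' * (2 * K')"] AE_I2 mult_mono simp: abs_mult K'_def[symmetric])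
 qed
 ultimately have "(LINT w|M. (I w - J w)\<^sup>2) = 0" by (simp add: power2_eq_square left_diff_distrib)
 moreover have "integrable M (%w. (I w - J w)\<^sup>2)"
  using Bochner_Integration.integrable_diff[OF iI iJ] by (simp add: power2_eq_square left_diff_distrib)
 ultimately have "AE w in M. (I w - J w)\<^sup>2 = 0" by (subst (asm) integral_nonneg_eq_0_iff_AE) auto
 hence "AE w in M. J w = I w" by eventually_elim simp
 hence "I \<in> borel_measurable (\<F> s)" using t by (intro F_modification[OF _ mJ]) auto
 thus ?thesis unfolding Ieq .
qed

text \<open>The third form continues the path by 0, because the differentiation of its integral is
  stated for paths on the whole line.\<close>

lemma control_path:
 assumes V: "V \<in> controls M \<F> l t T" and w: "w \<in> space M"
 shows "bdm t T (%s. V s w)" "!!s. s \<in> {t..T} ==> norm (V s w) <= l"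
  "!!a b. bdm a b (%s. indicator {t..T} s *\<^sub>R V s w)"
proof -
 have joint: "(%(s, w). V s w) \<in> borel_measurable (restrict_space borel {t..T} \<Otimes>\<^sub>M M)" using V by (simp add: controls_def)
 have m: "(%s. V s w) \<in> borel_measurable (restrict_space borel {t..T})" using measurable_compose[OF measurable_Pair2'[OF w] joint] by simp
 show l: "!!s. s \<in> {t..T} ==> norm (V s w) <= l" using V w by (auto simp: controls_def)
 show "bdm t T (%s. V s w)" unfolding bdm_def using m l by blast
 have "(%s. indicator {t..T} s *\<^sub>R V s w) \<in> borel_measurable borel" using m by (simp add: borel_measurable_restrict_space_iff)
 hence "(%s. indicator {t..T} s *\<^sub>R V s w) \<in> borel_measurable (restrict_space borel {a..b})" for a b by (rule measurable_restrict_space1)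
 moreover have "norm (indicator {t..T} s *\<^sub>R V s w) <= abs l" for s using l[of s] by (auto simp: indicator_def)
 ultimately show "bdm a b (%s. indicator {t..T} s *\<^sub>R V s w)" for a b unfolding bdm_def by blast
qed

lemma adapted_control_integral:
 assumes V: "V \<in> controls M \<F> l t T" and t: "0 <= t" "t <= p" "p <= s" "s <= T"
 shows "(%w. LBINT r:{p..s}. V r w) \<in> borel_measurable (\<F> s)"
proof -
 have *: "(%w. LBINT r:{t..s'}. V r w) \<in> borel_measurable (\<F> s)" if s': "t <= s'" "s' <= s" for s'
 proof -
  have "(%w. (LBINT r:{t..s'}. V r w) \<bullet> axis i 1) \<in> borel_measurable (\<F> s')" for i
  proof -
   have "(%w. LBINT r:{t..s'}. V r w \<bullet> axis i 1) \<in> borel_measurable (\<F> s')"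
   proof (rule adapted_integral_real[where K=l and T=T])
    show "(%(r, w). V r w \<bullet> axis i 1) \<in> borel_measurable (restrict_space borel {t..T} \<Otimes>\<^sub>M M)"
     using V by (auto simp: controls_def split_beta' intro!: borel_measurable_inner)
    show "(%w. V r w \<bullet> axis i 1) \<in> borel_measurable (\<F> s')" if "r \<in> {t..s'}" for r
     using V that s' t by (auto simp: controls_def intro!: borel_measurable_inner intro: F_mono[of r s'])
    show "abs (V r w \<bullet> axis i 1) <= l" if "r \<in> {t..T}" "w \<in> space M" for r w
     using control_path(2)[OF V that(2,1)] component_le_norm_cart[of "V r w" i] by (simp add: inner_axis)
   qed (use s' t in auto)
   thus ?thesis
   proof (rule measurable_cong[THEN iffD1, rotated])
    fix w assume "w \<in> space (\<F> s')"
    hence "w \<in> space M" by (simp add: space_F)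
    from bdm_integrable[OF control_path(1)[OF V this], of t s'] s' t
    have "set_integrable lborel {t..s'} (%r. V r w)" by auto
    thus "(LBINT r:{t..s'}. V r w \<bullet> axis i 1) = (LBINT r:{t..s'}. V r w) \<bullet> axis i 1"
     unfolding set_lebesgue_integral_def set_integrable_def by (subst integral_inner_left[symmetric]) (auto simp: )
   qed
  qed
  hence "(%w. LBINT r:{t..s'}. V r w) \<in> borel_measurable (\<F> s')" by (subst borel_measurable_euclidean_space) (auto simp: Basis_vec_def)
  thus ?thesis using F_mono s' by blast
 qed
 have "(%w. (LBINT r:{t..s}. V r w) - (LBINT r:{t..p}. V r w)) \<in> borel_measurable (\<F> s)"
  using t by (intro borel_measurable_diff *) auto
 thus ?thesis
 proof (rule measurable_cong[THEN iffD1, rotated])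
  fix w assume "w \<in> space (\<F> s)"
  hence "w \<in> space M" by (simp add: space_F)
  from LBINT_split[OF control_path(1)[OF V this], of t p s] t
  show "(LBINT r:{t..s}. V r w) - (LBINT r:{t..p}. V r w) = (LBINT r:{p..s}. V r w)" by simp
 qed
qed

end

section \<open>The Euler scheme of a bounded control problem\<close>

text \<open>Beyond the distance d belonging to e, the crude bound \<open>2 * K\<close> is at most
  \<open>2 * K / d\<close> times the distance. Affine moduli of this kind pass through expectations
  and infima with explicit constants, so the dynamic programming recursion preserves them.\<close>

lemma almost_lipschitz:
 fixes a :: "'a::metric_space => real"
 assumes uc: "uniformly_continuous_on UNIV a" and K: "!!p. abs (a p) <= K" and e: "0 < e"
 shows "\<exists>C\<ge>0. ALL p q. abs (a p - a q) <= e + C * dist p q"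
proof -
 obtain d where d: "0 < d" "!!p q. dist q p < d ==> dist (a q) (a p) < e"
  using uc e unfolding uniformly_continuous_on_def by (metis UNIV_I)
 have K0: "0 <= K" using K[of undefined] by linarith
 show ?thesis
 proof (intro exI[of _ "2 * K / d"] conjI allI)
  fix p q :: 'a
  have nn: "0 <= 2 * K / d * dist p q" using K0 d(1) by (intro mult_nonneg_nonneg) auto
  show "abs (a p - a q) <= e + 2 * K / d * dist p q"
  proof (cases "dist p q < d")
   case True
   thus ?thesis using d(2)[of p q] nn by (auto simp: dist_real_def)
  next
   case False
   hence "2 * K / d * d <= 2 * K / d * dist p q" using K0 d(1) by (intro mult_left_mono) auto
   hence "2 * K <= 2 * K / d * dist p q" using d(1) by simp
   moreover have "abs (a p - a q) <= 2 * K" using K[of p] K[of q] by linarith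
   ultimately show ?thesis using e by linarith
  qed
 qed (use K0 d in auto)
qed

lemma continuous_if_almost_lipschitz:
 fixes a :: "'a::metric_space => real"
 assumes "!!e. 0 < e ==> \<exists>C\<ge>0. \<forall>p\<in>S. \<forall>q\<in>S. abs (a p - a q) <= e + C * dist p q"
 shows "continuous_on S a" unfolding continuous_on_iff
proof (intro ballI allI impI)
 fix p and e :: real assume p: "p \<in> S" and e: "0 < e"
 obtain C where C: "0 <= C" "!!p q. p \<in> S ==> q \<in> S ==> abs (a p - a q) <= e / 2 + C * dist p q"
  using assms[of "e / 2"] e by auto
 show "\<exists>d>0. \<forall>q\<in>S. dist q p < d --> dist (a q) (a p) < e"
 proof (intro exI[of _ "e / (2 * (C + 1))"] conjI ballI impI)
  fix q assume q: "q \<in> S" and "dist q p < e / (2 * (C + 1))"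
  hence "(C + 1) * dist q p < e / 2" using C(1) by (simp add: field_simps)
  moreover have "C * dist q p <= (C + 1) * dist q p" by (intro mult_right_mono) auto
  ultimately show "dist (a q) (a p) < e" using C(2)[OF q p] by (simp add: dist_real_def)
 qed (use e C in auto)
qed

lemma cINF_diff_le:
 fixes F G :: "'a => real"
 assumes "S ~= {}" "!!a. a \<in> S ==> abs (F a - G a) <= c" "!!a. a \<in> S ==> m <= F a" "!!a. a \<in> S ==> m' <= G a"
 shows "abs ((INF a\<in>S. F a) - (INF a\<in>S. G a)) <= c"
proof -
 have bF: "bdd_below (F ` S)" and bG: "bdd_below (G ` S)" using assms(3,4) by (auto intro!: bdd_belowI2)
 have "(INF a\<in>S. F a) - c <= (INF a\<in>S. G a)"
 proof (rule cINF_greatest[OF assms(1)])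
  fix a assume a: "a \<in> S"
  show "(INF a\<in>S. F a) - c <= G a" using cINF_lower[OF bF a] assms(2)[OF a] by linarith
 qed
 moreover have "(INF a\<in>S. G a) - c <= (INF a\<in>S. F a)"
 proof (rule cINF_greatest[OF assms(1)])
  fix a assume a: "a \<in> S"
  show "(INF a\<in>S. G a) - c <= F a" using cINF_lower[OF bG a] assms(2)[OF a] by linarith
 qed
 ultimately show ?thesis by linarith
qed

lemma mult_div_cancel: "0 < P ==> e / (c * P) * P = e / (c::real)" by simp

lemma abs_leD2: "abs x <= c ==> - c <= (x::real)" by linarith

text \<open>Drift, costs and noise are abstract on purpose. The locale is used with truncated costs,
  whose value approximates the value function, with a truncated Lyapunov function as both costs, and
  with zero costs when only the state process matters.\<close>

locale bounded_problem = brownian_basis M \<F> W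
 for M :: "'w measure" and \<F> and W :: "real => 'w => real^'n::finite" +
 fixes l T L K :: real and b :: "'e::euclidean_space => 'e"
  and \<Gamma> \<Sigma> :: "real^'n => 'e" and f :: "real \<times> 'e \<times> (real^'n) => real" and g :: "'e => real"
 assumes l_pos: "0 < l" and T_pos: "0 < T" and L_pos: "0 < L"
  and b_lip: "L-lipschitz_on UNIV b" and b_bd: "!!z. norm (b z) <= K"
  and lin_Gm: "bounded_linear \<Gamma>" and lin_Sg: "bounded_linear \<Sigma>"
  and f_bd: "!!p. abs (f p) <= K" and g_bd: "!!z. abs (g z) <= K"
  and f_uc: "uniformly_continuous_on UNIV f" and g_uc: "uniformly_continuous_on UNIV g"
begin

lemma K_nn: "0 <= K" using b_bd[of 0] norm_ge_zero order_trans by blast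

lemma ball_ne: "cball 0 l ~= ({} :: (real^'n) set)" using l_pos by auto

lemma continuous_b: "continuous_on UNIV b" by (rule lipschitz_on_continuous_on[OF b_lip])

lemma continuous_f: "continuous_on UNIV f" and continuous_g: "continuous_on UNIV g"
 by (rule uniformly_continuous_imp_continuous[OF f_uc], rule uniformly_continuous_imp_continuous[OF g_uc])

lemma meas_b[measurable]: "b \<in> borel_measurable borel"
 and meas_f[measurable]: "f \<in> borel_measurable borel"
 and meas_g[measurable]: "g \<in> borel_measurable borel"
 and meas_Gm[measurable]: "\<Gamma> \<in> borel_measurable borel"
 and meas_Sg[measurable]: "\<Sigma> \<in> borel_measurable borel" using continuous_b continuous_f continuous_g
  linear_continuous_on[OF lin_Gm] linear_continuous_on[OF lin_Sg] by (auto intro: borel_measurable_continuous_onI)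

section \<open>One step of the scheme\<close>

definition G where "G = onorm \<Gamma>"
definition Sn where "Sn = onorm \<Sigma>"

lemma Gm_le: "norm (\<Gamma> a) <= G * norm a" and G_nn: "0 <= G" unfolding G_def by (auto intro: onorm[OF lin_Gm] onorm_pos_le[OF lin_Gm])

lemma Sg_le: "norm (\<Sigma> y) <= Sn * norm y" and Sn_nn: "0 <= Sn" unfolding Sn_def by (auto intro: onorm[OF lin_Sg] onorm_pos_le[OF lin_Sg])

lemma Gm_ball: "a \<in> cball 0 l ==> norm (\<Gamma> a) <= G * l" using Gm_le[of a] G_nn by (auto intro: order_trans mult_left_mono)

definition stepf where "stepf d z a y = z + d *\<^sub>R (b z + \<Gamma> a) + \<Sigma> y"

lemma meas_stepf[measurable (raw)]:
 assumes "p \<in> borel_measurable N" "q \<in> borel_measurable N" "r \<in> borel_measurable N"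
 shows "(%x. stepf d (p x) (q x) (r x)) \<in> borel_measurable N" using assms unfolding stepf_def by measurable

lemma stepf_diff:
 assumes "0 <= d"
 shows "norm (stepf d z a y - stepf d z' a' y) <= (1 + L * d) * norm (z - z') + d * G * norm (a - a')"
proof -
 interpret \<Gamma>: bounded_linear \<Gamma> by (rule lin_Gm)
 have "stepf d z a y - stepf d z' a' y = (z - z') + d *\<^sub>R (b z - b z') + d *\<^sub>R \<Gamma> (a - a')" by (simp add: stepf_def algebra_simps \<Gamma>.diff)
 also have "norm ... <= norm (z - z') + d * norm (b z - b z') + d * norm (\<Gamma> (a - a'))"
  using assms by (intro order_trans[OF norm_triangle_ineq] add_mono) auto
 also have "... <= norm (z - z') + d * (L * norm (z - z')) + d * (G * norm (a - a'))" using assms lipschitz_onD[OF b_lip, of z z'] Gm_le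
  by (intro add_mono mult_left_mono) (auto simp: dist_norm)
 finally show ?thesis by (simp add: algebra_simps)
qed

text \<open>The transition operator of the Euler chain under the constant control
  \<open>a\<close>.\<close>

definition Pst where "Pst d c z a = (LINT y|gauss d. c (stepf d z a y))"

lemma Pst_integrable:
 fixes e :: "'e => real"
 assumes "0 < d" "e \<in> borel_measurable borel" "!!z. abs (e z) <= c"
 shows "integrable (gauss d) (%y. e (stepf d z a y))"
proof -
 interpret gs: prob_space "gauss d :: (real^'n) measure" by (rule prob_space_gauss) fact
 show ?thesis by (rule gs.integrable_const_bound[where B=c]) (use assms in \<open>auto\<close>)
qed

lemma Pst_abs_le:
 assumes "0 < d" "!!z. abs (e z) <= c"
 shows "abs (Pst d e z a) <= (c::real)"
proof -
 interpret gs: prob_space "gauss d :: (real^'n) measure" by (rule prob_space_gauss) fact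
 have "abs (Pst d e z a) <= (LINT y|gauss d. abs (e (stepf d z a y)))" unfolding Pst_def by (rule integral_abs_bound)
 also have "... <= (LINT y|(gauss d :: (real^'n) measure). c)" using assms(2) order_trans[OF abs_ge_zero assms(2)] by (intro integral_mono') auto
 finally show ?thesis using gs.prob_space by simp
qed

lemma Pst_diff:
 fixes i :: "'e => real"
 assumes d: "0 < d" and i: "i \<in> borel_measurable borel" "!!z. abs (i z) <= c"
  and mod: "!!z z'. abs (i z - i z') <= e + C * norm (z - z')" and C: "0 <= C"
 shows "abs (Pst d i z a - Pst d i z' a') <= e + C * ((1 + L * d) * norm (z - z') + d * G * norm (a - a'))"
proof -
 interpret gs: prob_space "gauss d :: (real^'n) measure" by (rule prob_space_gauss) fact
 have "abs (Pst d i z a - Pst d i z' a') = abs (\<integral>y. i (stepf d z a y) - i (stepf d z' a' y) \<partial>gauss d)"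
  unfolding Pst_def by (subst Bochner_Integration.integral_diff) (auto intro: Pst_integrable[OF d i])
 also have "... <= (LINT y|gauss d. abs (i (stepf d z a y) - i (stepf d z' a' y)))" by (rule integral_abs_bound)
 also have "... <= (LINT y|(gauss d :: (real^'n) measure). e + C * ((1 + L * d) * norm (z - z') + d * G * norm (a - a')))"
 proof (rule integral_mono')
  fix y
  have "abs (i (stepf d z a y) - i (stepf d z' a' y)) <= e + C * norm (stepf d z a y - stepf d z' a' y)" by (rule mod)
  also have "... <= e + C * ((1 + L * d) * norm (z - z') + d * G * norm (a - a'))" using d C by (intro add_left_mono mult_left_mono stepf_diff) auto
  finally show "abs (i (stepf d z a y) - i (stepf d z' a' y)) <= e + C * ((1 + L * d) * norm (z - z') + d * G * norm (a - a'))" .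
  thus "0 <= e + C * ((1 + L * d) * norm (z - z') + d * G * norm (a - a'))" by (rule order_trans[OF abs_ge_zero])
 qed simp
 finally show ?thesis using gs.prob_space by simp
qed

text \<open>The discrete value function. The index counts the steps that are left, so a step taken
  with \<open>Suc k\<close> of them left starts at time \<open>T - real (Suc k) * d\<close>.\<close>

primrec vs :: "real => nat => 'e => real" where
 "vs d 0 = g"
| "vs d (Suc k) = (%z. INF a\<in>cball 0 l. d * f (T - real (Suc k) * d, z, a) + Pst d (vs d k) z a)"

abbreviation body where "body d k z a \<equiv> d * f (T - real (Suc k) * d, z, a) + Pst d (vs d k) z a"

lemma body_bound_step:
 assumes d: "0 < d" and "!!z. abs (vs d k z) <= K * (1 + real k * d)"
 shows "abs (body d k z a) <= K * (1 + real (Suc k) * d)"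
proof -
 have "abs (d * f (T - real (Suc k) * d, z, a)) <= d * K" unfolding abs_mult using d f_bd by (intro mult_mono) auto
 moreover have "abs (Pst d (vs d k) z a) <= K * (1 + real k * d)" by (rule Pst_abs_le[OF assms])
 ultimately show ?thesis by (simp add: algebra_simps)
qed

section \<open>Moduli of the discrete value, uniform in the mesh\<close>

lemma vs_bound:
 assumes d: "0 < d" shows "abs (vs d k z) <= K * (1 + real k * d)"
proof (induction k arbitrary: z)
 case (Suc k)
 note bb = body_bound_step[OF d Suc]
 have "abs ((INF a\<in>cball 0 l. body d k z a) - (INF a\<in>cball (0::real^'n) l. 0)) <= K * (1 + real (Suc k) * d)"
  using bb abs_leD2[OF bb] by (intro cINF_diff_le[OF ball_ne, where m="- (K * (1 + real (Suc k) * d))" and m'=0]) auto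
 thus ?case using ball_ne by simp
qed (use g_bd in simp)

lemma body_bound: "0 < d ==> abs (body d k z a) <= K * (1 + real (Suc k) * d)" by (intro body_bound_step vs_bound)

lemma bdd_body: "0 < d ==> bdd_below (body d k z ` cball 0 l)"
 using abs_leD2[OF body_bound[of d k z]] by (intro bdd_belowI2[where m="- (K * (1 + real (Suc k) * d))"])

lemma vs_le_body: "0 < d ==> a \<in> cball 0 l ==> vs d (Suc k) z <= body d k z a" unfolding vs.simps by (rule cINF_lower[OF bdd_body])

definition modul where
 "modul e C \<longleftrightarrow> 0 <= e & 0 <= C & (ALL p q. abs (f p - f q) <= e + C * dist p q) & (ALL z z'. abs (g z - g z') <= e + C * dist z z')"

lemma modul_exists: assumes "0 < e" shows "EX C. modul e C"
proof -
 obtain C C' where C: "0 <= C" "!!p q. abs (f p - f q) <= e + C * dist p q" "0 <= C'" "!!p q. abs (g p - g q) <= e + C' * dist p q"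
  using almost_lipschitz[OF f_uc f_bd assms] almost_lipschitz[OF g_uc g_bd assms] by blast
 have "C * x <= max C C' * x" "C' * x <= max C C' * x" if "0 <= x" for x :: real using that by (auto intro: mult_right_mono)
 hence "modul e (max C C')" unfolding modul_def using assms C(1) order_trans[OF C(2) add_left_mono] order_trans[OF C(4) add_left_mono]
  by (metis less_imp_le max.coboundedI1 zero_le_dist)
 thus ?thesis ..
qed

text \<open>One step multiplies the slope by \<open>1 + L * d\<close> and adds at most
  \<open>C * d\<close>; this is a closed upper bound for that recursion.\<close>

definition lipk where "lipk C d k = C * (1 + real k * d) * (1 + L * d) ^ k"

text \<open>The dependence on the control is tracked as well: \<open>selector_exists\<close>
  replaces an optimal control by a point of a countable dense set.\<close>

lemma body_modulus_step:
 assumes d: "0 < d" and m: "modul e C"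
  and IH: "!!z z'. abs (vs d k z - vs d k z') <= e * (1 + real k * d) + lipk C d k * norm (z - z')"
  and meas: "vs d k \<in> borel_measurable borel"
 shows "abs (body d k z a - body d k z' a') <= e * (1 + real (Suc k) * d) + lipk C d (Suc k) * norm (z - z')
  + (d * C + lipk C d k * d * G) * norm (a - a')"
proof -
 have C: "0 <= C" "!!p q. abs (f p - f q) <= e + C * dist p q" using m by (auto simp: modul_def)
 have lk: "0 <= lipk C d k" using C d L_pos by (simp add: lipk_def)
 have lk2: "C <= C * (1 + L * d) ^ Suc k" using mult_left_mono[OF one_le_power[of "1 + L * d" "Suc k"] C(1)] d L_pos by simp
 have "dist (T - real (Suc k) * d, z, a) (T - real (Suc k) * d, z', a') <= norm (z - z') + norm (a - a')"
  using sqrt_sum_squares_le_sum[of "norm (z - z')" "norm (a - a')"] unfolding dist_Pair_Pair by (simp add: dist_norm)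
 hence "abs (f (T - real (Suc k) * d, z, a) - f (T - real (Suc k) * d, z', a')) <= e + C * (norm (z - z') + norm (a - a'))"
  by (intro order_trans[OF C(2)] add_left_mono mult_left_mono C(1))
 hence 1: "abs (d * f (T - real (Suc k) * d, z, a) - d * f (T - real (Suc k) * d, z', a')) <= d * (e + C * (norm (z - z') + norm (a - a')))"
  using d unfolding right_diff_distrib[symmetric] abs_mult by (intro mult_mono) auto
 have 2: "abs (Pst d (vs d k) z a - Pst d (vs d k) z' a') <= e * (1 + real k * d) + lipk C d k * ((1 + L * d) * norm (z - z') + d * G * norm (a - a'))"
  by (rule Pst_diff[OF d meas vs_bound[OF d] IH lk])
 have "lipk C d k * (1 + L * d) + d * C <= lipk C d (Suc k)" using mult_left_mono[OF lk2, of d] d by (simp add: lipk_def algebra_simps)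
 hence 3: "(lipk C d k * (1 + L * d) + d * C) * norm (z - z') <= lipk C d (Suc k) * norm (z - z')" by (intro mult_right_mono) auto
 have "abs (body d k z a - body d k z' a') <= d * (e + C * (norm (z - z') + norm (a - a')))
  + (e * (1 + real k * d) + lipk C d k * ((1 + L * d) * norm (z - z') + d * G * norm (a - a')))" using 1 2 by linarith
 also have "... = e * (1 + real (Suc k) * d) + (lipk C d k * (1 + L * d) + d * C) * norm (z - z') + (d * C + lipk C d k * d * G) * norm (a - a')"
  by (simp add: algebra_simps)
 finally show ?thesis using 3 by linarith
qed

text \<open>Modulus and continuity are proved in one induction: the step integrates
  \<open>vs d k\<close>, so it needs measurability, which is obtained from continuity.\<close>

lemma vs_modulus_aux:
 assumes d: "0 < d"
 shows "(ALL e C. modul e C --> (ALL z z'. abs (vs d k z - vs d k z') <= e * (1 + real k * d) + lipk C d k * norm (z - z')))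
  & continuous_on UNIV (vs d k)"
proof (induction k)
 case 0
 thus ?case using continuous_g by (auto simp: modul_def lipk_def dist_norm)
next
 case (Suc k)
 have meas: "vs d k \<in> borel_measurable borel" using Suc by (intro borel_measurable_continuous_onI) auto
 have A: "abs (vs d (Suc k) z - vs d (Suc k) z') <= e * (1 + real (Suc k) * d) + lipk C d (Suc k) * norm (z - z')"
  if m: "modul e C" for e C z z' unfolding vs.simps
 proof (rule cINF_diff_le[OF ball_ne])
  fix a :: "real^'n"
  show "abs (body d k z a - body d k z' a) <= e * (1 + real (Suc k) * d) + lipk C d (Suc k) * norm (z - z')"
   using body_modulus_step[OF d m _ meas, of z a z' a] Suc m by auto
 qed (rule abs_leD2[OF body_bound[OF d, of k]])+
 have "continuous_on UNIV (vs d (Suc k))"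
 proof (rule continuous_if_almost_lipschitz)
  fix e :: real assume "0 < e"
  hence "0 < e / (1 + real (Suc k) * d)" using d by (simp add: add_pos_nonneg)
  then obtain C where m: "modul (e / (1 + real (Suc k) * d)) C" using modul_exists by blast
  moreover have "1 + real (Suc k) * d ~= 0" using d by (smt (verit) mult_nonneg_nonneg of_nat_0_le_iff)
  moreover have "0 <= lipk C d (Suc k)" using m d L_pos by (simp add: lipk_def modul_def)
  ultimately show "\<exists>C\<ge>0. \<forall>p\<in>UNIV. \<forall>q\<in>UNIV. abs (vs d (Suc k) p - vs d (Suc k) q) <= e + C * dist p q"
   using A[OF m] by (intro exI[of _ "lipk C d (Suc k)"]) (auto simp: dist_norm)
 qed
 thus ?case using A by blast
qed

lemma vs_measurable: "0 < d ==> vs d k \<in> borel_measurable borel" using vs_modulus_aux by (auto intro: borel_measurable_continuous_onI)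

lemma body_modulus:
 assumes "0 < d" "modul e C"
 shows "abs (body d k z a - body d k z' a') <= e * (1 + real (Suc k) * d) + lipk C d (Suc k) * norm (z - z')
  + (d * C + lipk C d k * d * G) * norm (a - a')" using vs_modulus_aux[OF assms(1)] assms by (intro body_modulus_step vs_measurable) auto

lemma lipk_le:
 assumes d: "0 < d" "real k * d <= T" and C: "0 <= C"
 shows "lipk C d k <= C * (1 + T) * exp (L * T)"
proof -
 have "(1 + L * d) ^ k <= exp (L * d) ^ k" using d L_pos by (intro power_mono exp_ge_add_one_self) auto
 also have "... = exp (L * (real k * d))" by (simp flip: exp_of_nat_mult add: algebra_simps)
 also have "... <= exp (L * T)" using d L_pos by simp
 finally show ?thesis unfolding lipk_def using d C T_pos L_pos by (intro mult_mono) auto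
qed

lemma vs_modulus:
 assumes d: "0 < d" "real k * d <= T" and m: "modul e C"
 shows "abs (vs d k z - vs d k z') <= e * (1 + T) + C * (1 + T) * exp (L * T) * norm (z - z')"
proof -
 have "abs (vs d k z - vs d k z') <= e * (1 + real k * d) + lipk C d k * norm (z - z')" using vs_modulus_aux[OF d(1)] m by auto
 also have "... <= e * (1 + T) + C * (1 + T) * exp (L * T) * norm (z - z')"
  using d m by (intro add_mono mult_left_mono mult_right_mono lipk_le) (auto simp: modul_def)
 finally show ?thesis .
qed

text \<open>The rate at which one step produces second moment: twice the squared bound of drift and
  control, plus the variance of the noise.\<close>

definition quad where "quad = 2 * (K + G * l)\<^sup>2 + Sn\<^sup>2 * real CARD('n)"

lemma quad_nn: "0 <= quad" by (simp add: quad_def)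

text \<open>The term linear in the noise has mean zero. The cross term with the drift is split by
  \<open>2 * x * B <= x^2 + B^2\<close>, which produces the factor \<open>1 + d\<close>.\<close>

lemma stepf_square:
 assumes d: "0 < d" "d <= 1" and a: "a \<in> cball 0 l"
 shows "integrable (gauss d) (%y. (norm (stepf d y0 a y - z))\<^sup>2)"
  and "(LINT y|gauss d. (norm (stepf d y0 a y - z))\<^sup>2) <= (1 + d) * (norm (y0 - z))\<^sup>2 + quad * d"
proof -
 interpret gs: prob_space "gauss d :: (real^'n) measure" by (rule prob_space_gauss) fact
 interpret \<Sigma>: bounded_linear \<Sigma> by (rule lin_Sg)
 define w where "w = y0 - z + d *\<^sub>R (b y0 + \<Gamma> a)"
 note iy = integrable_gauss_norm[OF d(1), where 'n='n]
 have eq: "(norm (stepf d y0 a y - z))\<^sup>2 = (norm w)\<^sup>2 + 2 * (w \<bullet> \<Sigma> y) + (norm (\<Sigma> y))\<^sup>2" for y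
 proof -
  have "stepf d y0 a y - z = w + \<Sigma> y" by (simp add: stepf_def w_def)
  thus ?thesis by (simp add: power2_norm_eq_inner inner_simps inner_commute)
 qed
 have iS: "integrable (gauss d) \<Sigma>" and IS: "(LINT y|gauss d. \<Sigma> y) = 0"
  using integrable_bounded_linear[OF lin_Sg iy(3)] integral_bounded_linear[OF lin_Sg iy(3)] by (auto simp: integral_gauss_id \<Sigma>.zero)
 have i2: "integrable (gauss d) (%y. (norm (\<Sigma> y))\<^sup>2)"
 proof (rule Bochner_Integration.integrable_bound)
  show "integrable (gauss d) (%y::real^'n. Sn\<^sup>2 * (norm y)\<^sup>2)" using iy(1) by simp
  show "AE y in gauss d. norm ((norm (\<Sigma> y))\<^sup>2) <= norm (Sn\<^sup>2 * (norm y)\<^sup>2)"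
   using power_mono[OF Sg_le, of _ 2] by (auto simp: power_mult_distrib)
 qed measurable
 have i1: "integrable (gauss d) (%y. w \<bullet> \<Sigma> y)" by (rule integrable_inner_right) (use iS in auto)
 show "integrable (gauss d) (%y. (norm (stepf d y0 a y - z))\<^sup>2)" unfolding eq using i1 i2 by auto
 have "(LINT y|gauss d. (norm (stepf d y0 a y - z))\<^sup>2) = (norm w)\<^sup>2 + (LINT y|gauss d. (norm (\<Sigma> y))\<^sup>2)"
  unfolding eq using i1 i2 IS iS gs.prob_space by simp
 also have "(LINT y|gauss d. (norm (\<Sigma> y))\<^sup>2) <= (LINT y|gauss d. Sn\<^sup>2 * (norm (y::real^'n))\<^sup>2)"
  using i2 iy(1) power_mono[OF Sg_le, of _ 2] by (intro integral_mono) (auto simp: power_mult_distrib)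
 also have "... = Sn\<^sup>2 * real CARD('n) * d" using iy(2) by simp
 also have "(norm w)\<^sup>2 <= (1 + d) * (norm (y0 - z))\<^sup>2 + 2 * (K + G * l)\<^sup>2 * d"
 proof -
  define B where "B = K + G * l"
  define x where "x = norm (y0 - z)"
  have nb: "norm (b y0 + \<Gamma> a) <= B" unfolding B_def using b_bd[of y0] Gm_ball[OF a] by (intro order_trans[OF norm_triangle_ineq] add_mono) auto
  have "norm w <= x + d * B" unfolding w_def x_def using nb d by (intro order_trans[OF norm_triangle_ineq]) auto
  hence "(norm w)\<^sup>2 <= (x + d * B)\<^sup>2" by (intro power_mono) auto
  also have "... = x\<^sup>2 + d * (2 * (x * B)) + d * d * B\<^sup>2" by (simp add: power2_eq_square algebra_simps)
  also have "... <= x\<^sup>2 + d * (x\<^sup>2 + B\<^sup>2) + 1 * d * B\<^sup>2"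
   using d sum_squares_bound[of x B] by (intro add_mono mult_left_mono mult_right_mono) (auto simp: mult.assoc)
  finally show ?thesis by (simp add: B_def x_def algebra_simps)
 qed
 finally show "(LINT y|gauss d. (norm (stepf d y0 a y - z))\<^sup>2) <= (1 + d) * (norm (y0 - z))\<^sup>2 + quad * d"
  by (simp add: quad_def algebra_simps)
qed

text \<open>The majorant is quadratic because first order noise cancels in the mean of a square, so
  that a step costs O(d). The norm itself would cost a multiple of sqrt d in every step, which does
  not sum.\<close>

lemma vs_time_modulus_aux:
 assumes d: "0 < d" "d <= 1" and A: "0 <= A" and base: "!!y. abs (vs d k y - vs d k z) <= e + A * (norm (y - z))\<^sup>2"
 shows "abs (vs d (k + j) y - vs d k z) <= e + A * (1 + d) ^ j * ((norm (y - z))\<^sup>2 + quad * real j * d) + real j * d * K"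
proof (induction j arbitrary: y)
 case 0
 thus ?case using base by simp
next
 case (Suc j)
 interpret gs: prob_space "gauss d :: (real^'n) measure" by (rule prob_space_gauss) fact
 let ?c = "A * (1 + d) ^ j"
 have c0: "0 <= ?c" using A d by simp
 have "abs (vs d (Suc (k + j)) y - (INF a\<in>cball (0::real^'n) l. vs d k z)) <=
   e + A * (1 + d) ^ Suc j * ((norm (y - z))\<^sup>2 + quad * real (Suc j) * d) + real (Suc j) * d * K" unfolding vs.simps
 proof (rule cINF_diff_le[OF ball_ne, where m'="vs d k z"])
  fix a :: "real^'n" assume a: "a \<in> cball 0 l"
  note sq = stepf_square[OF d a, of y z]
  have iv: "integrable (gauss d) (%x. vs d (k + j) (stepf d y a x))" by (rule Pst_integrable[OF d(1) vs_measurable[OF d(1)] vs_bound[OF d(1)]])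
  have "abs (Pst d (vs d (k + j)) y a - vs d k z) = abs (\<integral>x. vs d (k + j) (stepf d y a x) - vs d k z \<partial>gauss d)"
   unfolding Pst_def using iv gs.prob_space by simp
  also have "... <= (LINT x|gauss d. abs (vs d (k + j) (stepf d y a x) - vs d k z))" by (rule integral_abs_bound)
  also have "... <= (LINT x|gauss d. e + ?c * ((norm (stepf d y a x - z))\<^sup>2 + quad * real j * d) + real j * d * K)"
  proof (rule integral_mono)
   show "integrable (gauss d) (%x. abs (vs d (k + j) (stepf d y a x) - vs d k z))" using iv by simp
   show "integrable (gauss d) (%x. e + ?c * ((norm (stepf d y a x - z))\<^sup>2 + quad * real j * d) + real j * d * K)" using sq(1) by simp
  qed (rule Suc)
  also have "... = e + ?c * ((LINT x|gauss d. (norm (stepf d y a x - z))\<^sup>2) + quad * real j * d) + real j * d * K"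
   using sq(1) gs.prob_space by simp
  also have "... <= e + ?c * (((1 + d) * (norm (y - z))\<^sup>2 + quad * d) + quad * real j * d) + real j * d * K"
   by (intro add_right_mono add_left_mono mult_left_mono sq(2) c0)
  also have "... <= e + ?c * ((1 + d) * ((norm (y - z))\<^sup>2 + quad * real (Suc j) * d)) + real j * d * K"
  proof -
   have "quad * d + quad * real j * d <= (1 + d) * (quad * real (Suc j) * d)" using d quad_nn by (simp add: algebra_simps)
   thus ?thesis by (intro add_right_mono add_left_mono mult_left_mono c0) (simp add: algebra_simps)
  qed
  finally have P: "abs (Pst d (vs d (k + j)) y a - vs d k z) <= e + A * (1 + d) ^ Suc j * ((norm (y - z))\<^sup>2 + quad * real (Suc j) * d) + real j * d * K"
   by (simp add: mult_ac)
  have "abs (d * f (T - real (Suc (k + j)) * d, y, a)) <= d * K" unfolding abs_mult using d f_bd by (intro mult_mono) auto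
  thus "abs (body d (k + j) y a - vs d k z) <=
   e + A * (1 + d) ^ Suc j * ((norm (y - z))\<^sup>2 + quad * real (Suc j) * d) + real (Suc j) * d * K" using P by (simp add: algebra_simps)
 qed (rule abs_leD2[OF body_bound[OF d(1), of "k + j" y]], simp)
 thus ?case using ball_ne by simp
qed

text \<open>Joint equicontinuity in time and state, with a constant that does not depend on the
  mesh. It turns pointwise convergence of the discrete values into locally uniform convergence in
  \<open>vs_local_uniform\<close>.\<close>

lemma vs_time_modulus:
 assumes e: "0 < e"
 shows "\<exists>A\<ge>0. ALL d k j y z. 0 < d --> d <= 1 --> real (k + j) * d <= T -->
  abs (vs d (k + j) y - vs d k z) <= e + A * ((norm (y - z))\<^sup>2 + real j * d)"
proof -
 define e' where "e' = e / (2 * (1 + T))"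
 have e': "0 < e'" using e T_pos by (simp add: e'_def)
 then obtain C where m: "modul e' C" using modul_exists by blast
 have e'T: "e' * (1 + T) = e / 2" unfolding e'_def using T_pos by (intro mult_div_cancel) simp
 define D where "D = C * (1 + T) * exp (L * T)"
 have D0: "0 <= D" using m T_pos by (simp add: D_def modul_def)
 define A0 where "A0 = D\<^sup>2 / (2 * e)"
 have A0: "0 <= A0" using e by (simp add: A0_def)
 define A where "A = A0 * exp T * (1 + quad) + K"
 have "abs (vs d (k + j) y - vs d k z) <= e + A * ((norm (y - z))\<^sup>2 + real j * d)"
  if d: "0 < d" "d <= 1" and T: "real (k + j) * d <= T" for d k j y z
 proof -
  have jT: "real j * d <= T" and kT: "real k * d <= T" using T d by (smt (verit, ccfv_SIG) mult_right_mono of_nat_add of_nat_0_le_iff)+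
  have base: "abs (vs d k y - vs d k z) <= e + A0 * (norm (y - z))\<^sup>2" for y
  proof -
   have "abs (vs d k y - vs d k z) <= e / 2 + D * norm (y - z)" using vs_modulus[OF d(1) kT m, of y z] unfolding e'T D_def by simp
   \<comment> \<open>Young's inequality turns the linear modulus into the quadratic one; this fixes
     \<open>A0\<close>.\<close>
   also have "D * norm (y - z) <= e / 2 + A0 * (norm (y - z))\<^sup>2"
   proof -
    have "0 <= (e - D * norm (y - z))\<^sup>2" by simp
    hence "2 * e * (D * norm (y - z)) <= e\<^sup>2 + D\<^sup>2 * (norm (y - z))\<^sup>2" by (simp add: power2_diff power_mult_distrib)
    hence "(2 * e * (D * norm (y - z))) / (2 * e) <= (e\<^sup>2 + D\<^sup>2 * (norm (y - z))\<^sup>2) / (2 * e)" using e by (intro divide_right_mono) auto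
    thus ?thesis using e by (simp add: A0_def add_divide_distrib power2_eq_square)
   qed
   finally show ?thesis by simp
  qed
  have "(1 + d) ^ j <= exp d ^ j" using d by (intro power_mono exp_ge_add_one_self) auto
  also have "... = exp (real j * d)" by (simp flip: exp_of_nat_mult)
  also have "... <= exp T" using jT by simp
  finally have pw: "(1 + d) ^ j <= exp T" .
  have nn: "0 <= (norm (y - z))\<^sup>2 + quad * real j * d" using quad_nn d by simp
  have "abs (vs d (k + j) y - vs d k z) <= e + A0 * (1 + d) ^ j * ((norm (y - z))\<^sup>2 + quad * real j * d) + real j * d * K"
   by (rule vs_time_modulus_aux[OF d A0 base])
  also have "... <= e + A0 * exp T * ((1 + quad) * ((norm (y - z))\<^sup>2 + real j * d)) + K * ((norm (y - z))\<^sup>2 + real j * d)"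
  proof -
   have "(norm (y - z))\<^sup>2 + quad * real j * d <= (1 + quad) * ((norm (y - z))\<^sup>2 + real j * d)" using quad_nn d by (simp add: algebra_simps)
   from mult_mono[OF mult_left_mono[OF pw A0] this] nn A0
   have "A0 * (1 + d) ^ j * ((norm (y - z))\<^sup>2 + quad * real j * d) <= A0 * exp T * ((1 + quad) * ((norm (y - z))\<^sup>2 + real j * d))" by simp
   moreover have "real j * d * K <= K * ((norm (y - z))\<^sup>2 + real j * d)" using K_nn by (simp add: algebra_simps)
   ultimately show ?thesis by linarith
  qed
  also have "... = e + A * ((norm (y - z))\<^sup>2 + real j * d)" by (simp add: A_def algebra_simps)
  finally show ?thesis .
 qed
 moreover have "0 <= A" using A0 quad_nn K_nn by (simp add: A_def)
 ultimately show ?thesis by blast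
qed

subsection \<open>Controlled chains and dynamic programming\<close>

definition noise where "noise t d c i w = d *\<^sub>R \<Gamma> (c i w) + \<Sigma> (W (t + real (Suc i) * d) w - W (t + real i * d) w)"

definition chain where "chain t d z c k w = euler b d z (%i. noise t d c i w) k"

lemma chain_0[simp]: "chain t d z c 0 w = z" by (simp add: chain_def)

lemma chain_Suc: "chain t d z c (Suc k) w
  = stepf d (chain t d z c k w) (c k w) (W (t + real (Suc k) * d) w - W (t + real k * d) w)"
 by (simp add: chain_def stepf_def noise_def algebra_simps)

definition adm where
 "adm t d N c \<longleftrightarrow> (\<forall>k<N. c k \<in> borel_measurable (\<F> (t + real k * d)) & (\<forall>w\<in>space M. c k w \<in> cball 0 l))"

lemma chain_measurable:
 assumes t: "0 <= t" and d: "0 <= d" and c: "adm t d N c" and k: "k <= N"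
 shows "chain t d z c k \<in> borel_measurable (\<F> (t + real k * d))" using k
proof (induction k)
 case 0
 have "chain t d z c 0 = (%_. z)" by auto
 thus ?case by simp
next
 case (Suc k)
 have le: "t + real k * d <= t + real (Suc k) * d" using d by (simp add: algebra_simps)
 have "chain t d z c k \<in> borel_measurable (\<F> (t + real (Suc k) * d))" using Suc by (intro F_mono[OF le]) auto
 moreover have "c k \<in> borel_measurable (\<F> (t + real (Suc k) * d))" using c Suc by (intro F_mono[OF le]) (auto simp: adm_def)
 moreover have "(%w. W (t + real (Suc k) * d) w - W (t + real k * d) w) \<in> borel_measurable (\<F> (t + real (Suc k) * d))"
  using t d le by (intro increment_measurable) auto
 ultimately show ?case unfolding chain_Suc[abs_def] by measurable
qed

lemma chain_step_expectation:
 fixes e :: "'e => real"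
 assumes t: "0 <= t" and d: "0 < d" and a: "adm t d N a" and k: "k < N"
  and B: "B \<in> sets (\<F> (t + real k * d))"
  and e[measurable]: "e \<in> borel_measurable borel" and c: "!!z. abs (e z) <= c"
 shows "(LINT w|M. indicator B w * e (chain t d z a (Suc k) w)) = (LINT w|M. indicator B w * Pst d e (chain t d z a k w) (a k w))"
  and "integrable M (%w. indicator B w * Pst d e (chain t d z a k w) (a k w))"
proof -
 let ?s = "t + real k * d"
 let ?X = "%w. (indicator B w :: real, chain t d z a k w, a k w)"
 let ?f = "%p. (if fst (fst p) = (1::real) then e (stepf d (fst (snd (fst p))) (snd (snd (fst p))) (snd p)) else 0)"
 have c0: "0 <= c" by (rule order_trans[OF abs_ge_zero c[of z]])
 have [measurable]: "chain t d z a k \<in> borel_measurable (\<F> ?s)" "a k \<in> borel_measurable (\<F> ?s)" "B \<in> sets (\<F> ?s)"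
  using chain_measurable[OF t _ a, of k z] a k d B by (auto simp: adm_def)
 have s: "0 <= ?s" "?s < t + real (Suc k) * d" "t + real (Suc k) * d - ?s = d" using t d by (auto simp: algebra_simps)
 have X: "?X \<in> measurable (\<F> ?s) (borel \<Otimes>\<^sub>M borel \<Otimes>\<^sub>M borel)" by measurable
 have mf: "?f \<in> borel_measurable ((borel \<Otimes>\<^sub>M borel \<Otimes>\<^sub>M borel) \<Otimes>\<^sub>M borel)" by measurable
 note fr = integral_freeze[OF s(1,2) X mf, of c, unfolded s(3)]
 have Pe: "(LINT y|gauss d. ?f (?X w, y)) = indicator B w * Pst d e (chain t d z a k w) (a k w)" for w
  by (auto simp: Pst_def indicator_def)
 have "(LINT w|M. ?f (?X w, W (t + real (Suc k) * d) w - W ?s w)) = (LINT w|M. indicator B w * Pst d e (chain t d z a k w) (a k w))"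
  using fr(1) c c0 unfolding Pe by auto
 thus "(LINT w|M. indicator B w * e (chain t d z a (Suc k) w)) = (LINT w|M. indicator B w * Pst d e (chain t d z a k w) (a k w))"
  unfolding chain_Suc by (subst (asm) Bochner_Integration.integral_cong[OF refl]) (auto simp: indicator_def)
 have "(%w. indicator B w * Pst d e (chain t d z a k w) (a k w)) \<in> borel_measurable M"
  using F_le_M[OF fr(2)] c c0 unfolding Pe by auto
 thus "integrable M (%w. indicator B w * Pst d e (chain t d z a k w) (a k w))"
  by (intro integrable_const_bound[where B=c])
   (auto simp: abs_mult indicator_def c0 intro!: Pst_abs_le d c AE_I2)
qed

definition chain_cost where
 "chain_cost t d z c N w = (\<Sum>i<N. d * f (t + real i * d, chain t d z c i w, c i w)) + g (chain t d z c N w)"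

text \<open>Cost of the first j steps plus the discrete value of the rest: it interpolates between
  \<open>vs d N z\<close> at j = 0 and the cost of the control at j = N.\<close>

definition dp_sum where
 "dp_sum t d z c N j w = (\<Sum>i<j. d * f (t + real i * d, chain t d z c i w, c i w)) + vs d (N - j) (chain t d z c j w)"

lemma chain_measurable_M:
 assumes "0 <= t" "0 <= d" "adm t d N c"
 shows "k <= N ==> chain t d z c k \<in> borel_measurable M" "k < N ==> c k \<in> borel_measurable M"
 using chain_measurable[OF assms] assms(3) by (auto simp: adm_def intro: F_le_M)

lemma dp_sum_integrable:
 assumes t: "0 <= t" and d: "0 < d" and c: "adm t d N c" and j: "j <= N" and B[measurable]: "B \<in> sets M"
 shows "integrable M (%w. indicator B w * dp_sum t d z c N j w)"
proof (rule integrable_const_bound)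
 note m = chain_measurable_M[OF t less_imp_le[OF d] c]
 have "dp_sum t d z c N j \<in> borel_measurable M" unfolding dp_sum_def
 proof (intro borel_measurable_add borel_measurable_sum borel_measurable_times borel_measurable_const)
  fix i assume "i \<in> {..<j}"
  hence [measurable]: "chain t d z c i \<in> borel_measurable M" "c i \<in> borel_measurable M" using m j by auto
  show "(%w. f (t + real i * d, chain t d z c i w, c i w)) \<in> borel_measurable M"
   by (rule measurable_compose[OF _ meas_f]) measurable
 next
  show "(%w. vs d (N - j) (chain t d z c j w)) \<in> borel_measurable M"
   by (rule measurable_compose[OF _ vs_measurable[OF d]]) (use m j in auto)
 qed
 thus "(%w. indicator B w * dp_sum t d z c N j w) \<in> borel_measurable M" by measurable
 show "AE w in M. norm (indicator B w * dp_sum t d z c N j w) <= real j * (d * K) + K * (1 + real (N - j) * d)"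
 proof (rule AE_I2)
  fix w
  have "abs (\<Sum>i<j. d * f (t + real i * d, chain t d z c i w, c i w)) <= (\<Sum>i<j. d * K)"
   using d f_bd by (intro order_trans[OF sum_abs] sum_mono) (auto simp: abs_mult intro!: mult_left_mono)
  hence "abs (dp_sum t d z c N j w) <= real j * (d * K) + K * (1 + real (N - j) * d)"
   using vs_bound[OF d, of "N - j" "chain t d z c j w"] unfolding dp_sum_def by (simp add: )
  thus "norm (indicator B w * dp_sum t d z c N j w) <= real j * (d * K) + K * (1 + real (N - j) * d)"
   by (auto simp: indicator_def intro: order_trans[OF abs_ge_zero])
 qed
qed

text \<open>In mean, the increment is the gap in the discrete Bellman equation. The gap is
  nonnegative for every control and small for a near-optimal one; summing it gives
  \<open>dp_lower\<close> and \<open>dp_upper\<close>.\<close>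

lemma dp_sum_step:
 assumes t: "0 <= t" and d: "0 < d" and c: "adm t d N c" and j: "j < N" and B: "B \<in> sets (\<F> t)" and T: "t + real N * d = T"
 shows "(LINT w|M. indicator B w * dp_sum t d z c N (Suc j) w) - (LINT w|M. indicator B w * dp_sum t d z c N j w)
  = (LINT w|M. indicator B w * (body d (N - Suc j) (chain t d z c j w) (c j w) - vs d (Suc (N - Suc j)) (chain t d z c j w)))"
  and "integrable M (%w. indicator B w * (body d (N - Suc j) (chain t d z c j w) (c j w) - vs d (Suc (N - Suc j)) (chain t d z c j w)))"
proof -
 have BM[measurable]: "B \<in> sets M" by (rule sets_F_le[OF B])
 have Bj: "B \<in> sets (\<F> (t + real j * d))" using d by (intro sets_F_mono[OF _ B]) auto
 let ?m = "N - Suc j"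
 have Sm: "Suc ?m = N - j" using j by auto
 have time: "T - real (Suc ?m) * d = t + real j * d" using j T unfolding Sm by (simp add: of_nat_diff algebra_simps)
 let ?Z = "chain t d z c"
 note i1 = dp_sum_integrable[OF t d c Suc_leI[OF j] BM, of z] and i2 = dp_sum_integrable[OF t d c less_imp_le[OF j] BM, of z]
 note ce = chain_step_expectation[OF t d c j Bj vs_measurable[OF d, of ?m] vs_bound[OF d, of ?m], of z]
 note m = chain_measurable_M[OF t less_imp_le[OF d] c]
 have [measurable]: "?Z j \<in> borel_measurable M" "?Z (Suc j) \<in> borel_measurable M" "c j \<in> borel_measurable M" using m j by auto
 note [measurable] = vs_measurable[OF d]
 have iv: "integrable M (%w. indicator B w * vs d k (?Z i w))" if "i = j \<or> i = Suc j" for k i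
 proof (rule integrable_const_bound[where B="K * (1 + real k * d)"])
  have "?Z i \<in> borel_measurable M" using that j m by auto
  thus "(%w. indicator B w * vs d k (?Z i w)) \<in> borel_measurable M" by measurable
  show "AE w in M. norm (indicator B w * vs d k (?Z i w)) <= K * (1 + real k * d)"
   using vs_bound[OF d, of k] by (auto simp: indicator_def intro!: AE_I2 intro: order_trans[OF abs_ge_zero])
 qed
 have iF: "integrable M (%w. indicator B w * (d * f (t + real j * d, ?Z j w, c j w)))"
 proof (rule integrable_const_bound[where B="d * K"])
  have [measurable]: "(%w. f (t + real j * d, ?Z j w, c j w)) \<in> borel_measurable M"
   by (rule measurable_compose[OF _ meas_f]) measurable
  show "(%w. indicator B w * (d * f (t + real j * d, ?Z j w, c j w))) \<in> borel_measurable M" by measurable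
  show "AE w in M. norm (indicator B w * (d * f (t + real j * d, ?Z j w, c j w))) <= d * K"
   using d f_bd K_nn by (auto simp: indicator_def abs_mult intro!: AE_I2)
 qed
 have "(LINT w|M. indicator B w * dp_sum t d z c N (Suc j) w) - (LINT w|M. indicator B w * dp_sum t d z c N j w)
  = (LINT w|M. indicator B w * dp_sum t d z c N (Suc j) w - indicator B w * dp_sum t d z c N j w)"
  by (rule Bochner_Integration.integral_diff[OF i1 i2, symmetric])
 also have "... = (LINT w|M. indicator B w * vs d ?m (?Z (Suc j) w) + indicator B w * (d * f (t + real j * d, ?Z j w, c j w)) - indicator B w * vs d (Suc ?m) (?Z j w))"
  by (intro Bochner_Integration.integral_cong) (auto simp: dp_sum_def Sm algebra_simps simp del: vs.simps)
 also have "... = (LINT w|M. indicator B w * vs d ?m (?Z (Suc j) w)) + (LINT w|M. indicator B w * (d * f (t + real j * d, ?Z j w, c j w))) - (LINT w|M. indicator B w * vs d (Suc ?m) (?Z j w))"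
  using iv iF by (simp del: vs.simps)
 also have "... = (LINT w|M. indicator B w * Pst d (vs d ?m) (?Z j w) (c j w)) + (LINT w|M. indicator B w * (d * f (t + real j * d, ?Z j w, c j w))) - (LINT w|M. indicator B w * vs d (Suc ?m) (?Z j w))"
  unfolding ce(1) ..
 also have "... = (LINT w|M. indicator B w * Pst d (vs d ?m) (?Z j w) (c j w) + indicator B w * (d * f (t + real j * d, ?Z j w, c j w)) - indicator B w * vs d (Suc ?m) (?Z j w))"
  using iv iF ce(2) by (simp del: vs.simps)
 also have "... = (LINT w|M. indicator B w * (body d ?m (?Z j w) (c j w) - vs d (Suc ?m) (?Z j w)))"
  unfolding time by (intro Bochner_Integration.integral_cong) (auto simp: algebra_simps simp del: vs.simps)
 finally show "(LINT w|M. indicator B w * dp_sum t d z c N (Suc j) w) - (LINT w|M. indicator B w * dp_sum t d z c N j w)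
  = (LINT w|M. indicator B w * (body d ?m (?Z j w) (c j w) - vs d (Suc ?m) (?Z j w)))" .
 have "integrable M (%w. indicator B w * Pst d (vs d ?m) (?Z j w) (c j w) + indicator B w * (d * f (t + real j * d, ?Z j w, c j w)) - indicator B w * vs d (Suc ?m) (?Z j w))"
  using iv iF ce(2) by (simp del: vs.simps)
 thus "integrable M (%w. indicator B w * (body d ?m (?Z j w) (c j w) - vs d (Suc ?m) (?Z j w)))"
  unfolding time by (rule Bochner_Integration.integrable_cong[THEN iffD1, rotated -1]) (auto simp: algebra_simps simp del: vs.simps)
qed

lemma dp_lower:
 assumes t: "0 <= t" and d: "0 < d" and c: "adm t d N c" and B: "B \<in> sets (\<F> t)" and T: "t + real N * d = T"
 shows "vs d N z * prob B <= (LINT w|M. indicator B w * chain_cost t d z c N w)"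
proof -
 have "vs d N z * prob B <= (LINT w|M. indicator B w * dp_sum t d z c N j w)" if "j <= N" for j using that
 proof (induction j)
  case 0
  have "(LINT w|M. indicator B w * dp_sum t d z c N 0 w) = vs d N z * prob B"
   using sets_F_le[OF B] by (simp add: dp_sum_def)
  thus ?case by simp
 next
  case (Suc j)
  hence j: "j < N" by simp
  have "0 <= (LINT w|M. indicator B w * (body d (N - Suc j) (chain t d z c j w) (c j w) - vs d (Suc (N - Suc j)) (chain t d z c j w)))"
  proof (rule integral_nonneg_AE, rule AE_I2)
   fix w assume "w \<in> space M"
   hence "c j w \<in> cball 0 l" using c j by (auto simp: adm_def)
   from vs_le_body[OF d this] show "0 <= indicator B w * (body d (N - Suc j) (chain t d z c j w) (c j w) - vs d (Suc (N - Suc j)) (chain t d z c j w))"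
    by (auto simp: indicator_def simp del: vs.simps)
  qed
  thus ?case using dp_sum_step(1)[OF t d c j B T, of z] Suc by linarith
 qed
 from this[of N] show ?thesis by (simp add: dp_sum_def chain_cost_def)
qed

text \<open>Continuity in the control lets the infimum be approached along a countable dense subset
  of the ball. The least index that is good enough depends measurably on the state.\<close>

lemma selector_exists:
 assumes d: "0 < d" and e: "0 < e"
 shows "\<exists>q\<in>borel_measurable borel. ALL z. q z \<in> cball 0 l & body d k z (q z) <= vs d (Suc k) z + e"
proof -
 obtain D where D: "countable D" "D \<subseteq> cball 0 l" "cball 0 l \<subseteq> closure (D :: (real^'n) set)" using separable[of "cball 0 l :: (real^'n) set"] by blast
 have "D ~= {}" using D(3) ball_ne by auto
 define a where "a = from_nat_into D"
 have aD: "a i \<in> D" for i unfolding a_def by (rule from_nat_into[OF \<open>D ~= {}\<close>])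
 have aball: "a i \<in> cball 0 l" for i using aD D(2) by blast
 have ex: "EX i. body d k z (a i) < vs d (Suc k) z + e" for z
 proof -
  have "\<exists>x\<in>cball 0 l. body d k z x < vs d (Suc k) z + e / 2" using cINF_less_iff[OF ball_ne bdd_body[OF d, of k z], of "vs d (Suc k) z + e / 2"] e by simp
  then obtain x where x: "x \<in> cball 0 l" "body d k z x < vs d (Suc k) z + e / 2" by blast
  have pos: "0 < 1 + real (Suc k) * d" using d by (intro add_pos_nonneg) auto
  hence "0 < e / (8 * (1 + real (Suc k) * d))" using e by simp
  then obtain C where m: "modul (e / (8 * (1 + real (Suc k) * d))) C" using modul_exists by blast
  let ?H = "d * C + lipk C d k * d * G"
  have H: "0 <= ?H" using m d G_nn L_pos by (auto simp: modul_def lipk_def)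
  have "x \<in> closure D" using x D(3) by blast
  moreover have "0 < e / (8 * (?H + 1))" using e H by (intro divide_pos_pos) auto
  ultimately obtain y where y: "y \<in> D" "dist y x < e / (8 * (?H + 1))" unfolding closure_approachable by blast
  obtain i where i: "a i = y" using y(1) D(1) unfolding a_def by (metis from_nat_into_to_nat_on)
  have "abs (body d k z y - body d k z x) <= e / 8 + ?H * norm (y - x)" using body_modulus[OF d m, of k z y z x] unfolding mult_div_cancel[OF pos] by simp
  also have "?H * norm (y - x) <= (?H + 1) * (e / (8 * (?H + 1)))" using y(2) H by (intro mult_mono) (auto simp: dist_norm)
  also have "... = e / 8" using H by (simp add: field_simps)
  finally show ?thesis using x(2) e unfolding i[symmetric] by (intro exI[of _ i]) linarith
 qed
 define n where "n z = (LEAST i. body d k z (a i) < vs d (Suc k) z + e)" for z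
 have nz: "body d k z (a (n z)) < vs d (Suc k) z + e" for z unfolding n_def by (rule LeastI_ex[OF ex])
 have mb: "(%z. body d k z x) \<in> borel_measurable borel" for x
 proof (rule borel_measurable_continuous_onI, rule continuous_if_almost_lipschitz)
  fix e :: real assume "0 < e"
  have pos: "0 < 1 + real (Suc k) * d" using d by (intro add_pos_nonneg) auto
  hence "0 < e / (1 + real (Suc k) * d)" using \<open>0 < e\<close> by simp
  then obtain C where m: "modul (e / (1 + real (Suc k) * d)) C" using modul_exists by blast
  thus "\<exists>C\<ge>0. \<forall>p\<in>UNIV. \<forall>q\<in>UNIV. abs (body d k p x - body d k q x) <= e + C * dist p q"
   using body_modulus[OF d m, of k _ x _ x] pos d L_pos by (intro exI[of _ "lipk C d (Suc k)"]) (auto simp: dist_norm lipk_def modul_def)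
 qed
 have "n \<in> measurable borel (count_space UNIV)"
  unfolding n_def using mb vs_measurable[OF d, of "Suc k"] by (intro measurable_Least) (auto simp del: vs.simps intro: borel_measurable_less)
 hence "(%z. a (n z)) \<in> borel_measurable borel" by (rule measurable_compose) simp
 thus ?thesis using nz aball less_imp_le by (intro bexI[of _ "%z. a (n z)"]) auto
qed

text \<open>The chain under feedback \<open>q\<close>. It is defined on its own because the control
  process to be built is a function of the chain which it drives.\<close>

primrec fchain :: "real => real => 'e => (nat => 'e => real^'n) => nat => 'w => 'e" where
 "fchain t d z q 0 = (%w. z)"
| "fchain t d z q (Suc k) = (%w. stepf d (fchain t d z q k w) (q k (fchain t d z q k w))
   (W (t + real (Suc k) * d) w - W (t + real k * d) w))"

lemma dp_upper:
 assumes t: "0 <= t" and d: "0 < d" and T: "t + real N * d = T" and e: "0 < e"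
 shows "EX c. adm t d N c & (LINT w|M. chain_cost t d z c N w) <= vs d N z + e"
proof -
 \<comment> \<open>Each of the N steps may lose \<open>e'\<close>; the extra 1 keeps the quotient
   meaningful for N = 0.\<close>
 define e' where "e' = e / (real N + 1)"
 have e': "0 < e'" using e by (simp add: e'_def)
 have "ALL j. \<exists>q\<in>borel_measurable borel. ALL z. q z \<in> cball 0 l & body d (N - Suc j) z (q z) <= vs d (Suc (N - Suc j)) z + e'"
  using selector_exists[OF d e'] by blast
 then obtain q where q: "!!j. q j \<in> borel_measurable borel" "!!j z. q j z \<in> cball 0 l"
   "!!j z. body d (N - Suc j) z (q j z) <= vs d (Suc (N - Suc j)) z + e'" by metis
 define c where "c k w = q k (fchain t d z q k w)" for k w
 have ce: "chain t d z c k w = fchain t d z q k w" for k w by (induction k) (auto simp: chain_Suc c_def)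
 have fm: "fchain t d z q k \<in> borel_measurable (\<F> (t + real k * d))" for k
 proof (induction k)
  case (Suc k)
  have le: "t + real k * d <= t + real (Suc k) * d" using d by (simp add: algebra_simps)
  have 1: "fchain t d z q k \<in> borel_measurable (\<F> (t + real (Suc k) * d))" by (rule F_mono[OF le Suc])
  have 2: "(%w. q k (fchain t d z q k w)) \<in> borel_measurable (\<F> (t + real (Suc k) * d))" by (rule measurable_compose[OF 1 q(1)])
  have 3: "(%w. W (t + real (Suc k) * d) w - W (t + real k * d) w) \<in> borel_measurable (\<F> (t + real (Suc k) * d))"
   using t d le by (intro increment_measurable) auto
  show ?case unfolding fchain.simps by (rule meas_stepf[OF 1 2 3])
 qed simp
 have c: "adm t d N c" unfolding adm_def c_def using q(2) by (auto intro!: measurable_compose[OF fm q(1)] simp del: mem_cball)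
 have top: "space M \<in> sets (\<F> t)" using space_F[of t] by (metis sets.top)
 have "(LINT w|M. indicator (space M) w * dp_sum t d z c N j w) <= vs d N z + real j * e'" if "j <= N" for j using that
 proof (induction j)
  case 0
  thus ?case by (simp add: dp_sum_def prob_space)
 next
  case (Suc j)
  hence j: "j < N" by simp
  have "(LINT w|M. indicator (space M) w * (body d (N - Suc j) (chain t d z c j w) (c j w) - vs d (Suc (N - Suc j)) (chain t d z c j w))) <= (LINT w|M. e')"
  proof (rule integral_mono[OF dp_sum_step(2)[OF t d c j top T]])
   fix w assume "w \<in> space M"
   show "indicator (space M) w * (body d (N - Suc j) (chain t d z c j w) (c j w) - vs d (Suc (N - Suc j)) (chain t d z c j w)) <= e'"
    using q(3)[of j "chain t d z c j w"] e' unfolding c_def ce[unfolded c_def] by (auto simp: indicator_def simp del: vs.simps)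
  qed simp
  thus ?case using dp_sum_step(1)[OF t d c j top T, of z] Suc prob_space by (simp add: algebra_simps del: vs.simps)
 qed
 from this[of N] have "(LINT w|M. indicator (space M) w * chain_cost t d z c N w) <= vs d N z + real N * e'"
  by (simp add: dp_sum_def chain_cost_def)
 moreover have "(LINT w|M. indicator (space M) w * chain_cost t d z c N w) = (LINT w|M. chain_cost t d z c N w)"
  by (rule Bochner_Integration.integral_cong) auto
 moreover have "real N * e' <= e" using e by (simp add: e'_def field_simps)
 ultimately show ?thesis using c by (intro exI[of _ c]) auto
qed

end

section \<open>Controlled solutions and the value of a bounded problem\<close>

text \<open>Uniform continuity on a compact interval, recast as a null sequence indexed by the mesh,
  which is the form a defect takes in \<open>approx\<close>.\<close>

lemma path_modulus:
 fixes w :: "real => 'a::euclidean_space"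
 assumes w: "continuous_on {t..T} w" and d: "d \<longlonglongrightarrow> 0"
 shows "EX a. a \<longlonglongrightarrow> 0 & (ALL N s s'. s \<in> {t..T} --> s' \<in> {t..T} --> abs (s - s') <= d N --> norm (w s - w s') <= a N)"
proof -
 define S where "S N = {norm (w s - w s') | s s'. s \<in> {t..T} & s' \<in> {t..T} & abs (s - s') <= d N}" for N
 \<comment> \<open>Inserting 0 makes the set nonempty even when no pair of times qualifies, and
   makes the supremum nonnegative.\<close>
 define a where "a N = Sup (insert 0 (S N))" for N
 have "bounded (w ` {t..T})" using compact_continuous_image[OF w] compact_imp_bounded by auto
 then obtain Kw where Kw: "!!s. s \<in> {t..T} ==> norm (w s) <= Kw" unfolding bounded_iff by blast
 have bd: "bdd_above (insert 0 (S N))" for N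
 proof (rule bdd_aboveI[where M="2 * abs Kw"])
  fix x assume "x \<in> insert 0 (S N)"
  thus "x <= 2 * abs Kw"
  proof
   assume "x \<in> S N"
   then obtain s s' where "x = norm (w s - w s')" "s \<in> {t..T}" "s' \<in> {t..T}" by (auto simp: S_def)
   thus ?thesis using Kw[of s] Kw[of s'] norm_triangle_ineq4[of "w s" "w s'"] by linarith
  qed simp
 qed
 have le: "norm (w s - w s') <= a N" if "s \<in> {t..T}" "s' \<in> {t..T}" "abs (s - s') <= d N" for s s' N
  unfolding a_def using that by (intro cSup_upper bd) (auto simp: S_def)
 have "a \<longlonglongrightarrow> 0"
 proof (rule LIMSEQ_I)
  fix e :: real assume e: "0 < e"
  have "uniformly_continuous_on {t..T} w" by (rule compact_uniformly_continuous[OF w]) simp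
  then obtain r where r: "0 < r" "!!s s'. s \<in> {t..T} ==> s' \<in> {t..T} ==> dist s' s < r ==> dist (w s') (w s) < e / 2"
   unfolding uniformly_continuous_on_def using e by (metis half_gt_zero)
  have "eventually (%N. d N < r) sequentially" by (rule order_tendstoD(2)[OF d r(1)])
  then obtain N0 where N0: "!!N. N >= N0 ==> d N < r" by (auto simp: eventually_sequentially)
  show "EX no. \<forall>N\<ge>no. norm (a N - 0) < e"
  proof (intro exI[of _ N0] allI impI)
   fix N assume N: "N0 <= N"
   have "a N <= e / 2" unfolding a_def
   proof (rule cSup_least)
    fix x assume "x \<in> insert 0 (S N)"
    thus "x <= e / 2"
    proof
     assume "x \<in> S N"
     then obtain s s' where *: "x = norm (w s - w s')" "s \<in> {t..T}" "s' \<in> {t..T}" "abs (s - s') <= d N" by (auto simp: S_def)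
     hence "dist (w s) (w s') < e / 2" using N0[OF N] by (intro r(2)) (auto simp: dist_real_def)
     thus ?thesis using * by (simp add: dist_norm)
    qed (use e in simp)
   qed simp
   moreover have "0 <= a N" unfolding a_def by (intro cSup_upper bd) auto
   ultimately show "norm (a N - 0) < e" using e by simp
  qed
 qed
 thus ?thesis using le by blast
qed

lemma LBINT_null1: fixes a :: real shows "(LBINT r:{a}. f r) = 0" using LBINT_null[of a f] by simp

lemma LBINT_abs_le_AE:
 fixes h :: "real => real"
 assumes h: "bdm t T h" and "t <= T" and c: "AE s in lborel. s \<in> {t..T} --> abs (h s) <= c"
 shows "abs (LBINT s:{t..T}. h s) <= c * (T - t)"
proof -
 have i: "integrable lborel (%s. indicator {t..T} s *\<^sub>R h s)" using bdm_integrable[OF h order_refl] by (simp add: set_integrable_def)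
 have "abs (LBINT s:{t..T}. h s) <= (LINT s|lborel. abs (indicator {t..T} s *\<^sub>R h s))"
  unfolding set_lebesgue_integral_def by (rule integral_abs_bound)
 also have "... <= (LINT s|lborel. indicator {t..T} s *\<^sub>R c)"
 proof (rule integral_mono_AE)
  show "integrable lborel (%s. indicator {t..T} s *\<^sub>R c)" unfolding real_scaleR_def
   by (intro integrable_mult_left integrable_real_indicator) (auto simp: emeasure_lborel_Icc_eq)
  show "AE s in lborel. abs (indicator {t..T} s *\<^sub>R h s) <= indicator {t..T} s *\<^sub>R c" using c by eventually_elim (auto simp: indicator_def)
 qed (use i in simp)
 also have "... = c * (T - t)" using assms(2) by (simp add: mult.commute)
 finally show ?thesis .
qed

lemma step_ix_dist:
 assumes "0 < d" "t <= s"
 shows "abs (s - (t + real (step_ix t d s) * d)) <= d"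
proof -
 define k where "k = step_ix t d s"
 show ?thesis using step_ix_bounds[OF assms] unfolding k_def[symmetric] by (auto simp: algebra_simps)
qed

context bounded_problem
begin

definition forcing where "forcing t V w s = \<Gamma> (LBINT r:{t..s}. V r w) + \<Sigma> (W s w - W t w)"

text \<open>With \<open>real N + 1\<close> cells no division by zero occurs for t < T, and exactly
  \<open>Suc N\<close> steps reach T.\<close>

definition dN where "dN t N = (T - t) / (real N + 1)"

definition avV :: "real => (real => 'w => real^'n) => nat => nat => 'w => real^'n"
 where "avV t V N k w = delayed_avg (%r. indicator {t..T} r *\<^sub>R V r w) t (dN t N) k"

definition EP where "EP t z V N s w = chain t (dN t N) z (avV t V N) (step_ix t (dN t N) s) w"

text \<open>The \<open>lim\<close> is taken at every sample point, whether or not the polygons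
  converge there; being a limit of measurable functions it is measurable with no exceptional
  set.\<close>

definition sol where "sol t z V s w = lim (%N. EP t z V N s w)"

lemma dN_pos: "t < T ==> 0 < dN t N" by (simp add: dN_def)

lemma dN_total: "t + real (Suc N) * dN t N = T" by (simp add: dN_def field_simps)

lemma dN_tendsto: "dN t \<longlonglongrightarrow> 0"
proof -
 have "(%N. (T - t) * (1 / (real N + 1))) \<longlonglongrightarrow> (T - t) * 0"
  using LIMSEQ_inverse_real_of_nat by (intro tendsto_intros) (simp add: inverse_eq_divide add.commute)
 thus ?thesis by (simp add: dN_def[abs_def])
qed

lemma LBINT_indicator:
 fixes V :: "real => real^'n"
 assumes "{c..d} \<subseteq> {t..T}"
 shows "(LBINT r:{c..d}. indicator {t..T} r *\<^sub>R V r) = (LBINT r:{c..d}. V r)" using assms by (intro set_lebesgue_integral_cong) auto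

lemma grid_le: "t < T ==> k <= Suc N ==> t + real k * dN t N <= T"
 using dN_pos[of t N] mult_right_mono[of "real k" "real (Suc N)" "dN t N"] by (subst (2) dN_total[of t N, symmetric]) auto

lemma avV_adm:
 assumes t: "0 <= t" "t < T" and V: "V \<in> controls M \<F> l t T"
 shows "adm t (dN t N) (Suc N) (avV t V N)" unfolding adm_def
proof (intro allI impI conjI ballI)
 fix k assume k: "k < Suc N"
 note d = dN_pos[OF t(2), of N]
 have le: "t + real k * dN t N <= T" using k t by (intro grid_le) auto
 show "avV t V N k \<in> borel_measurable (\<F> (t + real k * dN t N))"
 proof (cases "k = 0")
  case True
  hence "avV t V N k = (%_. 0)" by (auto simp: avV_def delayed_avg_def)
  thus ?thesis by simp
 next
  case False
  let ?p = "t + real (k - 1) * dN t N" and ?s = "t + real k * dN t N"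
  have ps: "t <= ?p" "?p <= ?s" using d by (auto intro: mult_right_mono)
  have "avV t V N k = (%w. (LBINT u:{?p..?s}. V u w) /\<^sub>R dN t N)"
  proof
   fix w
   have "{?p..?s} \<subseteq> {t..T}" using ps le by auto
   from LBINT_indicator[OF this, of "%u. V u w"] show "avV t V N k w = (LBINT u:{?p..?s}. V u w) /\<^sub>R dN t N"
    using False by (simp add: avV_def delayed_avg_def)
  qed
  thus ?thesis using adapted_control_integral[OF V t(1) ps le] by simp
 qed
 fix w assume w: "w \<in> space M"
 show "avV t V N k w \<in> cball 0 l"
  unfolding avV_def using norm_delayed_avg[OF control_path(3)[OF V w] d le, of l] control_path(2)[OF V w] l_pos by (auto simp: indicator_def)
qed

lemma step_ix_le:
 assumes "t < T" "s \<in> {t..T}" shows "step_ix t (dN t N) s <= Suc N"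
proof -
 note d = dN_pos[OF assms(1), of N]
 have "t + real (step_ix t (dN t N) s) * dN t N <= t + real (Suc N) * dN t N" using step_ix_bounds(1)[OF d, of t s] assms dN_total[of t N] by auto
 thus ?thesis using d by auto
qed

lemma step_ix_T: "t < T ==> step_ix t (dN t N) T = Suc N" using dN_total[of t N] dN_pos[of t N] by (intro step_ix_eq) (auto simp: algebra_simps)

lemma EP_measurable:
 assumes t: "0 <= t" "t <= T" and V: "V \<in> controls M \<F> l t T" and s: "s \<in> {t..T}"
 shows "EP t z V N s \<in> borel_measurable (\<F> s)"
proof (cases "t = T")
 case True
 hence "EP t z V N s = (%_. z)" by (auto simp: EP_def dN_def)
 thus ?thesis by simp
next
 case False
 hence tT: "t < T" using t by simp
 note d = dN_pos[OF tT, of N]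
 let ?k = "step_ix t (dN t N) s"
 have "chain t (dN t N) z (avV t V N) ?k \<in> borel_measurable (\<F> (t + real ?k * dN t N))"
  using d by (intro chain_measurable[OF t(1) _ avV_adm[OF t(1) tT V]] step_ix_le tT s) auto
 from F_mono[OF _ this, of s] have "chain t (dN t N) z (avV t V N) ?k \<in> borel_measurable (\<F> s)" using step_ix_bounds(1)[OF d, of t s] s by simp
 moreover have "EP t z V N s = chain t (dN t N) z (avV t V N) ?k" by (simp only: EP_def fun_eq_iff simp_thms)
 ultimately show ?thesis by simp
qed

lemma sol_measurable:
 assumes t: "0 <= t" "t <= T" and V: "V \<in> controls M \<F> l t T" and s: "s \<in> {t..T}"
 shows "sol t z V s \<in> borel_measurable (\<F> s)" unfolding sol_def[abs_def] using EP_measurable[OF assms, of z] by (rule borel_measurable_lim_metric)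

abbreviation good where "good w \<equiv> w \<in> space M & continuous_on {0..} (%s. W s w)"

lemma AE_good: "AE w in M. good w" using W_continuous AE_space by eventually_elim auto

lemma noise_sum:
 "(\<Sum>i<k. noise t d c i w) = \<Gamma> (\<Sum>i<k. d *\<^sub>R c i w) + \<Sigma> (W (t + real k * d) w - W t w)"
proof -
 interpret \<Gamma>: bounded_linear \<Gamma> by (rule lin_Gm)
 interpret \<Sigma>: bounded_linear \<Sigma> by (rule lin_Sg)
 show ?thesis by (induction k) (auto simp: noise_def \<Gamma>.zero \<Sigma>.zero \<Gamma>.add \<Gamma>.scaleR \<Sigma>.diff algebra_simps)
qed

lemma forcing_continuous:
 assumes t: "0 <= t" and w: "good w" and V: "V \<in> controls M \<F> l t T"
 shows "continuous_on {t..T} (forcing t V w)" unfolding forcing_def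
proof (intro continuous_intros)
 show "continuous_on {t..T} (%s. \<Gamma> (LBINT r:{t..s}. V r w))"
  using w by (intro bounded_linear.continuous_on[OF lin_Gm] LBINT_continuous control_path(1)[OF V]) auto
 have "continuous_on {t..T} (%s. W s w)" using w t by (auto intro: continuous_on_subset)
 thus "continuous_on {t..T} (%s. \<Sigma> (W s w - W t w))" by (intro bounded_linear.continuous_on[OF lin_Sg] continuous_intros)
qed

text \<open>The bound is uniform in the discrete control as long as its integral stays close to that of
  \<open>V\<close>; this serves both the delayed averages and step controls.\<close>
lemma chain_approx:
 assumes t: "0 <= t" "t < T" and w: "good w"
 shows "EX e. e \<longlonglongrightarrow> 0 & (ALL N V c z. (\<forall>s\<in>{t..T}. norm ((\<Sum>i<step_ix t (dN t N) s. dN t N *\<^sub>R c i w) - (LBINT r:{t..s}. V r w)) <= 2 * l * dN t N)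
  --> approx b t T z (forcing t V w) (e N) (%s. chain t (dN t N) z c (step_ix t (dN t N) s) w))"
proof -
 interpret \<Gamma>: bounded_linear \<Gamma> by (rule lin_Gm)
 interpret \<Sigma>: bounded_linear \<Sigma> by (rule lin_Sg)
 have "continuous_on {t..T} (%s. W s w)" using w t by (auto intro: continuous_on_subset)
 from path_modulus[OF this dN_tendsto[of t]] obtain y where y: "y \<longlonglongrightarrow> 0"
  "!!N s s'. s \<in> {t..T} ==> s' \<in> {t..T} ==> abs (s - s') <= dN t N ==> norm (W s w - W s' w) <= y N" by blast
 \<comment> \<open>The three contributions are the lag of the integrated control, the oscillation of
   the Brownian path over one cell, and the unfinished Euler step.\<close>
 define e where "e N = (G * (2 * l * dN t N) + Sn * y N) + dN t N * K" for N
 have "e \<longlonglongrightarrow> (G * (2 * l * 0) + Sn * 0) + 0 * K" unfolding e_def by (intro tendsto_intros dN_tendsto y)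
 hence lim: "e \<longlonglongrightarrow> 0" by simp
 have "approx b t T z (forcing t V w) (e N) (%s. chain t (dN t N) z c (step_ix t (dN t N) s) w)"
  if A: "!!s. s \<in> {t..T} ==> norm ((\<Sum>i<step_ix t (dN t N) s. dN t N *\<^sub>R c i w) - (LBINT r:{t..s}. V r w)) <= 2 * l * dN t N" for N V c z
  unfolding e_def chain_def
 proof (rule euler_approx)
  note d = dN_pos[OF t(2), of N]
  show "0 < dN t N" by (rule d)
  show "norm (b x) <= K" for x by (rule b_bd)
  fix s assume s: "s \<in> {t..T}"
  let ?k = "step_ix t (dN t N) s"
  let ?q = "t + real ?k * dN t N"
  have q: "?q \<in> {t..T}" "abs (?q - s) <= dN t N" using step_ix_bounds[OF d, of t s] s d by (auto simp: algebra_simps)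
  have "(\<Sum>i<?k. noise t (dN t N) c i w) - forcing t V w s
   = \<Gamma> ((\<Sum>i<?k. dN t N *\<^sub>R c i w) - (LBINT r:{t..s}. V r w)) + \<Sigma> (W ?q w - W s w)"
   unfolding noise_sum forcing_def by (simp add: \<Gamma>.diff \<Sigma>.diff)
  also have "norm ... <= G * norm ((\<Sum>i<?k. dN t N *\<^sub>R c i w) - (LBINT r:{t..s}. V r w)) + Sn * norm (W ?q w - W s w)"
   by (intro order_trans[OF norm_triangle_ineq] add_mono Gm_le Sg_le)
  also have "... <= G * (2 * l * dN t N) + Sn * y N" by (intro add_mono mult_left_mono A s y(2) q G_nn Sn_nn)
  finally show "norm ((\<Sum>i<?k. noise t (dN t N) c i w) - forcing t V w s) <= G * (2 * l * dN t N) + Sn * y N" .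
 qed
 thus ?thesis using lim by blast
qed

text \<open>The delayed sum integrates the control up to the grid time before the current cell, so
  at most two cell lengths are missing.\<close>

lemma delayed_close:
 assumes t: "0 <= t" "t < T" and w: "w \<in> space M" and V: "V \<in> controls M \<F> l t T" and s: "s \<in> {t..T}"
 shows "norm ((\<Sum>i<step_ix t (dN t N) s. dN t N *\<^sub>R avV t V N i w) - (LBINT r:{t..s}. V r w)) <= 2 * l * dN t N"
proof -
 note d = dN_pos[OF t(2), of N]
 let ?k = "step_ix t (dN t N) s"
 let ?p = "t + real (?k - 1) * dN t N"
 note kb = step_ix_bounds[OF d, of t s]
 have p: "t <= ?p" "?p <= s" "s - ?p <= 2 * dN t N" "?p <= T"
 proof -
  show "t <= ?p" using d by simp
  have "?p <= t + real ?k * dN t N" using d by (intro add_left_mono mult_right_mono) auto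
  thus "?p <= s" "?p <= T" using kb s by auto
  have "real ?k <= real (?k - 1) + 1" by linarith
  hence "real ?k * dN t N <= (real (?k - 1) + 1) * dN t N" using d by (intro mult_right_mono) auto
  thus "s - ?p <= 2 * dN t N" using kb(2) s by (auto simp: algebra_simps)
 qed
 have "(\<Sum>i<?k. dN t N *\<^sub>R avV t V N i w) = (LBINT r:{t..?p}. indicator {t..T} r *\<^sub>R V r w)"
 proof (cases "?k = 0")
  case True
  hence "(\<Sum>i<?k. dN t N *\<^sub>R avV t V N i w) = 0" by (simp only: lessThan_0 sum.empty)
  moreover have "?p = t" using True by simp
  ultimately show ?thesis by (simp only: LBINT_null)
 next
  case False
  hence Sk: "Suc (?k - 1) = ?k" by simp
  show ?thesis using delayed_avg_sum[OF control_path(3)[OF V w] d p(4)] unfolding Sk avV_def .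
 qed
 also have "... = (LBINT r:{t..?p}. V r w)" using p by (intro LBINT_indicator) auto
 finally have "(\<Sum>i<?k. dN t N *\<^sub>R avV t V N i w) - (LBINT r:{t..s}. V r w) = - (LBINT r:{?p..s}. V r w)"
  using LBINT_split[OF control_path(1)[OF V w] _ p(1,2)] s by simp
 also have "norm ... <= l * (s - ?p)" unfolding norm_minus_cancel
 proof (rule norm_LBINT_le[OF control_path(1)[OF V w] p(1,2)])
  fix r assume "r \<in> {?p..s}"
  hence "r \<in> {t..T}" using p(1) s by auto
  thus "norm (V r w) <= l" by (rule control_path(2)[OF V w])
 qed (use s in auto)
 also have "... <= l * (2 * dN t N)" using p l_pos by (intro mult_left_mono) auto
 finally show ?thesis by simp
qed

text \<open>For t = T the mesh is 0; division by zero yields index 0, and every polygon stays at its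
  initial point.\<close>

lemma sol_T: "sol T z V s w = z" by (simp add: sol_def EP_def dN_def)

lemma sol_solves:
 assumes t: "0 <= t" "t <= T" and w: "good w" and V: "V \<in> controls M \<F> l t T"
 shows "solves b t T z (forcing t V w) (%s. sol t z V s w)"
  and "t < T ==> EX e. e \<longlonglongrightarrow> 0 & (ALL N. \<forall>s\<in>{t..T}. norm (EP t z V N s w - sol t z V s w) <= e N)"
proof -
 interpret \<Gamma>: bounded_linear \<Gamma> by (rule lin_Gm)
 interpret \<Sigma>: bounded_linear \<Sigma> by (rule lin_Sg)
 have "solves b t T z (forcing t V w) (%s. sol t z V s w) &
  (EX e. e \<longlonglongrightarrow> 0 & (ALL N. \<forall>s\<in>{t..T}. norm (EP t z V N s w - sol t z V s w) <= e N))" if tT: "t < T"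
 proof -
  obtain e where e: "e \<longlonglongrightarrow> 0" "!!N. approx b t T z (forcing t V w) (e N) (%s. EP t z V N s w)"
   using chain_approx[OF t(1) tT w] delayed_close[OF t(1) tT _ V] w unfolding EP_def by blast
  note lim = approx_limit[OF b_lip L_pos forcing_continuous[OF t(1) w V] e(2,1)]
  have "(%N. 2 * e N * exp (2 * L * (T - t))) \<longlonglongrightarrow> 2 * 0 * exp (2 * L * (T - t))" by (intro tendsto_intros e)
  thus ?thesis using lim unfolding sol_def by (intro conjI exI[of _ "%N. 2 * e N * exp (2 * L * (T - t))"]) auto
 qed note * = this
 thus "t < T ==> EX e. e \<longlonglongrightarrow> 0 & (ALL N. \<forall>s\<in>{t..T}. norm (EP t z V N s w - sol t z V s w) <= e N)" by blast
 show "solves b t T z (forcing t V w) (%s. sol t z V s w)"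
 proof (cases "t < T")
  case False
  hence "t = T" using t by simp
  thus ?thesis by (auto simp: solves_def sol_T LBINT_null1 forcing_def \<Gamma>.zero \<Sigma>.zero)
 qed (use * in blast)
qed

lemma EP_tendsto:
 assumes t: "0 <= t" "t <= T" and w: "good w" and V: "V \<in> controls M \<F> l t T" and s: "s \<in> {t..T}"
 shows "(%N. EP t z V N s w) \<longlonglongrightarrow> sol t z V s w"
proof (cases "t < T")
 case True
 then obtain e where e: "e \<longlonglongrightarrow> 0" "!!N s. s \<in> {t..T} ==> norm (EP t z V N s w - sol t z V s w) <= e N"
  using sol_solves(2)[OF t w V, of z] by blast
 show ?thesis by (rule LIM_zero_cancel, rule Lim_null_comparison[OF _ e(1)]) (use e(2)[OF s] in auto)
next
 case False
 thus ?thesis using t by (simp add: sol_T EP_def dN_def)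
qed

definition costf where
 "costf t z V w = (LBINT s:{t..T}. f (s, sol t z V s w, V s w)) + g (sol t z V T w)"

section \<open>Costs along controlled solutions\<close>

lemma bdm_f:
 assumes "X \<in> borel_measurable (restrict_space borel {t..T'})" "V \<in> borel_measurable (restrict_space borel {t..T'})"
  "k \<in> borel_measurable (restrict_space borel {t..T'})"
 shows "bdm t T' (%s. f (k s, X s, V s))" unfolding bdm_def
proof
 have "(%s. (k s, X s, V s)) \<in> borel_measurable (restrict_space borel {t..T'})" using assms by (intro borel_measurable_Pair)
 thus "(%s. f (k s, X s, V s)) \<in> borel_measurable (restrict_space borel {t..T'})" by (rule measurable_compose[OF _ meas_f])
qed (use f_bd in auto)

lemma LBINT_abs_le_K:
 assumes "bdm t T h" "t <= T" "!!s. s \<in> {t..T} ==> abs (h s) <= c" "0 <= t"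
 shows "abs (LBINT s:{t..T}. h s) <= c * (T - t)" using norm_LBINT_le[OF assms(1), of t T c] assms by auto

lemma sol_path:
 assumes t: "0 <= t" "t <= T" and w: "good w" and V: "V \<in> controls M \<F> l t T"
 shows "bdm t T (%s. sol t z V s w)" "bdm t T (%s. f (s, sol t z V s w, V s w))"
proof -
 show "bdm t T (%s. sol t z V s w)" using sol_solves(1)[OF assms, of z] by (auto simp: solves_def bdm_continuous)
 thus "bdm t T (%s. f (s, sol t z V s w, V s w))" using control_path(1)[OF V] w
  by (intro bdm_f) (auto simp: bdm_def intro: measurable_restrict_space1)
qed

lemma costf_bound:
 assumes t: "0 <= t" "t <= T" and w: "good w" and V: "V \<in> controls M \<F> l t T"
 shows "abs (costf t z V w) <= K * (1 + T)"
proof -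
 have "abs (LBINT s:{t..T}. f (s, sol t z V s w, V s w)) <= K * (T - t)" by (rule LBINT_abs_le_K[OF sol_path(2)[OF assms] t(2) f_bd t(1)])
 also have "... <= K * T" using t K_nn by (intro mult_left_mono) auto
 finally show ?thesis using g_bd[of "sol t z V T w"] unfolding costf_def by (simp add: algebra_simps)
qed

text \<open>As the integral of a step function the discrete cost can be compared with the continuous
  one by dominated convergence in time.\<close>

lemma chain_cost_LBINT:
 assumes t: "t < T"
 shows "chain_cost t (dN t N) z a (Suc N) w =
  (LBINT s:{t..T}. f (t + real (step_ix t (dN t N) s) * dN t N, chain t (dN t N) z a (step_ix t (dN t N) s) w, a (step_ix t (dN t N) s) w))
  + g (chain t (dN t N) z a (Suc N) w)" using t dN_total[of t N]
 by (subst LBINT_step[OF dN_pos[OF t], where c="%i. f (t + real i * dN t N, chain t (dN t N) z a i w, a i w)"])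
  (simp_all only: step_ix_T, simp_all add: chain_cost_def)

lemma chain_cost_bound:
 assumes t: "0 <= t" "t < T"
 shows "abs (chain_cost t (dN t N) z a (Suc N) w) <= K * (1 + T)"
proof -
 have "abs (LBINT s:{t..T}. f (t + real (step_ix t (dN t N) s) * dN t N, chain t (dN t N) z a (step_ix t (dN t N) s) w, a (step_ix t (dN t N) s) w)) <= K * (T - t)"
  using t by (intro LBINT_abs_le_K bdm_step[where c="%i. f (t + real i * dN t N, chain t (dN t N) z a i w, a i w)"] f_bd) auto
 also have "... <= K * T" using t K_nn by (intro mult_left_mono) auto
 finally show ?thesis unfolding chain_cost_LBINT[OF t(2)] using g_bd[of "chain t (dN t N) z a (Suc N) w"] by (simp add: algebra_simps)
qed

lemma chain_cost_measurable:
 assumes t: "0 <= t" "t < T" and c: "adm t (dN t N) (Suc N) c"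
 shows "chain_cost t (dN t N) z c (Suc N) \<in> borel_measurable M"
proof -
 have "chain_cost t (dN t N) z c (Suc N) w = dp_sum t (dN t N) z c (Suc N) (Suc N) w" for w by (simp add: chain_cost_def dp_sum_def)
 moreover have "integrable M (%w. indicator (space M) w * dp_sum t (dN t N) z c (Suc N) (Suc N) w)"
  by (rule dp_sum_integrable[OF t(1) dN_pos[OF t(2)] c]) auto
 ultimately have "(%w. indicator (space M) w * chain_cost t (dN t N) z c (Suc N) w) \<in> borel_measurable M"
  by (auto dest: borel_measurable_integrable)
 thus ?thesis by (rule measurable_cong[THEN iffD1, rotated]) auto
qed

text \<open>At almost every time the delayed averages converge to the control; the states converge
  at every time, and so do the grid times. The integrands therefore converge almost everywhere, and
  K dominates them.\<close>

lemma chain_cost_tendsto: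
 assumes t: "0 <= t" "t < T" and a: "good a" and V: "V \<in> controls M \<F> l t T"
 shows "(%N. chain_cost t (dN t N) z (avV t V N) (Suc N) a) \<longlonglongrightarrow> costf t z V a"
proof -
 have omM: "a \<in> space M" using a by simp
 note d = dN_pos[OF t(2)]
 let ?i = "%N s. step_ix t (dN t N) s"
 let ?c = "%N i. f (t + real i * dN t N, chain t (dN t N) z (avV t V N) i a, avV t V N i a)"
 have "(%N. LBINT s:{t..T}. ?c N (?i N s)) \<longlonglongrightarrow> (LBINT s:{t..T}. f (s, sol t z V s a, V s a))"
  unfolding set_lebesgue_integral_def
 proof (rule integral_dominated_convergence[where w="%s. indicator {t..T} s * K"])
  show "(%s. indicator {t..T} s *\<^sub>R f (s, sol t z V s a, V s a)) \<in> borel_measurable lborel"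
   using bdm_integrable[OF sol_path(2)[OF t(1) _ a V], of t T] t by (simp add: set_integrable_def borel_measurable_integrable)
  show "(%s. indicator {t..T} s *\<^sub>R ?c N (?i N s)) \<in> borel_measurable lborel" for N using bdm_integrable[OF bdm_step[of t T "?c N" "dN t N"], of t T]
   by (simp add: set_integrable_def borel_measurable_integrable)
  show "integrable lborel (%s. indicator {t..T} s * K)" by (intro integrable_mult_left integrable_real_indicator) (auto simp: emeasure_lborel_Icc_eq)
  show "AE s in lborel. norm (indicator {t..T} s *\<^sub>R ?c N (?i N s)) <= indicator {t..T} s * K" for N using f_bd by (auto simp: indicator_def intro!: AE_I2)
  have "AE s in lborel. t < s --> (%N. avV t V N (?i N s) a) \<longlonglongrightarrow> indicator {t..T} s *\<^sub>R V s a"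
   unfolding avV_def by (rule delayed_avg_tendsto[OF control_path(3)[OF V omM] d dN_tendsto])
  thus "AE s in lborel. (%N. indicator {t..T} s *\<^sub>R ?c N (?i N s)) \<longlonglongrightarrow> indicator {t..T} s *\<^sub>R f (s, sol t z V s a, V s a)"
   using AE_lborel_singleton[of t]
  proof eventually_elim
   fix s assume lim: "t < s --> (%N. avV t V N (?i N s) a) \<longlonglongrightarrow> indicator {t..T} s *\<^sub>R V s a" and "s ~= t"
   show "(%N. indicator {t..T} s *\<^sub>R ?c N (?i N s)) \<longlonglongrightarrow> indicator {t..T} s *\<^sub>R f (s, sol t z V s a, V s a)"
   proof (cases "s \<in> {t..T}")
    case True
    hence lim: "(%N. avV t V N (?i N s) a) \<longlonglongrightarrow> V s a" using lim \<open>s ~= t\<close> by auto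
    have lim2: "(%N. chain t (dN t N) z (avV t V N) (?i N s) a) \<longlonglongrightarrow> sol t z V s a"
     using EP_tendsto[OF t(1) _ a V True, of z] t by (simp add: EP_def)
    have lim3: "(%N. t + real (?i N s) * dN t N) \<longlonglongrightarrow> s"
    proof (rule tendsto_sandwich)
     show "(%N. s - dN t N) \<longlonglongrightarrow> s" using tendsto_diff[OF tendsto_const dN_tendsto] by auto
     show "\<forall>\<^sub>F N in sequentially. s - dN t N <= t + real (?i N s) * dN t N"
      using step_ix_bounds(2)[OF d, of t s] True by (auto simp: algebra_simps less_imp_le)
     show "\<forall>\<^sub>F N in sequentially. t + real (?i N s) * dN t N <= s" using step_ix_bounds(1)[OF d, of t s] True by auto
    qed simp
    show ?thesis by (intro tendsto_intros continuous_on_tendsto_compose[OF continuous_f] lim lim2 lim3) auto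
   qed simp
  qed
 qed
 moreover have "(%N. chain t (dN t N) z (avV t V N) (Suc N) a) \<longlonglongrightarrow> sol t z V T a"
  using EP_tendsto[OF t(1) _ a V, of T z] t by (simp add: EP_def step_ix_T del: of_nat_Suc)
 hence "(%N. g (chain t (dN t N) z (avV t V N) (Suc N) a)) \<longlonglongrightarrow> g (sol t z V T a)"
  by (intro continuous_on_tendsto_compose[OF continuous_g]) auto
 ultimately show ?thesis unfolding costf_def chain_cost_LBINT[OF t(2)] by (rule tendsto_add)
qed

text \<open>The cost is almost surely the limit of discrete costs, each of which is a finite sum of
  measurable variables. This avoids a joint measurability argument for the solution.\<close>

lemma costf_measurable:
 assumes t: "0 <= t" "t <= T" and V: "V \<in> controls M \<F> l t T"
 shows "costf t z V \<in> borel_measurable M"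
proof (cases "t < T")
 case True
 show ?thesis
 proof (rule M_modification)
  show "(%w. lim (%N. chain_cost t (dN t N) z (avV t V N) (Suc N) w)) \<in> borel_measurable M"
   using chain_cost_measurable[OF t(1) True avV_adm[OF t(1) True V]] by (rule borel_measurable_lim_metric)
  show "AE w in M. lim (%N. chain_cost t (dN t N) z (avV t V N) (Suc N) w) = costf t z V w"
   using AE_good by eventually_elim (auto intro!: limI chain_cost_tendsto[OF t(1) True _ V])
 qed auto
next
 case False
 hence "costf t z V = (%_. g z)" using t by (auto simp: costf_def sol_T LBINT_null1)
 thus ?thesis by simp
qed

lemma costf_integrable:
 assumes t: "0 <= t" "t <= T" and V: "V \<in> controls M \<F> l t T" and B[measurable]: "B \<in> sets M"
 shows "integrable M (costf t z V)" "integrable M (%w. indicator B w * costf t z V w)"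
proof -
 note [measurable] = costf_measurable[OF t V]
 have "AE w in M. abs (costf t z V w) <= K * (1 + T)" using AE_good by eventually_elim (rule costf_bound[OF t _ V])
 moreover have "0 <= K * (1 + T)" using K_nn T_pos by simp
 ultimately show "integrable M (costf t z V)" "integrable M (%w. indicator B w * costf t z V w)"
  by (auto intro!: integrable_const_bound[where B="K * (1 + T)"] elim!: eventually_mono simp: indicator_def)
qed

lemma chain_cost_expectation_tendsto:
 assumes t: "0 <= t" "t < T" and V: "V \<in> controls M \<F> l t T" and B[measurable]: "B \<in> sets M"
 shows "(%N. \<integral>a. indicator B a * chain_cost t (dN t N) z (avV t V N) (Suc N) a \<partial>M) \<longlonglongrightarrow> (LINT a|M. indicator B a * costf t z V a)"
proof (rule integral_dominated_convergence[where w="%_. K * (1 + T)"])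
 note [measurable] = costf_measurable[OF t(1) less_imp_le[OF t(2)] V] chain_cost_measurable[OF t avV_adm[OF t V]]
 show "(%a. indicator B a * costf t z V a) \<in> borel_measurable M" by measurable
 show "(%a. indicator B a * chain_cost t (dN t N) z (avV t V N) (Suc N) a) \<in> borel_measurable M" for N by measurable
 show "AE a in M. (%N. indicator B a * chain_cost t (dN t N) z (avV t V N) (Suc N) a) \<longlonglongrightarrow> indicator B a * costf t z V a"
  using AE_good by eventually_elim (intro tendsto_intros chain_cost_tendsto[OF t _ V])
 show "AE a in M. norm (indicator B a * chain_cost t (dN t N) z (avV t V N) (Suc N) a) <= K * (1 + T)" for N
  using chain_cost_bound[OF t] K_nn T_pos by (auto simp: indicator_def intro!: AE_I2)
qed simp

text \<open>At s = T the cell index is \<open>Suc N\<close>, for which admissibility says nothing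
  about the discrete control; 0 is a legal value there.\<close>

definition pc :: "real => nat => (nat => 'w => real^'n) => real => 'w => real^'n" where
 "pc t N c s w = (if step_ix t (dN t N) s <= N then c (step_ix t (dN t N) s) w else 0)"

lemma pc_control:
 assumes t: "0 <= t" "t < T" and c: "adm t (dN t N) (Suc N) c"
 shows "pc t N c \<in> controls M \<F> l t T"
proof -
 note d = dN_pos[OF t(2), of N]
 have a: "c k \<in> borel_measurable (\<F> (t + real k * dN t N))" if "k <= N" for k using c that by (auto simp: adm_def)
 have aM: "c k \<in> borel_measurable M" if "k <= N" for k using F_le_M[OF a[OF that]] .
 have ad: "pc t N c s \<in> borel_measurable (\<F> s)" if "s \<in> {t..T}" for s
 proof (cases "step_ix t (dN t N) s <= N")
  case True
  hence "pc t N c s = c (step_ix t (dN t N) s)" by (auto simp: pc_def)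
  thus ?thesis using F_mono[OF step_ix_bounds(1)[OF d] a[OF True]] that by auto
 next
  case False
  hence "pc t N c s = (%_. 0)" by (auto simp: pc_def)
  thus ?thesis by simp
 qed
 have "(%p. (%i p. if i <= N then c i (snd p) else 0) (step_ix t (dN t N) (fst p)) p) \<in> borel_measurable (borel \<Otimes>\<^sub>M M)"
 proof (rule measurable_compose_countable)
  show "(%p. if i <= N then c i (snd p) else 0) \<in> borel_measurable (borel \<Otimes>\<^sub>M M)" for i
   using aM[of i] by (cases "i <= N") (auto intro: measurable_compose[OF measurable_snd])
  show "(%p. step_ix t (dN t N) (fst p)) \<in> measurable (borel \<Otimes>\<^sub>M M) (count_space UNIV)" by measurable
 qed
 hence j: "(%p. pc t N c (fst p) (snd p)) \<in> borel_measurable (borel \<Otimes>\<^sub>M M)" by (simp add: pc_def)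
 have "(%p. (fst p, snd p)) \<in> measurable (restrict_space borel {t..T} \<Otimes>\<^sub>M M) ((borel :: real measure) \<Otimes>\<^sub>M M)"
  by (intro measurable_Pair measurable_compose[OF measurable_fst] measurable_restrict_space1 measurable_snd) auto
 from measurable_compose[OF this j] have "(%(s, w). pc t N c s w) \<in> borel_measurable (restrict_space borel {t..T} \<Otimes>\<^sub>M M)"
  by (simp add: split_beta')
 moreover have "pc t N c s w \<in> cball 0 l" if "w \<in> space M" for s w using c that l_pos by (auto simp: pc_def adm_def)
 ultimately show ?thesis using ad by (auto simp: controls_def simp del: mem_cball)
qed

lemma pc_close:
 assumes t: "0 <= t" "t < T" and a: "adm t (dN t N) (Suc N) a" and w: "w \<in> space M" and s: "s \<in> {t..T}"
 shows "norm ((\<Sum>i<step_ix t (dN t N) s. dN t N *\<^sub>R a i w) - (LBINT r:{t..s}. pc t N a r w)) <= 2 * l * dN t N"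
proof -
 note d = dN_pos[OF t(2), of N]
 let ?k = "step_ix t (dN t N) s"
 let ?c = "%i. if i <= N then a i w else 0"
 have k: "?k <= Suc N" by (rule step_ix_le[OF t(2) s])
 have ts: "t <= s" using s by simp
 have "(LBINT r:{t..s}. pc t N a r w) = (\<Sum>i<?k. dN t N *\<^sub>R ?c i) + (s - t - real ?k * dN t N) *\<^sub>R ?c ?k"
  using LBINT_step[OF d ts, of ?c] by (simp only: pc_def)
 also have "(\<Sum>i<?k. dN t N *\<^sub>R ?c i) = (\<Sum>i<?k. dN t N *\<^sub>R a i w)" using k by (intro sum.cong) auto
 finally have "(\<Sum>i<?k. dN t N *\<^sub>R a i w) - (LBINT r:{t..s}. pc t N a r w) = - ((s - t - real ?k * dN t N) *\<^sub>R ?c ?k)"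
  by simp
 also have "norm ... = abs (s - t - real ?k * dN t N) * norm (?c ?k)" by (simp only: norm_minus_cancel norm_scaleR)
 also have "... <= dN t N * l"
 proof (rule mult_mono)
  show "abs (s - t - real ?k * dN t N) <= dN t N" using step_ix_bounds[OF d ts] by (auto simp: algebra_simps)
  show "norm (?c ?k) <= l" using a w l_pos by (auto simp: adm_def)
 qed (use d in auto)
 also have "... <= 2 * l * dN t N" using d l_pos by simp
 finally show ?thesis .
qed

text \<open>The threshold depends on the sample point but not on the discrete control. This is
  essential because the near-optimal controls to which the lemma is applied change with N.\<close>

lemma pc_cost_close:
 assumes t: "0 <= t" "t < T" and w: "good w" and e: "0 < e"
 shows "EX N0. \<forall>N\<ge>N0. ALL a z. adm t (dN t N) (Suc N) a -->
  abs (costf t z (pc t N a) w - chain_cost t (dN t N) z a (Suc N) w) <= e"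
proof -
 obtain j where j: "j \<longlonglongrightarrow> 0" "!!N V a z. (!!s. s \<in> {t..T} ==> norm ((\<Sum>i<step_ix t (dN t N) s. dN t N *\<^sub>R a i w) - (LBINT r:{t..s}. V r w)) <= 2 * l * dN t N)
  ==> approx b t T z (forcing t V w) (j N) (%s. chain t (dN t N) z a (step_ix t (dN t N) s) w)"
  using chain_approx[OF t w] by blast
 define e' where "e' = e / (2 * (1 + T))"
 have e': "0 < e'" "e' * (1 + T) = e / 2" using e T_pos unfolding e'_def by (simp, intro mult_div_cancel) simp
 obtain C where m: "modul e' C" using modul_exists[OF e'(1)] by blast
 hence C: "0 <= C" by (simp add: modul_def)
 define y where "y N = dN t N + 2 * j N * exp (2 * L * (T - t))" for N
 have "y \<longlonglongrightarrow> 0 + 2 * 0 * exp (2 * L * (T - t))" unfolding y_def by (intro tendsto_intros dN_tendsto j)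
 hence "(%N. C * (1 + T) * y N) \<longlonglongrightarrow> C * (1 + T) * 0" by (intro tendsto_intros) simp
 hence "\<forall>\<^sub>F N in sequentially. C * (1 + T) * y N < e / 2" using e by (intro order_tendstoD) auto
 then obtain N0 where N0: "!!N. N >= N0 ==> C * (1 + T) * y N < e / 2" by (auto simp: eventually_sequentially)
 have "abs (costf t z (pc t N a) w - chain_cost t (dN t N) z a (Suc N) w) <= e"
  if N: "N0 <= N" and a: "adm t (dN t N) (Suc N) a" for N a z
 proof -
  let ?V = "pc t N a" and ?i = "%s. step_ix t (dN t N) s"
  let ?Z = "%s. sol t z ?V s w" and ?X = "%i. chain t (dN t N) z a i w"
  let ?c = "%i. f (t + real i * dN t N, ?X i, a i w)"
  note V = pc_control[OF t a] and d = dN_pos[OF t(2), of N]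
  have ap: "approx b t T z (forcing t ?V w) (j N) (%s. ?X (?i s))" using pc_close[OF t a] w by (intro j(2)) auto
  have e0: "0 <= j N" using ap t norm_ge_zero order_trans unfolding approx_def by (meson atLeastAtMost_iff less_imp_le order_refl)
  have tl: "t <= T" using t by simp
  have close: "norm (?Z s - ?X (?i s)) <= 2 * j N * exp (2 * L * (T - t))" if s: "s \<in> {t..T}" for s
  proof -
   have "norm (?Z s - ?X (?i s)) <= 2 * (norm (z - z) + 0 + 0 + j N) * exp (2 * L * (s - t))"
    by (rule approx_close[OF b_lip L_pos solves_imp_approx[OF sol_solves(1)[OF t(1) tl w V]] ap _ s]) auto
   also have "... <= 2 * j N * exp (2 * L * (T - t))" using e0 s L_pos by (auto intro!: mult_left_mono)
   finally show ?thesis .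
  qed
  have b1: "bdm t T (%s. f (s, ?Z s, ?V s w))" by (rule sol_path(2)[OF t(1) tl w V])
  have b2: "bdm t T (%s. ?c (?i s))" by (rule bdm_step)
  have pt: "abs (f (s, ?Z s, ?V s w) - ?c (?i s)) <= e' + C * y N" if s: "s \<in> {t..<T}" for s
  proof -
   have s': "s \<in> {t..T}" using s by auto
   have "?i s <= N"
   proof (rule ccontr)
    assume "\<not> ?i s <= N"
    hence "real (Suc N) * dN t N <= real (?i s) * dN t N" using d by (intro mult_right_mono) auto
    thus False using step_ix_bounds(1)[OF d, of t s] dN_total[of t N] s by auto
   qed
   hence "?V s w = a (?i s) w" by (simp add: pc_def)
   moreover have "abs (s - (t + real (?i s) * dN t N)) <= dN t N" by (rule step_ix_dist[OF d]) (use s in auto)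
   ultimately have "dist (s, ?Z s, ?V s w) (t + real (?i s) * dN t N, ?X (?i s), a (?i s) w) <= y N"
    using close[OF s'] sqrt_sum_squares_le_sum[of "abs (s - (t + real (?i s) * dN t N))" "norm (?Z s - ?X (?i s))"]
    unfolding dist_Pair_Pair y_def by (auto simp: dist_norm)
   hence "e' + C * dist (s, ?Z s, ?V s w) (t + real (?i s) * dN t N, ?X (?i s), a (?i s) w) <= e' + C * y N"
    using C by (intro add_left_mono mult_left_mono)
   thus ?thesis using m unfolding modul_def by (meson order_trans)
  qed
  have "abs ((LBINT s:{t..T}. f (s, ?Z s, ?V s w)) - (LBINT s:{t..T}. ?c (?i s))) = abs (LBINT s:{t..T}. f (s, ?Z s, ?V s w) - ?c (?i s))"
   by (subst set_integral_diff) (auto intro: bdm_integrable[OF b1] bdm_integrable[OF b2])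
  also have "... <= (e' + C * y N) * (T - t)"
  proof (rule LBINT_abs_le_AE[OF bdm_diff[OF b1 b2] tl])
   \<comment> \<open>At s = T the step control is 0 while the discrete integrand reads index
     \<open>Suc N\<close>; this single time is discarded.\<close>
   show "AE s in lborel. s \<in> {t..T} --> abs (f (s, ?Z s, ?V s w) - ?c (?i s)) <= e' + C * y N"
    using AE_lborel_singleton[of T] by eventually_elim (intro impI pt, auto)
  qed
  also have "... <= (e' + C * y N) * T" using e' C e0 d t by (intro mult_left_mono) (auto simp: y_def)
  finally have 1: "abs ((LBINT s:{t..T}. f (s, ?Z s, ?V s w)) - (LBINT s:{t..T}. ?c (?i s))) <= (e' + C * y N) * T" .
  have "dist (?Z T) (?X (Suc N)) <= y N" using close[of T] t d unfolding step_ix_T[OF t(2)] by (simp add: dist_norm y_def)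
  hence "e' + C * dist (?Z T) (?X (Suc N)) <= e' + C * y N" using C by (intro add_left_mono mult_left_mono)
  hence 2: "abs (g (?Z T) - g (?X (Suc N))) <= e' + C * y N" using m unfolding modul_def by (meson order_trans)
  have "abs (costf t z ?V w - chain_cost t (dN t N) z a (Suc N) w) <= (e' + C * y N) * T + (e' + C * y N)"
   using 1 2 unfolding costf_def chain_cost_LBINT[OF t(2)] by linarith
  also have "... = e' * (1 + T) + C * (1 + T) * y N" by (simp add: algebra_simps)
  also have "... <= e" using N0[OF N] e'(2) by linarith
  finally show ?thesis .
 qed
 thus ?thesis by blast
qed

definition u where "u t z = (INF V\<in>controls M \<F> l t T. \<integral>w. costf t z V w \<partial>M)"

section \<open>The value of the bounded problem as a limit of discrete values\<close>

lemma zero_control: "(%_ _. 0) \<in> controls M \<F> l t T" using l_pos by (auto simp: controls_def split_beta')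

lemma expected_cost_bound:
 assumes t: "0 <= t" "t <= T" and V: "V \<in> controls M \<F> l t T"
 shows "abs (\<integral>w. costf t z V w \<partial>M) <= K * (1 + T)"
proof -
 have ae: "AE w in M. abs (costf t z V w) <= K * (1 + T)" using AE_good by eventually_elim (rule costf_bound[OF t _ V])
 have "abs (\<integral>w. costf t z V w \<partial>M) <= (LINT w|M. abs (costf t z V w))" by (rule integral_abs_bound)
 also have "... <= (LINT w|M. K * (1 + T))" using ae costf_integrable[OF t V, of "space M" z] by (intro integral_mono_AE) auto
 finally show ?thesis using prob_space by simp
qed

lemma u_le:
 assumes t: "0 <= t" "t <= T" and V: "V \<in> controls M \<F> l t T"
 shows "u t z <= (LINT w|M. costf t z V w)" unfolding u_def using expected_cost_bound[OF t] V
 by (intro cINF_lower bdd_belowI2[where m="- (K * (1 + T))"]) (auto intro: abs_leD2)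

lemma u_approx:
 assumes t: "0 <= t" "t <= T" and e: "0 < e"
 shows "\<exists>V\<in>controls M \<F> l t T. (LINT w|M. costf t z V w) < u t z + e"
proof -
 have "bdd_below ((%V. \<integral>w. costf t z V w \<partial>M) ` controls M \<F> l t T)"
  using expected_cost_bound[OF t] by (intro bdd_belowI2[where m="- (K * (1 + T))"]) (auto intro: abs_leD2)
 moreover have "controls M \<F> l t T ~= {}" using zero_control by blast
 ultimately show ?thesis
  using cINF_less_iff[of "controls M \<F> l t T" "%V. \<integral>w. costf t z V w \<partial>M" "u t z + e"] e unfolding u_def by auto
qed

lemma u_T: "u T z = g z"
proof -
 have "costf T z V = (%_. g z)" for V by (auto simp: costf_def sol_T LBINT_null1)
 hence "u T z = (INF V\<in>(controls M \<F> l T T :: (real => 'w => real^'n) set). g z)" by (simp add: u_def prob_space)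
 also have "... = g z" using zero_control by (intro cINF_const) blast
 finally show ?thesis .
qed

text \<open>Both kinds of control can be converted into each other. A near-optimal discrete control
  becomes a step control of almost the same cost, so \<open>u\<close> is asymptotically at most the
  discrete value; the delayed averages of a near-optimal control are discrete controls, which gives
  the converse.\<close>

lemma vs_tendsto_u:
 assumes t: "0 <= t" "t < T"
 shows "(%N. vs (dN t N) (Suc N) z) \<longlonglongrightarrow> u t z"
proof -
 have tl: "t <= T" using t by simp
 have top: "space M \<in> sets (\<F> t)" using space_F[of t] by (metis sets.top)
 have ind: "(LINT c|M. indicator (space M) c * h c) = (LINT c|M. h c)" for h :: "'w => real"
  by (rule Bochner_Integration.integral_cong) auto
 have "ALL N. EX d. adm t (dN t N) (Suc N) d & (LINT c|M. chain_cost t (dN t N) z d (Suc N) c) <= vs (dN t N) (Suc N) z + 1 / (real N + 1)"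
  by (intro allI dp_upper[OF t(1) dN_pos[OF t(2)] dN_total]) simp
 then obtain d where d: "!!N. adm t (dN t N) (Suc N) (d N)"
  "!!N. (LINT c|M. chain_cost t (dN t N) z (d N) (Suc N) c) <= vs (dN t N) (Suc N) z + 1 / (real N + 1)" by metis
 let ?V = "%N. pc t N (d N)"
 let ?D = "%N c. costf t z (?V N) c - chain_cost t (dN t N) z (d N) (Suc N) c"
 note V = pc_control[OF t d(1)]
 note [measurable] = costf_measurable[OF t(1) tl V] chain_cost_measurable[OF t d(1)]
 have iC: "integrable M (chain_cost t (dN t N) z (d N) (Suc N))" for N
  by (rule integrable_const_bound[where B="K * (1 + T)"]) (use chain_cost_bound[OF t] in auto)
 have "(%N. \<integral>c. ?D N c \<partial>M) \<longlonglongrightarrow> (LINT c|M. 0)"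
 proof (rule integral_dominated_convergence[where w="%_. 2 * (K * (1 + T))"])
  show "AE c in M. (%N. ?D N c) \<longlonglongrightarrow> 0" using AE_good
  proof eventually_elim
   fix c assume c: "good c"
   show "(%N. ?D N c) \<longlonglongrightarrow> 0"
   proof (rule LIMSEQ_I)
    fix r :: real assume "0 < r"
    then obtain N0 where "!!N d z. N >= N0 ==> adm t (dN t N) (Suc N) d ==>
     abs (costf t z (pc t N d) c - chain_cost t (dN t N) z d (Suc N) c) <= r / 2"
     using pc_cost_close[OF t c, of "r / 2"] by auto
    thus "EX no. \<forall>N\<ge>no. norm (?D N c - 0) < r"
     using d(1) \<open>0 < r\<close> by (intro exI[of _ N0]) (force intro: le_less_trans[of _ "r / 2"])
   qed
  qed
  show "AE c in M. norm (?D N c) <= 2 * (K * (1 + T))" for N using AE_good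
  proof eventually_elim
   fix c assume c: "good c"
   show "norm (?D N c) <= 2 * (K * (1 + T))" using costf_bound[OF t(1) tl c V, of z N] chain_cost_bound[OF t, of N z "d N" c] by simp
  qed
 qed auto
 hence D: "(%N. \<integral>c. ?D N c \<partial>M) \<longlonglongrightarrow> 0" by simp
 have low: "u t z - 1 / (real N + 1) - (LINT c|M. ?D N c) <= vs (dN t N) (Suc N) z" for N
 proof -
  have "u t z <= (LINT c|M. costf t z (?V N) c)" by (rule u_le[OF t(1) tl V])
  also have "... = (LINT c|M. ?D N c) + (LINT c|M. chain_cost t (dN t N) z (d N) (Suc N) c)"
   using costf_integrable(1)[OF t(1) tl V, of "space M" z N] iC by simp
  finally show ?thesis using d(2)[of N] by linarith
 qed
 have up: "\<forall>\<^sub>F N in sequentially. vs (dN t N) (Suc N) z < u t z + e" if e: "0 < e" for e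
 proof -
  obtain V where V: "V \<in> controls M \<F> l t T" "(LINT c|M. costf t z V c) < u t z + e" using u_approx[OF t(1) tl e] by blast
  have "(%N. \<integral>c. indicator (space M) c * chain_cost t (dN t N) z (avV t V N) (Suc N) c \<partial>M) \<longlonglongrightarrow> (LINT c|M. indicator (space M) c * costf t z V c)"
   by (rule chain_cost_expectation_tendsto[OF t V(1)]) simp
  hence "\<forall>\<^sub>F N in sequentially. (LINT c|M. indicator (space M) c * chain_cost t (dN t N) z (avV t V N) (Suc N) c) < u t z + e"
   unfolding ind using V(2) by (rule order_tendstoD)
  thus ?thesis
  proof eventually_elim
   fix N assume "(LINT c|M. indicator (space M) c * chain_cost t (dN t N) z (avV t V N) (Suc N) c) < u t z + e"
   with dp_lower[OF t(1) dN_pos[OF t(2), of N] avV_adm[OF t V(1)] top dN_total, of z]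
   show "vs (dN t N) (Suc N) z < u t z + e" by (simp add: prob_space del: vs.simps)
  qed
 qed
 have "(%N. u t z - 1 / (real N + 1) - (LINT c|M. ?D N c)) \<longlonglongrightarrow> u t z - 0 - 0"
  using LIMSEQ_inverse_real_of_nat by (intro tendsto_intros D) (simp add: inverse_eq_divide add.commute)
 hence lowlim: "(%N. u t z - 1 / (real N + 1) - (LINT c|M. ?D N c)) \<longlonglongrightarrow> u t z" by simp
 show ?thesis
 proof (rule order_tendstoI)
  fix a assume "a < u t z"
  from order_tendstoD(1)[OF lowlim this] show "\<forall>\<^sub>F N in sequentially. a < vs (dN t N) (Suc N) z" by eventually_elim (rule less_le_trans[OF _ low])
 next
  fix a assume "u t z < a"
  with up[of "a - u t z"] show "\<forall>\<^sub>F N in sequentially. vs (dN t N) (Suc N) z < a" by simp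
 qed
qed

text \<open>\<open>dp_lower\<close> already holds on each event of the initial \<sigma>-algebra;
  only the mesh remains to be sent to 0.\<close>

lemma u_lower:
 assumes t: "0 <= t" "t < T" and V: "V \<in> controls M \<F> l t T" and B: "B \<in> sets (\<F> t)"
 shows "u t z * prob B <= (LINT w|M. indicator B w * costf t z V w)"
proof (rule LIMSEQ_le)
 show "(%N. vs (dN t N) (Suc N) z * prob B) \<longlonglongrightarrow> u t z * prob B" by (intro tendsto_intros vs_tendsto_u t)
 show "(%N. \<integral>w. indicator B w * chain_cost t (dN t N) z (avV t V N) (Suc N) w \<partial>M) \<longlonglongrightarrow> (LINT w|M. indicator B w * costf t z V w)"
  by (rule chain_cost_expectation_tendsto[OF t V sets_F_le[OF B]])
 show "EX N. \<forall>n\<ge>N. vs (dN t n) (Suc n) z * prob B <= (LINT w|M. indicator B w * chain_cost t (dN t n) z (avV t V n) (Suc n) w)"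
  using dp_lower[OF t(1) dN_pos[OF t(2)] avV_adm[OF t V] B dN_total] by blast
qed

end

context bounded_problem
begin

section \<open>Continuity of the value and locally uniform convergence\<close>

lemma control_restrict:
 assumes V: "V \<in> controls M \<F> l t T" and t: "t <= t'"
 shows "V \<in> controls M \<F> l t' T"
proof -
 have "(%p. (fst p, snd p)) \<in> measurable (restrict_space borel {t'..T} \<Otimes>\<^sub>M M) (restrict_space borel {t..T} \<Otimes>\<^sub>M M)"
 proof (rule measurable_Pair[OF _ measurable_snd])
  have "(%s. s) \<in> measurable (restrict_space borel {t'..T}) (restrict_space borel {t..T})" using t by (intro measurable_restrict_space3) auto
  from measurable_compose[OF measurable_fst this]
  show "fst \<in> measurable (restrict_space borel {t'..T} \<Otimes>\<^sub>M M) (restrict_space borel {t..T})" .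
 qed
 moreover have "(%p. V (fst p) (snd p)) \<in> borel_measurable (restrict_space borel {t..T} \<Otimes>\<^sub>M M)"
  using V unfolding controls_def split_beta' by blast
 ultimately have "(%p. V (fst p) (snd p)) \<in> borel_measurable (restrict_space borel {t'..T} \<Otimes>\<^sub>M M)" using measurable_compose by fastforce
 hence "(%(s, w). V s w) \<in> borel_measurable (restrict_space borel {t'..T} \<Otimes>\<^sub>M M)" unfolding split_beta' .
 thus ?thesis using V t by (auto simp: controls_def)
qed

lemma control_extend:
 assumes V: "V \<in> controls M \<F> l t' T" and t: "t <= t'"
 shows "(%s w. if s < t' then 0 else V s w) \<in> controls M \<F> l t T"
proof -
 let ?P = "restrict_space borel {t..T} \<Otimes>\<^sub>M M"
 have "(%p. if fst p < t' then 0 else V (fst p) (snd p)) \<in> borel_measurable ?P"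
 proof (subst measurable_If_restrict_space_iff)
  have id: "(%s. s) \<in> borel_measurable (restrict_space borel {t..T})" by (rule measurable_restrict_space1) simp
  have fm: "(%p. fst p) \<in> borel_measurable ?P" by (rule measurable_compose[OF measurable_fst id])
  thus "{x \<in> space ?P. fst x < t'} \<in> sets ?P" by measurable
  have "(%p. (fst p, snd p)) \<in> measurable (restrict_space ?P {x. \<not> fst x < t'}) (restrict_space borel {t'..T} \<Otimes>\<^sub>M M)"
  proof (rule measurable_Pair)
   show "(%p. fst p) \<in> measurable (restrict_space ?P {x. \<not> fst x < t'}) (restrict_space borel {t'..T})"
   proof (rule measurable_restrict_space2)
    show "(%p. fst p) \<in> borel_measurable (restrict_space ?P {x. \<not> fst x < t'})" by (rule measurable_restrict_space1[OF fm])
   qed (auto simp: space_restrict_space space_pair_measure)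
   show "(%p. snd p) \<in> measurable (restrict_space ?P {x. \<not> fst x < t'}) M" by (intro measurable_restrict_space1 measurable_snd)
  qed
  moreover have "(%p. V (fst p) (snd p)) \<in> borel_measurable (restrict_space borel {t'..T} \<Otimes>\<^sub>M M)"
   using V unfolding controls_def split_beta' by blast
  ultimately have "(%p. V (fst p) (snd p)) \<in> borel_measurable (restrict_space ?P {x. \<not> fst x < t'})" using measurable_compose by fastforce
  thus "(%x. 0) \<in> borel_measurable (restrict_space ?P {x. fst x < t'}) &
   (%x. V (fst x) (snd x)) \<in> borel_measurable (restrict_space ?P {x. \<not> fst x < t'})" by simp
 qed
 moreover have "(%w. if s < t' then 0 else V s w) \<in> borel_measurable (\<F> s)" if "s \<in> {t..T}" for s
  using V that by (cases "s < t'") (auto simp: controls_def)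
 ultimately show ?thesis using V t l_pos by (auto simp: controls_def split_beta')
qed

text \<open>The first solution is restarted at t', where it differs from z' by the drift, control
  and noise accumulated on \<open>{t..t'}\<close>. From there on both solve the same equation with
  the same control, and \<open>approx_close\<close> applies.\<close>

lemma cost_transfer:
 assumes t: "0 <= t" "t <= t'" "t' <= T" and w: "good w" and V: "V \<in> controls M \<F> l t T"
  and V': "V' \<in> controls M \<F> l t' T" and eq: "!!s. s \<in> {t'..T} ==> V s w = V' s w" and m: "modul e C"
 shows "abs (costf t z V w - costf t' z' V' w) <= K * (t' - t) + (1 + T) * (e + C * (2 * exp (2 * L * T) *
  (norm (z - z') + (K + G * l) * (t' - t) + Sn * norm (W t' w - W t w))))"
proof -
 interpret \<Gamma>: bounded_linear \<Gamma> by (rule lin_Gm)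
 interpret \<Sigma>: bounded_linear \<Sigma> by (rule lin_Sg)
 define Z where "Z s = sol t z V s w" for s
 define Z' where "Z' s = sol t' z' V' s w" for s
 have tT: "t <= T" and t'0: "0 <= t'" using t by auto
 have sZ: "solves b t T z (forcing t V w) Z" unfolding Z_def by (rule sol_solves(1)[OF t(1) tT w V])
 have sZ': "solves b t' T z' (forcing t' V' w) Z'" unfolding Z'_def by (rule sol_solves(1)[OF t'0 t(3) w V'])
 have bV: "bdm t T (%r. V r w)" using control_path(1)[OF V] w by auto
 have bZ: "bdm t T (%r. b (Z r))" using sZ by (auto simp: solves_def intro: bdm_lipschitz[OF b_lip] bdm_continuous)
 have "solves b t' T (Z t') (forcing t' V' w) Z" unfolding solves_def
 proof
  show "continuous_on {t'..T} Z" using sZ t by (auto simp: solves_def intro: continuous_on_subset)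
  show "\<forall>s\<in>{t'..T}. Z s = Z t' + (LBINT r:{t'..s}. b (Z r)) + forcing t' V' w s"
  proof
   fix s assume s: "s \<in> {t'..T}"
   have "(LBINT r:{t'..s}. V r w) = (LBINT r:{t'..s}. V' r w)" using s by (intro set_lebesgue_integral_cong) (auto intro: eq)
   moreover have "(LBINT r:{t..s}. V r w) = (LBINT r:{t..t'}. V r w) + (LBINT r:{t'..s}. V r w)" using s t by (intro LBINT_split[OF bV]) auto
   moreover have "(LBINT r:{t..s}. b (Z r)) = (LBINT r:{t..t'}. b (Z r)) + (LBINT r:{t'..s}. b (Z r))" using s t by (intro LBINT_split[OF bZ]) auto
   moreover have "s \<in> {t..T}" "t' \<in> {t..T}" using s t by auto
   hence "Z s = z + (LBINT r:{t..s}. b (Z r)) + forcing t V w s" "Z t' = z + (LBINT r:{t..t'}. b (Z r)) + forcing t V w t'"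
    using sZ unfolding solves_def by blast+
   ultimately show "Z s = Z t' + (LBINT r:{t'..s}. b (Z r)) + forcing t' V' w s" by (simp add: forcing_def \<Gamma>.add \<Sigma>.diff)
  qed
 qed
 note close = approx_close[OF b_lip L_pos solves_imp_approx[OF this] solves_imp_approx[OF sZ'], of 0]
 define Y where "Y = norm (z - z') + (K + G * l) * (t' - t) + Sn * norm (W t' w - W t w)"
 have "t' \<in> {t..T}" using t by auto
 hence "Z t' - z' = (z - z') + (LBINT r:{t..t'}. b (Z r)) + \<Gamma> (LBINT r:{t..t'}. V r w) + \<Sigma> (W t' w - W t w)"
  using sZ by (auto simp: solves_def forcing_def)
 hence "norm (Z t' - z') <= norm (z - z') + norm (LBINT r:{t..t'}. b (Z r)) + norm (\<Gamma> (LBINT r:{t..t'}. V r w)) + norm (\<Sigma> (W t' w - W t w))"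
  by (simp only:) (intro norm_triangle_le add_mono order_refl)
 moreover have "norm (LBINT r:{t..t'}. b (Z r)) <= K * (t' - t)" by (rule norm_LBINT_le[OF bZ order_refl t(2,3) b_bd])
 moreover have "norm (\<Gamma> (LBINT r:{t..t'}. V r w)) <= G * (l * (t' - t))"
 proof (rule order_trans[OF Gm_le mult_left_mono[OF _ G_nn]])
  show "norm (LBINT r:{t..t'}. V r w) <= l * (t' - t)" using control_path(2)[OF V] w t by (intro norm_LBINT_le[OF bV]) auto
 qed
 ultimately have Y: "norm (Z t' - z') <= Y" using Sg_le[of "W t' w - W t w"] unfolding Y_def by (simp add: algebra_simps)
 hence Y0: "0 <= Y" using norm_ge_zero order_trans by blast
 have close: "norm (Z s - Z' s) <= 2 * exp (2 * L * T) * Y" if s: "s \<in> {t'..T}" for s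
 proof -
  have "norm (Z s - Z' s) <= 2 * (norm (Z t' - z')) * exp (2 * L * (s - t'))" using close[OF _ s] by simp
  also have "... <= 2 * Y * exp (2 * L * T)" using Y Y0 s t L_pos by (intro mult_mono) auto
  finally show ?thesis by (simp add: mult_ac)
 qed
 define c where "c = e + C * (2 * exp (2 * L * T) * Y)"
 have C: "0 <= C" "0 <= e" using m by (auto simp: modul_def)
 have c0: "0 <= c" using C Y0 by (simp add: c_def)
 have b1: "bdm t T (%s. f (s, Z s, V s w))" unfolding Z_def by (rule sol_path(2)[OF t(1) tT w V])
 have b1': "bdm t' T (%s. f (s, Z s, V s w))" by (rule bdm_subset[OF b1]) (use t in auto)
 have b2: "bdm t' T (%s. f (s, Z' s, V' s w))" unfolding Z'_def by (rule sol_path(2)[OF t'0 t(3) w V'])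
 have i1: "abs (LBINT s:{t..t'}. f (s, Z s, V s w)) <= K * (t' - t)" using norm_LBINT_le[OF b1 order_refl t(2,3), of K] f_bd by auto
 have "abs ((LBINT s:{t'..T}. f (s, Z s, V s w)) - (LBINT s:{t'..T}. f (s, Z' s, V' s w))) = abs (LBINT s:{t'..T}. f (s, Z s, V s w) - f (s, Z' s, V' s w))"
  by (subst set_integral_diff) (auto intro: bdm_integrable[OF b1'] bdm_integrable[OF b2])
 also have "... <= c * (T - t')"
 proof (rule LBINT_abs_le_K[OF _ t(3) _ t'0])
  show "bdm t' T (%s. f (s, Z s, V s w) - f (s, Z' s, V' s w))" by (rule bdm_diff[OF b1' b2])
  fix s assume s: "s \<in> {t'..T}"
  have "abs (f (s, Z s, V s w) - f (s, Z' s, V' s w)) <= e + C * dist (s, Z s, V s w) (s, Z' s, V' s w)"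
   using m by (auto simp: modul_def)
  also have "... = e + C * norm (Z s - Z' s)" using eq[OF s] by (simp add: dist_Pair_Pair dist_norm)
  also have "... <= c" unfolding c_def using C close[OF s] by (intro add_left_mono mult_left_mono)
  finally show "abs (f (s, Z s, V s w) - f (s, Z' s, V' s w)) <= c" .
 qed
 also have "... <= c * T" using c0 t by (intro mult_left_mono) auto
 finally have i2: "abs ((LBINT s:{t'..T}. f (s, Z s, V s w)) - (LBINT s:{t'..T}. f (s, Z' s, V' s w))) <= c * T" .
 have "abs (g (Z T) - g (Z' T)) <= e + C * norm (Z T - Z' T)" using m by (auto simp: modul_def dist_norm)
 also have "... <= c" unfolding c_def using C close[of T] t by (intro add_left_mono mult_left_mono) auto
 finally have i3: "abs (g (Z T) - g (Z' T)) <= c" .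
 have "costf t z V w - costf t' z' V' w = (LBINT s:{t..t'}. f (s, Z s, V s w))
  + ((LBINT s:{t'..T}. f (s, Z s, V s w)) - (LBINT s:{t'..T}. f (s, Z' s, V' s w))) + (g (Z T) - g (Z' T))"
  using LBINT_split[OF b1 order_refl t(2,3) order_refl] by (simp add: costf_def Z_def Z'_def)
 hence "abs (costf t z V w - costf t' z' V' w) <= K * (t' - t) + c * T + c" using i1 i2 i3 by linarith
 thus ?thesis by (simp add: c_def Y_def algebra_simps)
qed

text \<open>A near-optimal control for one initial time yields one for the other, by restriction or
  by extension with 0, and the two agree on the later interval. The square root is the mean size of
  the Brownian increment.\<close>

lemma u_stable:
 assumes e: "0 < e"
 shows "\<exists>D\<ge>0. ALL t t' z z'. 0 <= t --> t <= t' --> t' <= T -->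
  abs (u t z - u t' z') <= e + D * (norm (z - z') + (t' - t) + sqrt (t' - t))"
proof -
 define e' where "e' = e / (2 * (1 + T))"
 have e': "0 < e'" "e' * (1 + T) = e / 2" using e T_pos unfolding e'_def by (simp, intro mult_div_cancel) simp
 obtain C where m: "modul e' C" using modul_exists[OF e'(1)] by blast
 hence C: "0 <= C" by (simp add: modul_def)
 define P where "P = (1 + T) * (C * (2 * exp (2 * L * T)))"
 have P0: "0 <= P" using C T_pos by (simp add: P_def)
 define D where "D = P * (1 + (K + G * l) + Sn * sqrt (real CARD('n))) + K"
 have Kl: "0 <= K + G * l" using K_nn G_nn l_pos by simp
 have D0: "0 <= D" using P0 K_nn Kl Sn_nn by (auto simp: D_def intro!: add_nonneg_nonneg mult_nonneg_nonneg)
 have "abs (u t z - u t' z') <= e + D * (norm (z - z') + (t' - t) + sqrt (t' - t))"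
  if t: "0 <= t" "t <= t'" "t' <= T" for t t' z z'
 proof -
  have tT: "t <= T" and t'0: "0 <= t'" using t by auto
  let ?R = "e + D * (norm (z - z') + (t' - t) + sqrt (t' - t))"
  have ex: "abs ((LINT w|M. costf t z V w) - (LINT w|M. costf t' z' V' w)) <= e / 2 + D * (norm (z - z') + (t' - t) + sqrt (t' - t))"
   if V: "V \<in> controls M \<F> l t T" and V': "V' \<in> controls M \<F> l t' T"
    and eq: "!!s w. s \<in> {t'..T} ==> V s w = V' s w" for V V'
  proof -
   note iV = costf_integrable(1)[OF t(1) tT V sets.top, of z] and iV' = costf_integrable(1)[OF t'0 t(3) V' sets.top, of z']
   have "abs ((LINT w|M. costf t z V w) - (LINT w|M. costf t' z' V' w)) = abs (\<integral>w. costf t z V w - costf t' z' V' w \<partial>M)"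
    using iV iV' by simp
   also have "... <= (LINT w|M. abs (costf t z V w - costf t' z' V' w))" by (rule integral_abs_bound)
   also have "... <= (LINT w|M. K * (t' - t) + (1 + T) * (e' + C * (2 * exp (2 * L * T) *
     (norm (z - z') + (K + G * l) * (t' - t) + Sn * norm (W t' w - W t w)))))"
   proof (rule integral_mono_AE)
    show "AE w in M. abs (costf t z V w - costf t' z' V' w) <= K * (t' - t) + (1 + T) * (e' + C * (2 * exp (2 * L * T) *
     (norm (z - z') + (K + G * l) * (t' - t) + Sn * norm (W t' w - W t w))))" using AE_good by eventually_elim (rule cost_transfer[OF t _ V V' eq m])
   qed (use iV iV' increment_norm(1)[OF t(1,2)] in auto)
   also have "... = K * (t' - t) + (1 + T) * (e' + C * (2 * exp (2 * L * T) *
     (norm (z - z') + (K + G * l) * (t' - t) + Sn * expectation (%w. norm (W t' w - W t w)))))"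
    using increment_norm(1)[OF t(1,2)] prob_space by simp
   also have "... = K * (t' - t) + e / 2 + P * (norm (z - z') + (K + G * l) * (t' - t) + Sn * expectation (%w. norm (W t' w - W t w)))"
    unfolding P_def e'(2)[symmetric] by (simp add: algebra_simps)
   also have "... <= K * (t' - t) + e / 2 + P * (norm (z - z') + (K + G * l) * (t' - t) + Sn * (sqrt (real CARD('n)) * sqrt (t' - t)))"
    using increment_norm(2)[OF t(1,2)] P0 Sn_nn by (intro add_left_mono mult_left_mono) (auto simp: real_sqrt_mult)
   also have "... <= e / 2 + D * (norm (z - z') + (t' - t) + sqrt (t' - t))"
   proof -
    define a where "a = norm (z - z')"
    define c where "c = t' - t"
    define r where "r = sqrt (t' - t)"
    have nn: "0 <= a" "0 <= c" "0 <= r" using t by (auto simp: a_def c_def r_def)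
    define k where "k = K + G * l"
    define s where "s = Sn * sqrt (real CARD('n))"
    have ks: "0 <= k" "0 <= s" using Kl Sn_nn by (auto simp: k_def s_def)
    have "a + k * c + s * r <= (1 + k + s) * (a + c + r)" using nn ks by (simp add: algebra_simps add_nonneg_nonneg)
    hence "P * (a + k * c + s * r) <= P * ((1 + k + s) * (a + c + r))" using P0 by (rule mult_left_mono)
    moreover have "K * c <= K * (a + c + r)" using nn K_nn by (intro mult_left_mono) auto
    ultimately have "K * c + e / 2 + P * (a + k * c + s * r) <= e / 2 + (P * (1 + k + s) + K) * (a + c + r)" by (simp add: algebra_simps)
    thus ?thesis by (simp add: a_def c_def r_def k_def s_def D_def mult.assoc)
   qed
   finally show ?thesis .
  qed
  have "u t z <= u t' z' + ?R"
  proof -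
   obtain V' where V': "V' \<in> controls M \<F> l t' T" "(LINT w|M. costf t' z' V' w) < u t' z' + e / 2"
    using u_approx[OF t'0 t(3), of "e / 2" z'] e by auto
   note V = control_extend[OF V'(1) t(2)]
   show ?thesis using u_le[OF t(1) tT V, of z] ex[OF V V'(1)] V'(2) by (simp add: abs_le_iff)
  qed
  moreover have "u t' z' <= u t z + ?R"
  proof -
   obtain V where V: "V \<in> controls M \<F> l t T" "(LINT w|M. costf t z V w) < u t z + e / 2"
    using u_approx[OF t(1) tT, of "e / 2" z] e by auto
   note V' = control_restrict[OF V(1) t(2)]
   show ?thesis using u_le[OF t'0 t(3) V', of z'] ex[OF V(1) V'] V(2) by (simp add: abs_le_iff)
  qed
  ultimately show ?thesis by linarith
 qed
 thus ?thesis using D0 by blast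
qed

lemma u_continuous: "continuous_on ({0..T} \<times> UNIV) (%(t, z). u t z)" unfolding continuous_on_iff
proof (intro ballI allI impI)
 fix p and e :: real assume p: "p \<in> {0..T} \<times> (UNIV :: 'e set)" and e: "0 < e"
 obtain D where D: "0 <= D" "!!t t' z z'. 0 <= t ==> t <= t' ==> t' <= T ==>
  abs (u t z - u t' z') <= e / 2 + D * (norm (z - z') + (t' - t) + sqrt (t' - t))" using u_stable[of "e / 2"] e by auto
 have "((%d. D * (d + d + sqrt d)) \<longlongrightarrow> D * (0 + 0 + sqrt 0)) (at_right 0)" by (intro tendsto_intros)
 hence "\<forall>\<^sub>F d in at_right 0. D * (d + d + sqrt d) < e / 2" using e by (intro order_tendstoD(2)) auto
 then obtain d where d: "0 < d" "D * (d + d + sqrt d) < e / 2" unfolding eventually_at_right_field using dense by blast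
 have close: "abs (u t z - u t' z') < e" if "0 <= t" "t <= t'" "t' <= T" "t' - t < d" "norm (z - z') < d" for t t' z z'
 proof -
  have "D * (norm (z - z') + (t' - t) + sqrt (t' - t)) <= D * (d + d + sqrt d)" using that D(1) by (intro mult_left_mono add_mono) auto
  thus ?thesis using D(2)[OF that(1-3), of z z'] d(2) by linarith
 qed
 show "\<exists>d>0. \<forall>q\<in>{0..T} \<times> UNIV. dist q p < d --> dist (case q of (t, z) => u t z) (case p of (t, z) => u t z) < e"
 proof (intro exI[of _ d] conjI d(1) ballI impI)
  fix q assume q: "q \<in> {0..T} \<times> (UNIV :: 'e set)" and qp: "dist q p < d"
  obtain t z t' z' where pq: "p = (t, z)" "q = (t', z')" by (cases p, cases q)
  have "dist t' t < d" "dist z' z < d" using qp dist_fst_le[of q p] dist_snd_le[of q p] unfolding pq by auto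
  thus "dist (case q of (t, z) => u t z) (case p of (t, z) => u t z) < e" using close[of t t' z z'] close[of t' t z' z] p q unfolding pq
   by (cases "t <= t'") (auto simp: dist_real_def dist_norm norm_minus_commute abs_minus_commute)
 qed
qed

text \<open>Meshes are dyadic fractions of \<open>T - t0\<close>, so t0 and all coarse grid times
  stay grid times under refinement. Convergence at finitely many coarse times and at a finite net of
  states is pointwise; equicontinuity of the discrete values and of \<open>u\<close> fills the
  gaps.\<close>

lemma vs_local_uniform:
 assumes t0: "0 <= t0" "t0 < T" and e: "0 < e"
 shows "EX j0. \<forall>j\<ge>j0. ALL k z. real k * ((T - t0) / 2 ^ j) <= T --> norm z <= R -->
  abs (vs ((T - t0) / 2 ^ j) k z - u (T - real k * ((T - t0) / 2 ^ j)) z) <= e"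
proof -
 obtain A where A: "0 <= A" "!!d k j y z. 0 < d ==> d <= 1 ==> real (k + j) * d <= T ==>
  abs (vs d (k + j) y - vs d k z) <= e / 4 + A * ((norm (y - z))\<^sup>2 + real j * d)"
  using vs_time_modulus[of "e / 4"] e by (metis zero_less_divide_iff zero_less_numeral)
 obtain D where D: "0 <= D" "!!t t' z z'. 0 <= t ==> t <= t' ==> t' <= T ==>
  abs (u t z - u t' z') <= e / 4 + D * (norm (z - z') + (t' - t) + sqrt (t' - t))" using u_stable[of "e / 4"] e by auto
 have "((%d. A * (d\<^sup>2 + d)) \<longlongrightarrow> A * (0\<^sup>2 + 0)) (at_right 0)" "((%d. D * (d + d + sqrt d)) \<longlongrightarrow> D * (0 + 0 + sqrt 0)) (at_right 0)"
  by (intro tendsto_intros)+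
 hence "\<forall>\<^sub>F d in at_right 0. A * (d\<^sup>2 + d) < e / 8 & D * (d + d + sqrt d) < e / 8" using e by (intro eventually_conj order_tendstoD(2)) auto
 then obtain r where r: "0 < r" "A * (r\<^sup>2 + r) < e / 8" "D * (r + r + sqrt r) < e / 8" unfolding eventually_at_right_field using dense by blast
 define a where "a j = (T - t0) / 2 ^ j" for j :: nat
 have de0: "0 < a j" for j using t0 by (simp add: a_def)
 have delim: "a \<longlonglongrightarrow> 0" unfolding a_def using LIMSEQ_divide_realpow_zero[of 2 "T - t0"] by simp
 have "\<forall>\<^sub>F j in sequentially. a j < r" by (rule order_tendstoD(2)[OF delim r(1)])
 then obtain p where p: "a p < r" by (auto simp: eventually_sequentially)
 define I where "I = {i::nat. real i * a p <= T}"
 have "I \<subseteq> {..nat \<lceil>T / a p\<rceil>}"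
 proof
  fix i assume "i \<in> I"
  hence "real i <= T / a p" using de0[of p] by (simp add: I_def field_simps)
  thus "i \<in> {..nat \<lceil>T / a p\<rceil>}" by simp linarith
 qed
 hence finI: "finite I" using finite_subset by blast
 have "compact (cball (0::'e) R)" by simp
 then obtain X where X: "finite X" "cball (0::'e) R \<subseteq> (\<Union>x\<in>X. ball x r)" using compact_imp_seq_compact seq_compact_imp_totally_bounded r(1) by metis
 have pw: "\<forall>\<^sub>F j in sequentially. abs (vs (a j) (i * 2 ^ (j - p)) x - u (T - real i * a p) x) < e / 4" if i: "i \<in> I" for i x
 proof (cases "i = 0")
  case True
  thus ?thesis using e by (simp add: u_T)
 next
  case False
  define t where "t = T - real i * a p"
  have t: "0 <= t" "t < T" using i False de0[of p] by (auto simp: I_def t_def)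
  \<comment> \<open>\<open>dN t N\<close> cuts \<open>{t..T}\<close> into \<open>Suc N\<close>
    cells. Between t and T there are \<open>i * 2 ^ (j - p)\<close> cells of the fine mesh, hence
    the subtraction of 1.\<close>
  have "filterlim (%j. i * 2 ^ (j - p) - 1) sequentially sequentially"
  proof (rule filterlim_at_top_mono[where f="%j. j - (p + 1)"])
   show "filterlim (%j. j - (p + 1)) sequentially sequentially" by (rule filterlim_minus_const_nat_at_top)
   show "\<forall>\<^sub>F j in sequentially. j - (p + 1) <= i * 2 ^ (j - p) - 1"
   proof (intro always_eventually allI)
    fix j
    have "j - p < 2 ^ (j - p)" by (rule less_exp)
    also have "... <= i * 2 ^ (j - p)" using False by simp
    finally show "j - (p + 1) <= i * 2 ^ (j - p) - 1" by simp
   qed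
  qed
  from filterlim_compose[OF vs_tendsto_u[OF t, of x] this]
  have "(%j. vs (dN t (i * 2 ^ (j - p) - 1)) (Suc (i * 2 ^ (j - p) - 1)) x) \<longlonglongrightarrow> u t x" .
  hence "\<forall>\<^sub>F j in sequentially. dist (vs (dN t (i * 2 ^ (j - p) - 1)) (Suc (i * 2 ^ (j - p) - 1)) x) (u t x) < e / 4" using e by (intro tendstoD) auto
  thus ?thesis using eventually_ge_at_top[of p]
  proof eventually_elim
   fix j assume D: "dist (vs (dN t (i * 2 ^ (j - p) - 1)) (Suc (i * 2 ^ (j - p) - 1)) x) (u t x) < e / 4" and jp: "p <= j"
   have S: "Suc (i * 2 ^ (j - p) - 1) = i * 2 ^ (j - p)" using False by simp
   have "(2::real) ^ j = 2 ^ p * 2 ^ (j - p)" using jp by (simp flip: power_add)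
   moreover have "real (i * 2 ^ (j - p) - 1) + 1 = real i * 2 ^ (j - p)" using S by (metis of_nat_Suc of_nat_mult of_nat_numeral of_nat_power add.commute)
   ultimately have "dN t (i * 2 ^ (j - p) - 1) = a j" using False by (simp add: dN_def t_def a_def field_simps)
   thus "abs (vs (a j) (i * 2 ^ (j - p)) x - u (T - real i * a p) x) < e / 4" using D unfolding S by (simp add: dist_real_def t_def)
  qed
 qed
 have "\<forall>\<^sub>F j in sequentially. \<forall>i\<in>I. \<forall>x\<in>X. abs (vs (a j) (i * 2 ^ (j - p)) x - u (T - real i * a p) x) < e / 4"
  using pw by (intro eventually_ball_finite finI X(1) ballI)
 moreover have "\<forall>\<^sub>F j in sequentially. a j < 1" by (rule order_tendstoD(2)[OF delim]) simp
 ultimately have "\<forall>\<^sub>F j in sequentially. p <= j & a j < 1 & (\<forall>i\<in>I. \<forall>x\<in>X. abs (vs (a j) (i * 2 ^ (j - p)) x - u (T - real i * a p) x) < e / 4)"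
  using eventually_ge_at_top[of p] by eventually_elim auto
 then obtain j0 where j0: "!!j. j >= j0 ==> p <= j & a j < 1 & (\<forall>i\<in>I. \<forall>x\<in>X. abs (vs (a j) (i * 2 ^ (j - p)) x - u (T - real i * a p) x) < e / 4)"
  by (auto simp: eventually_sequentially)
 have "abs (vs (a j) k z - u (T - real k * a j) z) <= e" if j: "j0 <= j" and k: "real k * a j <= T" and z: "norm z <= R" for j k z
 proof -
  from j0[OF j] have jp: "p <= j" and d1: "a j <= 1" and pt: "!!i x. i \<in> I ==> x \<in> X ==> abs (vs (a j) (i * 2 ^ (j - p)) x - u (T - real i * a p) x) < e / 4" by auto
  define q :: nat where "q = 2 ^ (j - p)"
  have q: "0 < q" "real q * a j = a p"
  proof -
   have "(2::real) ^ j = 2 ^ p * 2 ^ (j - p)" using jp by (simp flip: power_add)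
   thus "real q * a j = a p" by (simp add: q_def a_def)
  qed (simp add: q_def)
  \<comment> \<open>The fine grid time is rounded to the coarse one after \<open>i * q\<close> fine
    steps; the remaining m steps last less than r.\<close>
  define i where "i = k div q"
  define m where "m = k mod q"
  have km: "k = i * q + m" by (simp add: i_def m_def)
  have m: "real m * a j < r"
  proof -
   have "real m * a j <= real q * a j" using q(1) de0[of j] by (intro mult_right_mono) (auto simp: m_def less_imp_le)
   thus ?thesis using q(2) p by simp
  qed
  have iq: "real (i * q) * a j = real i * a p" using q(2) by (simp add: mult.assoc)
  have split: "real k * a j = real i * a p + real m * a j" using iq unfolding km by (simp add: algebra_simps)
  have m0: "0 <= real m * a j" using de0[of j] by simp
  have iI: "i \<in> I" using k split m0 unfolding I_def by auto
  obtain x where x: "x \<in> X" "norm (z - x) < r" using X(2) z by (auto simp: dist_norm norm_minus_commute subset_iff)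
  have "abs (vs (a j) (i * q + m) z - vs (a j) (i * q) x) <= e / 4 + A * ((norm (z - x))\<^sup>2 + real m * a j)"
   using k unfolding km by (intro A(2) de0 d1)
  moreover have "A * ((norm (z - x))\<^sup>2 + real m * a j) <= A * (r\<^sup>2 + r)" using A(1) x(2) m by (intro mult_left_mono add_mono power_mono) auto
  moreover have "abs (u (T - real k * a j) z - u (T - real i * a p) x)
   <= e / 4 + D * (norm (z - x) + (T - real i * a p - (T - real k * a j)) + sqrt (T - real i * a p - (T - real k * a j)))"
   using k split m0 de0[of p] by (intro D(2)) auto
  moreover have "D * (norm (z - x) + (T - real i * a p - (T - real k * a j)) + sqrt (T - real i * a p - (T - real k * a j))) <= D * (r + r + sqrt r)"
   using D(1) x(2) m m0 split by (intro mult_left_mono add_mono) auto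
  moreover have "abs (vs (a j) (i * q) x - u (T - real i * a p) x) < e / 4" using pt[OF iI x(1)] by (simp add: q_def)
  ultimately show ?thesis using r unfolding km[symmetric] by linarith
 qed
 thus ?thesis unfolding a_def by blast
qed

subsection \<open>Lyapunov functions\<close>

text \<open>Here the terminal cost \<open>g\<close> plays the role of the Lyapunov function; with \<open>f = g\<close> the cost
  functional controls \<open>g\<close> along the whole path.\<close>
context
 fixes A :: "'e set" and d0 C :: real
 assumes d0: "0 < d0" and C0: "0 <= C" and closed_A: "closed A"
  and step_A: "!!d z a y. 0 < d ==> d <= d0 ==> z \<in> A ==> stepf d z a y \<in> A"
  and g_nn: "!!z. 0 <= g z"
  and drift: "!!d z a. 0 < d ==> d <= d0 ==> z \<in> A ==> a \<in> cball 0 l ==> Pst d g z a <= exp (C * d) * g z"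
begin

lemma chain_in_A: "0 < d ==> d <= d0 ==> z \<in> A ==> chain t d z c k w \<in> A"
 by (induction k) (auto simp: chain_Suc step_A)

lemma chain_drift:
 assumes t: "0 <= t" and d: "0 < d" "d <= d0" and c: "adm t d N c" and k: "k < N" and B: "B \<in> sets (\<F> (t + real k * d))" and z: "z \<in> A"
 shows "(LINT w|M. indicator B w * g (chain t d z c (Suc k) w)) <= exp (C * d) * (LINT w|M. indicator B w * g (chain t d z c k w))"
proof -
 note [measurable] = sets_F_le[OF B] chain_measurable_M(1)[OF t less_imp_le[OF d(1)] c, of k z]
 have i: "integrable M (%w. indicator B w * g (chain t d z c k w))"
  by (rule integrable_const_bound[where B=K]) (use g_bd K_nn k in \<open>auto simp: indicator_def\<close>)
 note ce = chain_step_expectation[OF t d(1) c k B meas_g g_bd, of z]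
 have "(LINT w|M. indicator B w * g (chain t d z c (Suc k) w)) <= (LINT w|M. exp (C * d) * (indicator B w * g (chain t d z c k w)))"
  unfolding ce(1)
 proof (rule integral_mono[OF ce(2)])
  show "integrable M (%w. exp (C * d) * (indicator B w * g (chain t d z c k w)))" using i by simp
  fix w assume "w \<in> space M"
  hence "c k w \<in> cball 0 l" using c k by (auto simp: adm_def)
  from drift[OF d chain_in_A[OF d z] this]
  show "indicator B w * Pst d g (chain t d z c k w) (c k w) <= exp (C * d) * (indicator B w * g (chain t d z c k w))"
   by (auto simp: indicator_def)
 qed
 thus ?thesis by simp
qed

lemma chain_moment:
 assumes t: "0 <= t" and d: "0 < d" "d <= d0" and c: "adm t d N c" and z: "z \<in> A"
 shows "k <= N ==> (LINT w|M. g (chain t d z c k w)) <= exp (C * (real k * d)) * g z"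
proof (induction k)
 case 0
 thus ?case by (simp add: prob_space)
next
 case (Suc k)
 have ind: "(LINT w|M. indicator (space M) w * h w) = (LINT w|M. h w)" for h :: "'w => real"
  by (rule Bochner_Integration.integral_cong) auto
 have "space M \<in> sets (\<F> (t + real k * d))" using space_F by (metis sets.top)
 from chain_drift[OF t d c _ this z] Suc
 have "(LINT w|M. g (chain t d z c (Suc k) w)) <= exp (C * d) * (LINT w|M. g (chain t d z c k w))" by (simp add: ind)
 also have "... <= exp (C * d) * (exp (C * (real k * d)) * g z)" using Suc by (intro mult_left_mono) auto
 finally show ?case by (simp add: algebra_simps flip: exp_add)
qed

definition stay where "stay t d z c q k = {w \<in> space M. \<forall>i\<le>k. g (chain t d z c i w) < q}"

lemma stay_sets:
 assumes t: "0 <= t" and d: "0 < d" and c: "adm t d N c" and k: "k <= N"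
 shows "stay t d z c q k \<in> sets (\<F> (t + real k * d))"
proof -
 have "chain t d z c i \<in> borel_measurable (\<F> (t + real k * d))" if "i <= k" for i
 proof -
  have le: "t + real i * d <= t + real k * d" using that d by auto
  show ?thesis by (rule F_mono[OF le chain_measurable[OF t _ c]]) (use d that k in auto)
 qed
 hence "{w \<in> space (\<F> (t + real k * d)). \<forall>i\<in>{..k}. g (chain t d z c i w) < q} \<in> sets (\<F> (t + real k * d))"
  by (intro sets.sets_Collect_finite_All borel_measurable_less measurable_compose[OF _ meas_g]) auto
 moreover have "stay t d z c q k = {w \<in> space (\<F> (t + real k * d)). \<forall>i\<in>{..k}. g (chain t d z c i w) < q}"
  by (auto simp: stay_def space_F)
 ultimately show ?thesis by simp
qed

text \<open>A maximal inequality for a chain whose Lyapunov function grows in mean by at most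
  \<open>exp (C * d)\<close> per step.\<close>

lemma chain_maximal:
 assumes t: "0 <= t" and d: "0 < d" "d <= d0" and c: "adm t d N c" and z: "z \<in> A" and q: "0 < q"
 shows "q * prob (space M - stay t d z c q N) <= exp (C * (real N * d)) * g z"
proof -
 let ?S = "stay t d z c q" and ?Z = "%k. chain t d z c k"
 \<comment> \<open>A lower estimate of the mean of g stopped at the first step where it reaches q.
   Paths leaving at step \<open>Suc k\<close> satisfy g >= q there, so trading g for q only
   decreases the value.\<close>
 define p where "p k = q * (1 - prob (?S k)) + (LINT w|M. indicator (?S k) w * g (?Z k w))" for k
 have SM: "?S k \<in> sets M" if "k <= N" for k by (rule sets_F_le[OF stay_sets[OF t d(1) c that]])
 have int: "integrable M (%w. indicator (?S i) w * g (?Z k w))" if "k <= N" "i <= N" for k i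
 proof -
  note [measurable] = SM[OF that(2)] chain_measurable_M(1)[OF t less_imp_le[OF d(1)] c that(1), of z]
  show ?thesis by (rule integrable_const_bound[where B=K]) (use g_bd K_nn in \<open>auto simp: indicator_def\<close>)
 qed
 have ip: "p k = (LINT w|M. q * (1 - indicator (?S k) w) + indicator (?S k) w * g (?Z k w))" if "k <= N" for k
  using int[OF that that] integrable_real_indicator[OF SM[OF that]] SM[OF that] prob_space by (simp add: p_def emeasure_eq_measure)
 have "p k <= exp (C * (real k * d)) * g z" if "k <= N" for k using that
 proof (induction k)
  case 0
  have "?S 0 = (if g z < q then space M else {})" by (auto simp: stay_def)
  thus ?case using prob_space by (simp add: p_def)
 next
  case (Suc k)
  hence k: "k < N" "k <= N" by auto
  have "p (Suc k) <= (LINT w|M. q * (1 - indicator (?S k) w) + indicator (?S k) w * g (?Z (Suc k) w))"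
   unfolding ip[OF Suc(2)]
  proof (rule integral_mono)
   show "integrable M (%w. q * (1 - indicat_real (?S (Suc k)) w) + indicat_real (?S (Suc k)) w * g (?Z (Suc k) w))"
    using int[of "Suc k" "Suc k"] integrable_real_indicator[OF SM[of "Suc k"]] Suc by (simp add: emeasure_eq_measure)
   show "integrable M (%w. q * (1 - indicat_real (?S k) w) + indicat_real (?S k) w * g (?Z (Suc k) w))"
    using int[of "Suc k" k] integrable_real_indicator[OF SM[of k]] Suc by (simp add: emeasure_eq_measure)
   fix w assume "w \<in> space M"
   thus "q * (1 - indicat_real (?S (Suc k)) w) + indicat_real (?S (Suc k)) w * g (?Z (Suc k) w)
    <= q * (1 - indicat_real (?S k) w) + indicat_real (?S k) w * g (?Z (Suc k) w)" by (auto simp: stay_def indicator_def le_Suc_eq)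
  qed
  also have "... = q * (1 - prob (?S k)) + (LINT w|M. indicator (?S k) w * g (?Z (Suc k) w))"
   using int[of "Suc k" k] integrable_real_indicator[OF SM[of k]] SM[of k] Suc prob_space by (simp add: emeasure_eq_measure)
  also have "... <= exp (C * d) * (q * (1 - prob (?S k))) + exp (C * d) * (LINT w|M. indicator (?S k) w * g (?Z k w))"
  proof (rule add_mono)
   have "1 * (q * (1 - prob (?S k))) <= exp (C * d) * (q * (1 - prob (?S k)))" using C0 d q by (intro mult_right_mono) auto
   thus "q * (1 - prob (?S k)) <= exp (C * d) * (q * (1 - prob (?S k)))" by simp
   show "(LINT w|M. indicator (?S k) w * g (?Z (Suc k) w)) <= exp (C * d) * (LINT w|M. indicator (?S k) w * g (?Z k w))"
    by (rule chain_drift[OF t d c k(1) stay_sets[OF t d(1) c k(2)] z])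
  qed
  also have "... = exp (C * d) * p k" by (simp add: p_def algebra_simps)
  also have "... <= exp (C * d) * (exp (C * (real k * d)) * g z)" using Suc by (intro mult_left_mono) auto
  finally show ?case by (simp add: algebra_simps flip: exp_add)
 qed
 from this[of N] have "p N <= exp (C * (real N * d)) * g z" by simp
 moreover have "0 <= (LINT w|M. indicator (?S N) w * g (?Z N w))" by (intro integral_nonneg_AE AE_I2) (auto simp: g_nn)
 moreover have "prob (space M - ?S N) = 1 - prob (?S N)" using SM[of N] by (intro prob_compl) auto
 ultimately show ?thesis by (simp add: p_def)
qed

lemma dN_eventually_small: "\<forall>\<^sub>F N in sequentially. dN t N <= d0" using order_tendstoD(2)[OF dN_tendsto[of t] d0] by eventually_elim simp

lemma exp_time_le:
 assumes "0 <= t" "t < T" "k <= Suc N" shows "exp (C * (real k * dN t N)) <= exp (C * T)"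
proof -
 have "real k * dN t N <= T" using grid_le[OF assms(2,3)] assms(1) by linarith
 thus ?thesis using C0 by (simp add: mult_left_mono)
qed

lemma sol_in_A:
 assumes t: "0 <= t" "t < T" and z: "z \<in> A" and V: "V \<in> controls M \<F> l t T" and w: "good w" and s: "s \<in> {t..T}"
 shows "sol t z V s w \<in> A"
proof (rule Lim_in_closed_set[OF closed_A])
 show "(%N. EP t z V N s w) \<longlonglongrightarrow> sol t z V s w" using t by (intro EP_tendsto w V s) auto
 show "\<forall>\<^sub>F N in sequentially. EP t z V N s w \<in> A" using dN_eventually_small by eventually_elim (auto simp: EP_def intro!: chain_in_A dN_pos t z)
qed simp

text \<open>With f equal to the Lyapunov function, one expected cost bounds both its time integral
  and its terminal value.\<close>

lemma lyapunov_moment: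
 assumes t: "0 <= t" "t < T" and z: "z \<in> A" and V: "V \<in> controls M \<F> l t T"
  and fg: "!!s z a. f (s, z, a) = g z"
 shows "(LINT w|M. costf t z V w) <= (1 + T) * exp (C * T) * g z"
proof -
 have ind: "(LINT w|M. indicator (space M) w * h w) = (LINT w|M. h w)" for h :: "'w => real"
  by (rule Bochner_Integration.integral_cong) auto
 have lim: "(%N. \<integral>w. chain_cost t (dN t N) z (avV t V N) (Suc N) w \<partial>M) \<longlonglongrightarrow> (LINT w|M. costf t z V w)"
  using chain_cost_expectation_tendsto[OF t V sets.top, of z] unfolding ind .
 show ?thesis
 proof (rule tendsto_upperbound[OF lim])
  show "\<forall>\<^sub>F N in sequentially. (LINT w|M. chain_cost t (dN t N) z (avV t V N) (Suc N) w) <= (1 + T) * exp (C * T) * g z"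
   using dN_eventually_small
  proof eventually_elim
   fix N assume dd: "dN t N <= d0"
   note d = dN_pos[OF t(2), of N] and c = avV_adm[OF t V, of N]
   let ?Z = "%i w. chain t (dN t N) z (avV t V N) i w"
   have m: "(LINT w|M. g (?Z i w)) <= exp (C * T) * g z" if "i <= Suc N" for i
    using chain_moment[OF t(1) d dd c z that] mult_right_mono[OF exp_time_le[OF t that] g_nn[of z]] by linarith
   have i: "integrable M (%w. g (?Z i w))" if "i <= Suc N" for i
   proof -
    note [measurable] = chain_measurable_M(1)[OF t(1) less_imp_le[OF d] c that, of z]
    show ?thesis by (rule integrable_const_bound[where B=K]) (use g_bd in auto)
   qed
   have "(LINT w|M. chain_cost t (dN t N) z (avV t V N) (Suc N) w) = (\<Sum>i<Suc N. dN t N * (LINT w|M. g (?Z i w))) + (LINT w|M. g (?Z (Suc N) w))"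
    unfolding chain_cost_def fg using i by (subst Bochner_Integration.integral_add) (auto simp: Bochner_Integration.integral_sum simp del: sum.lessThan_Suc)
   also have "... <= (\<Sum>i<Suc N. dN t N * (exp (C * T) * g z)) + exp (C * T) * g z" using d by (intro add_mono sum_mono mult_left_mono m) auto
   also have "... = (real (Suc N) * dN t N + 1) * (exp (C * T) * g z)" by (simp add: algebra_simps)
   also have "... <= (1 + T) * (exp (C * T) * g z)" using dN_total[of t N] t g_nn[of z] by (intro mult_right_mono) auto
   finally show "(LINT w|M. chain_cost t (dN t N) z (avV t V N) (Suc N) w) <= (1 + T) * exp (C * T) * g z" by simp
  qed
 qed simp
qed

text \<open>The exceptional event consists of the points at which all sufficiently fine chains leave
  the level q. It is an increasing union of events, each inside the exit event of a single chain.
  Off it infinitely many chains stay below q, and so does their limit.\<close>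

lemma lyapunov_maximal:
 assumes t: "0 <= t" "t < T" and z: "z \<in> A" and V: "V \<in> controls M \<F> l t T" and q: "0 < q"
 shows "\<exists>Bad\<in>sets M. q * prob Bad <= exp (C * T) * g z &
  (ALL w. good w --> w \<notin> Bad --> (\<forall>s\<in>{t..T}. g (sol t z V s w) <= q))"
proof -
 let ?S = "%N. stay t (dN t N) z (avV t V N) q (Suc N)"
 define E where "E n = (\<Inter>N\<in>{n..}. space M - ?S N)" for n
 have SM: "?S N \<in> sets M" for N by (rule sets_F_le[OF stay_sets[OF t(1) dN_pos[OF t(2)] avV_adm[OF t V] order_refl]])
 have EM: "E n \<in> sets M" for n unfolding E_def using SM by (intro sets.countable_INT') auto
 obtain N1 where N1: "!!N. N >= N1 ==> dN t N <= d0" using dN_eventually_small by (auto simp: eventually_sequentially)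
 have pE: "q * prob (E n) <= exp (C * T) * g z" for n
 proof -
  define N where "N = max n N1"
  have "E n \<subseteq> space M - ?S N" by (auto simp: E_def N_def)
  hence "prob (E n) <= prob (space M - ?S N)" using SM by (intro finite_measure_mono) auto
  hence "q * prob (E n) <= q * prob (space M - ?S N)" using q by simp
  also have "... <= exp (C * (real (Suc N) * dN t N)) * g z"
   using N1[of N] by (intro chain_maximal[OF t(1) dN_pos[OF t(2)] _ avV_adm[OF t V] z q]) (auto simp: N_def)
  also have "... <= exp (C * T) * g z" by (intro mult_right_mono exp_time_le t g_nn order_refl)
  finally show ?thesis .
 qed
 have inc: "incseq E" unfolding incseq_def E_def by (auto simp: Ball_def)
 have lim: "(%n. q * prob (E n)) \<longlonglongrightarrow> q * prob (\<Union>n. E n)"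
  using EM inc by (intro tendsto_intros finite_Lim_measure_incseq) auto
 have "q * prob (\<Union>n. E n) <= exp (C * T) * g z" by (rule LIMSEQ_le_const2[OF lim]) (use pE in auto)
 moreover have "g (sol t z V s w) <= q" if w: "good w" and nb: "w \<notin> (\<Union>n. E n)" and s: "s \<in> {t..T}" for w s
 proof (rule ccontr)
  assume "\<not> g (sol t z V s w) <= q"
  hence gt: "q < g (sol t z V s w)" by simp
  have "(%N. EP t z V N s w) \<longlonglongrightarrow> sol t z V s w" using t by (intro EP_tendsto w V s) auto
  hence "(%N. g (EP t z V N s w)) \<longlonglongrightarrow> g (sol t z V s w)" by (intro continuous_on_tendsto_compose[OF continuous_g]) auto
  from order_tendstoD(1)[OF this gt] obtain n where n: "!!N. N >= n ==> q < g (EP t z V N s w)"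
   by (auto simp: eventually_sequentially)
  from nb w have "\<exists>N\<ge>n. w \<in> ?S N" by (auto simp: E_def)
  then obtain N where N: "N >= n" "w \<in> ?S N" by blast
  from n[OF N(1)] N(2) step_ix_le[OF t(2) s, of N] show False by (auto simp: stay_def EP_def dest!: spec[of _ "step_ix t (dN t N) s"])
 qed
 ultimately show ?thesis using EM by (intro bexI[of _ "\<Union>n. E n"]) auto
qed

end

end

section \<open>The energy as a Lyapunov function\<close>

text \<open>A relatively interior point can be pushed away from the barycentre within the simplex,
  which is impossible if a coordinate is 0. Conversely, the smallest coordinate is the radius of a
  ball whose part in the affine hull stays in the simplex.\<close>

lemma simplex_int_eq: "simplex_int = {p::real^'n::finite. (ALL i. 0 < p $ i) & (\<Sum>i\<in>UNIV. p $ i) = 1}"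
proof (intro set_eqI iffI)
 let ?S = "simplex_P :: (real^'n) set"
 let ?c = "(\<chi> i. 1 / real CARD('n)) :: real^'n"
 have cS: "?c \<in> ?S" by (auto simp: simplex_P_def field_simps)
 have conv: "convex ?S" unfolding convex_alt simplex_P_def
  by (auto simp: sum.distrib intro!: add_nonneg_nonneg mult_nonneg_nonneg convex_bound_le simp flip: sum_distrib_left)
 fix p :: "real^'n"
 { assume r: "p \<in> simplex_int"
  hence rS: "p \<in> ?S" using rel_interior_subset by blast
  obtain e where e: "e > 1" "(1 - e) *\<^sub>R ?c + e *\<^sub>R p \<in> ?S" using r convex_rel_interior_iff[OF conv] cS by blast
  have "0 < p $ i" for i
  proof (rule ccontr)
   assume "\<not> 0 < p $ i"
   moreover have "0 <= p $ i" using rS by (simp add: simplex_P_def)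
   ultimately have "p $ i = 0" by simp
   hence "((1 - e) *\<^sub>R ?c + e *\<^sub>R p) $ i = (1 - e) / real CARD('n)" by simp
   also have "... < 0" using e(1) by (simp add: divide_neg_pos)
   finally show False using e(2) by (auto simp: simplex_P_def not_le[symmetric])
  qed
  thus "p \<in> {p. (ALL i. 0 < p $ i) & (\<Sum>i\<in>UNIV. p $ i) = 1}" using rS by (auto simp: simplex_P_def) }
 { assume r: "p \<in> {p. (ALL i. 0 < p $ i) & (\<Sum>i\<in>UNIV. p $ i) = 1}"
  hence pos: "!!i. 0 < p $ i" and sum: "(\<Sum>i\<in>UNIV. p $ i) = 1" by auto
  have le1: "y $ i <= 1" if "!!i. 0 <= y $ i" "(\<Sum>i\<in>UNIV. y $ i) = 1" for y :: "real^'n" and i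
   using member_le_sum[of i UNIV "%i. y $ i"] that by simp
  hence rS: "p \<in> ?S" using pos sum by (auto simp: simplex_P_def less_imp_le)
  have aff: "affine {y::real^'n. (\<Sum>i\<in>UNIV. y $ i) = 1}" by (auto simp: affine_def sum.distrib simp flip: sum_distrib_left)
  have "affine hull ?S \<subseteq> {y. (\<Sum>i\<in>UNIV. y $ i) = 1}" by (rule hull_minimal[where S=affine, OF _ aff]) (auto simp: simplex_P_def)
  define e where "e = Min (range (%i. p $ i))"
  have e: "0 < e" "!!i. e <= p $ i" unfolding e_def using pos by (auto simp: Min_gr_iff)
  have "ball p e \<inter> affine hull ?S \<subseteq> ?S"
  proof
   fix y assume y: "y \<in> ball p e \<inter> affine hull ?S"
   hence sy: "(\<Sum>i\<in>UNIV. y $ i) = 1" using \<open>affine hull ?S \<subseteq> _\<close> by auto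
   have "0 <= y $ i" for i
   proof -
    have "abs ((p - y) $ i) < e" using y component_le_norm_cart[of "p - y" i] by (simp add: dist_norm)
    thus ?thesis using e(2)[of i] by simp
   qed
   thus "y \<in> ?S" using le1[of y] sy by (auto simp: simplex_P_def)
  qed
  thus "p \<in> simplex_int" using rS e(1) by (auto simp: mem_rel_interior_ball) }
qed

section \<open>Gradients and second differences\<close>

lemma gradI: "(f has_derivative (%h. h \<bullet> v)) (at x) ==> grad f x = v"
proof -
 assume f: "(f has_derivative (%h. h \<bullet> v)) (at x)"
 show "grad f x = v" unfolding grad_def
 proof (rule the_equality)
  show "GDERIV f x :> v" using f by (simp add: gderiv_def)
  fix D assume "GDERIV f x :> D"
  hence "(%h. h \<bullet> D) = (%h. h \<bullet> v)" using f has_derivative_unique unfolding gderiv_def by blast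
  hence "(D - v) \<bullet> (D - v) = 0" by (metis inner_diff_right diff_self)
  thus "D = v" by simp
 qed
qed

lemma linear_functional_inner:
 fixes D :: "'a::euclidean_space => real"
 assumes "bounded_linear D" shows "EX v. ALL d. D d = d \<bullet> v"
 using adjoint_works[OF bounded_linear.linear[OF assms], of _ 1] by (metis inner_real_def mult.right_neutral)

lemma grad_has_derivative:
 fixes f :: "'a::euclidean_space => real"
 assumes "f differentiable (at x)"
 shows "(f has_derivative (%h. h \<bullet> grad f x)) (at x)"
proof -
 obtain D where D: "(f has_derivative D) (at x)" using assms unfolding differentiable_def by blast
 then obtain v where "D = (%d. d \<bullet> v)" using linear_functional_inner[OF has_derivative_bounded_linear[OF D]] by blast
 thus ?thesis using gradI D by metis
qed

text \<open>Taylor's formula at v and at - v: the first order terms cancel. The Lagrange remainder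
  works with mere existence of the second derivative.\<close>

lemma second_difference_le:
 fixes f f' f'' :: "real => real"
 assumes f': "!!t. abs t <= abs v ==> DERIV f t :> f' t" and f'': "!!t. abs t <= abs v ==> DERIV f' t :> f'' t"
  and S: "!!t. abs t <= abs v ==> f'' t <= S"
 shows "f v + f (- v) - 2 * f 0 <= v\<^sup>2 * S"
proof -
 define df where "df m = (if m = 0 then f else if m = 1 then f' else f'')" for m :: nat
 have *: "EX t. abs t <= abs x & f x = f 0 + f' 0 * x + f'' t / 2 * x\<^sup>2" if "abs x = abs v" for x
 proof -
  have "EX t. abs t <= abs x & f x = (\<Sum>m<2. df m 0 / fact m * x ^ m) + df 2 t / fact 2 * x ^ 2"
  proof (rule Maclaurin_bi_le)
   show "df 0 = f" by (simp add: df_def)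
   show "ALL m t. m < 2 & abs t <= abs x --> DERIV (df m) t :> df (Suc m) t"
    using f' f'' that by (auto simp: df_def less_2_cases_iff)
  qed
  thus ?thesis by (simp add: df_def numeral_2_eq_2)
 qed
 obtain t1 where t1: "abs t1 <= abs v" "f v = f 0 + f' 0 * v + f'' t1 / 2 * v\<^sup>2" using *[of v] by auto
 obtain t2 where t2: "abs t2 <= abs v" "f (- v) = f 0 + f' 0 * (- v) + f'' t2 / 2 * (- v)\<^sup>2" using *[of "- v"] by auto
 have "f v + f (- v) - 2 * f 0 = v\<^sup>2 * ((f'' t1 + f'' t2) / 2)" using t1(2) t2(2) by (simp add: algebra_simps)
 also have "... <= v\<^sup>2 * S" using S[OF t1(1)] S[OF t2(1)] by (intro mult_left_mono) auto
 finally show ?thesis .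
qed

lemma norm_fst_diff: "norm (fst z - fst z') <= norm (z - z')"
 and norm_snd_diff: "norm (snd z - snd z') <= norm (z - z')" by (metis fst_diff norm_fst_le prod.collapse, metis snd_diff norm_snd_le prod.collapse)

lemma compact_rbox: "compact (rbox r :: (real^'n::finite) set)"
proof -
 have "closed (rbox r :: (real^'n) set)" unfolding rbox_def by (intro closed_Collect_all closed_Collect_le continuous_intros)
 moreover have "norm y <= real CARD('n) * r" if "y \<in> rbox r" for y :: "real^'n"
  using norm_le_l1_cart[of y] sum_mono[of UNIV "%i. abs (y $ i)" "%_. r"] that by (simp add: rbox_def)
 hence "bounded (rbox r :: (real^'n) set)" unfolding bounded_iff by blast
 ultimately show ?thesis by (simp add: compact_eq_bounded_closed)
qed

lemma integrable_rbox:
 fixes H :: "real^'n::finite => real" and p :: "real^'n => real^'n"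
 assumes d: "0 < d" and c: "continuous_on UNIV H" and [measurable]: "p \<in> borel_measurable borel" and p: "!!y. y \<in> rbox r ==> p y \<in> rbox r"
 shows "integrable (gauss d) (%y. indicator (rbox r) y * H (p y))"
proof -
 interpret gs: prob_space "gauss d :: (real^'n) measure" by (rule prob_space_gauss) fact
 have [measurable]: "H \<in> borel_measurable borel" by (rule borel_measurable_continuous_onI[OF c])
 have "compact (H ` rbox r)" by (intro compact_continuous_image compact_rbox continuous_on_subset[OF c]) simp
 from compact_imp_bounded[OF this] obtain B where "\<forall>y\<in>H ` rbox r. norm y <= B" unfolding bounded_iff by (elim exE)
 hence "abs (indicator (rbox r) y * H (p y)) <= max B 0" for y using p by (auto simp: indicator_def le_max_iff_disj)
 thus ?thesis by (intro gs.integrable_const_bound[where B="max B 0"]) auto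
qed

text \<open>Only second differences along the axes are needed: averaging over the reflection of one
  coordinate after the other removes all first order and mixed terms.\<close>
lemma gauss_symmetrize:
 fixes H :: "real^'n::finite => real"
 assumes d: "0 < d" and r: "0 < r" and cont: "continuous_on UNIV H"
  and sd: "!!i y v. y \<in> rbox r ==> y $ i = 0 ==> abs v <= r ==>
   H (y + v *\<^sub>R axis i 1) + H (y - v *\<^sub>R axis i 1) - 2 * H y <= v\<^sup>2 * c i"
 shows "(LINT y|gauss d. indicator (rbox r) y * H y) <= H 0 * measure (gauss d) (rbox r :: (real^'n) set) + (\<Sum>i\<in>UNIV. c i * box_var d r i) / 2"
proof -
 have [measurable]: "H \<in> borel_measurable borel" by (rule borel_measurable_continuous_onI[OF cont])
 note int = integrable_rbox[OF d cont]
 \<comment> \<open>\<open>P I\<close> keeps the coordinates in I and sets the others to 0; the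
   induction releases one coordinate at a time.\<close>
 define P where "P I = flip (%i. if i \<in> I then 1 else 0 :: real)" for I :: "'n set"
 have [measurable]: "P I \<in> borel_measurable borel" for I unfolding P_def by measurable
 have Pbox: "P I y \<in> rbox r" if "y \<in> rbox r" for I y using that r by (auto simp: P_def rbox_def)
 have "(LINT y|gauss d. indicator (rbox r) y * H (P I y)) <= H 0 * measure (gauss d) (rbox r :: (real^'n) set) + (\<Sum>i\<in>I. c i * box_var d r i) / 2" if "finite I" for I
  using that
 proof induction
  case empty
  have "P {} y = 0" for y by (simp add: P_def vec_eq_iff)
  thus ?case by simp
 next
  case (insert i I)
  let ?m = "%j. if j = i then -1 else 1 :: real"
  have Pp: "P (insert i I) y = P I y + (y $ i) *\<^sub>R axis i 1" for y using insert(2) by (auto simp: P_def vec_eq_iff axis_def)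
  have Pm: "P (insert i I) (flip ?m y) = P I y - (y $ i) *\<^sub>R axis i 1" for y using insert(2) by (auto simp: P_def vec_eq_iff axis_def)
  have 1: "(LINT y|gauss d. indicator (rbox r) y * H (P (insert i I) y)) = (LINT y|gauss d. indicator (rbox r) y * H (P (insert i I) (flip ?m y)))"
   by (subst integral_gauss_flip[where c="?m", symmetric]) (auto simp: flip_rbox indicator_def)
  have i1: "integrable (gauss d) (%y. indicator (rbox r) y * H (P (insert i I) y))"
   and i2: "integrable (gauss d) (%y. indicator (rbox r) y * H (P (insert i I) (flip ?m y)))"
   and i3: "integrable (gauss d) (%y. indicator (rbox r) y * H (P I y))" by (rule int; auto intro!: Pbox simp: flip_rbox)+
  have "2 * (LINT y|gauss d. indicator (rbox r) y * H (P (insert i I) y))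
   = (LINT y|gauss d. indicator (rbox r) y * H (P (insert i I) y) + indicator (rbox r) y * H (P (insert i I) (flip ?m y)))"
   using i1 i2 1 by simp
  also have "... <= (LINT y|gauss d. 2 * (indicator (rbox r) y * H (P I y)) + c i * (indicator (rbox r) y * (y $ i)\<^sup>2))"
  proof (rule integral_mono)
   fix y :: "real^'n"
   show "indicator (rbox r) y * H (P (insert i I) y) + indicator (rbox r) y * H (P (insert i I) (flip ?m y))
    <= 2 * (indicator (rbox r) y * H (P I y)) + c i * (indicator (rbox r) y * (y $ i)\<^sup>2)"
   proof (cases "y \<in> rbox r")
    case True
    have "P I y $ i = 0" using insert(2) by (simp add: P_def)
    from sd[OF Pbox[OF True] this, of "y $ i"] True show ?thesis unfolding Pm[of y] Pp[of y] by (simp add: rbox_def mult.commute)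
   qed simp
  next
   show "integrable (gauss d) (%y. 2 * (indicator (rbox r) y * H (P I y)) + c i * (indicator (rbox r) y * (y $ i)\<^sup>2))"
    using i3 integrable_gauss_rbox_square[OF d] by (intro Bochner_Integration.integrable_add integrable_mult_right) (auto simp: mult_ac)
  qed (rule Bochner_Integration.integrable_add[OF i1 i2])
  also have "... = 2 * (LINT y|gauss d. indicator (rbox r) y * H (P I y)) + c i * box_var d r i"
   using i3 integrable_gauss_rbox_square[OF d, of r i] by (subst Bochner_Integration.integral_add) (auto intro!: integrable_mult_right simp: mult.assoc)
  finally show ?case using insert.IH unfolding sum.insert[OF insert(1,2)] add_divide_distrib by linarith
 qed
 from this[of UNIV] show ?thesis by (simp add: P_def flip_def)
qed

locale wasserstein_control = brownian_basis M \<F> W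
 for M :: "'w measure" and \<F> and W :: "real => 'w => real^'n::finite" +
 fixes E :: "('n \<times> 'n) set" and wt :: "'n => 'n => real" and H0 :: "real^'n => real^'n => real"
  and s :: "real^'n" and l T C1 C2 :: real
  and F :: "real => real^'n => real^'n => real^'n => real" and h :: "real^'n => real^'n => real"
 assumes graph: "weighted_graph E wt" and energy: "admissible_energy E H0" and tangent: "tangent_to_simplex H0"
  and l_pos: "0 < l" and T_pos: "0 < T" and costs: "admissible_costs E H0 l T F h"
  and C1_pos: "0 < C1" and C2_pos: "0 < C2"
  and second_derivatives: "!!i \<rho> x. \<rho> \<in> simplex_int ==> has_second_partial i (H0 \<rho>) x"
  and growth: "!!\<rho> x v. \<rho> \<in> simplex_int ==> v \<in> cball 0 l ==>
   norm (D_x (controlled_energy H0 v) \<rho> x)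
    + (\<Sum>i\<in>UNIV. abs (second_partial i (controlled_energy H0 v \<rho>) x))
   <= C1 * controlled_energy H0 v \<rho> x + C2"
begin

section \<open>The shifted energy and its growth\<close>

lemma Pr: "Pr_class E H0" using energy by (simp add: admissible_energy_def)

lemma Pr_level:
 assumes "0 < R"
 obtains c C C' where "0 < c" "0 < C'"
  "!!p x. p \<in> simplex_int ==> H0 p x <= R ==> norm (D_rho H0 p x) <= C & norm (D_x H0 p x) <= C"
  "!!p x i. p \<in> simplex_int ==> H0 p x <= R ==> c <= p $ i"
  "!!p x. p \<in> simplex_int ==> H0 p x <= R ==> \<forall>(i, j)\<in>E. abs (x $ i - x $ j) <= C'"
proof -
 have "\<forall>R>0. EX c C1 C2. 0 < c & c < 1 & 0 < C1 & 0 < C2 &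
    (\<forall>p\<in>simplex_int. ALL x. H0 p x <= R -->
      norm (D_rho H0 p x) <= C1 & norm (D_x H0 p x) <= C1 &
      (ALL i. c <= p $ i) & (\<forall>(i, j)\<in>E. abs (x $ i - x $ j) <= C2))" using Pr unfolding Pr_class_def by (elim conjE)
 from this[rule_format, OF assms] obtain c C C' where *: "0 < c" "0 < C'"
  "\<forall>p\<in>simplex_int. ALL x. H0 p x <= R -->
      norm (D_rho H0 p x) <= C & norm (D_x H0 p x) <= C &
      (ALL i. c <= p $ i) & (\<forall>(i, j)\<in>E. abs (x $ i - x $ j) <= C')" by (elim exE conjE)
 show thesis using *(3) by (intro that[OF *(1,2)]) blast+
qed

lemma H0_derivative:
 assumes r: "a \<in> simplex_int"
 shows "((%p. H0 (fst p) (snd p)) has_derivative (%d. fst d \<bullet> D_rho H0 a x + snd d \<bullet> D_x H0 a x)) (at (a, x))"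
proof -
 obtain N where "simplex_int \<subseteq> N" "C_k_on 1 (%(a, x). H0 a x) (N \<times> UNIV)" using Pr unfolding Pr_class_def by blast
 hence "(%p. H0 (fst p) (snd p)) differentiable (at (a, x))" using r by (auto simp: split_beta')
 then obtain D where D: "((%p. H0 (fst p) (snd p)) has_derivative D) (at (a, x))" unfolding differentiable_def by blast
 interpret D: bounded_linear D by (rule has_derivative_bounded_linear[OF D])
 have p1: "((%r. (r, x)) has_derivative (%d. (d, 0))) (at a)" and p2: "((%y. (a, y)) has_derivative (%d. (0, d))) (at x)"
  by (auto intro!: derivative_eq_intros)
 have "((%r. H0 r x) has_derivative (%d. D (d, 0))) (at a)" using has_derivative_compose[OF p1, of "%p. H0 (fst p) (snd p)" D] D by simp
 moreover from this obtain v where "(%d. D (d, 0)) = (%d. d \<bullet> v)" using linear_functional_inner[OF has_derivative_bounded_linear] by blast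
 ultimately have 1: "D (d, 0) = d \<bullet> D_rho H0 a x" for d unfolding D_rho_def using gradI[of "%r. H0 r x" v a] by (metis (mono_tags, lifting))
 have "(H0 a has_derivative (%d. D (0, d))) (at x)" using has_derivative_compose[OF p2, of "%p. H0 (fst p) (snd p)" D] D by simp
 moreover from this obtain v where "(%d. D (0, d)) = (%d. d \<bullet> v)" using linear_functional_inner[OF has_derivative_bounded_linear] by blast
 ultimately have 2: "D (0, d) = d \<bullet> D_x H0 a x" for d unfolding D_x_def using gradI[of "H0 a" v x] by (metis (mono_tags, lifting))
 have "D d = fst d \<bullet> D_rho H0 a x + snd d \<bullet> D_x H0 a x" for d using D.add[of "(fst d, 0)" "(0, snd d)"] 1 2 by simp
 thus ?thesis using D by (metis (no_types, lifting) ext)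
qed

lemma H0_continuous: "continuous_on (simplex_int \<times> UNIV) (%p. H0 (fst p) (snd p))"
 using H0_derivative by (auto intro!: continuous_at_imp_continuous_on has_derivative_continuous)

lemma H0_x_derivative:
 assumes r: "p \<in> simplex_int"
 shows "(H0 p has_derivative (%d. d \<bullet> D_x H0 p x)) (at x)" "continuous_on UNIV (H0 p)"
proof -
 show *: "(H0 p has_derivative (%d. d \<bullet> D_x H0 p x)) (at x)" for x
 proof -
  have "((%y. (p, y)) has_derivative (%d. (0, d))) (at x)" by (auto intro!: derivative_eq_intros)
  from has_derivative_compose[OF this H0_derivative[OF r]]
  show ?thesis by simp
 qed
 show "continuous_on UNIV (H0 p)" using has_derivative_continuous[OF *] by (auto intro!: continuous_at_imp_continuous_on)
qed

definition lowb where "lowb = (SOME b. \<forall>p\<in>simplex_int. ALL x. b <= H0 p x)"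

text \<open>Being at least 1 on the domain, it absorbs additive constants and its powers are
  increasing in the exponent.\<close>

definition eta where "eta z = H0 (fst z) (snd z) - lowb + 1"

lemma eta_ge_1: "fst z \<in> simplex_int ==> 1 <= eta z"
proof -
 have "EX b. \<forall>p\<in>simplex_int. ALL x. b <= H0 p x" using Pr unfolding Pr_class_def by blast
 from someI_ex[OF this] show "fst z \<in> simplex_int ==> 1 <= eta z" by (auto simp: eta_def lowb_def[symmetric])
qed

text \<open>Rewriting \<open>C1 * H0 + C2\<close> through \<open>eta\<close> leaves the constants
  \<open>C1 * (lowb - 1)\<close> and C2, which are absorbed because \<open>eta\<close> is at least
  1.\<close>

definition gc where "gc = C1 + C1 * abs (lowb - 1) + C2"

lemma gc_nn: "0 <= gc" using C1_pos C2_pos by (simp add: gc_def)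

lemma controlled_energy_0: "controlled_energy H0 0 = H0" by (simp add: controlled_energy_def fun_eq_iff)

lemma growth_eta:
 assumes r: "p \<in> simplex_int"
 shows "norm (D_x H0 p x) <= gc * eta (p, x)" "abs (second_partial i (H0 p) x) <= gc * eta (p, x)"
proof -
 have e1: "1 <= eta (p, x)" by (rule eta_ge_1) (simp add: r)
 have "C1 * H0 p x + C2 = C1 * eta (p, x) + C1 * (lowb - 1) + C2" by (simp add: eta_def algebra_simps)
 also have "... <= C1 * eta (p, x) + C1 * abs (lowb - 1) * eta (p, x) + C2 * eta (p, x)"
 proof (intro add_mono order_refl)
  have "C1 * (lowb - 1) <= C1 * abs (lowb - 1)" using C1_pos by (intro mult_left_mono) auto
  also have "... <= C1 * abs (lowb - 1) * eta (p, x)" using mult_left_mono[OF e1, of "C1 * abs (lowb - 1)"] C1_pos by simp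
  finally show "C1 * (lowb - 1) <= C1 * abs (lowb - 1) * eta (p, x)" .
  show "C2 <= C2 * eta (p, x)" using mult_left_mono[OF e1, of C2] C2_pos by simp
 qed
 finally have "C1 * H0 p x + C2 <= gc * eta (p, x)" by (simp add: gc_def algebra_simps)
 \<comment> \<open>The growth condition is used at the control value 0, where the controlled energy
   is \<open>H0\<close>.\<close>
 moreover have "norm (D_x H0 p x) + (\<Sum>i\<in>UNIV. abs (second_partial i (H0 p) x)) <= C1 * H0 p x + C2"
  using growth[OF r, of 0 x] l_pos by (simp add: controlled_energy_0)
 moreover have "abs (second_partial i (H0 p) x) <= (\<Sum>i\<in>UNIV. abs (second_partial i (H0 p) x))" by (rule member_le_sum) auto
 moreover have "0 <= (\<Sum>i\<in>UNIV. abs (second_partial i (H0 p) x))" by (rule sum_nonneg) auto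
 moreover have "0 <= norm (D_x H0 p x)" by simp
 ultimately show "norm (D_x H0 p x) <= gc * eta (p, x)" "abs (second_partial i (H0 p) x) <= gc * eta (p, x)" by linarith+
qed

text \<open>\<open>second_partial\<close> differentiates at parameter 0 of the line through its base
  point. Shifting the base point along the axis gives the second derivative at every parameter of
  one fixed line.\<close>

lemma axis_derivatives:
 fixes i :: 'n and x :: "real^'n"
 assumes r: "p \<in> simplex_int"
 defines "k \<equiv> %v. eta (p, x + v *\<^sub>R axis i 1)"
 shows "DERIV k t :> partial_on_line i (H0 p) x t"
  "DERIV (partial_on_line i (H0 p) x) t :> second_partial i (H0 p) (x + t *\<^sub>R axis i 1)"
  "abs (partial_on_line i (H0 p) x t) <= gc * k t" "abs (second_partial i (H0 p) (x + t *\<^sub>R axis i 1)) <= gc * k t"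
proof -
 have D: "DERIV (%v. H0 p (x + v *\<^sub>R axis i 1)) t :> axis i 1 \<bullet> D_x H0 p (x + t *\<^sub>R axis i 1)" for t
 proof -
  have "((%v. x + v *\<^sub>R axis i 1) has_derivative (%d. d *\<^sub>R axis i 1)) (at t)" by (auto intro!: derivative_eq_intros)
  from has_derivative_compose[OF this H0_x_derivative(1)[OF r]] show ?thesis by (simp add: has_field_derivative_def mult_commute_abs)
 qed
 hence pl: "partial_on_line i (H0 p) x t = axis i 1 \<bullet> D_x H0 p (x + t *\<^sub>R axis i 1)" for t x
 proof -
  have "((%v. x + v *\<^sub>R axis i 1) has_derivative (%d. d *\<^sub>R axis i 1)) (at t)" by (auto intro!: derivative_eq_intros)
  from has_derivative_compose[OF this H0_x_derivative(1)[OF r]] show ?thesis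
   unfolding partial_on_line_def by (intro DERIV_imp_deriv) (simp add: has_field_derivative_def mult_commute_abs)
 qed
 show "DERIV k t :> partial_on_line i (H0 p) x t" unfolding k_def eta_def pl fst_conv snd_conv using D[of t] by (auto intro!: derivative_eq_intros)
 show "abs (partial_on_line i (H0 p) x t) <= gc * k t"
 proof -
  have "abs (axis i 1 \<bullet> D_x H0 p (x + t *\<^sub>R axis i 1)) <= norm (D_x H0 p (x + t *\<^sub>R axis i 1))"
   using component_le_norm_cart[of "D_x H0 p (x + t *\<^sub>R axis i 1)" i] by (simp add: inner_axis' )
  also have "... <= gc * k t" unfolding k_def by (rule growth_eta(1)[OF r])
  finally show ?thesis unfolding pl .
 qed
 show "abs (second_partial i (H0 p) (x + t *\<^sub>R axis i 1)) <= gc * k t" unfolding k_def by (rule growth_eta(2)[OF r])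
 have "partial_on_line i (H0 p) (x + t *\<^sub>R axis i 1) differentiable (at 0)" using second_derivatives[OF r] by (auto simp: has_second_partial_def)
 hence "DERIV (partial_on_line i (H0 p) (x + t *\<^sub>R axis i 1)) 0 :> second_partial i (H0 p) (x + t *\<^sub>R axis i 1)"
  unfolding second_partial_def by (metis DERIV_deriv_iff_real_differentiable)
 moreover have "partial_on_line i (H0 p) (x + t *\<^sub>R axis i 1) = (%v. partial_on_line i (H0 p) x (v + t))"
  unfolding pl by (auto simp: fun_eq_iff algebra_simps)
 ultimately show "DERIV (partial_on_line i (H0 p) x) t :> second_partial i (H0 p) (x + t *\<^sub>R axis i 1)"
  using DERIV_shift[of "partial_on_line i (H0 p) x" "second_partial i (H0 p) (x + t *\<^sub>R axis i 1)" 0 t] by simp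
qed

text \<open>Both derivatives of \<open>eta\<close> along the axis are at most
  \<open>gc * eta\<close>, so the second derivative of its q-th power is at most a multiple of that
  same power. This homogeneity is what makes powers of the energy Lyapunov functions.\<close>

lemma eta_power_second_difference:
 assumes r: "p \<in> simplex_int" and q: "2 <= q" and Y: "!!t. abs t <= abs v ==> eta (p, x + t *\<^sub>R axis i 1) <= Y"
 shows "eta (p, x + v *\<^sub>R axis i 1) ^ q + eta (p, x - v *\<^sub>R axis i 1) ^ q - 2 * eta (p, x) ^ q
  <= v\<^sup>2 * ((real q)\<^sup>2 * (gc\<^sup>2 + gc) * Y ^ q)"
proof -
 let ?k = "%v. eta (p, x + v *\<^sub>R axis i 1)"
 let ?k1 = "partial_on_line i (H0 p) x" and ?k2 = "%t. second_partial i (H0 p) (x + t *\<^sub>R axis i 1)"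
 note ad = axis_derivatives[OF r, where x=x and i=i]
 have k1: "1 <= ?k t" for t by (rule eta_ge_1) (simp add: r)
 have "?k v ^ q + ?k (- v) ^ q - 2 * ?k 0 ^ q <= v\<^sup>2 * ((real q)\<^sup>2 * (gc\<^sup>2 + gc) * Y ^ q)"
 proof (rule second_difference_le)
  show "DERIV (%t. ?k t ^ q) t :> real q * ?k t ^ (q - 1) * ?k1 t" for t by (rule derivative_eq_intros ad(1) refl)+ (simp add: mult_ac)
  show "DERIV (%t. real q * ?k t ^ (q - 1) * ?k1 t) t :> real q * (real (q - 1) * ?k t ^ (q - 2) * ?k1 t) * ?k1 t + real q * ?k t ^ (q - 1) * ?k2 t" for t
   by (rule derivative_eq_intros ad(1,2) refl)+ (simp add: mult_ac numeral_2_eq_2)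
  fix t assume t: "abs t <= abs v"
  let ?K = "?k t"
  have K0: "0 <= ?K" using k1[of t] by simp
  have q2: "?K ^ (q - 2) * ?K\<^sup>2 = ?K ^ q" "?K ^ (q - 1) * ?K = ?K ^ q"
  proof -
   obtain m where "q = Suc (Suc m)" using q by (metis Suc_le_D numeral_2_eq_2 Suc_le_mono)
   thus "?K ^ (q - 2) * ?K\<^sup>2 = ?K ^ q" "?K ^ (q - 1) * ?K = ?K ^ q" by (simp_all add: power2_eq_square mult_ac)
  qed
  have "?k1 t * ?k1 t <= (gc * ?K) * (gc * ?K)" using mult_mono[OF ad(3)[of t] ad(3)[of t]] gc_nn K0 by (simp flip: abs_mult)
  hence a: "?K ^ (q - 2) * (?k1 t * ?k1 t) <= ?K ^ (q - 2) * ((gc * ?K) * (gc * ?K))" using K0 by (intro mult_left_mono) auto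
  have b: "?K ^ (q - 1) * ?k2 t <= ?K ^ (q - 1) * (gc * ?K)" using K0 ad(4)[of t] by (intro mult_left_mono) auto
  have "real q * (real (q - 1) * ?K ^ (q - 2) * ?k1 t) * ?k1 t + real q * ?K ^ (q - 1) * ?k2 t
   = real q * real (q - 1) * (?K ^ (q - 2) * (?k1 t * ?k1 t)) + real q * (?K ^ (q - 1) * ?k2 t)" by (simp add: mult_ac)
  also have "... <= real q * real (q - 1) * (?K ^ (q - 2) * ((gc * ?K) * (gc * ?K))) + real q * (?K ^ (q - 1) * (gc * ?K))"
   by (intro add_mono mult_left_mono a b) auto
  also have "... = real q * real (q - 1) * (gc\<^sup>2 * (?K ^ (q - 2) * ?K\<^sup>2)) + real q * (gc * (?K ^ (q - 1) * ?K))" by (simp add: power2_eq_square mult_ac)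
  also have "... = real q * real (q - 1) * (gc\<^sup>2 * ?K ^ q) + real q * (gc * ?K ^ q)" by (simp only: q2)
  also have "... <= (real q)\<^sup>2 * (gc\<^sup>2 * ?K ^ q) + (real q)\<^sup>2 * (gc * ?K ^ q)"
  proof (intro add_mono mult_right_mono)
   show "real q * real (q - 1) <= (real q)\<^sup>2" "real q <= (real q)\<^sup>2" using q by (auto simp: power2_eq_square intro!: mult_left_mono)
  qed (use gc_nn K0 in auto)
  also have "... = (real q)\<^sup>2 * (gc\<^sup>2 + gc) * ?K ^ q" by (simp add: algebra_simps)
  also have "... <= (real q)\<^sup>2 * (gc\<^sup>2 + gc) * Y ^ q" using Y[OF t] K0 gc_nn by (intro mult_left_mono power_mono) auto
  finally show "real q * (real (q - 1) * ?K ^ (q - 2) * ?k1 t) * ?k1 t + real q * ?K ^ (q - 1) * ?k2 t <= (real q)\<^sup>2 * (gc\<^sup>2 + gc) * Y ^ q" .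
 qed
 thus ?thesis by simp
qed

text \<open>Euler steps preserve the coordinate sum but not positivity, so chains live in this
  hyperplane rather than in the simplex.\<close>

definition hyper :: "((real^'n) \<times> (real^'n)) set" where
 "hyper = {z. (\<Sum>i\<in>UNIV. fst z $ i) = 1}"

text \<open>A positive sequence with limit 0 that stays below \<open>1 / CARD('n)\<close>, as the
  definition of local Lipschitz continuity demands.\<close>

definition r1 :: "nat => real" where "r1 j = 1 / (real CARD('n) * (real j + 2))"

text \<open>Closed convex sets exhausting the domain. They are unbounded, since adding a constant to
  all momenta changes no difference. All pairs are constrained, not only edges;
  \<open>connected_bound\<close> is the link.\<close>

definition Gset :: "nat => ((real^'n) \<times> (real^'n)) set" where
 "Gset j = {z. (\<Sum>i\<in>UNIV. fst z $ i) = 1 & (ALL i. r1 j <= fst z $ i) & (ALL i k. abs (snd z $ i - snd z $ k) <= real j + 1)}"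

lemma r1_bounds: "0 < r1 j" "r1 j < 1 / real CARD('n)" by (auto simp: r1_def divide_simps)

lemma r1_mono: "j <= j' ==> r1 j' <= r1 j" unfolding r1_def by (intro divide_left_mono mult_left_mono) auto

lemma Gset_mono: "j <= j' ==> Gset j \<subseteq> Gset j'"
proof
 fix z assume j: "j <= j'" and z: "z \<in> Gset j"
 hence "r1 j' <= fst z $ i" for i using r1_mono[OF j] order_trans by (auto simp: Gset_def)
 moreover have "abs (snd z $ i - snd z $ k) <= real j' + 1" for i k
 proof -
  have "abs (snd z $ i - snd z $ k) <= real j + 1" using z by (simp add: Gset_def)
  thus ?thesis using j by simp
 qed
 ultimately show "z \<in> Gset j'" using z by (simp add: Gset_def)
qed

lemma Gset_simplex: "z \<in> Gset j ==> fst z \<in> simplex_int" using r1_bounds(1)[of j] by (force simp: Gset_def simplex_int_eq intro: less_le_trans)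

lemma Gset_hyper: "Gset j \<subseteq> hyper" by (auto simp: Gset_def hyper_def)

lemma closed_Gset: "closed (Gset j)" and closed_hyper: "closed hyper" unfolding Gset_def hyper_def
 by (intro closed_Collect_conj closed_Collect_all closed_Collect_le closed_Collect_eq continuous_intros)+

lemma convex_Gset: "convex (Gset j)" unfolding convex_alt
proof (intro ballI allI impI, elim conjE)
 fix z z' and u :: real assume z: "z \<in> Gset j" "z' \<in> Gset j" and u: "0 <= u" "u <= 1"
 have "r1 j <= (1 - u) * fst z $ i + u * fst z' $ i" for i using convex_bound_le[of "- fst z $ i" "- r1 j" "- fst z' $ i" "1 - u" u] z u by (auto simp: Gset_def)
 moreover have "abs (((1 - u) * snd z $ i + u * snd z' $ i) - ((1 - u) * snd z $ k + u * snd z' $ k)) <= real j + 1" for i k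
 proof -
  have "((1 - u) * snd z $ i + u * snd z' $ i) - ((1 - u) * snd z $ k + u * snd z' $ k) = (1 - u) * (snd z $ i - snd z $ k) + u * (snd z' $ i - snd z' $ k)"
   by (simp add: algebra_simps)
  also have "abs (...) <= (1 - u) * abs (snd z $ i - snd z $ k) + u * abs (snd z' $ i - snd z' $ k)"
   using u by (intro order_trans[OF abs_triangle_ineq]) (auto simp: abs_mult)
  also have "... <= real j + 1" using z u by (intro convex_bound_le) (auto simp: Gset_def)
  finally show ?thesis .
 qed
 ultimately show "(1 - u) *\<^sub>R z + u *\<^sub>R z' \<in> Gset j" using z by (auto simp: Gset_def sum.distrib simp flip: sum_distrib_left)
qed

lemma Gset_center: "((\<chi> i. 1 / real CARD('n)), 0) \<in> Gset j" using r1_bounds[of j] by (auto simp: Gset_def less_imp_le)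

lemma Gset_ne: "Gset j ~= {}" using Gset_center by blast

definition b0 where "b0 z = (D_x H0 (fst z) (snd z), - D_rho H0 (fst z) (snd z))"

section \<open>Coefficient bounds on the exhausting sets\<close>

lemma locally_Lipschitz_Gset:
 assumes "locally_Lipschitz E f"
 shows "\<exists>C\<ge>0. \<forall>z\<in>Gset j. \<forall>z'\<in>Gset j. abs (f (fst z) (snd z) - f (fst z') (snd z')) <= C * norm (z - z')"
proof -
 obtain C where C: "0 < C" "\<forall>p\<in>simplex_int. \<forall>m\<in>simplex_int. ALL x y.
     (ALL i. r1 j <= p $ i & r1 j <= m $ i) &
     (\<forall>(i, k)\<in>E. abs (x $ i - x $ k) <= real j + 1 & abs (y $ i - y $ k) <= real j + 1) -->
     abs (f p x - f m y) <= C * (norm (p - m) + norm (x - y))"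
  using assms[unfolded locally_Lipschitz_def, rule_format, of "r1 j" "real j + 1"] r1_bounds[of j] by auto
 have "abs (f (fst z) (snd z) - f (fst z') (snd z')) <= 2 * C * norm (z - z')" if z: "z \<in> Gset j" "z' \<in> Gset j" for z z'
 proof -
  have "abs (f (fst z) (snd z) - f (fst z') (snd z')) <= C * (norm (fst z - fst z') + norm (snd z - snd z'))"
   using z Gset_simplex[OF z(1)] Gset_simplex[OF z(2)] by (intro C(2)[rule_format]) (auto simp: Gset_def)
  also have "... <= C * (norm (z - z') + norm (z - z'))" using C(1) by (intro mult_left_mono add_mono norm_fst_diff norm_snd_diff) auto
  finally show ?thesis by simp
 qed
 thus ?thesis using C(1) by (intro exI[of _ "2 * C"]) auto
qed

text \<open>Tangency of the drift to the simplex says that the derivative of the energy in the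
  direction (1, ..., 1) vanishes.\<close>

lemma translation_invariant:
 assumes r: "p \<in> simplex_int"
 shows "H0 p (x + c *\<^sub>R (\<chi> i. 1)) = H0 p x"
proof -
 have "DERIV (%v. H0 p (x + v *\<^sub>R (\<chi> i. 1))) t :> 0" for t
 proof -
  have "((%v. x + v *\<^sub>R (\<chi> i. 1)) has_derivative (%d. d *\<^sub>R (\<chi> i. 1))) (at t)" by (auto intro!: derivative_eq_intros)
  note has_derivative_compose[OF this H0_x_derivative(1)[OF r]]
  moreover have "(\<chi> i. 1) \<bullet> D_x H0 p y = 0" for y using tangent r by (auto simp: tangent_to_simplex_def inner_vec_def)
  ultimately have "((%v. H0 p (x + v *\<^sub>R (\<chi> i. 1))) has_derivative (%d. 0)) (at t)" by simp
  moreover have "(%d. 0 * d) = (%d::real. 0)" by simp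
  ultimately show ?thesis by (metis has_field_derivative_def)
 qed
 hence "(%v. H0 p (x + v *\<^sub>R (\<chi> i. 1))) c = (%v. H0 p (x + v *\<^sub>R (\<chi> i. 1))) 0"
  using DERIV_isconst_all by blast
 thus ?thesis by simp
qed

text \<open>\<open>Gset j\<close> is not compact, but a common shift of the momenta leaves the
  energy unchanged and moves every point into a compact part.\<close>

lemma H0_bounded_Gset: "EX B. \<forall>z\<in>Gset j. H0 (fst z) (snd z) <= B"
proof -
 define K where "K = Gset j \<inter> {z. ALL i. abs (snd z $ i) <= real j + 1}"
 have "closed K" unfolding K_def by (intro closed_Int closed_Gset closed_Collect_all closed_Collect_le continuous_intros)
 moreover have "norm z <= real CARD('n) + real CARD('n) * (real j + 1)" if z: "z \<in> K" for z
 proof -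
  have "0 <= fst z $ i" "fst z $ i <= 1" for i
  proof -
   have nn: "0 <= fst z $ i" for i using z r1_bounds(1)[of j] by (auto simp: K_def Gset_def intro: order_trans less_imp_le)
   thus "0 <= fst z $ i" .
   show "fst z $ i <= 1" using z nn member_le_sum[of i UNIV "%i. fst z $ i"] by (auto simp: K_def Gset_def)
  qed
  hence "norm (fst z) <= (\<Sum>i\<in>(UNIV::'n set). 1)" by (intro order_trans[OF norm_le_l1_cart] sum_mono) auto
  moreover have "norm (snd z) <= (\<Sum>i\<in>(UNIV::'n set). real j + 1)" using z by (intro order_trans[OF norm_le_l1_cart] sum_mono) (auto simp: K_def)
  ultimately show ?thesis using norm_Pair_le[of "fst z" "snd z"] by simp
 qed
 hence "bounded K" unfolding bounded_iff by blast
 ultimately have "compact K" by (simp add: compact_eq_bounded_closed)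
 moreover have "continuous_on K (%p. H0 (fst p) (snd p))"
  by (rule continuous_on_subset[OF H0_continuous]) (use Gset_simplex in \<open>auto simp: K_def\<close>, (metis fst_conv)?)
 ultimately have "compact ((%p. H0 (fst p) (snd p)) ` K)" by (intro compact_continuous_image)
 from compact_imp_bounded[OF this] obtain B where "\<forall>y\<in>(%p. H0 (fst p) (snd p)) ` K. norm y <= B" unfolding bounded_iff by (elim exE)
 hence B: "!!z. z \<in> K ==> abs (H0 (fst z) (snd z)) <= B" by simp
 have "H0 (fst z) (snd z) <= B" if z: "z \<in> Gset j" for z
 proof -
  \<comment> \<open>An arbitrary vertex, at which the momentum is shifted to 0; all other momenta
    then are at most \<open>real j + 1\<close> in modulus.\<close>
  let ?i = "undefined :: 'n"
  let ?x = "snd z + (- snd z $ ?i) *\<^sub>R (\<chi> i. 1)"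
  have "(fst z, ?x) \<in> K" using z by (auto simp: K_def Gset_def)
  from B[OF this] show ?thesis using translation_invariant[OF Gset_simplex[OF z], of "snd z" "- snd z $ ?i"] by simp
 qed
 thus ?thesis by blast
qed

text \<open>A bound for the energy on \<open>Gset j\<close> makes it part of a sublevel set, where
  the class condition bounds both gradients; the local Lipschitz conditions supply L.\<close>

lemma Gset_bounds: "EX K L. 0 < L & 0 <= K & (\<forall>z\<in>Gset j. norm (b0 z) <= K) &
  (\<forall>z\<in>Gset j. \<forall>z'\<in>Gset j. norm (b0 z - b0 z') <= L * norm (z - z') & abs (eta z - eta z') <= L * norm (z - z'))"
proof -
 obtain B where B: "!!z. z \<in> Gset j ==> H0 (fst z) (snd z) <= B" using H0_bounded_Gset by blast
 have "0 < max B 1" by simp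
 from Pr_level[OF this] obtain Cb where lev: "!!p x. p \<in> simplex_int ==> H0 p x <= max B 1 ==> norm (D_rho H0 p x) <= Cb & norm (D_x H0 p x) <= Cb"
  by metis
 have Cb: "norm (D_rho H0 (fst z) (snd z)) <= Cb" "norm (D_x H0 (fst z) (snd z)) <= Cb" if "z \<in> Gset j" for z
  using B[OF that] lev[OF Gset_simplex[OF that], of "snd z"] by auto
 have bb: "norm (b0 z) <= Cb + Cb" if "z \<in> Gset j" for z
  using Cb[OF that] norm_Pair_le[of "D_x H0 (fst z) (snd z)" "- D_rho H0 (fst z) (snd z)"] by (simp add: b0_def)
 have "ALL i. \<exists>C\<ge>0. \<forall>z\<in>Gset j. \<forall>z'\<in>Gset j. abs (D_rho H0 (fst z) (snd z) $ i - D_rho H0 (fst z') (snd z') $ i) <= C * norm (z - z')"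
  using energy locally_Lipschitz_Gset[of "%p x. D_rho H0 p x $ _"] by (auto simp: admissible_energy_def)
 then obtain Cr where Cr: "!!i. 0 <= Cr i" "!!i z z'. z \<in> Gset j ==> z' \<in> Gset j ==> abs (D_rho H0 (fst z) (snd z) $ i - D_rho H0 (fst z') (snd z') $ i) <= Cr i * norm (z - z')"
  by metis
 have "ALL i. \<exists>C\<ge>0. \<forall>z\<in>Gset j. \<forall>z'\<in>Gset j. abs (D_x H0 (fst z) (snd z) $ i - D_x H0 (fst z') (snd z') $ i) <= C * norm (z - z')"
  using energy locally_Lipschitz_Gset[of "%p x. D_x H0 p x $ _"] by (auto simp: admissible_energy_def)
 then obtain Cx where Cx: "!!i. 0 <= Cx i" "!!i z z'. z \<in> Gset j ==> z' \<in> Gset j ==> abs (D_x H0 (fst z) (snd z) $ i - D_x H0 (fst z') (snd z') $ i) <= Cx i * norm (z - z')"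
  by metis
 obtain Ch where Ch: "0 <= Ch" "!!z z'. z \<in> Gset j ==> z' \<in> Gset j ==> abs (H0 (fst z) (snd z) - H0 (fst z') (snd z')) <= Ch * norm (z - z')"
  using locally_Lipschitz_Gset[of H0 j] energy unfolding admissible_energy_def by blast
 define L where "L = 1 + Ch + ((\<Sum>i\<in>UNIV. Cx i) + (\<Sum>i\<in>UNIV. Cr i))"
 have nn: "0 <= (\<Sum>i\<in>UNIV. Cx i)" "0 <= (\<Sum>i\<in>UNIV. Cr i)" using Cx Cr by (auto intro: sum_nonneg)
 have "norm (b0 z - b0 z') <= L * norm (z - z') & abs (eta z - eta z') <= L * norm (z - z')" if z: "z \<in> Gset j" "z' \<in> Gset j" for z z'
 proof
  have "norm (b0 z - b0 z') <= norm (D_x H0 (fst z) (snd z) - D_x H0 (fst z') (snd z')) + norm (D_rho H0 (fst z) (snd z) - D_rho H0 (fst z') (snd z'))"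
   using norm_Pair_le[of "D_x H0 (fst z) (snd z) - D_x H0 (fst z') (snd z')" "- (D_rho H0 (fst z) (snd z) - D_rho H0 (fst z') (snd z'))"]
   unfolding norm_minus_cancel by (simp add: b0_def)
  also have "... <= (\<Sum>i\<in>UNIV. Cx i * norm (z - z')) + (\<Sum>i\<in>UNIV. Cr i * norm (z - z'))"
   using Cx(2)[OF z] Cr(2)[OF z] by (intro add_mono order_trans[OF norm_le_l1_cart] sum_mono) auto
  also have "... = ((\<Sum>i\<in>UNIV. Cx i) + (\<Sum>i\<in>UNIV. Cr i)) * norm (z - z')" by (simp add: sum_distrib_right distrib_right)
  also have "... <= L * norm (z - z')" using Ch(1) by (intro mult_right_mono) (auto simp: L_def)
  finally show "norm (b0 z - b0 z') <= L * norm (z - z')" .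
  have "abs (eta z - eta z') <= Ch * norm (z - z')" using Ch(2)[OF z] by (simp add: eta_def)
  also have "... <= L * norm (z - z')" using nn by (intro mult_right_mono) (auto simp: L_def)
  finally show "abs (eta z - eta z') <= L * norm (z - z')" .
 qed
 moreover have "0 < L" using nn Ch by (simp add: L_def)
 moreover have "0 <= Cb + Cb" using bb[OF Gset_center] norm_ge_zero order_trans by blast
 ultimately show ?thesis using bb by (intro exI[of _ "Cb + Cb"] exI[of _ L]) auto
qed

text \<open>Along a path of the connected graph the edge differences add up; the sum of the path
  lengths over all pairs is a common constant.\<close>

lemma connected_bound: "\<exists>P\<ge>0. \<forall>(x::real^'n) D. (\<forall>(i, k)\<in>E. abs (x $ i - x $ k) <= D) --> 0 <= D --> (ALL i k. abs (x $ i - x $ k) <= P * D)"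
proof -
 have "\<exists>m\<ge>0. \<forall>(x::real^'n) D. (\<forall>(i, k)\<in>E. abs (x $ i - x $ k) <= D) --> 0 <= D --> abs (x $ i - x $ k) <= m * D" for i k
 proof -
  have "(i, k) \<in> E\<^sup>*" using graph by (simp add: weighted_graph_def)
  thus ?thesis
  proof induction
   case base
   show ?case by (intro exI[of _ 0]) auto
  next
   case (step k k')
   then obtain m where m: "0 <= m" "!!(x::real^'n) D. (\<forall>(i, k)\<in>E. abs (x $ i - x $ k) <= D) ==> 0 <= D ==> abs (x $ i - x $ k) <= m * D" by blast
   show ?case
   proof (intro exI[of _ "m + 1"] conjI allI impI)
    fix x :: "real^'n" and D :: real assume a: "\<forall>(i, k)\<in>E. abs (x $ i - x $ k) <= D" "0 <= D"
    have "abs (x $ k - x $ k') <= D" using a(1) step(2) by auto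
    thus "abs (x $ i - x $ k') <= (m + 1) * D" using m(2)[OF a] by (simp add: algebra_simps)
   qed (use m in simp)
  qed
 qed
 then obtain m where m: "!!i k. 0 <= m i k" "!!i k (x::real^'n) D. (\<forall>(i, k)\<in>E. abs (x $ i - x $ k) <= D) ==> 0 <= D ==> abs (x $ i - x $ k) <= m i k * D"
  by metis
 define P where "P = (\<Sum>i\<in>UNIV. \<Sum>k\<in>UNIV. m i k)"
 have mP: "m i k <= P" for i k
 proof -
  have "m i k <= (\<Sum>k\<in>UNIV. m i k)" using m(1) by (intro member_le_sum) auto
  also have "... <= P" unfolding P_def using m(1) by (intro member_le_sum[where f="%i. \<Sum>k\<in>UNIV. m i k"] sum_nonneg) auto
  finally show ?thesis .
 qed
 show ?thesis
 proof (intro exI[of _ P] conjI allI impI)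
  show "0 <= P" using m(1) by (auto simp: P_def intro!: sum_nonneg)
  fix x :: "real^'n" and D :: real and i k assume a: "\<forall>(i, k)\<in>E. abs (x $ i - x $ k) <= D" "0 <= D"
  show "abs (x $ i - x $ k) <= P * D" using m(2)[OF a, of i k] mult_right_mono[OF mP[of i k] a(2)] by linarith
 qed
qed

text \<open>A sublevel set of the energy lies in every late \<open>Gset j\<close> together with a
  neighbourhood of fixed size m inside the hyperplane. The margin gives an Euler step room to leave
  the sublevel set without activating the projection.\<close>

lemma level_set_margin:
 "EX j0 m. 0 < m & (\<forall>j\<ge>j0. ALL z z'. fst z \<in> simplex_int --> eta z <= R --> z' \<in> hyper --> norm (z' - z) <= m --> z' \<in> Gset j)"
proof -
 have "0 < max (R + lowb - 1) 1" by simp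
 from Pr_level[OF this] obtain c C where c: "0 < c" "0 < C" and
  lev: "!!p x i. p \<in> simplex_int ==> H0 p x <= max (R + lowb - 1) 1 ==> c <= p $ i"
   "!!p x. p \<in> simplex_int ==> H0 p x <= max (R + lowb - 1) 1 ==> \<forall>(i, k)\<in>E. abs (x $ i - x $ k) <= C"
  by metis
 obtain P where P: "0 <= P" "!!(x::real^'n) D i k. (\<forall>(i, k)\<in>E. abs (x $ i - x $ k) <= D) ==> 0 <= D ==> abs (x $ i - x $ k) <= P * D"
  using connected_bound by blast
 define j0 where "j0 = nat \<lceil>max (2 / c) (P * C)\<rceil>"
 \<comment> \<open>Moving by \<open>c / 2\<close> keeps half of the lower bound c of the
   coordinates; moving two momenta by \<open>1 / 2\<close> each uses up the \<open>+ 1\<close> in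
   \<open>Gset\<close>.\<close>
 define m where "m = min (c / 2) (1 / 2)"
 have "z' \<in> Gset j" if j: "j0 <= j" and z: "fst z \<in> simplex_int" "eta z <= R" and z': "z' \<in> hyper" "norm (z' - z) <= m" for j z z'
 proof -
  have "max (2 / c) (P * C) <= real j" using j unfolding j0_def by linarith
  hence jc: "2 / c <= real j" "P * C <= real j" by auto
  have H: "H0 (fst z) (snd z) <= max (R + lowb - 1) 1" using z(2) by (simp add: eta_def)
  note lv = lev(1)[OF z(1) H] lev(2)[OF z(1) H]
  have comp: "abs (fst z' $ i - fst z $ i) <= m" "abs (snd z' $ i - snd z $ i) <= m" for i
   using z'(2) component_le_norm_cart[of "fst z' - fst z" i] component_le_norm_cart[of "snd z' - snd z" i]
    norm_fst_diff[of z' z] norm_snd_diff[of z' z] by auto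
  have "r1 j <= c / 2"
  proof -
   have "2 / c <= real CARD('n) * (real j + 2)"
   proof -
    have "1 * (real j + 2) <= real CARD('n) * (real j + 2)" by (intro mult_right_mono) (auto simp: Suc_le_eq)
    moreover have "2 / c <= 1 * (real j + 2)" using jc by simp
    ultimately show ?thesis by (rule order_trans[rotated])
   qed
   hence "1 / (real CARD('n) * (real j + 2)) <= 1 / (2 / c)" using c by (intro divide_left_mono) auto
   thus ?thesis by (simp add: r1_def)
  qed
  hence "r1 j <= fst z' $ i" for i using lv comp(1)[of i] unfolding m_def by (smt (verit, best) field_sum_of_halves min.cobounded1)
  moreover have "abs (snd z' $ i - snd z' $ k) <= real j + 1" for i k
  proof -
   have "abs (snd z $ i - snd z $ k) <= P * C" using lv c by (intro P(2)) auto
   thus ?thesis using comp(2)[of i] comp(2)[of k] jc unfolding m_def by linarith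
  qed
  ultimately show ?thesis using z'(1) by (auto simp: Gset_def hyper_def)
 qed
 moreover have "0 < m" using c by (simp add: m_def)
 ultimately show ?thesis by blast
qed

abbreviation \<pi> where "\<pi> j \<equiv> closest_point (Gset j)"

lemma \<pi>_in: "\<pi> j z \<in> Gset j" by (rule closest_point_in_set[OF closed_Gset Gset_ne])

lemma \<pi>_lipschitz: "norm (\<pi> j z - \<pi> j z') <= norm (z - z')"
 using closest_point_lipschitz[OF convex_Gset closed_Gset Gset_ne, of j z z'] by (simp add: dist_norm)

text \<open>If z were outside, a small move from its projection towards z would stay in
  \<open>Gset j\<close> and be closer to z.\<close>

lemma \<pi>_fixed:
 assumes a: "0 < a" and m: "!!z'. z' \<in> hyper ==> norm (z' - \<pi> j z) <= a ==> z' \<in> Gset j" and z: "z \<in> hyper"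
 shows "\<pi> j z = z"
proof (rule ccontr)
 assume ne: "\<pi> j z ~= z"
 define D where "D = norm (z - \<pi> j z)"
 have D: "0 < D" using ne by (simp add: D_def)
 define v where "v = min 1 (a / D)"
 have v: "0 < v" "v <= 1" "v * D <= a" using D a by (auto simp: v_def min_def field_simps)
 define y where "y = \<pi> j z + v *\<^sub>R (z - \<pi> j z)"
 have "\<pi> j z \<in> hyper" using \<pi>_in Gset_hyper by blast
 hence "y \<in> hyper" using z by (simp add: y_def hyper_def sum.distrib sum_subtractf flip: sum_distrib_left)
 moreover have "norm (y - \<pi> j z) <= a" using v by (simp add: y_def D_def)
 ultimately have "y \<in> Gset j" by (rule m)
 from closest_point_le[OF closed_Gset this, of z] have "D <= norm (z - y)" by (simp add: dist_norm D_def)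
 also have "z - y = (1 - v) *\<^sub>R (z - \<pi> j z)" by (simp add: y_def algebra_simps)
 also have "norm ... = (1 - v) * D" using v by (simp add: D_def)
 finally show False using mult_pos_pos[OF v(1) D] by (simp add: algebra_simps)
qed

end

lemma uniformly_continuous_on_mono:
 fixes f :: "'a::metric_space => 'b::metric_space"
 shows "uniformly_continuous_on A f ==> B \<subseteq> A ==> uniformly_continuous_on B f"
 unfolding uniformly_continuous_on_def by (meson subsetD)

context wasserstein_control
begin

definition Gm0 :: "real^'n => (real^'n) \<times> (real^'n)" where "Gm0 a = (0, - a)"
definition Sg0 :: "real^'n => (real^'n) \<times> (real^'n)" where "Sg0 y = (0, - (diag_matrix s *v y))"

section \<open>Projected coefficients and truncated Lyapunov functions\<close>

lemma diag_mult: "(diag_matrix s *v y) $ i = s $ i * y $ i" by (simp add: diag_matrix_def matrix_vector_mult_def if_distrib[where f="%x. x * _"] cong: if_cong)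

definition smax where "smax = (\<Sum>i\<in>UNIV. abs (s $ i))"

lemma smax_nn: "0 <= smax" by (simp add: smax_def sum_nonneg)

lemma norm_le_smax: "(!!k. abs (v $ k) <= abs (s $ k) * r) ==> norm v <= smax * r" for v :: "real^'n"
 unfolding smax_def sum_distrib_right by (intro order_trans[OF norm_le_l1_cart] sum_mono)

text \<open>The projection is a contraction, so the composed drift is bounded and Lipschitz on the
  whole space, and unchanged on \<open>Gset j\<close>.\<close>

definition bG where "bG j z = b0 (\<pi> j z)"

text \<open>A power of the energy, made bounded and uniformly continuous by projection and by the
  cap, so that it can serve as a cost of a bounded problem.\<close>

definition psi where "psi q m j z = min (eta (\<pi> j z) ^ q) (m ^ q)"

lemma lin_Gm0: "bounded_linear Gm0" and lin_Sg0: "bounded_linear Sg0" unfolding Gm0_def[abs_def] Sg0_def[abs_def]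
 by (intro bounded_linear_Pair bounded_linear_zero bounded_linear_minus bounded_linear_ident matrix_vector_mul_bounded_linear)+

lemma eta_bounded: "EX B. \<forall>z\<in>Gset j. 1 <= eta z & eta z <= B"
proof -
 obtain B where "!!z. z \<in> Gset j ==> H0 (fst z) (snd z) <= B" using H0_bounded_Gset by blast
 thus ?thesis using eta_ge_1[OF Gset_simplex] by (intro exI[of _ "B - lowb + 1"]) (auto simp: eta_def)
qed

lemma psi_uc: "uniformly_continuous_on UNIV (psi q m j)" and psi_bd: "1 <= m ==> abs (psi q m j z) <= m ^ q" "1 <= m ==> 0 <= psi q m j z"
proof -
 obtain L where L: "0 < L" "!!z z'. z \<in> Gset j ==> z' \<in> Gset j ==> abs (eta z - eta z') <= L * norm (z - z')"
  using Gset_bounds[of j] by blast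
 obtain B where "\<forall>z\<in>Gset j. 1 <= eta z & eta z <= B" using eta_bounded by blast
 hence B: "eta (\<pi> j z) \<in> {1..B}" for z using \<pi>_in[of j z] by simp
 have "abs (eta (\<pi> j z) - eta (\<pi> j z')) <= L * norm (z - z')" for z z'
  using L(2)[OF \<pi>_in \<pi>_in] \<pi>_lipschitz[of j z z'] L(1) by (meson mult_left_mono order_trans less_imp_le)
 hence "L-lipschitz_on UNIV (%z. eta (\<pi> j z))" using L by (simp add: lipschitz_on_def dist_norm)
 hence 1: "uniformly_continuous_on UNIV (%z. eta (\<pi> j z))" by (rule lipschitz_on_uniformly_continuous)
 have "uniformly_continuous_on {1..B} (%x. min (x ^ q) (m ^ q))" by (intro compact_uniformly_continuous continuous_intros) auto
 hence "uniformly_continuous_on (range (%z. eta (\<pi> j z))) (%x. min (x ^ q) (m ^ q))" by (rule uniformly_continuous_on_mono) (use B in auto)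
 from uniformly_continuous_on_compose[OF 1 this] show "uniformly_continuous_on UNIV (psi q m j)" by (simp add: psi_def[abs_def])
 have "0 <= eta (\<pi> j z) ^ q" using B[of z] by simp
 thus "1 <= m ==> abs (psi q m j z) <= m ^ q" "1 <= m ==> 0 <= psi q m j z" by (auto simp: psi_def)
qed

lemma tangent_hyper:
 assumes z: "z \<in> hyper" and z': "fst z' \<in> simplex_int"
 shows "z + d *\<^sub>R (b0 z' + Gm0 a) + Sg0 y \<in> hyper" using assms tangent
 by (simp add: hyper_def b0_def Gm0_def Sg0_def sum.distrib tangent_to_simplex_def flip: sum_distrib_left)

text \<open>Along the drift the terms \<open>D_rho \<cdot> D_x\<close> cancel (the Hamiltonian is conserved); only the control
  contributes to first order.\<close>
lemma eta_drift:
 assumes z: "z \<in> Gset j" and a: "a \<in> cball 0 l" and d: "0 < d"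
  and K: "!!z. z \<in> Gset j ==> norm (b0 z) <= K" and L: "0 < L" "!!z z'. z \<in> Gset j ==> z' \<in> Gset j ==> norm (b0 z - b0 z') <= L * norm (z - z')"
  and in_G: "z + d *\<^sub>R (b0 z + Gm0 a) \<in> Gset j" and small: "d * (2 * L * (K + l)\<^sup>2) <= 1"
 shows "eta (z + d *\<^sub>R (b0 z + Gm0 a)) <= eta z * (1 + (l * gc + 1) * d)"
proof -
 define w where "w = b0 z + Gm0 a"
 define v where "v = d *\<^sub>R w"
 define e where "e c = z + c *\<^sub>R v" for c :: real
 have a': "norm a <= l" using a by simp
 have "norm w <= norm (b0 z) + norm (Gm0 a)" unfolding w_def by (rule norm_triangle_ineq)
 also have "... <= K + l" using K[OF z] a' by (simp add: Gm0_def)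
 finally have w: "norm w <= K + l" .
 hence B: "0 <= K + l" using norm_ge_zero order_trans by blast
 have zeG: "e c \<in> Gset j" if "0 <= c" "c <= 1" for c
 proof -
  have "e c = (1 - c) *\<^sub>R z + c *\<^sub>R (z + d *\<^sub>R w)" by (simp add: e_def v_def algebra_simps)
  thus ?thesis using convex_Gset[of j, unfolded convex_alt] z in_G that unfolding w_def by auto
 qed
 have D: "((%c. eta (e c)) has_real_derivative (fst v \<bullet> D_rho H0 (fst (e c)) (snd (e c)) + snd v \<bullet> D_x H0 (fst (e c)) (snd (e c)))) (at c)"
  if "0 <= c" "c <= 1" for c
 proof -
  have 1: "(e has_derivative (%t. t *\<^sub>R v)) (at c)" unfolding e_def by (auto intro!: derivative_eq_intros)
  have 2: "((%p. H0 (fst p) (snd p)) has_derivative (%d. fst d \<bullet> D_rho H0 (fst (e c)) (snd (e c)) + snd d \<bullet> D_x H0 (fst (e c)) (snd (e c)))) (at (e c))"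
   using H0_derivative[OF Gset_simplex[OF zeG[OF that]], of "snd (e c)"] by simp
  have "((%c. H0 (fst (e c)) (snd (e c))) has_real_derivative (fst v \<bullet> D_rho H0 (fst (e c)) (snd (e c)) + snd v \<bullet> D_x H0 (fst (e c)) (snd (e c)))) (at c)"
   using has_derivative_compose[OF 1 2] unfolding has_field_derivative_def by (rule has_derivative_eq_rhs) (auto simp: fun_eq_iff algebra_simps)
  thus ?thesis unfolding eta_def by (auto intro!: derivative_eq_intros)
 qed
 obtain c where c: "0 < c" "c < 1" and mvt: "eta (e 1) - eta (e 0) = (1 - 0) * (fst v \<bullet> D_rho H0 (fst (e c)) (snd (e c)) + snd v \<bullet> D_x H0 (fst (e c)) (snd (e c)))"
  using MVT2[of 0 1 "%c. eta (e c)" "%c. fst v \<bullet> D_rho H0 (fst (e c)) (snd (e c)) + snd v \<bullet> D_x H0 (fst (e c)) (snd (e c))"] D by auto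
 define i where "i = b0 (e c) - b0 z"
 have i: "norm i <= L * (d * (K + l))"
 proof -
  have "norm i <= L * norm (e c - z)" unfolding i_def using c by (intro L(2) zeG z) auto
  also have "norm (e c - z) = c * (d * norm w)" using c d by (simp add: e_def v_def)
  also have "L * (c * (d * norm w)) <= L * (1 * (d * (K + l)))" using c d w L(1) by (intro mult_left_mono mult_mono) auto
  finally show ?thesis by simp
 qed
 define p where "p = D_x H0 (fst z) (snd z)"
 have pz: "fst (b0 z) = p" by (simp add: b0_def p_def)
 have "fst v \<bullet> D_rho H0 (fst (e c)) (snd (e c)) + snd v \<bullet> D_x H0 (fst (e c)) (snd (e c))
  = d * (- (fst w \<bullet> snd (b0 (e c))) + snd w \<bullet> fst (b0 (e c)))" by (simp add: v_def b0_def algebra_simps)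
 also have "- (fst w \<bullet> snd (b0 (e c))) + snd w \<bullet> fst (b0 (e c)) = - (a \<bullet> p) - fst w \<bullet> snd i + snd w \<bullet> fst i"
  using pz by (simp add: w_def i_def Gm0_def inner_diff_left inner_diff_right inner_add_left inner_commute)
 also have "... <= l * norm p + norm w * norm i + norm w * norm i"
 proof -
  have "- (a \<bullet> p) <= l * norm p" using Cauchy_Schwarz_ineq2[of a p] mult_right_mono[OF a' norm_ge_zero, of p] by linarith
  moreover have "- (fst w \<bullet> snd i) <= norm w * norm i"
   using Cauchy_Schwarz_ineq2[of "fst w" "snd i"] norm_fst_le[of "fst w" "snd w"] norm_snd_le[of "snd i" "fst i"]
    mult_mono[of "norm (fst w)" "norm w" "norm (snd i)" "norm i"] by simp
  moreover have "snd w \<bullet> fst i <= norm w * norm i"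
   using Cauchy_Schwarz_ineq2[of "snd w" "fst i"] norm_snd_le[of "snd w" "fst w"] norm_fst_le[of "fst i" "snd i"]
    mult_mono[of "norm (snd w)" "norm w" "norm (fst i)" "norm i"] by simp
  ultimately show ?thesis by linarith
 qed
 also have "... <= l * (gc * eta z) + (K + l) * (L * (d * (K + l))) + (K + l) * (L * (d * (K + l)))"
 proof -
  have "norm p <= gc * eta z" using growth_eta(1)[OF Gset_simplex[OF z], of "snd z"] by (simp add: p_def)
  hence "l * norm p <= l * (gc * eta z)" using l_pos by (intro mult_left_mono) auto
  moreover have "norm w * norm i <= (K + l) * (L * (d * (K + l)))" using w i B by (intro mult_mono) auto
  ultimately show ?thesis by linarith
 qed
 also have "... = l * gc * eta z + d * (2 * L * (K + l)\<^sup>2)" by (simp add: power2_eq_square)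
 \<comment> \<open>The error of freezing the vector field is at most 1 by \<open>small\<close>,
   hence at most \<open>eta z\<close>.\<close>
 also have "... <= l * gc * eta z + 1 * eta z" using small eta_ge_1[OF Gset_simplex[OF z]] by linarith
 finally have "eta (e 1) - eta (e 0) <= d * (l * gc * eta z + 1 * eta z)" using d mvt by simp
 thus ?thesis by (simp add: e_def v_def w_def algebra_simps)
qed

text \<open>Cutting off the Gaussian increment at a box costs only \<open>O(d\<^sup>2)\<close>; inside the box only second
  differences in the momentum directions enter.\<close>
lemma gauss_step_le:
 fixes f v :: "(real^'n) \<times> (real^'n) => real"
 assumes d: "0 < d" and r: "0 < r" and cont: "continuous_on UNIV (%x. f (fst z, x))"
  and N: "!!u. (!!k. abs (u $ k) <= abs (s $ k) * r) ==> (fst z, snd z + u) \<in> N"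
  and sd: "!!i x u. (!!t. abs t <= abs u ==> (fst z, x + t *\<^sub>R axis i 1) \<in> N) ==>
   f (fst z, x + u *\<^sub>R axis i 1) + f (fst z, x - u *\<^sub>R axis i 1) - 2 * f (fst z, x) <= u\<^sup>2 * c i"
  and v[measurable]: "v \<in> borel_measurable borel" and vK: "!!z. abs (v z) <= K"
  and le: "!!x. (fst z, x) \<in> N ==> v (fst z, x) <= f (fst z, x) + X"
  and p: "p = measure (gauss d) (- rbox r :: (real^'n) set)"
 shows "(LINT y|gauss d. v (z + Sg0 y)) <= (f z + X) * (1 - p)
  + (\<Sum>i\<in>UNIV. (s $ i)\<^sup>2 * c i * box_var d r i) / 2 + K * p"
proof -
 interpret gs: prob_space "gauss d :: (real^'n) measure" by (rule prob_space_gauss) fact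
 define H where "H y = f (z + Sg0 y)" for y
 have S: "z + Sg0 y = (fst z, snd z + (- (diag_matrix s *v y)))" for y by (simp add: Sg0_def prod_eq_iff)
 have contH: "continuous_on UNIV H"
  unfolding H_def S by (intro continuous_on_compose2[OF cont] continuous_intros linear_continuous_on matrix_vector_mul_bounded_linear) auto
 have NS: "z + Sg0 y \<in> N" if "y \<in> rbox r" for y unfolding S using that by (intro N) (auto simp: diag_mult abs_mult rbox_def intro!: mult_left_mono)
 have sym: "(LINT y|gauss d. indicator (rbox r) y * H y) <= H 0 * measure (gauss d) (rbox r :: (real^'n) set)
  + (\<Sum>i\<in>UNIV. (s $ i)\<^sup>2 * c i * box_var d r i) / 2"
 proof (rule gauss_symmetrize[OF d r contH])
  fix i and y :: "real^'n" and a :: real assume y: "y \<in> rbox r" "y $ i = 0" "abs a <= r"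
  define x where "x = snd z + (- (diag_matrix s *v y))"
  have e: "z + Sg0 (y + a *\<^sub>R axis i 1) = (fst z, x - (a * s $ i) *\<^sub>R axis i 1)"
   "z + Sg0 (y - a *\<^sub>R axis i 1) = (fst z, x + (a * s $ i) *\<^sub>R axis i 1)" "z + Sg0 y = (fst z, x)"
   unfolding S x_def by (auto simp: vec_eq_iff diag_mult axis_def algebra_simps)
  have "(fst z, x + t *\<^sub>R axis i 1) \<in> N" if t: "abs t <= abs (a * s $ i)" for t unfolding x_def add.assoc
  proof (rule N)
   fix k
   have "abs (s $ i) * abs a <= abs (s $ i) * r" by (intro mult_left_mono y(3)) simp
   hence "abs t <= abs (s $ i) * r" using t by (simp add: abs_mult mult.commute)
   thus "abs ((- (diag_matrix s *v y) + t *\<^sub>R axis i 1) $ k) <= abs (s $ k) * r"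
    using y(1,2) by (cases "k = i") (auto simp: diag_mult axis_def abs_mult rbox_def intro!: mult_left_mono)
  qed
  from sd[OF this, of "a * s $ i"] show "H (y + a *\<^sub>R axis i 1) + H (y - a *\<^sub>R axis i 1) - 2 * H y <= a\<^sup>2 * ((s $ i)\<^sup>2 * c i)"
   unfolding H_def e by (simp add: power_mult_distrib mult.assoc)
 qed
 have pc: "measure (gauss d) (rbox r :: (real^'n) set) = 1 - p" using gs.prob_compl[of "rbox r"] by (simp add: p Compl_eq_Diff_UNIV)
 have [measurable]: "Sg0 \<in> borel_measurable borel" by (rule borel_measurable_continuous_onI[OF linear_continuous_on[OF lin_Sg0]])
 have i: "integrable (gauss d) (indicat_real (- rbox r :: (real^'n) set))" "integrable (gauss d) (indicat_real (rbox r :: (real^'n) set))"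
  by (rule gs.integrable_const_bound[where B=1]; auto simp: Compl_eq_Diff_UNIV)+
 have iH: "integrable (gauss d) (%y. indicator (rbox r) y * H y)" using integrable_rbox[OF d contH, of "%y. y"] by simp
 have "(LINT y|gauss d. v (z + Sg0 y)) <= (LINT y|gauss d. indicator (rbox r) y * H y + X * indicator (rbox r) y + K * indicator (- rbox r) y)"
 proof (rule integral_mono)
  show "integrable (gauss d) (%y. v (z + Sg0 y))" by (rule gs.integrable_const_bound[where B=K]) (auto simp: vK simp del: split_paired_All)
  show "v (z + Sg0 y) <= indicator (rbox r) y * H y + X * indicator (rbox r) y + K * indicator (- rbox r) y" for y
   using NS[of y] le[of "snd (z + Sg0 y)"] vK[of "z + Sg0 y"] by (cases "y \<in> rbox r") (auto simp: S H_def)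
 qed (use i iH in auto)
 also have "... = (LINT y|gauss d. indicator (rbox r) y * H y) + X * (1 - p) + K * p"
  using i iH by (simp add: pc p[symmetric] Compl_eq_Diff_UNIV[symmetric])
 finally show ?thesis using sym unfolding pc by (simp add: H_def Sg0_def distrib_right flip: zero_prod_def)
qed

definition dissip where
 "dissip C q m j d0 \<longleftrightarrow> 0 < d0 & (ALL d z a. 0 < d --> d <= d0 --> z \<in> hyper --> a \<in> cball 0 l -->
  (LINT y|gauss d. psi q m j (z + d *\<^sub>R (bG j z + Gm0 a) + Sg0 y)) <= exp (C * d) * psi q m j z)"

text \<open>The order of quantifiers is the point: C is fixed before the cap m and the index j, and
  only the admissible mesh depends on them. At or above the cap the inequality is trivial; below it
  the margin keeps a step with increment in the cube inside \<open>Gset j\<close>, where the energy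
  at most doubles.\<close>

lemma one_step:
 assumes q: "2 <= q"
 shows "\<exists>C\<ge>0. \<forall>m\<ge>1. EX j0. \<forall>j\<ge>j0. EX d0. dissip C q m j d0"
proof -
 define w where "w = (real q)\<^sup>2 * (gc\<^sup>2 + gc)"
 have ka0: "0 <= w" using gc_nn by (simp add: w_def)
 define S where "S = (\<Sum>i\<in>UNIV. (s $ i)\<^sup>2)"
 have S0: "0 <= S" by (simp add: S_def sum_nonneg)
 define c1 where "c1 = real q * (l * gc + 1)"
 \<comment> \<open>The factor \<open>2 ^ q\<close> comes from the doubling of the energy within one
   step, the summand 1 from the Gaussian tail.\<close>
 define c2 where "c2 = S * w * 2 ^ q / 2 + 1"
 have c0: "0 <= c1" "0 <= c2" using l_pos gc_nn ka0 S0 by (auto simp: c1_def c2_def)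
 have main: "EX j0. \<forall>j\<ge>j0. EX d0. dissip (c1 + c2) q m j d0" if m: "1 <= m" for m
 proof -
  obtain j0 A where A: "0 < A" and marg: "!!j z z'. j >= j0 ==> fst z \<in> simplex_int ==> eta z <= m ==> z' \<in> hyper ==> norm (z' - z) <= A ==> z' \<in> Gset j"
   using level_set_margin[of m] by blast
  show ?thesis
  proof (intro exI[of _ j0] allI impI)
   fix j assume j: "j0 <= j"
   obtain K L where L0: "0 < L" and K0: "0 <= K" and K: "!!z. z \<in> Gset j ==> norm (b0 z) <= K" and
    Lb: "!!z z'. z \<in> Gset j ==> z' \<in> Gset j ==> norm (b0 z - b0 z') <= L * norm (z - z')" and
    Le: "!!z z'. z \<in> Gset j ==> z' \<in> Gset j ==> abs (eta z - eta z') <= L * norm (z - z')"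
    using Gset_bounds[of j] by blast
   define B where "B = K + l"
   have B: "0 < B" using K0 l_pos by (simp add: B_def)
   \<comment> \<open>Drift and noise may each move the state by e: together they stay within the
     margin A and change the energy by at most 1, hence at most double it.\<close>
   define e where "e = min (A / 2) (1 / (2 * L))"
   have e: "0 < e" "e + e <= A" "L * (e + e) <= 1" using A L0 by (auto simp: e_def min_def field_simps)
   define r where "r = e / (1 + smax)"
   have r: "0 < r" "smax * r <= e" using e smax_nn by (auto simp: r_def divide_simps)
   \<comment> \<open>The three bounds make the drift displacement at most e, the second order error
     of the drift at most 1, and the tail, weighted with the cap \<open>m ^ q\<close>, at most
     d.\<close>
   define d0 where "d0 = min (e / B) (min (1 / (2 * L * B\<^sup>2)) (r ^ 4 / (3 * real CARD('n) * m ^ q)))"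
   have Mq: "0 < m ^ q" "1 <= m ^ q" using m by auto
   have d0: "0 < d0" using e B L0 r Mq by (auto simp: d0_def)
   have "(LINT y|gauss d. psi q m j (z + d *\<^sub>R (bG j z + Gm0 a) + Sg0 y)) <= exp ((c1 + c2) * d) * psi q m j z"
    if d: "0 < d" "d <= d0" and z: "z \<in> hyper" and a: "a \<in> cball 0 l" for d z a
   proof -
    interpret gs: prob_space "gauss d :: (real^'n) measure" by (rule prob_space_gauss) fact
    have e1: "1 <= eta (\<pi> j y)" for y by (rule eta_ge_1[OF Gset_simplex[OF \<pi>_in]])
    show ?thesis
    proof (cases "eta (\<pi> j z) < m")
     \<comment> \<open>The truncated function is at its maximal value here, so its mean cannot
       exceed it.\<close>
     case False
     hence "m ^ q <= eta (\<pi> j z) ^ q" using m by (intro power_mono) auto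
     hence "psi q m j z = m ^ q" by (simp add: psi_def)
     moreover have "(LINT y|gauss d. psi q m j (z + d *\<^sub>R (bG j z + Gm0 a) + Sg0 y)) <= (LINT y|(gauss d :: (real^'n) measure). m ^ q)"
      using Mq by (intro integral_mono') (auto simp: psi_def)
     moreover have "1 * m ^ q <= exp ((c1 + c2) * d) * m ^ q" using c0 d Mq by (intro mult_right_mono) auto
     ultimately show ?thesis using gs.prob_space by simp
    next
     case True
     have \<pi>z: "\<pi> j z = z" using True by (intro \<pi>_fixed[OF A _ z] marg[OF j Gset_simplex[OF \<pi>_in]]) auto
     hence zG: "z \<in> Gset j" using \<pi>_in[of j z] by simp
     note zs = Gset_simplex[OF zG]
     have ez: "1 <= eta z" "eta z <= m" using e1[of z] True \<pi>z by auto
     have psiz: "psi q m j z = eta z ^ q" using ez \<pi>z by (simp add: psi_def power_mono min_absorb1)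
     define z1 where "z1 = z + d *\<^sub>R (b0 z + Gm0 a)"
     have "d <= e / B" "d <= 1 / (2 * L * B\<^sup>2)" "d <= r ^ 4 / (3 * real CARD('n) * m ^ q)" using d(2) by (auto simp: d0_def)
     hence dB: "d * B <= e" and dL: "d * (2 * L * B\<^sup>2) <= 1" and dM: "m ^ q * (3 * real CARD('n) * d\<^sup>2 / r ^ 4) <= d"
     proof -
      show "d * B <= e" using \<open>d <= e / B\<close> B by (simp add: pos_le_divide_eq)
      have "0 < 2 * L * B\<^sup>2" using L0 B by simp
      thus "d * (2 * L * B\<^sup>2) <= 1" using \<open>d <= 1 / (2 * L * B\<^sup>2)\<close> by (metis pos_le_divide_eq)
      have "0 < 3 * real CARD('n) * m ^ q" using Mq by simp
      hence "d * (3 * real CARD('n) * m ^ q) <= r ^ 4" using \<open>d <= r ^ 4 / _\<close> by (metis pos_le_divide_eq)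
      hence "d * (d * (3 * real CARD('n) * m ^ q)) <= d * r ^ 4" using d by (intro mult_left_mono) auto
      thus "m ^ q * (3 * real CARD('n) * d\<^sup>2 / r ^ 4) <= d" using r by (simp add: pos_divide_le_eq power2_eq_square mult_ac)
     qed
     have "norm (b0 z + Gm0 a) <= B" using K[OF zG] a norm_triangle_ineq[of "b0 z" "Gm0 a"] by (simp add: Gm0_def B_def)
     hence z1z: "norm (z1 - z) <= e" using d dB by (simp add: z1_def) (meson mult_left_mono order_trans less_imp_le)
     have z1h: "z1 \<in> hyper" using tangent_hyper[OF z zs, of d a 0] by (simp add: z1_def Sg0_def flip: zero_prod_def)
     have reg: "(fst z1, snd z1 + v) \<in> Gset j & eta (fst z1, snd z1 + v) <= 2 * eta z"
      if v: "!!k. abs (v $ k) <= abs (s $ k) * r" for v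
     proof -
      have "norm v <= e" using norm_le_smax[OF v] r by linarith
      moreover have eq: "(fst z1, snd z1 + v) - z = (z1 - z) + (0, v)" by (simp add: prod_eq_iff)
      ultimately have n: "norm ((fst z1, snd z1 + v) - z) <= e + e" unfolding eq using z1z by (intro norm_triangle_le add_mono) auto
      have h: "(fst z1, snd z1 + v) \<in> hyper" using z1h by (simp add: hyper_def)
      have G: "(fst z1, snd z1 + v) \<in> Gset j" using n e by (intro marg[OF j zs ez(2) h]) auto
      have "L * norm ((fst z1, snd z1 + v) - z) <= L * (e + e)" using n L0 by (intro mult_left_mono) auto
      hence "eta (fst z1, snd z1 + v) <= eta z + 1" using Le[OF G zG] e by linarith
      thus ?thesis using G ez by auto
     qed
     have z1G: "z1 \<in> Gset j" using reg[of 0] r by simp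
     note z1s = Gset_simplex[OF z1G]
     define p where "p = measure (gauss d) (- rbox r :: (real^'n) set)"
     have ez1: "1 <= eta z1" by (rule eta_ge_1[OF z1s])
     have "(LINT y|gauss d. psi q m j (z1 + Sg0 y)) <= (eta z1 ^ q + 0) * (1 - p)
      + (\<Sum>i\<in>UNIV. (s $ i)\<^sup>2 * (w * (2 * eta z) ^ q) * box_var d r i) / 2 + m ^ q * p"
     proof (rule gauss_step_le[OF d(1) r(1) _ _ _ _ psi_bd(1)[OF m] _ p_def, where f="%z. eta z ^ q" and z=z1 and X=0 and c="%_. w * (2 * eta z) ^ q" and N="{z'. z' \<in> Gset j & eta z' <= 2 * eta z}"])
      show "continuous_on UNIV (%x. eta (fst z1, x) ^ q)"
       unfolding eta_def fst_conv snd_conv by (intro continuous_intros continuous_on_compose2[OF H0_x_derivative(2)[OF z1s]]) auto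
      show "(fst z1, snd z1 + u) \<in> {z'. z' \<in> Gset j & eta z' <= 2 * eta z}" if "!!k. abs (u $ k) <= abs (s $ k) * r" for u
       using reg[OF that] by simp
      show "eta (fst z1, x + u *\<^sub>R axis i 1) ^ q + eta (fst z1, x - u *\<^sub>R axis i 1) ^ q - 2 * eta (fst z1, x) ^ q <= u\<^sup>2 * (w * (2 * eta z) ^ q)"
       if "!!t. abs t <= abs u ==> (fst z1, x + t *\<^sub>R axis i 1) \<in> {z'. z' \<in> Gset j & eta z' <= 2 * eta z}" for i x u
       using eta_power_second_difference[OF z1s q, of u x i "2 * eta z"] that unfolding w_def by blast
      show "psi q m j \<in> borel_measurable borel" by (rule borel_measurable_continuous_onI[OF uniformly_continuous_imp_continuous[OF psi_uc]])
      show "psi q m j (fst z1, x) <= eta (fst z1, x) ^ q + 0" if "(fst z1, x) \<in> {z'. z' \<in> Gset j & eta z' <= 2 * eta z}" for x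
       using that by (simp add: psi_def closest_point_self)
     qed
     also have "... <= (eta z1 ^ q + d / 2 * (S * (w * (2 * eta z) ^ q))) + d * eta z ^ q"
     proof (rule add_mono)
      have "0 <= eta z1 ^ q * p" using ez1 by (simp add: p_def)
      hence "(eta z1 ^ q + 0) * (1 - p) <= eta z1 ^ q" by (simp add: algebra_simps)
      moreover have "(\<Sum>i\<in>UNIV. (s $ i)\<^sup>2 * (w * (2 * eta z) ^ q) * box_var d r i) <= (\<Sum>i\<in>UNIV. (s $ i)\<^sup>2 * (w * (2 * eta z) ^ q) * d)"
       using ka0 ez by (intro sum_mono mult_left_mono integral_gauss_rbox_square d r) auto
      moreover have "... = d * (S * (w * (2 * eta z) ^ q))" by (simp add: S_def sum_distrib_right sum_distrib_left mult_ac)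
      ultimately show "(eta z1 ^ q + 0) * (1 - p) + (\<Sum>i\<in>UNIV. (s $ i)\<^sup>2 * (w * (2 * eta z) ^ q) * box_var d r i) / 2
       <= eta z1 ^ q + d / 2 * (S * (w * (2 * eta z) ^ q))" by linarith
      have "m ^ q * p <= m ^ q * (3 * real CARD('n) * d\<^sup>2 / r ^ 4)" unfolding p_def using Mq by (intro mult_left_mono measure_gauss_rbox_tail d r) auto
      also have "... <= d * 1" using dM by simp
      also have "... <= d * eta z ^ q" using d ez by (intro mult_left_mono) (auto intro: one_le_power)
      finally show "m ^ q * p <= d * eta z ^ q" .
     qed
     also have "... <= exp (c1 * d) * eta z ^ q + c2 * d * eta z ^ q"
     proof -
      have "eta z1 <= eta z * (1 + (l * gc + 1) * d)" unfolding z1_def using z1G dL unfolding z1_def B_def by (intro eta_drift[OF zG a d(1) K L0 Lb]) auto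
      also have "... <= eta z * exp ((l * gc + 1) * d)" using ez exp_ge_add_one_self[of "(l * gc + 1) * d"] by (intro mult_left_mono) auto
      finally have "eta z1 <= eta z * exp ((l * gc + 1) * d)" .
      hence "eta z1 ^ q <= (eta z * exp ((l * gc + 1) * d)) ^ q" using ez1 by (intro power_mono) auto
      also have "... = exp (c1 * d) * eta z ^ q" by (simp add: power_mult_distrib c1_def mult_ac flip: exp_of_nat_mult)
      finally have "eta z1 ^ q <= exp (c1 * d) * eta z ^ q" .
      thus ?thesis by (simp add: c2_def power_mult_distrib algebra_simps)
     qed
     also have "... = (exp (c1 * d) + c2 * d) * eta z ^ q" by (simp add: algebra_simps)
     also have "... <= exp ((c1 + c2) * d) * eta z ^ q"
     proof (rule mult_right_mono)
      have "exp (c1 * d) + c2 * d <= exp (c1 * d) + exp (c1 * d) * (c2 * d)" using mult_right_mono[of 1 "exp (c1 * d)" "c2 * d"] c0 d by simp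
      also have "... = exp (c1 * d) * (1 + c2 * d)" by (simp add: algebra_simps)
      also have "... <= exp (c1 * d) * exp (c2 * d)" by (intro mult_left_mono exp_ge_add_one_self) simp
      finally show "exp (c1 * d) + c2 * d <= exp ((c1 + c2) * d)" by (simp add: distrib_right exp_add)
     qed (use ez in auto)
     finally show ?thesis unfolding psiz by (simp add: z1_def bG_def \<pi>z)
    qed
   qed
   thus "EX d0. dissip (c1 + c2) q m j d0" using d0 unfolding dissip_def by blast
  qed
 qed
 thus ?thesis using c0 by (intro exI[of _ "c1 + c2"]) auto
qed

end

section \<open>The state process\<close>

lemma LBINT_bounded_linear:
 assumes "bounded_linear T" "bdm a b f" "{c..d} \<subseteq> {a..b}"
 shows "(LBINT r:{c..d}. T (f r)) = T (LBINT r:{c..d}. f r)" using integral_bounded_linear[OF assms(1) bdm_integrable[OF assms(2,3), unfolded set_integrable_def]]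
 by (simp add: set_lebesgue_integral_def linear_simps[OF assms(1)])

lemma LBINT_Pair:
 assumes "bdm a b f" "{c..d} \<subseteq> {a..b}"
 shows "(LBINT r:{c..d}. f r) = (LBINT r:{c..d}. fst (f r), LBINT r:{c..d}. snd (f r))"
 by (simp add: prod_eq_iff LBINT_bounded_linear[OF bounded_linear_fst assms] LBINT_bounded_linear[OF bounded_linear_snd assms])

lemma bdm_cong: "(!!r. r \<in> {a..b} ==> f r = g r) ==> bdm a b f = bdm a b g"
 unfolding bdm_def by (intro conj_cong measurable_cong ex_cong ball_cong) auto

lemma borel_measurable_Pair_components:
 "(%w. fst (f w)) \<in> borel_measurable N" "(%w. snd (f w)) \<in> borel_measurable N"
 if "f \<in> borel_measurable N" for f :: "'a => 'b::second_countable_topology \<times> 'c::second_countable_topology"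
 using that by (auto simp flip: borel_prod)

context wasserstein_control
begin

abbreviation Zs where "Zs j \<equiv> bounded_problem.sol W T (bG j) Gm0 Sg0"
abbreviation force where "force \<equiv> bounded_problem.forcing W Gm0 Sg0"
abbreviation Ctl :: "real => (real => 'w => real^'n) set" where "Ctl t \<equiv> controls M \<F> l t T"
abbreviation good where "good w \<equiv> w \<in> space M & continuous_on {0..} (%s. W s w)"

section \<open>The truncated dynamics\<close>

lemma bG_lipschitz: "\<exists>L>0. L-lipschitz_on UNIV (bG j)" and bG_bounded: "EX K. ALL z. norm (bG j z) <= K"
proof -
 obtain K L where L: "0 < L" and K: "!!z. z \<in> Gset j ==> norm (b0 z) <= K" and
  Lb: "!!z z'. z \<in> Gset j ==> z' \<in> Gset j ==> norm (b0 z - b0 z') <= L * norm (z - z')" using Gset_bounds[of j] by blast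
 have "norm (bG j z - bG j z') <= L * norm (z - z')" for z z'
  unfolding bG_def using Lb[OF \<pi>_in \<pi>_in] \<pi>_lipschitz[of j z z'] L by (meson mult_left_mono order_trans less_imp_le)
 thus "\<exists>L>0. L-lipschitz_on UNIV (bG j)" using L by (intro exI[of _ L]) (auto simp: lipschitz_on_def dist_norm)
 show "EX K. ALL z. norm (bG j z) <= K" unfolding bG_def using K[OF \<pi>_in] by blast
qed

lemma bdm_bG: "continuous_on {t..T'} X ==> bdm t T' (%r. bG j (X r))" using bG_lipschitz[of j] bdm_lipschitz[OF _ bdm_continuous] by blast

lemma bp_exists:
 assumes f: "!!p. abs (f p) <= B" "uniformly_continuous_on UNIV f" and g: "!!z. abs (g z) <= B" "uniformly_continuous_on UNIV g"
 shows "EX L K. bounded_problem M \<F> W l T L K (bG j) Gm0 Sg0 f g"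
proof -
 obtain L where L: "0 < L" "L-lipschitz_on UNIV (bG j)" using bG_lipschitz by blast
 obtain K where K: "!!z. norm (bG j z) <= K" using bG_bounded by blast
 have "bounded_problem M \<F> W l T L (max K B) (bG j) Gm0 Sg0 f g"
 proof (intro bounded_problem.intro bounded_problem_axioms.intro brownian_basis_axioms; (fact l_pos T_pos L lin_Gm0 lin_Sg0 f(2) g(2))?)
  show "norm (bG j z) <= max K B" for z using K[of z] by simp
  show "abs (f p) <= max K B" for p using f(1)[of p] by simp
  show "abs (g z) <= max K B" for z using g(1)[of z] by simp
 qed
 thus ?thesis by blast
qed

text \<open>The solution process does not involve costs, so its properties are read off from the
  instance with zero costs.\<close>

lemma Zs_basic:
 shows "0 <= t ==> t <= T ==> V \<in> Ctl t ==> r \<in> {t..T} ==> Zs j t z V r \<in> borel_measurable (\<F> r)"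
  "0 <= t ==> t <= T ==> V \<in> Ctl t ==> good w ==> solves (bG j) t T z (force t V w) (%r. Zs j t z V r w)"
  "Zs j T z V r w = z"
  "force t V w r = Gm0 (LBINT r:{t..r}. V r w) + Sg0 (W r w - W t w)"
proof -
 have u: "uniformly_continuous_on UNIV (%_. 0::real)" by (simp add: uniformly_continuous_on_const)
 obtain L K where "bounded_problem M \<F> W l T L K (bG j) Gm0 Sg0 (%_. 0) (%_. 0)"
  using bp_exists[of "%_. 0" 0 "%_. 0" j, OF _ u _ u] by auto
 then interpret P: bounded_problem M \<F> W l T L K "bG j" Gm0 Sg0 "%_. 0" "%_. 0" .
 show "0 <= t ==> t <= T ==> V \<in> Ctl t ==> r \<in> {t..T} ==> Zs j t z V r \<in> borel_measurable (\<F> r)"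
  by (rule P.sol_measurable)
 show "0 <= t ==> t <= T ==> V \<in> Ctl t ==> good w ==> solves (bG j) t T z (force t V w) (%r. Zs j t z V r w)"
  by (rule P.sol_solves(1))
 show "Zs j T z V r w = z" by (rule P.sol_T)
 show "force t V w r = Gm0 (LBINT r:{t..r}. V r w) + Sg0 (W r w - W t w)" by (rule P.forcing_def)
qed

lemma AE_good: "AE w in M. good w" using W_continuous AE_space by eventually_elim auto

lemma bG_eq: "z \<in> Gset j ==> bG j z = b0 z" by (simp add: bG_def closest_point_self)

lemma simplex_hyper: "fst z \<in> simplex_int ==> z \<in> hyper" by (simp add: hyper_def simplex_int_eq)

lemma Gset_ex:
 assumes "fst z \<in> simplex_int" shows "EX n. z \<in> Gset n"
proof -
 obtain j0 m where "0 < m" "\<forall>j\<ge>j0. ALL y z'. fst y \<in> simplex_int --> eta y <= eta z --> z' \<in> hyper --> norm (z' - y) <= m --> z' \<in> Gset j"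
  using level_set_margin by blast
 hence "z \<in> Gset j0" using assms simplex_hyper[OF assms] by (metis diff_self less_imp_le norm_zero order_refl)
 thus ?thesis ..
qed

lemma eta_continuous: "continuous_on (simplex_int \<times> UNIV) eta" unfolding eta_def[abs_def] by (intro continuous_intros H0_continuous)

lemma compact_Gset:
 assumes S: "compact S" "S \<subseteq> simplex_int \<times> UNIV" shows "EX n. S \<subseteq> Gset n"
proof -
 have "compact (eta ` S)" by (intro compact_continuous_image continuous_on_subset[OF eta_continuous] S)
 from compact_imp_bounded[OF this] obtain R where "\<forall>y\<in>eta ` S. norm y <= R" unfolding bounded_iff by (elim exE)
 hence R: "!!z. z \<in> S ==> eta z <= R" by force
 obtain j0 m where "0 < m" "\<forall>j\<ge>j0. ALL y z'. fst y \<in> simplex_int --> eta y <= R --> z' \<in> hyper --> norm (z' - y) <= m --> z' \<in> Gset j"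
  using level_set_margin by blast
 moreover have "z \<in> hyper" "fst z \<in> simplex_int" if "z \<in> S" for z using S(2) that simplex_hyper by auto
 ultimately have "S \<subseteq> Gset j0" using R by fastforce
 thus ?thesis ..
qed

text \<open>On \<open>Gset j\<close> the original and the projected drift agree, so uniqueness for
  the globally Lipschitz equation applies.\<close>

lemma Gset_path_eq:
 assumes t: "0 <= t" "t <= T" and w: "good w" and V: "V \<in> Ctl t"
  and X: "continuous_on {t..T} X" "!!r. r \<in> {t..T} ==> X r \<in> Gset j"
   "!!r. r \<in> {t..T} ==> X r = z + (LBINT r:{t..r}. b0 (X r)) + force t V w r" and r: "r \<in> {t..T}"
 shows "X r = Zs j t z V r w"
proof -
 have "(LBINT r:{t..r}. b0 (X r)) = (LBINT r:{t..r}. bG j (X r))" if "r \<in> {t..T}" for r using that X(2) by (intro set_lebesgue_integral_cong) (auto simp: bG_eq)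
 hence "solves (bG j) t T z (force t V w) X" unfolding solves_def using X(1,3) by auto
 moreover obtain L where "0 < L" "L-lipschitz_on UNIV (bG j)" using bG_lipschitz by blast
 ultimately show ?thesis using solves_unique Zs_basic(2)[OF t V w, of j z] r by blast
qed

text \<open>On such a path the projection is never active; it solves the original equation, and
  enlarging j does not change it.\<close>

definition tame where "tame j t z V w \<longleftrightarrow> (\<forall>r\<in>{t..T}. Zs j t z V r w \<in> Gset j)"

lemma tame_path:
 assumes t: "0 <= t" "t <= T" and w: "good w" and V: "V \<in> Ctl t" and tame: "tame j t z V w"
 shows "continuous_on {t..T} (%r. Zs j t z V r w)"
  "r \<in> {t..T} ==> Zs j t z V r w = z + (LBINT r:{t..r}. b0 (Zs j t z V r w)) + force t V w r"
  "bdm t T (%r. b0 (Zs j t z V r w))"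
proof -
 note s = Zs_basic(2)[OF t V w, of j z]
 show c: "continuous_on {t..T} (%r. Zs j t z V r w)" using s by (simp add: solves_def)
 have eq: "b0 (Zs j t z V r w) = bG j (Zs j t z V r w)" if "r \<in> {t..T}" for r using tame that by (simp add: bG_eq tame_def)
 have "(LBINT r:{t..r}. bG j (Zs j t z V r w)) = (LBINT r:{t..r}. b0 (Zs j t z V r w))" if "r \<in> {t..T}" for r
  using that by (intro set_lebesgue_integral_cong) (auto simp: eq)
 thus "r \<in> {t..T} ==> Zs j t z V r w = z + (LBINT r:{t..r}. b0 (Zs j t z V r w)) + force t V w r"
  using s by (simp add: solves_def)
 show "bdm t T (%r. b0 (Zs j t z V r w))" using bdm_bG[OF c, of j] bdm_cong[of t T "%r. b0 (Zs j t z V r w)", OF eq] by simp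
qed

lemma tame_stable:
 assumes t: "0 <= t" "t <= T" and w: "good w" and V: "V \<in> Ctl t" and tame: "tame j t z V w" and j: "j <= j'"
 shows "r \<in> {t..T} ==> Zs j' t z V r w = Zs j t z V r w" "tame j' t z V w"
proof -
 have G: "Zs j t z V r w \<in> Gset j'" if "r \<in> {t..T}" for r using tame that Gset_mono[OF j] by (auto simp: tame_def)
 show *: "r \<in> {t..T} ==> Zs j' t z V r w = Zs j t z V r w" for r
  using Gset_path_eq[OF t w V tame_path(1)[OF assms(1-5)] G tame_path(2)[OF assms(1-5)]] by simp
 show "tame j' t z V w" using G * by (simp add: tame_def)
qed

definition lyap where
 "lyap C q m j t z V \<longleftrightarrow> (ALL w r. good w --> r \<in> {t..T} --> Zs j t z V r w \<in> hyper) &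
  (let Y = (%w. (LBINT r:{t..T}. psi q m j (Zs j t z V r w)) + psi q m j (Zs j t z V T w)) in
   integrable M Y & (LINT w|M. Y w) <= C * psi q m j z) &
  (\<forall>v>0. \<exists>Bad\<in>sets M. v * prob Bad <= C * psi q m j z &
   (ALL w. good w --> w \<notin> Bad --> (\<forall>r\<in>{t..T}. psi q m j (Zs j t z V r w) <= v)))"

text \<open>The truncated power \<open>psi\<close> is used both as running and as terminal cost. The
  constant depends only on q and the data, not on the cap m or the index j.\<close>

lemma lyapunov:
 assumes q: "2 <= q"
 shows "\<exists>C\<ge>1. \<forall>m\<ge>1. EX j0. \<forall>j\<ge>j0. ALL t z V. 0 <= t --> t <= T --> z \<in> hyper --> V \<in> Ctl t -->
  lyap C q m j t z V"
proof -
 obtain C0 where C0: "0 <= C0" and step: "!!m. 1 <= m ==> EX j0. \<forall>j\<ge>j0. EX d0. dissip C0 q m j d0"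
  using one_step[OF q] by blast
 \<comment> \<open>One constant for both estimates: the moment bound needs the factor
   \<open>1 + T\<close>, the maximal inequality the exponential alone.\<close>
 define C where "C = (1 + T) * exp (C0 * T)"
 have eT: "1 <= exp (C0 * T)" using C0 T_pos by simp
 have "exp (C0 * T) * 1 <= exp (C0 * T) * (1 + T)" using T_pos by (intro mult_left_mono) auto
 hence "exp (C0 * T) <= C" by (simp add: C_def mult.commute)
 hence C: "1 <= C" "exp (C0 * T) <= C" using eT by linarith+
 show ?thesis
 proof (intro exI[of _ C] conjI allI impI C(1))
  fix m :: real assume m: "1 <= m"
  obtain j0 where j0: "!!j. j0 <= j ==> EX d0. dissip C0 q m j d0" using step[OF m] by blast
  show "EX j0. \<forall>j\<ge>j0. ALL t z V. 0 <= t --> t <= T --> z \<in> hyper --> V \<in> Ctl t -->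
   lyap C q m j t z V"
  proof (intro exI[of _ j0] allI impI)
   fix j t z V assume j: "j0 <= j" and t: "0 <= t" "t <= T" and z: "z \<in> hyper" and V: "V \<in> Ctl t"
   obtain d0 where "dissip C0 q m j d0" using j0[OF j] by blast
   note d0 = this[unfolded dissip_def]
   let ?f = "%p::real \<times> ((real^'n) \<times> (real^'n)) \<times> (real^'n). psi q m j (fst (snd p))"
   have "uniformly_continuous_on UNIV (%p::real \<times> ((real^'n) \<times> (real^'n)) \<times> (real^'n). fst (snd p))"
    by (intro bounded_linear.uniformly_continuous_on[OF bounded_linear_fst_comp] bounded_linear.uniformly_continuous_on[OF bounded_linear_snd] uniformly_continuous_on_id bounded_linear_fst bounded_linear_ident)
   from uniformly_continuous_on_compose[OF this uniformly_continuous_on_mono[OF psi_uc]]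
   have "uniformly_continuous_on UNIV ?f" by simp
   then obtain L K where "bounded_problem M \<F> W l T L K (bG j) Gm0 Sg0 ?f (psi q m j)"
    using bp_exists[of ?f "m ^ q" "psi q m j" j] psi_bd(1)[OF m] psi_uc by blast
   then interpret P: bounded_problem M \<F> W l T L K "bG j" Gm0 Sg0 ?f "psi q m j" .
   have "!!d z a y. 0 < d ==> d <= d0 ==> z \<in> hyper ==> P.stepf d z a y \<in> hyper"
    unfolding P.stepf_def bG_def by (intro tangent_hyper Gset_simplex[OF \<pi>_in])
   moreover have "!!d z a. 0 < d ==> d <= d0 ==> z \<in> hyper ==> a \<in> cball 0 l ==> P.Pst d (psi q m j) z a <= exp (C0 * d) * psi q m j z"
    unfolding P.Pst_def P.stepf_def using d0 by blast
   ultimately have ctx: "0 < d0" "0 <= C0" "closed hyper" "!!d z a y. 0 < d ==> d <= d0 ==> z \<in> hyper ==> P.stepf d z a y \<in> hyper"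
    "!!z. 0 <= psi q m j z" "!!d z a. 0 < d ==> d <= d0 ==> z \<in> hyper ==> a \<in> cball 0 l ==> P.Pst d (psi q m j) z a <= exp (C0 * d) * psi q m j z"
    using d0 C0 closed_hyper psi_bd(2)[OF m] by auto
   have Y: "P.costf t z V = (%w. (LBINT r:{t..T}. psi q m j (Zs j t z V r w)) + psi q m j (Zs j t z V T w))"
    by (simp add: P.costf_def[abs_def])
   show "lyap C q m j t z V" unfolding lyap_def Let_def Y[symmetric]
   proof (intro conjI allI impI P.costf_integrable(1)[OF t V sets.top])
    have t1: "t < T \<or> t = T" using t by auto
    show "Zs j t z V r w \<in> hyper" if "good w" "r \<in> {t..T}" for w r using t1
    proof
     assume "t < T"
     from P.sol_in_A[OF ctx t(1) this z V that] show ?thesis .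
    qed (simp add: P.sol_T z del: split_paired_All)
    have psi0: "0 <= psi q m j z" by (rule ctx)
    have le1: "psi q m j z <= C * psi q m j z" using mult_right_mono[OF C(1) psi0] by simp
    show "(LINT w|M. P.costf t z V w) <= C * psi q m j z"
    proof (cases "t = T")
     case True
     thus ?thesis using le1 unfolding Y by (simp add: P.sol_T LBINT_null1 prob_space)
    next
     case False
     hence "t < T" using t by simp
     from P.lyapunov_moment[OF ctx t(1) this z V] show ?thesis by (simp add: C_def)
    qed
    show "\<exists>Bad\<in>sets M. v * prob Bad <= C * psi q m j z &
     (ALL w. good w --> w \<notin> Bad --> (\<forall>r\<in>{t..T}. psi q m j (Zs j t z V r w) <= v))" if v: "0 < v" for v
    proof (cases "t = T")
     case True
     show ?thesis
     proof (cases "psi q m j z <= v")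
      case True
      thus ?thesis using psi0 C(1) \<open>t = T\<close> by (intro bexI[of _ "{}"]) (auto simp: P.sol_T)
     next
      case False
      thus ?thesis using le1 by (intro bexI[of _ "space M"]) (auto simp: prob_space)
     qed
    next
     case False
     hence "t < T" using t by simp
     from P.lyapunov_maximal[OF ctx t(1) this z V v] obtain Bad where Bad: "Bad \<in> sets M" "v * prob Bad <= exp (C0 * T) * psi q m j z"
      "ALL w. good w --> w \<notin> Bad --> (\<forall>r\<in>{t..T}. psi q m j (Zs j t z V r w) <= v)" by blast
     thus ?thesis using mult_right_mono[OF C(2) psi0] by (intro bexI[of _ Bad]) auto
    qed
   qed
  qed
 qed
qed

section \<open>Paths that never meet the truncation\<close>

lemma psi_eta: "z \<in> Gset j ==> psi q m j z = min (eta z ^ q) (m ^ q)" by (simp add: psi_def closest_point_self)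

text \<open>The maximal inequality is applied at half the cap. Below that level the energy at the
  projected point is less than m, and \<open>\<pi>_fixed\<close> shows that the projected point is
  the state itself.\<close>

lemma tame_prob:
 assumes d: "0 < d"
 shows "EX j0. ALL t z V. 0 <= t --> t <= T --> z \<in> Gset n --> V \<in> Ctl t -->
  (\<exists>Bad\<in>sets M. prob Bad <= d & (ALL w. good w --> w \<notin> Bad --> tame j0 t z V w))"
proof -
 from lyapunov[OF order_refl] obtain C where C: "1 <= C" and
  lya: "!!m. 1 <= m ==> EX j0. \<forall>j\<ge>j0. ALL t z V. 0 <= t --> t <= T --> z \<in> hyper --> V \<in> Ctl t --> lyap C 2 m j t z V"
  by blast
 obtain B where B: "!!z. z \<in> Gset n ==> 1 <= eta z & eta z <= B" using eta_bounded by blast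
 \<comment> \<open>Chosen such that \<open>2 * C * B^2 / m^2\<close>, the bound for the exceptional
   probability, is at most d.\<close>
 define m where "m = 1 + 2 * C * B\<^sup>2 / d"
 have m: "1 <= m" using C d by (simp add: m_def)
 have "2 * C * B\<^sup>2 / d * 1 <= m * m" using m C d by (intro mult_mono) (auto simp: m_def)
 hence mB: "2 * C * B\<^sup>2 <= m\<^sup>2 * d" using d by (simp add: power2_eq_square divide_simps)
 obtain j1 where j1: "!!j t z V. j1 <= j ==> 0 <= t ==> t <= T ==> z \<in> hyper ==> V \<in> Ctl t ==> lyap C 2 m j t z V"
  using lya[OF m] by blast
 obtain j2 a where a: "0 < a" and marg: "!!j z z'. j2 <= j ==> fst z \<in> simplex_int ==> eta z <= m ==> z' \<in> hyper ==> norm (z' - z) <= a ==> z' \<in> Gset j"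
  using level_set_margin[of m] by blast
 define j where "j = max n (max j1 j2)"
 show ?thesis
 proof (intro exI[of _ j] allI impI)
  fix t z V assume t: "0 <= t" "t <= T" and z: "z \<in> Gset n" and V: "V \<in> Ctl t"
  have zj: "z \<in> Gset j" using z Gset_mono[of n j] by (auto simp: j_def)
  have zh: "z \<in> hyper" using z Gset_hyper by blast
  have jj: "j1 <= j" by (simp add: j_def)
  have J0: "lyap C 2 m j t z V" by (rule j1[OF jj]) (fact t zh V)+
  note J = J0[unfolded lyap_def]
  have "0 < m\<^sup>2 / 2" using m by simp
  with J obtain Bad where Bad: "Bad \<in> sets M" "m\<^sup>2 / 2 * prob Bad <= C * psi 2 m j z"
   "!!w r. good w ==> w \<notin> Bad ==> r \<in> {t..T} ==> psi 2 m j (Zs j t z V r w) <= m\<^sup>2 / 2" by blast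
  have "psi 2 m j z <= (eta z)\<^sup>2" by (simp add: psi_eta[OF zj])
  also have "... <= B\<^sup>2" using B[OF z] by (intro power_mono) auto
  finally have "C * psi 2 m j z <= C * B\<^sup>2" using C by (intro mult_left_mono) auto
  hence "m\<^sup>2 * prob Bad <= m\<^sup>2 * d" using Bad(2) mB by linarith
  hence "prob Bad <= d" using m by simp
  moreover have "tame j t z V w" if w: "good w" "w \<notin> Bad" for w unfolding tame_def
  proof
   fix r assume r: "r \<in> {t..T}"
   let ?Z = "Zs j t z V r w"
   have "?Z \<in> hyper" using J w r by blast
   have "0 < m\<^sup>2" using m by simp
   hence "(eta (\<pi> j ?Z))\<^sup>2 < m\<^sup>2" using Bad(3)[OF w r] unfolding psi_def by linarith
   hence "eta (\<pi> j ?Z) <= m" using m by (metis less_eq_real_def power2_less_imp_less order_trans zero_le_one)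
   hence "\<pi> j ?Z = ?Z" by (intro \<pi>_fixed[OF a _ \<open>?Z \<in> hyper\<close>] marg[OF _ Gset_simplex[OF \<pi>_in]]) (auto simp: j_def le_max_iff_disj)
   thus "?Z \<in> Gset j" by (metis \<pi>_in)
  qed
  ultimately show "\<exists>Bad\<in>sets M. prob Bad <= d & (ALL w. good w --> w \<notin> Bad --> tame j t z V w)"
   using Bad(1) by blast
 qed
qed

lemma AE_small:
 assumes "!!d. 0 < d ==> \<exists>Bad\<in>sets M. prob Bad <= d & (ALL w. good w --> w \<notin> Bad --> P w)"
 shows "AE w in M. good w & P w"
proof -
 have "ALL i. \<exists>Bad\<in>sets M. prob Bad <= 1 / real (Suc i) & (ALL w. good w --> w \<notin> Bad --> P w)"
  using assms[of "1 / real (Suc _)"] by simp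
 then obtain Bad where Bad: "!!i. Bad i \<in> sets M" "!!i. prob (Bad i) <= 1 / real (Suc i)" "!!i w. good w ==> w \<notin> Bad i ==> P w"
  by metis
 define N where "N = (\<Inter>i. Bad i)"
 have N: "N \<in> sets M" unfolding N_def using Bad(1) by (intro sets.countable_INT') auto
 have "prob N <= 1 / real (Suc i)" for i by (rule order_trans[OF finite_measure_mono Bad(2)]) (auto simp: N_def Bad(1))
 hence "prob N <= 0" by (intro LIMSEQ_le_const[OF LIMSEQ_inverse_real_of_nat]) (auto simp: inverse_eq_divide)
 hence "prob N = 0" by (simp add: order_antisym)
 hence "AE w in M. w \<notin> N" using N by (intro AE_not_in) (simp add: null_sets_def emeasure_eq_measure)
 with AE_good show ?thesis by eventually_elim (use Bad(3) in \<open>auto simp: N_def\<close>)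
qed

lemma AE_tame:
 assumes t: "0 <= t" "t <= T" and z: "fst z \<in> simplex_int" and V: "V \<in> Ctl t"
 shows "AE w in M. good w & (EX j. tame j t z V w)"
proof -
 obtain n where n: "z \<in> Gset n" using Gset_ex[OF z] by blast
 show ?thesis
 proof (rule AE_small)
  fix d :: real assume "0 < d"
  from tame_prob[OF this, of n] show "\<exists>Bad\<in>sets M. prob Bad <= d & (ALL w. good w --> w \<notin> Bad --> (EX j. tame j t z V w))"
   using t n V by blast
 qed
qed

text \<open>On a tame path the sequence is eventually constant in j; writing it as a
  \<open>lim\<close> keeps the process adapted.\<close>

definition Xs where "Xs t z V r w = lim (%j. Zs j t z V r w)"

lemma Xs_eq:
 assumes "0 <= t" "t <= T" "good w" "V \<in> Ctl t" "tame j t z V w" "r \<in> {t..T}"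
 shows "Xs t z V r w = Zs j t z V r w" unfolding Xs_def
 by (intro limI tendsto_eventually eventually_sequentiallyI[of j] tame_stable(1)[OF assms(1-5)] assms(6))

lemma tame_Xs:
 assumes t: "0 <= t" "t <= T" and w: "good w" and V: "V \<in> Ctl t" and tame: "tame j t z V w"
 shows "continuous_on {t..T} (%r. Xs t z V r w)" "r \<in> {t..T} ==> Xs t z V r w \<in> Gset j"
  "r \<in> {t..T} ==> Xs t z V r w = z + (LBINT r:{t..r}. b0 (Xs t z V r w)) + force t V w r"
  "bdm t T (%r. b0 (Xs t z V r w))"
proof -
 note eq = Xs_eq[OF assms]
 show "continuous_on {t..T} (%r. Xs t z V r w)" by (subst continuous_on_cong[OF refl eq]) (auto intro: tame_path(1)[OF assms])
 show "r \<in> {t..T} ==> Xs t z V r w \<in> Gset j" using eq tame by (simp add: tame_def)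
 have "(LBINT r:{t..r}. b0 (Xs t z V r w)) = (LBINT r:{t..r}. b0 (Zs j t z V r w))" if "r \<in> {t..T}" for r
  using that by (intro set_lebesgue_integral_cong) (auto simp: eq)
 thus "r \<in> {t..T} ==> Xs t z V r w = z + (LBINT r:{t..r}. b0 (Xs t z V r w)) + force t V w r"
  using tame_path(2)[OF assms] eq by simp
 show "bdm t T (%r. b0 (Xs t z V r w))"
  using tame_path(3)[OF assms] eq bdm_cong[of t T "%r. b0 (Xs t z V r w)" "%r. b0 (Zs j t z V r w)"] by simp
qed

definition true_path where
 "true_path t z V w X \<longleftrightarrow> continuous_on {t..T} X &
  (\<forall>r\<in>{t..T}. fst (X r) \<in> simplex_int & X r = z + (LBINT r:{t..r}. b0 (X r)) + force t V w r)"

text \<open>A continuous path inside the domain has a compact range, hence lies in some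
  \<open>Gset j\<close> and is identified with the truncated solution there.\<close>

lemma true_path_eq:
 assumes t: "0 <= t" "t <= T" and w: "good w" and V: "V \<in> Ctl t" and X: "true_path t z V w X" and r: "r \<in> {t..T}"
 shows "X r = Xs t z V r w"
proof -
 have "compact (X ` {t..T})" using X by (intro compact_continuous_image) (auto simp: true_path_def)
 moreover have "X ` {t..T} \<subseteq> simplex_int \<times> UNIV"
 proof (intro image_subsetI)
  fix r assume "r \<in> {t..T}"
  hence "fst (X r) \<in> simplex_int" using X unfolding true_path_def by blast
  thus "X r \<in> simplex_int \<times> UNIV" by (simp add: mem_Times_iff)
 qed
 ultimately obtain j where j: "X ` {t..T} \<subseteq> Gset j" using compact_Gset by blast
 have eq: "X r = Zs j t z V r w" if "r \<in> {t..T}" for r by (rule Gset_path_eq[OF t w V _ _ _ that]) (use X j in \<open>auto simp: true_path_def\<close>)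
 hence "tame j t z V w" using j by (auto simp: tame_def)
 thus ?thesis using Xs_eq[OF t w V _ r] eq[OF r] by simp
qed

lemma true_path_components:
 assumes t: "0 <= t" "t <= T" and w: "good w" and V: "V \<in> Ctl t"
 shows "true_path t (p, x) V w (%r. (R r, S r)) \<longleftrightarrow>
  continuous_on {t..T} R & continuous_on {t..T} S &
  (\<forall>r\<in>{t..T}. R r \<in> simplex_int & R r = p + (LBINT r:{t..r}. D_x H0 (R r) (S r)) &
   S r = x - (LBINT r:{t..r}. D_rho H0 (R r) (S r) + V r w) - diag_matrix s *v (W r w - W t w))"
  (is "?l \<longleftrightarrow> ?c & ?d & ?e")
proof -
 have c: "continuous_on {t..T} (%r. (R r, S r)) \<longleftrightarrow> ?c & ?d" by (auto intro: continuous_on_Pair dest: continuous_on_fst continuous_on_snd)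
 have "fst (R r, S r) \<in> simplex_int & (R r, S r) = (p, x) + (LBINT r:{t..r}. b0 (R r, S r)) + force t V w r \<longleftrightarrow>
  R r \<in> simplex_int & R r = p + (LBINT r:{t..r}. D_x H0 (R r) (S r)) &
   S r = x - (LBINT r:{t..r}. D_rho H0 (R r) (S r) + V r w) - diag_matrix s *v (W r w - W t w)"
  if RS: "?c" "?d" "!!r. r \<in> {t..T} ==> R r \<in> simplex_int" and r: "r \<in> {t..T}" for r
 proof -
  have ct: "continuous_on {t..T} (%r. (R r, S r))" using c RS by blast
  have "compact ((%r. (R r, S r)) ` {t..T})" by (intro compact_continuous_image ct) auto
  moreover have "(%r. (R r, S r)) ` {t..T} \<subseteq> simplex_int \<times> UNIV" using RS by auto
  ultimately obtain j where j: "(%r. (R r, S r)) ` {t..T} \<subseteq> Gset j" using compact_Gset by blast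
  have eq: "b0 (R r, S r) = bG j (R r, S r)" if "r \<in> {t..T}" for r using j that by (intro bG_eq[symmetric]) auto
  have b: "bdm t T (%r. b0 (R r, S r))" using bdm_bG[OF ct, of j] bdm_cong[of t T "%r. b0 (R r, S r)", OF eq] by simp
  have sub: "{t..r} \<subseteq> {t..T}" using r by auto
  have i1: "set_integrable lborel {t..r} (%r. - D_rho H0 (R r) (S r))" using bdm_integrable[OF b sub] integrable_bounded_linear[OF bounded_linear_snd]
   by (fastforce simp: set_integrable_def b0_def)
  have i2: "set_integrable lborel {t..r} (%r. V r w)" using w by (intro bdm_integrable[OF control_path(1)[OF V] sub]) auto
  have d: "(LBINT r:{t..r}. D_rho H0 (R r) (S r) + V r w) = - (LBINT r:{t..r}. - D_rho H0 (R r) (S r)) + (LBINT r:{t..r}. V r w)"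
   using set_integral_diff(2)[OF i2 i1] by (simp add: algebra_simps)
  show ?thesis using RS(3)[OF r] unfolding LBINT_Pair[OF b sub] Zs_basic(4) d by (auto simp: b0_def Gm0_def Sg0_def)
 qed
 thus ?thesis unfolding true_path_def c by fastforce
qed

definition Xcost where
 "Xcost t z V w = (LBINT r:{t..T}. F r (fst (Xs t z V r w)) (snd (Xs t z V r w)) (V r w)) + h (fst (Xs t z V T w)) (snd (Xs t z V T w))"

text \<open>The cost functional refers to an unspecified solution. Existence shows that the choice
  is a solution, and pathwise uniqueness identifies its cost with \<open>Xcost\<close> almost
  surely, which is why C is only determined up to null sets.\<close>

lemma cost_functional_eq:
 assumes t: "0 <= t" "t <= T" and a: "a \<in> simplex_int" and V: "V \<in> Ctl t"
 shows "EX C. (AE w in M. C w = Xcost t (a, x) V w) &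
  cost_functional M \<F> W (diag_matrix s) H0 T F h t a x V = real_cond_exp M (\<F> t) C"
proof -
 let ?X = "Xs t (a, x) V"
 let ?S = "%(R, S). solves_state_equation M \<F> W (diag_matrix s) H0 T t a x V R S"
 have "?S (%r w. fst (?X r w), %r w. snd (?X r w))" unfolding solves_state_equation_def prod.case
 proof (intro conjI ballI)
  fix r assume r: "r \<in> {t..T}"
  have "?X r \<in> borel_measurable (\<F> r)" unfolding Xs_def[abs_def] using Zs_basic(1)[OF t V r] by (rule borel_measurable_lim_metric)
  from borel_measurable_Pair_components[OF this]
  show "(%w. fst (?X r w)) \<in> borel_measurable (\<F> r)" "(%w. snd (?X r w)) \<in> borel_measurable (\<F> r)" .
 next
  have tp: "true_path t (a, x) V w (%r. (fst (?X r w), snd (?X r w)))"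
   if "good w" "tame j t (a, x) V w" for w j
   using tame_Xs[OF t that(1) V that(2)] Gset_simplex unfolding true_path_def prod.collapse by blast
  show "AE w in M. continuous_on {t..T} (%r. fst (?X r w)) & continuous_on {t..T} (%r. snd (?X r w)) &
   (\<forall>r\<in>{t..T}. fst (?X r w) \<in> simplex_int &
    fst (?X r w) = a + (LBINT r:{t..r}. D_x H0 (fst (?X r w)) (snd (?X r w))) &
    snd (?X r w) = x - (LBINT r:{t..r}. D_rho H0 (fst (?X r w)) (snd (?X r w)) + V r w) - diag_matrix s *v (W r w - W t w))"
  proof -
   have "AE w in M. good w & (EX j. tame j t (a, x) V w)" using a by (intro AE_tame t V) simp
   thus ?thesis by (rule eventually_mono, elim conjE exE) (subst true_path_components[OF t _ V, symmetric]; (intro tp conjI)?; blast)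
  qed
 qed
 from someI[of ?S, OF this] obtain R S where RS: "(SOME p. ?S p) = (R, S)" and sol: "solves_state_equation M \<F> W (diag_matrix s) H0 T t a x V R S"
  by (cases "SOME p. ?S p") auto
 define C where "C w = (LBINT s:{t..T}. F s (R s w) (S s w) (V s w)) + h (R T w) (S T w)" for w
 have "AE w in M. C w = Xcost t (a, x) V w" using AE_good sol[unfolded solves_state_equation_def, THEN conjunct2]
 proof eventually_elim
  case (elim w)
  hence "true_path t (a, x) V w (%r. (R r w, S r w))" by (subst true_path_components[OF t elim(1) V])
  from true_path_eq[OF t elim(1) V this] have eq: "?X r w = (R r w, S r w)" if "r \<in> {t..T}" for r using that by simp
  have "(LBINT r:{t..T}. F r (fst (?X r w)) (snd (?X r w)) (V r w)) = (LBINT s:{t..T}. F s (R s w) (S s w) (V s w))"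
   by (intro set_lebesgue_integral_cong) (auto simp: eq)
  thus ?case using eq[of T] t by (simp add: C_def Xcost_def)
 qed
 thus ?thesis unfolding cost_functional_def RS by (intro exI[of _ C]) (simp add: C_def[abs_def])
qed

end

section \<open>Truncated costs\<close>

lemma uniformly_continuous_closest_point:
 fixes C :: "'a::euclidean_space set" and a :: "'a => real"
 assumes C: "compact C" "convex C" "C ~= {}" and a: "continuous_on C a"
 shows "uniformly_continuous_on UNIV (%p. min (a (closest_point C p)) N)"
proof -
 have cl: "closed C" using C(1) by (rule compact_imp_closed)
 have "1-lipschitz_on UNIV (closest_point C)" using closest_point_lipschitz[OF C(2) cl C(3)] by (simp add: lipschitz_on_def)
 hence 1: "uniformly_continuous_on UNIV (closest_point C)" by (rule lipschitz_on_uniformly_continuous)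
 have "uniformly_continuous_on C (%p. min (a p) N)" by (intro compact_uniformly_continuous C(1) continuous_intros a)
 hence "uniformly_continuous_on (range (closest_point C)) (%p. min (a p) N)"
  by (rule uniformly_continuous_on_mono) (use closest_point_in_set[OF cl C(3)] in auto)
 from uniformly_continuous_on_compose[OF 1 this] show ?thesis .
qed

lemma bdm_min:
 fixes f :: "real => real"
 assumes "bdm a b f" shows "bdm a b (%r. min (f r) N)"
proof -
 obtain K where K: "!!r. r \<in> {a..b} ==> abs (f r) <= K" using assms unfolding bdm_def real_norm_def by blast
 have "abs (min (f r) N) <= max K \<bar>N\<bar>" if "r \<in> {a..b}" for r using K[OF that] by (auto simp: min_def max_def)
 thus ?thesis using assms unfolding bdm_def real_norm_def by (intro conjI exI[of _ "max K \<bar>N\<bar>"]) auto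
qed

lemma LBINT_range:
 fixes f :: "real => real"
 assumes f: "bdm a b f" and ab: "a <= b" and c: "!!r. r \<in> {a..b} ==> 0 <= f r & f r <= c"
 shows "0 <= (LBINT r:{a..b}. f r)" "(LBINT r:{a..b}. f r) <= c * (b - a)"
proof -
 have "(LBINT r:{a..b}. 0) <= (LBINT r:{a..b}. f r)" by (rule LBINT_mono[OF _ f]) (use c in \<open>auto simp: bdm_continuous\<close>)
 thus "0 <= (LBINT r:{a..b}. f r)" by simp
 have "abs (LBINT r:{a..b}. f r) <= c * (b - a)" using norm_LBINT_le[OF f order_refl ab order_refl, of c] c by simp
 thus "(LBINT r:{a..b}. f r) <= c * (b - a)" by simp
qed

text \<open>Continuity from above: the events that the path exceeds i at some rational time decrease
  to a null event.\<close>

lemma (in brownian_basis) W_sup: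
 assumes a: "0 < a"
 shows "\<exists>R\<ge>0. \<exists>Bad\<in>sets M. prob Bad <= a & (\<forall>w\<in>space M - Bad. continuous_on {0..} (%r. W r w) --> (\<forall>r\<in>{0..T}. norm (W r w) <= R))"
proof -
 \<comment> \<open>Rational times make the union countable; the horizon \<open>T + 1\<close> leaves
   room for a rational time just after r = T.\<close>
 define A where "A i = (\<Union>r\<in>\<rat> \<inter> {0..T + 1}. {w \<in> space M. real i < norm (W r w)})" for i :: nat
 have [measurable]: "W r \<in> borel_measurable M" if "0 <= r" for r using measurable_from_subalg[OF subalgebra_F W_measurable[OF that order_refl]] .
 have AM: "A i \<in> sets M" for i unfolding A_def by (intro sets.countable_UN' countable_subset[OF _ countable_rat]) auto
 have dec: "decseq A" unfolding A_def decseq_def by (intro allI impI UN_mono order_refl Collect_mono) (use le_less_trans of_nat_mono in blast)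
 have "(\<Inter>i. A i) \<subseteq> {w \<in> space M. \<not> continuous_on {0..} (%r. W r w)}"
 proof
  fix w assume w: "w \<in> (\<Inter>i. A i)"
  have "\<not> continuous_on {0..} (%r. W r w)"
  proof
   assume "continuous_on {0..} (%r. W r w)"
   hence "compact ((%r. W r w) ` {0..T + 1})" by (intro compact_continuous_image) (auto elim: continuous_on_subset)
   from compact_imp_bounded[OF this] obtain B where B: "\<forall>y\<in>(%r. W r w) ` {0..T + 1}. norm y <= B" unfolding bounded_iff by (elim exE)
   have "w \<in> A (nat \<lceil>B\<rceil>)" using w by auto
   then obtain r where "r \<in> {0..T + 1}" "real (nat \<lceil>B\<rceil>) < norm (W r w)" unfolding A_def by blast
   moreover have "norm (W r w) <= B" using B calculation(1) by blast
   ultimately show False by linarith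
  qed
  moreover have "w \<in> space M" using w by (auto simp: A_def)
  ultimately show "w \<in> {w \<in> space M. \<not> continuous_on {0..} (%r. W r w)}" by simp
 qed
 moreover have "AE w in M. continuous_on {0..} (%r. W r w)" by (rule W_continuous)
 ultimately have "AE w in M. w \<notin> (\<Inter>i. A i)" by (elim eventually_mono) blast
 hence "prob (\<Inter>i. A i) = prob {}" by (intro finite_measure_eq_AE) (auto simp: AM)
 moreover have "(%i. prob (A i)) \<longlonglongrightarrow> prob (\<Inter>i. A i)" by (rule finite_Lim_measure_decseq[OF _ dec]) (auto simp: AM)
 ultimately have "(%i. prob (A i)) \<longlonglongrightarrow> 0" by simp
 then obtain i where i: "prob (A i) < a" using order_tendstoD(2)[OF _ a] eventually_happens by force
 show ?thesis
 proof (intro exI[of _ "real i"] conjI bexI[of _ "A i"] ballI impI AM)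
  fix w r assume w: "w \<in> space M - A i" and c: "continuous_on {0..} (%r. W r w)" and r: "r \<in> {0..T}"
  show "norm (W r w) <= real i"
  proof (rule ccontr)
   assume "\<not> norm (W r w) <= real i"
   hence "0 < norm (W r w) - real i" by simp
   with c r obtain d where d: "0 < d" "!!r'. r' \<in> {0..} ==> dist r' r < d ==> dist (W r' w) (W r w) < norm (W r w) - real i"
    unfolding continuous_on_iff by (metis atLeastAtMost_iff atLeast_iff)
   obtain r' where r': "r' \<in> \<rat>" "r < r'" "r' < r + min d 1" using Rats_dense_in_real[of r "r + min d 1"] d by auto
   have "dist (W r' w) (W r w) < norm (W r w) - real i" using r r' by (intro d) (auto simp: dist_real_def)
   hence "real i < norm (W r' w)" using norm_triangle_ineq2[of "W r w" "W r' w"] by (simp add: dist_norm norm_minus_commute)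
   hence "w \<in> A i" using r r' w by (auto simp: A_def)
   thus False using w by simp
  qed
 qed (use i in auto)
qed

context wasserstein_control
begin

abbreviation Fz where "Fz p \<equiv> F (fst p) (fst (fst (snd p))) (snd (fst (snd p))) (snd (snd p))"
abbreviation hz where "hz z \<equiv> h (fst z) (snd z)"

section \<open>Costs on compact parts of the domain\<close>

lemma costs_nonneg: "r \<in> {0..T} ==> fst z \<in> simplex_int ==> a \<in> cball 0 l ==> 0 <= Fz (r, z, a)" "fst z \<in> simplex_int ==> 0 <= hz z"
 using costs by (auto simp: admissible_costs_def)

lemma costs_continuous: "continuous_on ({0..T} \<times> (simplex_int \<times> UNIV) \<times> cball 0 l) Fz" "continuous_on (simplex_int \<times> UNIV) hz"
proof -
 have *: "continuous_on ({0..T} \<times> simplex_int \<times> UNIV \<times> cball 0 l) (%(s, r, x, v). F s r x v)"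
  and **: "continuous_on (simplex_int \<times> UNIV) (%(r, x). h r x)" using costs unfolding admissible_costs_def by blast+
 have "continuous_on ({0..T} \<times> (simplex_int \<times> UNIV) \<times> cball 0 l)
   (%p. (%(s, r, x, v). F s r x v) (fst p, fst (fst (snd p)), snd (fst (snd p)), snd (snd p)))"
  by (rule continuous_on_compose2[OF *]) (auto intro!: continuous_intros)
 thus "continuous_on ({0..T} \<times> (simplex_int \<times> UNIV) \<times> cball 0 l) Fz" by simp
 show "continuous_on (simplex_int \<times> UNIV) hz" using ** by (simp add: split_beta')
qed

text \<open>Since \<open>eta\<close> is at least 1, the real exponent can be replaced by a larger
  natural one and the modulus of the energy by a multiple of \<open>eta\<close>.\<close>

lemma cost_growth:
 "EX p C. 1 <= p & 0 <= C & (\<forall>r\<in>{0..T}. ALL z a. fst z \<in> simplex_int --> a \<in> cball 0 l --> Fz (r, z, a) <= C * eta z ^ p & hz z <= C * eta z ^ p)"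
proof -
 obtain p C where p: "0 <= p" "0 < C" and le: "!!s c x v. s \<in> {0..T} ==> c \<in> simplex_int ==> v \<in> cball 0 l ==> max (F s c x v) (h c x) <= C * (abs (H0 c x) powr p + 1)"
  using costs unfolding admissible_costs_def by (elim conjE exE) blast
 define A where "A = 1 + abs (lowb - 1)"
 define m where "m = nat \<lceil>p\<rceil> + 1"
 have "C * (abs (H0 (fst z) (snd z)) powr p + 1) <= C * (A ^ m + 1) * eta z ^ m" if z: "fst z \<in> simplex_int" for z
 proof -
  have e: "1 <= eta z" by (rule eta_ge_1[OF z])
  have "abs (H0 (fst z) (snd z)) <= eta z + abs (lowb - 1) * 1" using e by (simp add: eta_def)
  also have "... <= eta z + abs (lowb - 1) * eta z" using e by (intro add_left_mono mult_left_mono) auto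
  finally have H: "abs (H0 (fst z) (snd z)) <= A * eta z" by (simp add: A_def algebra_simps)
  have "1 * 1 <= A * eta z" using e by (intro mult_mono) (auto simp: A_def)
  hence "(A * eta z) powr p <= (A * eta z) powr real m" by (intro powr_mono) (auto simp: m_def, linarith)
  moreover have "abs (H0 (fst z) (snd z)) powr p <= (A * eta z) powr p" using H p by (intro powr_mono2) auto
  moreover have "(A * eta z) powr real m = A ^ m * eta z ^ m" using \<open>1 * 1 <= A * eta z\<close> by (subst powr_realpow) (auto simp: power_mult_distrib)
  ultimately have "abs (H0 (fst z) (snd z)) powr p + 1 <= A ^ m * eta z ^ m + 1 * eta z ^ m" using one_le_power[OF e, of m] by linarith
  hence "C * (abs (H0 (fst z) (snd z)) powr p + 1) <= C * (A ^ m * eta z ^ m + 1 * eta z ^ m)" using p by (intro mult_left_mono) auto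
  thus ?thesis by (simp add: algebra_simps)
 qed
 note * = order_trans[OF le this]
 have "0 <= C * (A ^ m + 1)" using p by (simp add: A_def)
 moreover have "1 <= m" by (simp add: m_def)
 ultimately show ?thesis using * by (intro exI[of _ m] exI[of _ "C * (A ^ m + 1)"]) fastforce
qed

text \<open>The costs need not be invariant under a common shift of the momenta, so the momenta
  themselves are bounded too; this makes the set compact.\<close>

definition Qset where "Qset k = Gset k \<inter> {z. ALL i. abs (snd z $ i) <= real k}"

lemma Qset_G: "Qset k \<subseteq> Gset k" by (simp add: Qset_def)

lemma Qset_mono: "k <= k' ==> Qset k \<subseteq> Qset k'" unfolding Qset_def using Gset_mono[of k k'] by (fastforce intro: order_trans)

lemma Qset_I: "z \<in> Gset j ==> j <= k ==> norm z <= real k ==> z \<in> Qset k"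
 unfolding Qset_def using Gset_mono[of j k] norm_snd_le[of "snd z" "fst z"] by (auto intro!: order_trans[OF component_le_norm_cart])

lemma compact_Qset: "compact (Qset k)" and convex_Qset: "convex (Qset k)" and Qset_ne: "Qset k ~= {}"
proof -
 have "closed (Qset k)" unfolding Qset_def by (intro closed_Int closed_Gset closed_Collect_all closed_Collect_le continuous_intros)
 moreover have "norm z <= real CARD('n) + real CARD('n) * real k" if z: "z \<in> Qset k" for z
 proof -
  have "abs (fst z $ i) <= 1" for i
  proof -
   have nn: "0 <= fst z $ i" for i using z r1_bounds(1)[of k] by (auto simp: Qset_def Gset_def intro: order_trans less_imp_le)
   thus "abs (fst z $ i) <= 1" using z member_le_sum[of i UNIV "%i. fst z $ i"] by (auto simp: Qset_def Gset_def)
  qed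
  hence "norm (fst z) <= (\<Sum>i\<in>(UNIV::'n set). 1)" by (intro order_trans[OF norm_le_l1_cart] sum_mono) auto
  moreover have "norm (snd z) <= (\<Sum>i\<in>(UNIV::'n set). real k)" using z by (intro order_trans[OF norm_le_l1_cart] sum_mono) (auto simp: Qset_def)
  ultimately show ?thesis using norm_Pair_le[of "fst z" "snd z"] by simp
 qed
 hence "bounded (Qset k)" unfolding bounded_iff by blast
 ultimately show "compact (Qset k)" by (simp add: compact_eq_bounded_closed)
 have "convex {z :: (real^'n) \<times> (real^'n). abs (snd z $ i) <= real k}" for i
  unfolding convex_alt by (auto intro!: order_trans[OF abs_triangle_ineq] convex_bound_le simp: abs_mult)
 hence "convex (\<Inter>i. {z :: (real^'n) \<times> (real^'n). abs (snd z $ i) <= real k})" by (intro convex_INT) auto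
 moreover have "(\<Inter>i. {z :: (real^'n) \<times> (real^'n). abs (snd z $ i) <= real k}) = {z. ALL i. abs (snd z $ i) <= real k}" by auto
 ultimately show "convex (Qset k)" unfolding Qset_def by (intro convex_Int convex_Gset) simp
 show "Qset k ~= {}" using Gset_center[of k] by (auto simp: Qset_def)
qed

lemma Qset_simplex: "Qset k \<subseteq> simplex_int \<times> UNIV" using Qset_G[of k] Gset_simplex by (auto simp: mem_Times_iff)

abbreviation Cset where "Cset k \<equiv> {0..T} \<times> Qset k \<times> cball (0::real^'n) l"

text \<open>The nearest point of a compact set gives uniform continuity, the cap N a bound
  independent of k. Keeping N and k apart matters in \<open>costk_close\<close>, where N is chosen
  first.\<close>

definition fk where "fk N k p = min (Fz (closest_point (Cset k) p)) N"
definition gk where "gk N k z = min (hz (closest_point (Qset k) z)) N"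

lemma Cset: "compact (Cset k)" "convex (Cset k)" "Cset k ~= {}"
 using compact_Qset convex_Qset Qset_ne l_pos T_pos by (auto intro!: compact_Times convex_Times simp: less_imp_le)

lemma costs_continuous_compact: "continuous_on (Cset k) Fz" "continuous_on (Qset k) hz"
 using Qset_simplex[of k] by (auto intro!: continuous_on_subset[OF costs_continuous(1)] continuous_on_subset[OF costs_continuous(2)])

lemma fk_props:
 assumes "0 <= N"
 shows "0 <= fk N k p & fk N k p <= N" "0 <= gk N k z & gk N k z <= N"
  "uniformly_continuous_on UNIV (fk N k)" "uniformly_continuous_on UNIV (gk N k)"
proof -
 show "uniformly_continuous_on UNIV (fk N k)" "uniformly_continuous_on UNIV (gk N k)" unfolding fk_def[abs_def] gk_def[abs_def]
  by (intro uniformly_continuous_closest_point Cset compact_Qset convex_Qset Qset_ne costs_continuous_compact)+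
 have "closest_point (Cset k) p \<in> Cset k" by (intro closest_point_in_set compact_imp_closed Cset)
 hence "0 <= Fz (closest_point (Cset k) p)"
  using Qset_simplex[of k] costs_nonneg(1)[of "fst (closest_point (Cset k) p)" "fst (snd (closest_point (Cset k) p))" "snd (snd (closest_point (Cset k) p))"]
  by (auto simp: mem_Times_iff)
 thus "0 <= fk N k p & fk N k p <= N" using assms by (simp add: fk_def)
 have "closest_point (Qset k) z \<in> Qset k" by (intro closest_point_in_set compact_imp_closed compact_Qset Qset_ne)
 hence "0 <= hz (closest_point (Qset k) z)" using Qset_simplex[of k] by (intro costs_nonneg(2)) (auto simp: mem_Times_iff)
 thus "0 <= gk N k z & gk N k z <= N" using assms by (simp add: gk_def)
qed

lemma fk_eq: "r \<in> {0..T} ==> z \<in> Qset k ==> a \<in> cball 0 l ==> fk N k (r, z, a) = min (Fz (r, z, a)) N"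
 and gk_eq: "z \<in> Qset k ==> gk N k z = min (hz z) N" by (simp_all add: fk_def gk_def closest_point_self)

lemma bpk: "0 <= N ==> EX L K. bounded_problem M \<F> W l T L K (bG k) Gm0 Sg0 (fk N k) (gk N k)"
 using fk_props[of N] by (intro bp_exists[where B=N]) auto

abbreviation costk where "costk N k \<equiv> bounded_problem.costf W T (bG k) Gm0 Sg0 (fk N k) (gk N k)"
abbreviation uk where "uk N k \<equiv> bounded_problem.u M \<F> W l T (bG k) Gm0 Sg0 (fk N k) (gk N k)"

lemma costk:
 assumes N: "0 <= N" and t: "0 <= t" "t <= T" and V: "V \<in> Ctl t"
 shows "costk N k t z V w = (LBINT r:{t..T}. fk N k (r, Zs k t z V r w, V r w)) + gk N k (Zs k t z V T w)"
  "good w ==> bdm t T (%r. fk N k (r, Zs k t z V r w, V r w))"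
  "good w ==> 0 <= costk N k t z V w & costk N k t z V w <= N * (T + 1)"
  "integrable M (costk N k t z V)"
proof -
 obtain L K where "bounded_problem M \<F> W l T L K (bG k) Gm0 Sg0 (fk N k) (gk N k)" using bpk[OF N] by blast
 then interpret P: bounded_problem M \<F> W l T L K "bG k" Gm0 Sg0 "fk N k" "gk N k" .
 show c: "costk N k t z V w = (LBINT r:{t..T}. fk N k (r, Zs k t z V r w, V r w)) + gk N k (Zs k t z V T w)" by (rule P.costf_def)
 show b: "bdm t T (%r. fk N k (r, Zs k t z V r w, V r w))" if "good w" by (rule P.sol_path(2)[OF t that V])
 show "good w ==> 0 <= costk N k t z V w & costk N k t z V w <= N * (T + 1)"
 proof -
  assume w: "good w"
  note LBINT_range[OF b[OF w] t(2), of N, OF fk_props(1)[OF N]] fk_props(2)[OF N, of k "Zs k t z V T w"]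
  moreover have "N * (T - t) <= N * T" using t N by (intro mult_left_mono) auto
  ultimately show ?thesis unfolding c distrib_left by linarith
 qed
 show "integrable M (costk N k t z V)" by (rule P.costf_integrable(1)[OF t V sets.top])
qed

lemma costk_tame:
 assumes t: "0 <= t" "t <= T" and V: "V \<in> Ctl t" and N: "0 <= N" and w: "good w" and tame: "tame j t z V w" and j: "j <= k"
  and Q: "!!r. r \<in> {t..T} ==> Xs t z V r w \<in> Qset k"
 shows "bdm t T (%r. min (Fz (r, Xs t z V r w, V r w)) N)"
  "costk N k t z V w = (LBINT r:{t..T}. min (Fz (r, Xs t z V r w, V r w)) N) + min (hz (Xs t z V T w)) N"
proof -
 have eq: "Zs k t z V r w = Xs t z V r w" if "r \<in> {t..T}" for r
  using tame_stable(1)[OF t w V tame j that] Xs_eq[OF t w V tame that] by simp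
 have Vl: "V r w \<in> cball 0 l" if "r \<in> {t..T}" for r using control_path(2)[OF V] w that by simp
 have f: "fk N k (r, Zs k t z V r w, V r w) = min (Fz (r, Xs t z V r w, V r w)) N" if "r \<in> {t..T}" for r
  unfolding eq[OF that] using that t by (intro fk_eq Q Vl) auto
 show "bdm t T (%r. min (Fz (r, Xs t z V r w, V r w)) N)"
  using costk(2)[OF N t V w, of k z] bdm_cong[of t T "%r. fk N k (r, Zs k t z V r w, V r w)", OF f] by simp
 have "(LBINT r:{t..T}. fk N k (r, Zs k t z V r w, V r w)) = (LBINT r:{t..T}. min (Fz (r, Xs t z V r w, V r w)) N)"
  using f by (intro set_lebesgue_integral_cong) auto
 thus "costk N k t z V w = (LBINT r:{t..T}. min (Fz (r, Xs t z V r w, V r w)) N) + min (hz (Xs t z V T w)) N"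
  unfolding costk(1)[OF N t V] using gk_eq[OF Q[of T]] eq[of T] t by simp
qed

text \<open>A tame path on a compact time interval stays in one compact set, where the costs are
  bounded; for large i neither truncation is felt.\<close>

lemma path_costs:
 assumes t: "0 <= t" "t <= T" and V: "V \<in> Ctl t" and w: "good w" and tame: "tame j t z V w"
 shows "bdm t T (%r. Fz (r, Xs t z V r w, V r w))" "EX i0. \<forall>i\<ge>i0. costk (real i) i t z V w = Xcost t z V w"
proof -
 note X = tame_Xs[OF t w V tame]
 have "compact ((%r. Xs t z V r w) ` {t..T})" by (intro compact_continuous_image X(1)) auto
 from compact_imp_bounded[OF this] obtain R where R: "\<forall>y\<in>(%r. Xs t z V r w) ` {t..T}. norm y <= R" unfolding bounded_iff by (elim exE)
 define k where "k = max j (nat \<lceil>R\<rceil>)"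
 have Qk: "Xs t z V r w \<in> Qset k" if "r \<in> {t..T}" for r
 proof (rule Qset_I[OF X(2)[OF that]])
  have "norm (Xs t z V r w) <= R" using R that by blast
  also have "... <= real k" by (simp add: k_def) linarith
  finally show "norm (Xs t z V r w) <= real k" .
 qed (simp add: k_def)
 have "compact (Fz ` Cset k)" "compact (hz ` Qset k)" by (intro compact_continuous_image costs_continuous_compact Cset compact_Qset)+
 from this[THEN compact_imp_bounded] obtain B B' where B: "\<forall>y\<in>Fz ` Cset k. norm y <= B" "\<forall>y\<in>hz ` Qset k. norm y <= B'"
  unfolding bounded_iff by (elim exE)
 have FB: "Fz (r, Xs t z V r w, V r w) <= B" "hz (Xs t z V r w) <= B'" if r: "r \<in> {t..T}" for r
 proof -
  have "(r, Xs t z V r w, V r w) \<in> Cset k" using r t Qk control_path(2)[OF V, of w r] w by simp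
  hence "norm (Fz (r, Xs t z V r w, V r w)) <= B" "norm (hz (Xs t z V r w)) <= B'" using B Qk[OF r] by blast+
  thus "Fz (r, Xs t z V r w, V r w) <= B" "hz (Xs t z V r w) <= B'" by auto
 qed
 have eq: "min (Fz (r, Xs t z V r w, V r w)) N = Fz (r, Xs t z V r w, V r w)" if "r \<in> {t..T}" "B <= N" for r N
  using FB(1)[OF that(1)] that(2) by simp
 have "j <= k" by (simp add: k_def)
 from costk_tame(1)[OF t V _ w tame this Qk, of "max 0 B"] show "bdm t T (%r. Fz (r, Xs t z V r w, V r w))"
  using bdm_cong[of t T "%r. min (Fz (r, Xs t z V r w, V r w)) (max 0 B)", OF eq] by simp
 show "EX i0. \<forall>i\<ge>i0. costk (real i) i t z V w = Xcost t z V w"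
 proof (intro exI[of _ "max k (nat \<lceil>max B B'\<rceil>)"] allI impI)
  fix i assume i: "max k (nat \<lceil>max B B'\<rceil>) <= i"
  hence "max B B' <= real i" by linarith
  hence Bi: "B <= real i" "B' <= real i" by auto
  have ji: "j <= i" using i by (simp add: k_def)
  have "costk (real i) i t z V w = (LBINT r:{t..T}. min (Fz (r, Xs t z V r w, V r w)) (real i)) + min (hz (Xs t z V T w)) (real i)"
   using Qk Qset_mono[of k i] i by (intro costk_tame(2)[OF t V _ w tame ji]) auto
  also have "(LBINT r:{t..T}. min (Fz (r, Xs t z V r w, V r w)) (real i)) = (LBINT r:{t..T}. Fz (r, Xs t z V r w, V r w))"
   using eq Bi by (intro set_lebesgue_integral_cong) auto
  also have "min (hz (Xs t z V T w)) (real i) = hz (Xs t z V T w)" using FB(2)[of T] Bi t by simp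
  finally show "costk (real i) i t z V w = Xcost t z V w" by (simp add: Xcost_def)
 qed
qed

lemma measurable_AE_limit:
 fixes f :: "nat => 'w => real"
 assumes "!!i. f i \<in> borel_measurable M" "AE w in M. EX i0. \<forall>i\<ge>i0. f i w = g w"
 shows "g \<in> borel_measurable M"
proof (rule M_modification)
 show "(%w. lim (%i. f i w)) \<in> borel_measurable M" using assms(1) by (rule borel_measurable_lim_metric)
 show "AE w in M. lim (%i. f i w) = g w"
  using assms(2) by eventually_elim (auto intro!: limI tendsto_eventually intro: eventually_sequentiallyI)
qed simp

lemma Xcost_measurable:
 assumes t: "0 <= t" "t <= T" and z: "fst z \<in> simplex_int" and V: "V \<in> Ctl t"
 shows "Xcost t z V \<in> borel_measurable M"
proof (rule measurable_AE_limit)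
 show "costk (real i) i t z V \<in> borel_measurable M" for i using costk(4)[OF _ t V] by auto
 show "AE w in M. EX i0. \<forall>i\<ge>i0. costk (real i) i t z V w = Xcost t z V w"
  using AE_tame[OF t z V] by eventually_elim (use path_costs(2)[OF t V] in blast)
qed

definition Ycost where "Ycost q t z V w = (LBINT r:{t..T}. eta (Xs t z V r w) ^ q) + eta (Xs t z V T w) ^ q"

text \<open>The moment bound for the truncated power does not depend on the cap, so Fatou's lemma
  removes the cap.\<close>

lemma Ycost_moment:
 assumes q: "2 <= q"
 shows "\<exists>C\<ge>0. ALL t z V. 0 <= t --> t <= T --> fst z \<in> simplex_int --> V \<in> Ctl t -->
  integrable M (Ycost q t z V) & (LINT w|M. Ycost q t z V w) <= C * eta z ^ q"
proof -
 from lyapunov[OF q] obtain C where C: "1 <= C" and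
  lya: "!!m. 1 <= m ==> EX j0. \<forall>j\<ge>j0. ALL t z V. 0 <= t --> t <= T --> z \<in> hyper --> V \<in> Ctl t --> lyap C q m j t z V"
  by blast
 have "ALL i. EX j0. \<forall>j\<ge>j0. ALL t z V. 0 <= t --> t <= T --> z \<in> hyper --> V \<in> Ctl t --> lyap C q (real (Suc i)) j t z V"
  by (intro allI lya) simp
 then obtain j0 where j0: "!!i j t z V. j0 i <= j ==> 0 <= t ==> t <= T ==> z \<in> hyper ==> V \<in> Ctl t ==> lyap C q (real (Suc i)) j t z V"
  by metis
 have "integrable M (Ycost q t z V) & (LINT w|M. Ycost q t z V w) <= C * eta z ^ q"
  if t: "0 <= t" "t <= T" and z: "fst z \<in> simplex_int" and V: "V \<in> Ctl t" for t z V
 proof -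
  obtain n where n: "z \<in> Gset n" using Gset_ex[OF z] by blast
  \<comment> \<open>Large enough for the Lyapunov estimate with cap \<open>Suc i\<close>, unbounded
    in i, and with z in \<open>Gset (J i)\<close>.\<close>
  define J where "J i = max (j0 i) (max i n)" for i
  define Y where "Y i w = (LBINT r:{t..T}. psi q (real (Suc i)) (J i) (Zs (J i) t z V r w)) + psi q (real (Suc i)) (J i) (Zs (J i) t z V T w)" for i w
  have int: "integrable M (Y i) & (LINT w|M. Y i w) <= C * psi q (real (Suc i)) (J i) z" for i
   using j0[of i "J i" t z V] t V simplex_hyper[OF z] unfolding lyap_def Let_def Y_def by (simp add: J_def)
  have psin: "psi q (real (Suc i)) (J i) z <= eta z ^ q" for i using subsetD[OF Gset_mono n, of "J i"] by (subst psi_eta) (auto simp: J_def)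
  have e0: "0 <= eta z ^ q" using eta_ge_1[OF z] by simp
  have conv: "AE w in M. EX i0. \<forall>i\<ge>i0. Y i w = Ycost q t z V w" using AE_tame[OF t z V]
  proof eventually_elim
   case (elim w)
   then obtain j where w: "good w" and tame: "tame j t z V w" by blast
   note X = tame_Xs[OF t w V tame]
   obtain B where B: "!!z. z \<in> Gset j ==> eta z <= B" using eta_bounded by blast
   show ?case
   proof (intro exI[of _ "max j (nat \<lceil>B\<rceil>)"] allI impI)
    fix i assume i: "max j (nat \<lceil>B\<rceil>) <= i"
    hence "B <= real i" by linarith
    moreover have jJ: "j <= J i" using i by (auto simp: J_def)
    ultimately have eq: "psi q (real (Suc i)) (J i) (Zs (J i) t z V r w) = eta (Xs t z V r w) ^ q" if r: "r \<in> {t..T}" for r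
    proof -
     have Z: "Zs (J i) t z V r w = Xs t z V r w" using tame_stable(1)[OF t w V tame jJ r] Xs_eq[OF t w V tame r] by simp
     have "eta (Xs t z V r w) <= real (Suc i)" using B[OF X(2)[OF r]] \<open>B <= real i\<close> by simp
     hence "eta (Xs t z V r w) ^ q <= real (Suc i) ^ q" using eta_ge_1[OF Gset_simplex[OF X(2)[OF r]]] by (intro power_mono) auto
     thus ?thesis unfolding Z using X(2)[OF r] Gset_mono[OF jJ] by (subst psi_eta) auto
    qed
    have "(LBINT r:{t..T}. psi q (real (Suc i)) (J i) (Zs (J i) t z V r w)) = (LBINT r:{t..T}. eta (Xs t z V r w) ^ q)"
     using eq by (intro set_lebesgue_integral_cong) auto
    thus "Y i w = Ycost q t z V w" using eq[of T] t by (simp add: Y_def Ycost_def)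
   qed
  qed
  have Ym: "Ycost q t z V \<in> borel_measurable M" by (rule measurable_AE_limit[OF _ conv]) (use int in auto)
  have Ynn: "0 <= Y i w" for i w unfolding Y_def set_lebesgue_integral_def using psi_bd(2) by (intro add_nonneg_nonneg integral_nonneg) auto
  have Ynn': "AE w in M. 0 <= Ycost q t z V w" using conv by eventually_elim (metis Ynn order_refl)
  have "(\<integral>\<^sup>+w. ennreal (Ycost q t z V w) \<partial>M) <= (\<integral>\<^sup>+w. liminf (%i. ennreal (Y i w)) \<partial>M)"
  proof (rule nn_integral_mono_AE)
   show "AE w in M. ennreal (Ycost q t z V w) <= liminf (%i. ennreal (Y i w))" using conv
   proof eventually_elim
    case (elim w)
    hence "(%i. ennreal (Y i w)) \<longlonglongrightarrow> ennreal (Ycost q t z V w)"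
     by (force intro!: tendsto_eventually simp: eventually_sequentially)
    thus ?case using lim_imp_Liminf[OF sequentially_bot] by fastforce
   qed
  qed
  also have "... <= liminf (%i. \<integral>\<^sup>+w. ennreal (Y i w) \<partial>M)"
   using int by (intro nn_integral_liminf measurable_compose[OF _ measurable_ennreal] borel_measurable_integrable) blast
  also have "... <= ennreal (C * eta z ^ q)"
  proof (rule Liminf_le)
   have "(\<integral>\<^sup>+w. ennreal (Y i w) \<partial>M) <= ennreal (C * eta z ^ q)" for i
   proof -
    have "(\<integral>\<^sup>+w. ennreal (Y i w) \<partial>M) = ennreal (LINT w|M. Y i w)" using int Ynn by (intro nn_integral_eq_integral) auto
    also have "... <= ennreal (C * eta z ^ q)" using int[of i] mult_left_mono[OF psin[of i], of C] C by (intro ennreal_leI) linarith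
    finally show ?thesis .
   qed
   thus "\<forall>\<^sub>F i in sequentially. (\<integral>\<^sup>+w. ennreal (Y i w) \<partial>M) <= ennreal (C * eta z ^ q)" by simp
  qed simp
  finally have le: "(\<integral>\<^sup>+w. ennreal (Ycost q t z V w) \<partial>M) <= ennreal (C * eta z ^ q)" .
  hence i: "integrable M (Ycost q t z V)" by (intro integrableI_nonneg Ym Ynn') (use le_less_trans in fastforce)
  moreover have "ennreal (LINT w|M. Ycost q t z V w) <= ennreal (C * eta z ^ q)" using le nn_integral_eq_integral[OF i Ynn'] by simp
  ultimately show ?thesis using C e0 by (simp add: ennreal_le_iff)
 qed
 thus ?thesis using C by (intro exI[of _ C]) auto
qed

text \<open>Tameness bounds momentum differences only. The momenta themselves are controlled through
  the integral equation, with bounded drift and a bound for the Brownian path.\<close>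

lemma path_bound: "EX R. ALL t z V w r. 0 <= t --> t <= T --> V \<in> Ctl t --> good w --> tame j t z V w -->
 (\<forall>r\<in>{0..T}. norm (W r w) <= B) --> r \<in> {t..T} --> norm (Xs t z V r w) <= norm z + R"
proof -
 obtain K where K0: "0 <= K" and K: "!!z. z \<in> Gset j ==> norm (b0 z) <= K" using Gset_bounds[of j] by blast
 have "norm (Xs t z V r w) <= norm z + (K * T + (l * T + smax * (B + B)))"
  if t: "0 <= t" "t <= T" and V: "V \<in> Ctl t" and w: "good w" and tame: "tame j t z V w"
   and B: "\<forall>r\<in>{0..T}. norm (W r w) <= B" and r: "r \<in> {t..T}" for t z V w r
 proof -
  note X = tame_Xs[OF t w V tame]
  have rt: "t <= r" "r <= T" using r by auto
  have "norm (LBINT r:{t..r}. b0 (Xs t z V r w)) <= K * (r - t)" using r by (intro norm_LBINT_le[OF X(4) order_refl rt] K X(2)) auto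
  moreover have "K * (r - t) <= K * T" using rt t K0 by (intro mult_left_mono) auto
  moreover have "norm (LBINT r:{t..r}. V r w) <= l * (r - t)"
   using r w by (intro norm_LBINT_le[OF control_path(1)[OF V] order_refl rt] control_path(2)[OF V]) auto
  moreover have "l * (r - t) <= l * T" using rt t l_pos by (intro mult_left_mono) auto
  moreover have "norm (diag_matrix s *v (W r w - W t w)) <= smax * (B + B)"
  proof (rule norm_le_smax)
   have "norm (W r w - W t w) <= B + B" using B rt t by (intro order_trans[OF norm_triangle_ineq4] add_mono) auto
   thus "abs ((diag_matrix s *v (W r w - W t w)) $ k) <= abs (s $ k) * (B + B)" for k
    unfolding diag_mult abs_mult using component_le_norm_cart[of "W r w - W t w" k] by (intro mult_left_mono) auto
  qed
  moreover have "norm (force t V w r) <= norm (LBINT r:{t..r}. V r w) + norm (diag_matrix s *v (W r w - W t w))"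
   unfolding Zs_basic(4) by (rule order_trans[OF norm_triangle_ineq]) (simp add: Gm0_def Sg0_def)
  moreover have "norm (Xs t z V r w) <= norm z + norm (LBINT r:{t..r}. b0 (Xs t z V r w)) + norm (force t V w r)"
   unfolding X(3)[OF r] by (intro norm_triangle_le norm_triangle_ineq add_right_mono)
  ultimately show ?thesis by linarith
 qed
 thus ?thesis by blast
qed

text \<open>Chebyshev's inequality in pointwise form: what the cap removes is at most the square
  divided by N.\<close>

lemma cost_truncation_le:
 fixes x y N :: real
 assumes "0 < N" "0 <= x" "x <= y" shows "abs (x - min x N) <= y\<^sup>2 / N"
proof -
 have "(x - min x N) * N <= x\<^sup>2"
 proof (cases "x <= N")
  case False
  hence "(x - N) * N <= x * x" using assms by (intro mult_mono) auto
  thus ?thesis using False by (simp add: power2_eq_square)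
 qed (use assms in simp)
 also have "... <= y\<^sup>2" using assms by (intro power_mono) auto
 finally show ?thesis using assms by (simp add: pos_le_divide_eq)
qed

definition close where
 "close e n N k \<longleftrightarrow> (ALL t z V. 0 <= t --> t <= T --> z \<in> Qset n --> V \<in> Ctl t -->
  integrable M (Xcost t z V) & (LINT w|M. abs (Xcost t z V w - costk N k t z V w)) <= e)"

text \<open>The cap on the costs costs a moment divided by N; the bad event, on which the path
  leaves \<open>Qset k\<close>, costs its probability times \<open>N * (T + 1)\<close>. The exponent
  q is twice the growth exponent p, because the first error involves the square of the cost.\<close>

lemma costk_close:
 assumes e: "0 < e"
 shows "EX N k. 0 <= N & A <= N & n <= k & close e n N k"
proof -
 obtain p C3 where p: "1 <= p" "0 <= C3" and gr: "!!r z a. r \<in> {0..T} ==> fst z \<in> simplex_int ==> a \<in> cball 0 l ==> Fz (r, z, a) <= C3 * eta z ^ p & hz z <= C3 * eta z ^ p"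
  using cost_growth by blast
 define q where "q = p * 2"
 have "2 <= q" using p by (simp add: q_def)
 from Ycost_moment[OF this] obtain C where C: "0 <= C" and mom: "!!t z V. 0 <= t ==> t <= T ==> fst z \<in> simplex_int ==> V \<in> Ctl t ==>
  integrable M (Ycost q t z V) & (LINT w|M. Ycost q t z V w) <= C * eta z ^ q" by blast
 obtain B0 where B0: "!!z. z \<in> Gset n ==> 1 <= eta z & eta z <= B0" using eta_bounded by blast
 define B where "B = max 0 B0"
 have B: "1 <= eta z & eta z <= B" if "z \<in> Gset n" for z using B0[OF that] by (simp add: B_def)
 define D where "D = C3\<^sup>2 * (C * B ^ q)"
 have D: "0 <= D" using C by (simp add: D_def B_def)
 define N where "N = max A (1 + 2 * D / e)"
 have "0 <= 2 * D / e" using D e by simp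
 hence Lm0: "0 < N" by (simp add: N_def less_max_iff_disj)
 have "2 * D / e <= N" by (simp add: N_def)
 hence DLm: "D / N <= e / 2" using e Lm0 by (simp add: divide_simps mult.commute)
 \<comment> \<open>Chosen after N, so that the two exceptional events together contribute at most
   \<open>e / 2\<close>.\<close>
 define d where "d = e / (4 * (N * (T + 1)))"
 have d: "0 < d" "N * (T + 1) * (d + d) = e / 2"
 proof -
  have aux: "p * (e / (4 * p) + e / (4 * p)) = e / 2" if "0 < p" for p using that by (simp add: field_simps)
  have p: "0 < N * (T + 1)" using Lm0 T_pos by simp
  thus "0 < d" using e unfolding d_def by (intro divide_pos_pos) auto
  show "N * (T + 1) * (d + d) = e / 2" unfolding d_def by (rule aux[OF p])
 qed
 obtain j where j: "!!t z V. 0 <= t ==> t <= T ==> z \<in> Gset n ==> V \<in> Ctl t ==>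
  \<exists>Bad\<in>sets M. prob Bad <= d & (ALL w. good w --> w \<notin> Bad --> tame j t z V w)"
  using tame_prob[OF d(1), of n] by blast
 obtain R Bad2 where Bad2: "Bad2 \<in> sets M" "prob Bad2 <= d"
  "!!w. good w ==> w \<notin> Bad2 ==> \<forall>r\<in>{0..T}. norm (W r w) <= R" using W_sup[OF d(1), of T] by blast
 obtain R' where R': "!!t z V w r. 0 <= t ==> t <= T ==> V \<in> Ctl t ==> good w ==> tame j t z V w ==>
  \<forall>r\<in>{0..T}. norm (W r w) <= R ==> r \<in> {t..T} ==> norm (Xs t z V r w) <= norm z + R'"
  using path_bound[of j R] by blast
 obtain R0 where R0: "\<forall>z\<in>Qset n. norm z <= R0" using compact_imp_bounded[OF compact_Qset, of n] unfolding bounded_iff by (elim exE)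
 define k where "k = max n (max j (nat \<lceil>R0 + R'\<rceil>))"
 have k: "max j (nat \<lceil>R0 + R'\<rceil>) <= k" by (simp add: k_def)
 show ?thesis
 proof (intro exI[of _ N] exI[of _ k] conjI; (simp add: k_def; fail)?)
  show "0 <= N" "A <= N" using Lm0 by (auto simp: N_def)
  show "close e n N k" unfolding close_def
  proof (intro allI impI)
   fix t z V assume t: "0 <= t" "t <= T" and z: "z \<in> Qset n" and V: "V \<in> Ctl t"
   have zG: "z \<in> Gset n" using z Qset_G by blast
   note zs = Gset_simplex[OF zG]
   obtain Bad1 where Bad1: "Bad1 \<in> sets M" "prob Bad1 <= d" "!!w. good w ==> w \<notin> Bad1 ==> tame j t z V w" using j[OF t zG V] by blast
   note [measurable] = Bad1(1) Bad2(1)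
   define Y where "Y w = C3\<^sup>2 / N * Ycost q t z V w + N * (T + 1) * (indicator Bad1 w + indicator Bad2 w)" for w
   have main: "AE w in M. abs (Xcost t z V w - costk N k t z V w) <= Y w" using AE_tame[OF t zs V]
   proof eventually_elim
    case (elim w)
    then obtain j' where w: "good w" and tame: "tame j' t z V w" by blast
    let ?X = "%r. Xs t z V r w"
    let ?F = "%r. Fz (r, ?X r, V r w)"
    note X = tame_Xs[OF t w V tame] and bF = path_costs(1)[OF t V w tame]
    have Xs: "fst (?X r) \<in> simplex_int" "V r w \<in> cball 0 l" "r \<in> {0..T}" if "r \<in> {t..T}" for r
     using Gset_simplex[OF X(2)[OF that]] control_path(2)[OF V] that t w by auto
    have F0: "0 <= ?F r" "?F r <= C3 * eta (?X r) ^ p" "0 <= hz (?X r)" "hz (?X r) <= C3 * eta (?X r) ^ p" if "r \<in> {t..T}" for r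
     using costs_nonneg(1)[OF Xs(3,1,2)[OF that]] costs_nonneg(2)[OF Xs(1)[OF that]] gr[OF Xs(3,1,2)[OF that]] by auto
    have sq: "(C3 * eta y ^ p)\<^sup>2 / N = C3\<^sup>2 / N * eta y ^ q" for y by (simp add: power_mult_distrib q_def power_mult)
    have dF: "abs (?F r - min (?F r) N) <= C3\<^sup>2 / N * eta (?X r) ^ q" "abs (hz (?X r) - min (hz (?X r)) N) <= C3\<^sup>2 / N * eta (?X r) ^ q" if "r \<in> {t..T}" for r
     using cost_truncation_le[OF Lm0 F0(1,2)[OF that]] cost_truncation_le[OF Lm0 F0(3,4)[OF that]] unfolding sq by auto
    have bm: "bdm t T (%r. min (?F r) N)" by (rule bdm_min[OF bF])
    define Xtr where "Xtr = (LBINT r:{t..T}. min (?F r) N) + min (hz (?X T)) N"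
    have tT: "T \<in> {t..T}" using t by simp
    have 1: "abs (Xcost t z V w - Xtr) <= C3\<^sup>2 / N * Ycost q t z V w"
    proof -
     have ce: "continuous_on {t..T} (%r. eta (?X r) ^ q)"
      using Xs(1) by (intro continuous_on_power continuous_on_compose2[OF eta_continuous X(1)] image_subsetI) (simp add: mem_Times_iff)
     have be: "bdm t T (%r. C3\<^sup>2 / N * eta (?X r) ^ q)" by (intro bdm_continuous continuous_intros ce)
     have i: "set_integrable lborel {t..T} ?F" "set_integrable lborel {t..T} (%r. min (?F r) N)"
      by (intro bdm_integrable[OF bF] bdm_integrable[OF bm] order_refl)+
     have "abs ((LBINT r:{t..T}. ?F r) - (LBINT r:{t..T}. min (?F r) N)) = norm (LBINT r:{t..T}. ?F r - min (?F r) N)"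
      using set_integral_diff(2)[OF i] by simp
     also have "... <= (LBINT r:{t..T}. norm (?F r - min (?F r) N))"
      using integral_norm_bound[of lborel "%r. indicator {t..T} r *\<^sub>R (?F r - min (?F r) N)"]
      by (simp add: set_lebesgue_integral_def abs_mult)
     also have "... <= (LBINT r:{t..T}. C3\<^sup>2 / N * eta (?X r) ^ q)" using dF by (intro LBINT_mono[OF bdm_norm[OF bdm_diff[OF bF bm]] be]) auto
     also have "... = C3\<^sup>2 / N * (LBINT r:{t..T}. eta (?X r) ^ q)" by simp
     finally show ?thesis using dF(2)[OF tT] unfolding Xcost_def Xtr_def Ycost_def fst_conv snd_conv distrib_left by linarith
    qed
    have 2: "abs (Xtr - costk N k t z V w) <= N * (T + 1) * (indicator Bad1 w + indicator Bad2 w)"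
    proof (cases "w \<in> Bad1 \<or> w \<in> Bad2")
     case True
     have "0 <= (LBINT r:{t..T}. min (?F r) N)" "(LBINT r:{t..T}. min (?F r) N) <= N * (T - t)"
      using LBINT_range[OF bm t(2), of N] F0(1) Lm0 by auto
     moreover have "N * (T - t) <= N * T" using Lm0 t by (intro mult_left_mono) auto
     moreover have "0 <= min (hz (?X T)) N" "min (hz (?X T)) N <= N" using F0(3)[OF tT] Lm0 by auto
     moreover have "N * (T + 1) = N * T + N" by (simp add: distrib_left)
     ultimately have "0 <= Xtr" "Xtr <= N * (T + 1)" unfolding Xtr_def by linarith+
     moreover have "0 <= costk N k t z V w" "costk N k t z V w <= N * (T + 1)" using costk(3)[OF _ t V w, of N k z] Lm0 by auto
     ultimately have "abs (Xtr - costk N k t z V w) <= N * (T + 1) * 1" by simp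
     also have "... <= N * (T + 1) * (indicator Bad1 w + indicator Bad2 w)"
      using True Lm0 T_pos by (intro mult_left_mono) (auto simp: indicator_def)
     finally show ?thesis .
    next
     case False
     hence tj: "tame j t z V w" and Wb: "\<forall>r\<in>{0..T}. norm (W r w) <= R" using Bad1(3) Bad2(3) w by auto
     have jk: "j <= k" using k by simp
     have "?X r \<in> Qset k" if r: "r \<in> {t..T}" for r
     proof (rule Qset_I[OF tame_Xs(2)[OF t w V tj r] jk])
      have "norm (?X r) <= norm z + R'" by (rule R'[OF t V w tj Wb r])
      also have "... <= R0 + R'" using R0 z by simp
      also have "... <= real k" using k by linarith
      finally show "norm (?X r) <= real k" .
     qed
     hence "costk N k t z V w = Xtr" unfolding Xtr_def using Lm0 by (intro costk_tame(2)[OF t V _ w tj jk]) auto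
     thus ?thesis using False by simp
    qed
    show ?case using 1 2 unfolding Y_def by linarith
   qed
   note mom' = mom[OF t zs V]
   have iY: "integrable M Y" unfolding Y_def[abs_def]
    using mom' by (intro Bochner_Integration.integrable_add integrable_mult_right integrable_real_indicator) (auto simp: emeasure_eq_measure)
   have ck: "integrable M (costk N k t z V)" using costk(4)[OF _ t V] Lm0 by simp
   note [measurable] = Xcost_measurable[OF t zs V]
   have id: "integrable M (%w. Xcost t z V w - costk N k t z V w)"
    by (rule Bochner_Integration.integrable_bound[OF iY]) (use main ck in \<open>auto elim: eventually_mono\<close>)
   have "integrable M (%w. (Xcost t z V w - costk N k t z V w) + costk N k t z V w)"
    using id ck by (rule Bochner_Integration.integrable_add)
   hence "integrable M (Xcost t z V)" by simp
   moreover have "(LINT w|M. abs (Xcost t z V w - costk N k t z V w)) <= (LINT w|M. Y w)"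
    by (rule integral_mono_AE[OF integrable_abs[OF id] iY main])
   moreover have "(LINT w|M. Y w) = C3\<^sup>2 / N * (LINT w|M. Ycost q t z V w) + N * (T + 1) * (prob Bad1 + prob Bad2)"
   proof -
    have "integrable M (%w. C3\<^sup>2 / N * Ycost q t z V w)" using mom' by (intro integrable_mult_right) auto
    moreover have ib: "integrable M (indicator Bad1 :: _ => real)" "integrable M (indicator Bad2 :: _ => real)"
     by (auto intro!: integrable_real_indicator simp: emeasure_eq_measure)
    moreover have "integrable M (%w. N * (T + 1) * (indicator Bad1 w + indicator Bad2 w))"
     by (intro integrable_mult_right Bochner_Integration.integrable_add ib)
    ultimately show ?thesis unfolding Y_def by (simp add: Bochner_Integration.integral_add)
   qed
   moreover have "C3\<^sup>2 / N * (LINT w|M. Ycost q t z V w) <= C3\<^sup>2 / N * (C * B ^ q)"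
   proof (intro mult_left_mono)
    have "eta z ^ q <= B ^ q" using B[OF zG] by (intro power_mono) auto
    hence "C * eta z ^ q <= C * B ^ q" using C by (intro mult_left_mono)
    thus "(LINT w|M. Ycost q t z V w) <= C * B ^ q" using mom' by linarith
   qed (use Lm0 in simp)
   moreover have "C3\<^sup>2 / N * (C * B ^ q) = D / N" by (simp add: D_def)
   moreover have "N * (T + 1) * (prob Bad1 + prob Bad2) <= N * (T + 1) * (d + d)"
    using Lm0 T_pos Bad1(2) Bad2(2) by (intro mult_left_mono add_mono) auto
   ultimately show "integrable M (Xcost t z V) & (LINT w|M. abs (Xcost t z V w - costk N k t z V w)) <= e"
    using DLm d(2) by linarith
  qed
 qed
qed

end

section \<open>The value function\<close>

context wasserstein_control
begin

definition U where "U t z = (INF V\<in>Ctl t. \<integral>w. Xcost t z V w \<partial>M)"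

lemma Qset_nhd:
 assumes z: "fst z \<in> simplex_int"
 shows "EX n m. 0 < m & (ALL z'. z' \<in> hyper --> norm (z' - z) <= m --> z' \<in> Qset n)"
proof -
 obtain j m where m: "0 < m" and marg: "!!z'. z' \<in> hyper ==> norm (z' - z) <= m ==> z' \<in> Gset j"
  using level_set_margin[of "eta z"] z by blast
 define n where "n = max j (nat \<lceil>norm z + m\<rceil>)"
 have "z' \<in> Qset n" if z': "z' \<in> hyper" "norm (z' - z) <= m" for z'
 proof (rule Qset_I[OF marg[OF z']])
  have "norm z' <= norm z + m" using norm_triangle_sub[of z' z] z'(2) by linarith
  thus "norm z' <= real n" unfolding n_def by linarith
 qed (simp add: n_def)
 thus ?thesis using m by blast
qed

lemma Qset_ex: "fst z \<in> simplex_int ==> EX n. z \<in> Qset n" using Qset_nhd[of z] simplex_hyper[of z] by (metis diff_self less_imp_le norm_zero)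

lemma Xcost_nonneg:
 assumes t: "0 <= t" "t <= T" and z: "fst z \<in> simplex_int" and V: "V \<in> Ctl t"
 shows "0 <= (LINT w|M. Xcost t z V w)"
proof (rule integral_nonneg_AE)
 show "AE w in M. 0 <= Xcost t z V w" using AE_tame[OF t z V]
 proof eventually_elim
  case (elim w)
  then obtain j where w: "good w" and tame: "tame j t z V w" by blast
  have X: "fst (Xs t z V r w) \<in> simplex_int" if "r \<in> {t..T}" for r by (rule Gset_simplex[OF tame_Xs(2)[OF t w V tame that]])
  have "0 <= Fz (r, Xs t z V r w, V r w)" if "r \<in> {t..T}" for r
   using that t w control_path(2)[OF V, of w r] by (intro costs_nonneg(1) X) auto
  hence "0 <= (LBINT r:{t..T}. Fz (r, Xs t z V r w, V r w))"
   unfolding set_lebesgue_integral_def by (intro Bochner_Integration.integral_nonneg) (auto simp: indicator_def)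
  thus ?case using costs_nonneg(2)[OF X[of T]] t by (simp add: Xcost_def)
 qed
qed

lemma zero_Ctl: "(%_ _. 0) \<in> Ctl t" using l_pos by (auto simp: controls_def split_beta')

lemma Xcost_integrable:
 assumes t: "0 <= t" "t <= T" and z: "fst z \<in> simplex_int" and V: "V \<in> Ctl t"
 shows "integrable M (Xcost t z V)"
proof -
 obtain n where "z \<in> Qset n" using Qset_ex[OF z] by blast
 thus ?thesis using costk_close[OF zero_less_one, of 0 n] t V unfolding close_def by blast
qed

lemma U_approx:
 assumes t: "0 <= t" "t <= T" and z: "fst z \<in> simplex_int" and e: "0 < e"
 shows "\<exists>V\<in>Ctl t. (LINT w|M. Xcost t z V w) < U t z + e"
proof -
 have "bdd_below ((%V. \<integral>w. Xcost t z V w \<partial>M) ` Ctl t)" by (intro bdd_belowI2[where m=0] Xcost_nonneg t z)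
 moreover have "Ctl t ~= {}" using zero_Ctl by blast
 moreover have "(INF V\<in>Ctl t. \<integral>w. Xcost t z V w \<partial>M) < U t z + e" using e by (simp add: U_def)
 ultimately show ?thesis by (subst (asm) cINF_less_iff) auto
qed

lemma U_close:
 assumes close: "close e n N k" and N: "0 <= N" and t: "0 <= t" "t <= T" and z: "z \<in> Qset n"
 shows "abs (U t z - uk N k t z) <= e"
proof -
 obtain L K where "bounded_problem M \<F> W l T L K (bG k) Gm0 Sg0 (fk N k) (gk N k)" using bpk[OF N] by blast
 then interpret P: bounded_problem M \<F> W l T L K "bG k" Gm0 Sg0 "fk N k" "gk N k" .
 have zs: "fst z \<in> simplex_int" using z Qset_simplex by fastforce
 show ?thesis unfolding U_def P.u_def
 proof (rule cINF_diff_le)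
  show "Ctl t ~= {}" using zero_Ctl by blast
  fix V assume V: "V \<in> Ctl t"
  show "0 <= (LINT w|M. Xcost t z V w)" by (rule Xcost_nonneg[OF t zs V])
  show "- (K * (1 + T)) <= (LINT w|M. P.costf t z V w)" using P.expected_cost_bound[OF t V, of z] by (rule abs_leD2)
  note c = close[unfolded close_def, rule_format, OF t z V] P.costf_integrable(1)[OF t V sets.top, of z]
  have "abs ((LINT w|M. Xcost t z V w) - (LINT w|M. P.costf t z V w)) = abs (\<integral>w. Xcost t z V w - P.costf t z V w \<partial>M)"
   using c by simp
  also have "... <= (LINT w|M. abs (Xcost t z V w - P.costf t z V w))" by (rule integral_abs_bound)
  also have "... <= e" using c by simp
  finally show "abs ((LINT w|M. Xcost t z V w) - (LINT w|M. P.costf t z V w)) <= e" .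
 qed
qed

lemma U_T: assumes "fst z \<in> simplex_int" shows "U T z = hz z"
proof -
 have "Xs T z V r w = z" for V r w by (simp add: Xs_def Zs_basic(3))
 hence X: "Xcost T z V = (%_. hz z)" for V by (auto simp: Xcost_def fun_eq_iff LBINT_null1)
 have "U T z = (INF V\<in>Ctl T. hz z)" by (simp add: U_def X prob_space)
 also have "... = hz z" using zero_Ctl by (intro cINF_const) blast
 finally show ?thesis .
qed

text \<open>Localising to an event of \<open>\<F> t\<close> is what turns the bound for the mean into one for the
  conditional expectation.\<close>
lemma U_lower:
 assumes t: "0 <= t" "t <= T" and z: "fst z \<in> simplex_int" and V: "V \<in> Ctl t" and B: "B \<in> sets (\<F> t)"
 shows "U t z * prob B <= (LINT w|M. indicator B w * Xcost t z V w)"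
proof (rule field_le_epsilon)
 fix e :: real assume e: "0 < e"
 obtain n where n: "z \<in> Qset n" using Qset_ex[OF z] by blast
 have "0 < e / 2" using e by simp
 from costk_close[OF this, of 0 n] obtain N k where N: "0 <= N" and cl: "close (e / 2) n N k" by blast
 note uc = U_close[OF cl N t n] and cc = cl[unfolded close_def, rule_format, OF t n V]
 obtain L K where "bounded_problem M \<F> W l T L K (bG k) Gm0 Sg0 (fk N k) (gk N k)" using bpk[OF N] by blast
 then interpret P: bounded_problem M \<F> W l T L K "bG k" Gm0 Sg0 "fk N k" "gk N k" .
 have BM[measurable]: "B \<in> sets M" by (rule sets_F_le[OF B])
 have low: "P.u t z * prob B <= (LINT w|M. indicator B w * P.costf t z V w)"
 proof (cases "t = T")
  case True
  hence "P.costf t z V = (%_. gk N k z)" by (auto simp: P.costf_def P.sol_T LBINT_null1)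
  thus ?thesis using P.u_T True by (simp add: mult.commute)
 next
  case False
  hence "t < T" using t by simp
  from P.u_lower[OF t(1) this V B] show ?thesis .
 qed
 have i: "integrable M (%w. indicator B w * Xcost t z V w)" using integrable_mult_indicator[OF BM, of "Xcost t z V"] cc by simp
 note ic = P.costf_integrable[OF t V BM, of z]
 have "(LINT w|M. indicator B w * P.costf t z V w) - (LINT w|M. indicator B w * Xcost t z V w)
  = (LINT w|M. indicator B w * P.costf t z V w - indicator B w * Xcost t z V w)" using i ic by simp
 also have "... <= (LINT w|M. abs (Xcost t z V w - P.costf t z V w))"
  using i ic cc by (intro integral_mono Bochner_Integration.integrable_diff integrable_abs) (auto simp: indicator_def)
 finally have "(LINT w|M. indicator B w * P.costf t z V w) <= (LINT w|M. indicator B w * Xcost t z V w) + e / 2"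
  using cc by linarith
 moreover have "U t z * prob B <= (P.u t z + e / 2) * prob B" using abs_le_D1[OF uc] by (intro mult_right_mono) auto
 moreover have "e / 2 * prob B <= e / 2 * 1" using e by (intro mult_left_mono) auto
 ultimately show "U t z * prob B <= (LINT w|M. indicator B w * Xcost t z V w) + e" using low by (simp add: distrib_right)
qed

text \<open>No conditional cost lies below the constant, by \<open>U_lower\<close> on the event
  where it would, and near-optimal controls leave no room for a larger lower bound. Hence the
  essential infimum is the deterministic constant \<open>U t (p, x)\<close>.\<close>

lemma value_function_eq:
 assumes t: "0 <= t" "t <= T" and p: "p \<in> simplex_int"
 shows "value_function M \<F> W (diag_matrix s) H0 l T F h t p x = U t (p, x)"
proof -
 let ?X = "Xcost t (p, x)" and ?u = "U t (p, x)" and ?c = "cost_functional M \<F> W (diag_matrix s) H0 T F h t p x" and ?S = "cost_functional M \<F> W (diag_matrix s) H0 T F h t p x ` Ctl t"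
 interpret S: finite_measure_subalgebra M "\<F> t" by unfold_locales (rule subalgebra_F)
 have z: "fst (p, x) \<in> simplex_int" using p by simp
 have J: "EX C. integrable M C & (AE w in M. C w = ?X V w) &
   ?c V = real_cond_exp M (\<F> t) C" if V: "V \<in> Ctl t" for V
 proof -
  obtain C where C: "AE w in M. C w = ?X V w" "?c V = real_cond_exp M (\<F> t) C" using cost_functional_eq[OF t p V] by blast
  have "C \<in> borel_measurable M" by (rule M_modification[OF Xcost_measurable[OF t z V]]) (use C(1) in \<open>auto elim: eventually_mono\<close>)
  with C(1) have "integrable M C" using Xcost_integrable[OF t z V] by (subst integrable_cong_AE) auto
  thus ?thesis using C by blast
 qed
 have lower: "AE w in M. ?u <= ?c V w" if V: "V \<in> Ctl t" for V
 proof -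
  obtain C where C: "integrable M C" "AE w in M. C w = ?X V w"
   and eq: "?c V = real_cond_exp M (\<F> t) C" using J[OF V] by blast
  let ?J = "real_cond_exp M (\<F> t) C"
  \<comment> \<open>The event where the conditional cost is too small. It belongs to the initial
    \<sigma>-algebra, so \<open>U_lower\<close> applies and forces it to be null.\<close>
  define B where "B = {w \<in> space (\<F> t). ?J w < ?u}"
  have B: "B \<in> sets (\<F> t)" unfolding B_def by measurable
  note BM[measurable] = sets_F_le[OF B]
  have iJ: "integrable M (%w. indicator B w * ?J w)" using integrable_mult_indicator[OF BM, of ?J] S.real_cond_exp_int(1)[OF C(1)] by simp
  have iB: "integrable M (%w. ?u * indicator B w)" by (intro integrable_mult_right integrable_real_indicator) (auto simp: emeasure_eq_measure)
  have "(LINT w|M. indicator B w * ?J w) = (LINT w|M. indicator B w * C w)"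
   using S.real_cond_exp_intA[OF C(1) B] by (simp add: set_lebesgue_integral_def)
  also have "... = (LINT w|M. indicator B w * ?X V w)"
   using C Xcost_measurable[OF t z V] by (intro integral_cong_AE) (auto elim: eventually_mono)
  finally have "?u * prob B <= (LINT w|M. indicator B w * ?J w)" using U_lower[OF t z V B] by simp
  hence "(LINT w|M. ?u * indicator B w - indicator B w * ?J w) <= 0" using iJ iB by simp
  moreover have nn: "0 <= ?u * indicator B w - indicator B w * ?J w" for w by (auto simp: B_def indicator_def)
  ultimately have "(LINT w|M. ?u * indicator B w - indicator B w * ?J w) = 0" by (intro antisym Bochner_Integration.integral_nonneg nn)
  hence "AE w in M. ?u * indicator B w - indicator B w * ?J w = 0"
   by (subst (asm) integral_nonneg_eq_0_iff_AE[OF Bochner_Integration.integrable_diff[OF iB iJ]]) (use nn in auto)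
  thus ?thesis unfolding eq using AE_space by eventually_elim (auto simp: B_def space_F indicator_def not_less split: if_splits)
 qed
 have greatest: "AE w in M. Z w <= ?u" if [measurable]: "Z \<in> borel_measurable M" and Z: "\<forall>J\<in>?S. AE w in M. Z w <= J w" for Z
 proof -
  \<comment> \<open>The positive part of \<open>Z - ?u\<close> is dominated by the excess of a
    near-optimal conditional cost, whose mean is below any e.\<close>
  have "(\<integral>\<^sup>+w. ennreal (Z w - ?u) \<partial>M) <= 0"
  proof (rule ennreal_le_epsilon)
   fix e :: real assume e: "0 < e"
   obtain V where V: "V \<in> Ctl t" "(LINT w|M. ?X V w) < ?u + e" using U_approx[OF t z e] by blast
   obtain C where C: "integrable M C" "AE w in M. C w = ?X V w"
    and eq: "?c V = real_cond_exp M (\<F> t) C" using J[OF V(1)] by blast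
   let ?J = "real_cond_exp M (\<F> t) C"
   note iJ = S.real_cond_exp_int[OF C(1)]
   have "AE w in M. Z w <= ?J w" using bspec[OF Z imageI[OF V(1)]] unfolding eq .
   hence "(\<integral>\<^sup>+w. ennreal (Z w - ?u) \<partial>M) <= (\<integral>\<^sup>+w. ennreal (?J w - ?u) \<partial>M)"
    by (intro nn_integral_mono_AE) (auto elim!: eventually_mono intro!: ennreal_leI)
   also have "... = ennreal (LINT w|M. ?J w - ?u)"
    using iJ(1) lower[OF V(1)] unfolding eq by (intro nn_integral_eq_integral) (auto elim: eventually_mono)
   also have "(LINT w|M. ?J w - ?u) = (LINT w|M. C w) - ?u" using iJ by (simp add: prob_space)
   also have "(LINT w|M. C w) = (LINT w|M. ?X V w)"
    using C Xcost_measurable[OF t z V(1)] by (intro integral_cong_AE) auto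
   also have "ennreal ((LINT w|M. ?X V w) - ?u) <= ennreal e" using V(2) by (intro ennreal_leI) simp
   finally show "(\<integral>\<^sup>+w. ennreal (Z w - ?u) \<partial>M) <= 0 + ennreal e" by simp
  qed
  hence "AE w in M. ennreal (Z w - ?u) = 0" by (subst nn_integral_0_iff_AE[symmetric]) auto
  thus ?thesis by eventually_elim (simp add: ennreal_eq_0_iff)
 qed
 have "is_ess_inf M ?S (%_. ?u)" unfolding is_ess_inf_def using lower greatest by auto
 moreover have "v = ?u" if v: "is_ess_inf M ?S (%_. v)" for v
 proof -
  have "\<forall>J\<in>?S. AE w in M. ?u <= J w" using lower by auto
  hence "AE w in M. ?u <= v" using v[unfolded is_ess_inf_def, THEN conjunct2, THEN conjunct2, THEN bspec, of "%_. ?u"] by simp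
  moreover have "AE w in M. v <= ?u" using greatest[OF borel_measurable_const v[unfolded is_ess_inf_def, THEN conjunct2, THEN conjunct1]] .
  ultimately show ?thesis by simp
 qed
 ultimately show ?thesis unfolding value_function_def by (rule the_equality)
qed

text \<open>Near each point \<open>U\<close> is a uniform limit of continuous values of bounded
  problems.\<close>

lemma U_continuous: "continuous_on ({0..T} \<times> simplex_int \<times> UNIV) (%(t, z). U t z)" unfolding continuous_on_iff
proof (intro ballI allI impI)
 fix p :: "real \<times> (real^'n) \<times> (real^'n)" and e :: real assume p: "p \<in> {0..T} \<times> simplex_int \<times> UNIV" and e: "0 < e"
 obtain t z where p_eq: "p = (t, z)" by (cases p)
 have t: "0 <= t" "t <= T" and z: "fst z \<in> simplex_int" using p by (auto simp: p_eq mem_Times_iff)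
 obtain n m where m: "0 < m" and n: "!!z'. z' \<in> hyper ==> norm (z' - z) <= m ==> z' \<in> Qset n" using Qset_nhd[OF z] by blast
 have "0 < e / 3" using e by simp
 from costk_close[OF this, of 0 n] obtain N k where N: "0 <= N" and cl: "close (e / 3) n N k" by blast
 note c = U_close[OF cl N]
 obtain L K where "bounded_problem M \<F> W l T L K (bG k) Gm0 Sg0 (fk N k) (gk N k)" using bpk[OF N] by blast
 then interpret P: bounded_problem M \<F> W l T L K "bG k" Gm0 Sg0 "fk N k" "gk N k" .
 obtain d where d: "0 < d" "!!q. q \<in> {0..T} \<times> UNIV ==> dist q p < d ==> dist (case q of (t, z) => P.u t z) (P.u t z) < e / 3"
  using P.u_continuous[unfolded continuous_on_iff, rule_format, of p "e / 3"] e t by (auto simp: p_eq)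
 show "\<exists>d>0. \<forall>q\<in>{0..T} \<times> simplex_int \<times> UNIV. dist q p < d --> dist (case q of (t, z) => U t z) (case p of (t, z) => U t z) < e"
 proof (intro exI[of _ "min d m"] conjI ballI impI)
  fix q :: "real \<times> (real^'n) \<times> (real^'n)" assume q: "q \<in> {0..T} \<times> simplex_int \<times> UNIV" and dq: "dist q p < min d m"
  obtain t' z' where q_eq: "q = (t', z')" by (cases q)
  have t': "0 <= t'" "t' <= T" and z': "fst z' \<in> simplex_int" using q by (auto simp: q_eq mem_Times_iff)
  have "norm (z' - z) <= m" using dq dist_snd_le[of q p] by (simp add: q_eq p_eq dist_norm)
  hence "z' \<in> Qset n" by (intro n simplex_hyper z')
  moreover have "z \<in> Qset n" using m by (intro n simplex_hyper z) auto
  ultimately have "abs (U t' z' - P.u t' z') <= e / 3" "abs (U t z - P.u t z) <= e / 3" using c t t' by auto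
  moreover have "abs (P.u t' z' - P.u t z) < e / 3" using d(2)[of q] q dq by (simp add: q_eq dist_real_def)
  ultimately show "dist (case q of (t, z) => U t z) (case p of (t, z) => U t z) < e" unfolding p_eq q_eq dist_real_def prod.case by linarith
 qed (use d m in auto)
qed

end

section \<open>The Hamilton--Jacobi--Bellman equation\<close>

lemma mvt_bound:
 fixes f :: "'a::real_inner => real"
 assumes D: "!!a. 0 <= a ==> a <= 1 ==> EX g. (f has_derivative (%d. d \<bullet> g)) (at (p + a *\<^sub>R v)) & norm (g - c) <= e"
 shows "f (p + v) - f p <= c \<bullet> v + e * norm v"
proof -
 have "\<forall>a\<in>{0..1}. EX g. (f has_derivative (%d. d \<bullet> g)) (at (p + a *\<^sub>R v)) & norm (g - c) <= e" using D by simp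
 then obtain g where g: "!!a. a \<in> {0..1} ==> (f has_derivative (%d. d \<bullet> g a)) (at (p + a *\<^sub>R v))" "!!a. a \<in> {0..1} ==> norm (g a - c) <= e"
  by metis
 have "((%a. f (p + a *\<^sub>R v)) has_real_derivative v \<bullet> g a) (at a)" if "0 <= a" "a <= 1" for a
 proof -
  have "((%a. p + a *\<^sub>R v) has_derivative (%d. d *\<^sub>R v)) (at a)" by (auto intro!: derivative_eq_intros)
  from has_derivative_compose[OF this g(1)] that show ?thesis by (simp add: has_field_derivative_def mult_commute_abs)
 qed
 from MVT2[OF zero_less_one this] obtain a where a: "0 < a" "a < 1" "f (p + v) - f p = v \<bullet> g a" by auto
 have "v \<bullet> g a = c \<bullet> v + v \<bullet> (g a - c)" by (simp add: inner_diff_right inner_commute)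
 also have "v \<bullet> (g a - c) <= norm v * norm (g a - c)" by (rule norm_cauchy_schwarz)
 also have "... <= norm v * e" using g(2)[of a] a by (intro mult_left_mono) auto
 finally show ?thesis using a(3) by (simp add: mult.commute)
qed

text \<open>Testing with the vertices determines all coordinates up to a common constant, and the
  zero sum fixes the constant.\<close>

lemma has_simplex_derivative_unique:
 fixes r :: "real^'n::finite"
 assumes p: "has_simplex_derivative f r p" and p': "has_simplex_derivative f r p'"
 shows "p = p'"
proof -
 have "p $ i - p' $ i = (p - p') \<bullet> r" for i
 proof -
  have "axis i (1::real) \<in> simplex_P" by (auto simp: simplex_P_def axis_def)
  hence "p \<bullet> (axis i 1 - r) = p' \<bullet> (axis i 1 - r)"
   using p p' tendsto_unique[OF trivial_limit_at_right_real] unfolding has_simplex_derivative_def by blast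
  thus ?thesis by (simp add: inner_diff_left inner_diff_right inner_axis)
 qed
 moreover from this have "(\<Sum>i\<in>(UNIV::'n set). p $ i - p' $ i) = real CARD('n) * ((p - p') \<bullet> r)" by simp
 hence "(p - p') \<bullet> r = 0" using p p' by (simp add: has_simplex_derivative_def sum_subtractf)
 ultimately show "p = p'" by (simp add: vec_eq_iff)
qed

text \<open>The derivative on the simplex is the Euclidean gradient minus its mean; the mean is
  invisible to vectors with zero coordinate sum.\<close>

lemma simplex_derivative_inner:
 fixes r v :: "real^'n::finite"
 assumes f: "(f has_derivative (%d. d \<bullet> c)) (at r)" and r: "r \<in> simplex_P" and v: "(\<Sum>i\<in>UNIV. v $ i) = 0"
 shows "simplex_derivative f r \<bullet> v = c \<bullet> v"
proof -
 define m where "m = (\<Sum>i\<in>UNIV. c $ i) / real CARD('n)"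
 define p where "p = c - m *\<^sub>R (\<chi> i. 1)"
 have p: "p \<bullet> w = c \<bullet> w" if "(\<Sum>i\<in>UNIV. w $ i) = 0" for w
  using that by (simp add: p_def inner_diff_left inner_vec_def left_diff_distrib sum_subtractf flip: sum_distrib_left)
 have "has_simplex_derivative f r p" unfolding has_simplex_derivative_def
 proof (intro conjI ballI)
  show "(\<Sum>i\<in>UNIV. p $ i) = 0" by (simp add: p_def sum_subtractf m_def)
  fix a :: "real^'n" assume a: "a \<in> simplex_P"
  have "((%s. r + s *\<^sub>R (a - r)) has_derivative (%d. d *\<^sub>R (a - r))) (at 0)" by (auto intro!: derivative_eq_intros)
  moreover have "(f has_derivative (%d. d \<bullet> c)) (at (r + 0 *\<^sub>R (a - r)))" using f by simp
  ultimately have "((%s. f (r + s *\<^sub>R (a - r))) has_derivative (%d. (d *\<^sub>R (a - r)) \<bullet> c)) (at 0)"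
   by (rule has_derivative_compose)
  hence "((%s. f (r + s *\<^sub>R (a - r))) has_real_derivative (a - r) \<bullet> c) (at 0)"
   by (simp add: has_field_derivative_def mult_commute_abs)
  hence "(%s. (f (r + s *\<^sub>R (a - r)) - f r) / s) \<midarrow>0\<rightarrow> (a - r) \<bullet> c" by (simp add: has_field_derivative_iff)
  moreover have "(1 - s) *\<^sub>R r + s *\<^sub>R a = r + s *\<^sub>R (a - r)" for s by (simp add: algebra_simps)
  moreover have "(a - r) \<bullet> c = p \<bullet> (a - r)" using r a by (subst p) (auto simp: simplex_P_def sum_subtractf inner_commute)
  ultimately show "((%s. (f ((1 - s) *\<^sub>R r + s *\<^sub>R a) - f r) / s) \<longlongrightarrow> p \<bullet> (a - r)) (at_right 0)"
   by (simp add: tendsto_within_subset[of _ _ _ UNIV])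
 qed
 hence "simplex_derivative f r = p" unfolding simplex_derivative_def using has_simplex_derivative_unique by (intro the_equality) auto
 thus ?thesis using p[OF v] by simp
qed

lemma trace_diag: "trace (diag_matrix s ** transpose (diag_matrix s) ** Q) = (\<Sum>i\<in>UNIV. (s $ i)\<^sup>2 * Q $ i $ i)"
 for s :: "real^'n::finite"
proof -
 have "(diag_matrix s ** transpose (diag_matrix s)) $ i $ j = (if i = j then (s $ i)\<^sup>2 else 0)" for i j
  by (simp add: matrix_matrix_mult_def diag_matrix_def transpose_def power2_eq_square if_distrib[where f="%x. x * _"] cong: if_cong)
 thus ?thesis by (simp add: trace_def matrix_matrix_mult_def[of "_ ** _"] if_distrib[where f="%x. x * _"] cong: if_cong)
qed

text \<open>Derivatives of a test function within \<open>e\<close> of constants on a ball of radius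
  \<open>r\<close>. Since the diffusion matrix is diagonal, only diagonal second derivatives are
  recorded.\<close>

definition near :: "(real => real^'n => real^'n => real) => real => (real^'n) \<times> (real^'n) => real => real =>
  real => real^'n => real^'n => ('n::finite => real) => bool" where
 "near a t0 z0 r e ct cr cx Q \<longleftrightarrow> (ALL t p x. abs (t - t0) <= r --> p \<in> simplex_int --> norm ((p, x) - z0) <= r -->
  (EX g. ((%s. a s p x) has_derivative (%d. d \<bullet> g)) (at t) & norm (g - ct) <= e) &
  (EX g. ((%r. a t r x) has_derivative (%d. d \<bullet> g)) (at p) & norm (g - cr) <= e) &
  (a t p has_derivative (%d. d \<bullet> grad (a t p) x)) (at x) & norm (grad (a t p) x - cx) <= e &
  (ALL i. EX q. ((%v. axis i 1 \<bullet> grad (a t p) (x + v *\<^sub>R axis i 1)) has_real_derivative q) (at 0) & abs (q - Q i) <= e))"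

section \<open>Derivatives of test functions near a point\<close>

lemma continuous_on_near:
 fixes f :: "real \<times> (real^'n::finite) \<times> (real^'n) => 'b::metric_space"
 assumes c: "continuous_on ({0<..<T} \<times> N \<times> UNIV) f" and N: "simplex_int \<subseteq> N" and t0: "0 < t0" "t0 < T" and z0: "fst z0 \<in> simplex_int" and e: "0 < e"
 shows "\<forall>\<^sub>F r in at_right 0. ALL t i x. abs (t - t0) <= r --> i \<in> simplex_int --> norm ((i, x) - z0) <= r --> t \<in> {0<..<T} & dist (f (t, i, x)) (f (t0, z0)) <= e"
proof -
 have "(t0, z0) \<in> {0<..<T} \<times> N \<times> UNIV" using N t0 z0 by (cases z0) auto
 then obtain d where d: "0 < d" "!!p. p \<in> {0<..<T} \<times> N \<times> UNIV ==> dist p (t0, z0) < d ==> dist (f p) (f (t0, z0)) < e"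
  using c e unfolding continuous_on_iff by blast
 have "0 < min (d / 2) (min t0 (T - t0))" using d t0 by simp
 thus ?thesis unfolding eventually_at_right_field
 proof (intro exI[of _ "min (d / 2) (min t0 (T - t0))"] conjI allI impI)
  fix r t i x assume r: "0 < r" "r < min (d / 2) (min t0 (T - t0))" and a: "abs (t - t0) <= r" "i \<in> simplex_int" "norm ((i, x) - z0) <= r"
  show t: "t \<in> {0<..<T}" using r a by auto
  have "dist (t, i, x) (t0, z0) <= abs (t - t0) + norm ((i, x) - z0)" using norm_Pair_le[of "t - t0" "(i, x) - z0"] by (simp add: dist_norm)
  also have "... < d" using a r by simp
  finally show "dist (f (t, i, x)) (f (t0, z0)) <= e" using d(2)[of "(t, i, x)"] t a N by (auto intro: less_imp_le)
 qed
qed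

lemma near_exists:
 assumes j: "test_function T j" and t0: "0 < t0" "t0 < T" and z0: "fst z0 \<in> simplex_int" and e: "0 < e"
 shows "\<forall>\<^sub>F r in at_right 0. near j t0 z0 r e (deriv (%s. j s (fst z0) (snd z0)) t0) (grad (%r. j t0 r (snd z0)) (fst z0))
  (grad (j t0 (fst z0)) (snd z0)) (%i. hessian (j t0 (fst z0)) (snd z0) $ i $ i)"
  "t \<in> {0<..<T} ==> k \<in> simplex_int ==> continuous_on UNIV (j t k)"
  "((%r. j t0 r (snd z0)) has_derivative (%d. d \<bullet> grad (%r. j t0 r (snd z0)) (fst z0))) (at (fst z0))"
proof -
 obtain N where N: "simplex_int \<subseteq> N" and
  D: "\<forall>t\<in>{0<..<T}. \<forall>k\<in>N. ALL x. (%s. j s k x) differentiable at t & (%r. j t r x) differentiable at k &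
    j t k differentiable at x & grad (j t k) differentiable at x" and
  c: "continuous_on ({0<..<T} \<times> N \<times> UNIV) (%(t, k, x). deriv (%s. j s k x) t)"
   "continuous_on ({0<..<T} \<times> N \<times> UNIV) (%(t, k, x). grad (%r. j t r x) k)"
   "continuous_on ({0<..<T} \<times> N \<times> UNIV) (%(t, k, x). grad (j t k) x)"
   "continuous_on ({0<..<T} \<times> N \<times> UNIV) (%(t, k, x). hessian (j t k) x)" using j unfolding test_function_def by blast
 have ch: "continuous_on ({0<..<T} \<times> N \<times> UNIV) (%p. (case p of (t, k, x) => hessian (j t k) x) $ i $ i)" for i
  by (intro continuous_intros c(4))
 have h: "\<forall>\<^sub>F r in at_right 0. \<forall>i\<in>UNIV. ALL t k x. abs (t - t0) <= r --> k \<in> simplex_int --> norm ((k, x) - z0) <= r -->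
   t \<in> {0<..<T} & dist ((case (t, k, x) of (t, k, x) => hessian (j t k) x) $ i $ i) ((case (t0, z0) of (t, k, x) => hessian (j t k) x) $ i $ i) <= e"
  by (intro eventually_ball_finite ballI continuous_on_near[OF ch N t0 z0 e]) simp
 have H: "((%m. axis i 1 \<bullet> grad (j t k) (x + m *\<^sub>R axis i 1)) has_real_derivative hessian (j t k) x $ i $ i) (at 0)"
  if "t \<in> {0<..<T}" "k \<in> simplex_int" for t k x i
 proof -
  have "(grad (j t k) has_derivative (%h. hessian (j t k) x *v h)) (at x)" unfolding hessian_def using D that N jacobian_works by blast
  hence g: "(grad (j t k) has_derivative (%h. hessian (j t k) x *v h)) (at (x + 0 *\<^sub>R axis i 1))" by simp
  have "((%m. x + m *\<^sub>R axis i 1) has_derivative (%d. d *\<^sub>R axis i 1)) (at (0::real))" by (auto intro!: derivative_eq_intros)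
  from has_derivative_inner_right[OF has_derivative_compose[OF this g], of "axis i 1"]
  show ?thesis by (simp add: has_field_derivative_def inner_axis' matrix_vector_mult_scaleR matrix_vector_mult_basis column_def mult_commute_abs)
 qed
 from h continuous_on_near[OF c(1) N t0 z0 e] continuous_on_near[OF c(2) N t0 z0 e] continuous_on_near[OF c(3) N t0 z0 e]
 show "\<forall>\<^sub>F r in at_right 0. near j t0 z0 r e (deriv (%s. j s (fst z0) (snd z0)) t0) (grad (%r. j t0 r (snd z0)) (fst z0))
  (grad (j t0 (fst z0)) (snd z0)) (%i. hessian (j t0 (fst z0)) (snd z0) $ i $ i)"
 proof eventually_elim
  case (elim r)
  show ?case unfolding near_def
  proof (intro allI impI)
   fix t k x assume a: "abs (t - t0) <= r" "k \<in> simplex_int" "norm ((k, x) - z0) <= r"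
   note E = elim(1)[rule_format, OF UNIV_I a] elim(2)[rule_format, OF a] elim(3)[rule_format, OF a] elim(4)[rule_format, OF a]
   have t: "t \<in> {0<..<T}" using E(2) by blast
   have dd: "(%s. j s k x) differentiable at t" "(%r. j t r x) differentiable at k" "j t k differentiable at x"
    using D t a N by blast+
   have "((%s. j s k x) has_derivative (%d. d \<bullet> deriv (%s. j s k x) t)) (at t)"
    using dd(1) DERIV_deriv_iff_real_differentiable by (simp add: has_field_derivative_def mult_commute_abs)
   thus "(EX g. ((%s. j s k x) has_derivative (%d. d \<bullet> g)) (at t) & norm (g - deriv (%s. j s (fst z0) (snd z0)) t0) <= e) &
    (EX g. ((%r. j t r x) has_derivative (%d. d \<bullet> g)) (at k) & norm (g - grad (%r. j t0 r (snd z0)) (fst z0)) <= e) &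
    (j t k has_derivative (%d. d \<bullet> grad (j t k) x)) (at x) & norm (grad (j t k) x - grad (j t0 (fst z0)) (snd z0)) <= e &
    (ALL i. EX q. ((%m. axis i 1 \<bullet> grad (j t k) (x + m *\<^sub>R axis i 1)) has_real_derivative q) (at 0) &
     abs (q - hessian (j t0 (fst z0)) (snd z0) $ i $ i) <= e)" using E H[OF t a(2)] grad_has_derivative[OF dd(2)] grad_has_derivative[OF dd(3)]
    by (auto simp: dist_norm split_beta' simp del: inner_real_def)
  qed
 qed
 show "t \<in> {0<..<T} ==> k \<in> simplex_int ==> continuous_on UNIV (j t k)"
  using D N by (intro continuous_at_imp_continuous_on ballI differentiable_imp_continuous_within) blast
 show "((%r. j t0 r (snd z0)) has_derivative (%d. d \<bullet> grad (%r. j t0 r (snd z0)) (fst z0))) (at (fst z0))"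
  using D N z0 t0 by (intro grad_has_derivative) auto
qed

text \<open>The sign k treats subsolutions (k = 1) and supersolutions (k = -1) in one
  argument.\<close>

context
 fixes e :: "real => real^'n::finite => real^'n => real" and t0 z0 r j ct cr cx Q k
 assumes near: "near e t0 z0 r j ct cr cx Q" and k: "k = 1 \<or> k = (-1::real)"
begin

text \<open>The point is moved in time, then in density, then in momentum. Bounding each component
  by \<open>r / 2\<close> keeps all intermediate pairs within distance r.\<close>

lemma near_increment:
 assumes t: "abs (t - t0) <= r" "abs (t + m - t0) <= r" "0 <= m"
  and z: "fst z \<in> simplex_int" "norm (z - z0) <= r / 2" and z1: "fst z1 \<in> simplex_int" "norm (z1 - z0) <= r / 2"
 shows "k * e (t + m) (fst z1) (snd z1) - k * e t (fst z) (snd z) <=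
  k * (ct * m + cr \<bullet> (fst z1 - fst z) + cx \<bullet> (snd z1 - snd z)) + j * (m + norm (fst z1 - fst z) + norm (snd z1 - snd z))"
proof -
 have ns: "norm (k *\<^sub>R g - k *\<^sub>R c) = norm (g - c)" for g c :: "'b::real_normed_vector"
  using k by (auto simp: norm_minus_commute simp flip: scaleR_right_diff_distrib)
 have S: "((%y. k * f y) has_derivative (%d. d \<bullet> (k *\<^sub>R g))) (at y)" if "(f has_derivative (%d. d \<bullet> g)) (at y)" for f :: "'b::real_inner => real" and g y
  using has_derivative_mult_right[OF that, of k] by simp
 have lift: "EX g. ((%y. k * f y) has_derivative (%d. d \<bullet> g)) (at y) & norm (g - k *\<^sub>R c) <= j"
  if "EX g. (f has_derivative (%d. d \<bullet> g)) (at y) & norm (g - c) <= j" for f :: "'b::real_inner => real" and y c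
  using that S ns by metis
 have comp: "norm (fst z - fst z0) <= r / 2" "norm (snd z - snd z0) <= r / 2" "norm (fst z1 - fst z0) <= r / 2" "norm (snd z1 - snd z0) <= r / 2"
  using norm_fst_diff[of z z0] norm_snd_diff[of z z0] norm_fst_diff[of z1 z0] norm_snd_diff[of z1 z0] z z1 by linarith+
 have conv: "convex simplex_int"
  unfolding simplex_int_eq convex_alt by (auto simp: sum.distrib simp flip: sum_distrib_left) (smt (verit) mult_nonneg_nonneg mult_pos_pos)
 have pair: "norm ((p, x) - z0) <= r" if "norm (p - fst z0) <= r / 2" "norm (x - snd z0) <= r / 2" for p x
  using norm_Pair_le[of "p - fst z0" "x - snd z0"] that by (cases z0) auto
 have seg: "norm (y + a *\<^sub>R (y' - y) - c) <= r / 2" if "norm (y - c) <= r / 2" "norm (y' - c) <= r / 2" "0 <= a" "a <= 1" for y y' c :: "real^'n" and a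
 proof -
  have eq: "y + a *\<^sub>R (y' - y) - c = (1 - a) *\<^sub>R (y - c) + a *\<^sub>R (y' - c)" by (simp add: algebra_simps)
  have "norm (y + a *\<^sub>R (y' - y) - c) <= (1 - a) * norm (y - c) + a * norm (y' - c)" unfolding eq using that by (intro norm_triangle_le) simp
  also have "... <= r / 2" using that by (intro convex_bound_le) auto
  finally show ?thesis .
 qed
 note nr = near[unfolded near_def, rule_format]
 have "k * e (t + m) (fst z1) (snd z1) - k * e t (fst z1) (snd z1) <= k *\<^sub>R ct \<bullet> m + j * norm m"
 proof (rule mvt_bound[where f="%s. k * e s (fst z1) (snd z1)"], rule lift)
  fix a :: real assume a: "0 <= a" "a <= 1"
  have "0 <= a * m" "a * m <= m" using a t(3) by (auto simp: mult_left_le_one_le)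
  hence "abs (t + a *\<^sub>R m - t0) <= r" using t unfolding real_scaleR_def by linarith
  from nr[OF this z1(1) pair[OF comp(3,4)]]
  show "EX g. ((%s. e s (fst z1) (snd z1)) has_derivative (%d. d \<bullet> g)) (at (t + a *\<^sub>R m)) & norm (g - ct) <= j" by blast
 qed
 moreover have "k * e t (fst z + (fst z1 - fst z)) (snd z1) - k * e t (fst z) (snd z1) <= k *\<^sub>R cr \<bullet> (fst z1 - fst z) + j * norm (fst z1 - fst z)"
 proof (rule mvt_bound[where f="%p. k * e t p (snd z1)"], rule lift)
  fix a :: real assume a: "0 <= a" "a <= 1"
  have "fst z + a *\<^sub>R (fst z1 - fst z) = (1 - a) *\<^sub>R fst z + a *\<^sub>R fst z1" by (simp add: algebra_simps)
  hence "fst z + a *\<^sub>R (fst z1 - fst z) \<in> simplex_int" using conv z(1) z1(1) a unfolding convex_alt by auto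
  from nr[OF t(1) this pair[OF seg[OF comp(1,3) a] comp(4)]]
  show "EX g. ((%p. e t p (snd z1)) has_derivative (%d. d \<bullet> g)) (at (fst z + a *\<^sub>R (fst z1 - fst z))) & norm (g - cr) <= j" by blast
 qed
 moreover have "k * e t (fst z) (snd z + (snd z1 - snd z)) - k * e t (fst z) (snd z) <= k *\<^sub>R cx \<bullet> (snd z1 - snd z) + j * norm (snd z1 - snd z)"
 proof (rule mvt_bound[where f="%x. k * e t (fst z) x"], rule lift)
  fix a :: real assume a: "0 <= a" "a <= 1"
  from nr[OF t(1) z(1) pair[OF comp(1) seg[OF comp(2,4) a]]]
  show "EX g. (e t (fst z) has_derivative (%d. d \<bullet> g)) (at (snd z + a *\<^sub>R (snd z1 - snd z))) & norm (g - cx) <= j" by blast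
 qed
 ultimately show ?thesis using t(3) by (simp add: algebra_simps)
qed

lemma near_second_difference:
 assumes t: "abs (t - t0) <= r" and p: "p \<in> simplex_int" and x: "!!u. abs u <= abs a ==> norm ((p, x + u *\<^sub>R axis i 1) - z0) <= r"
 shows "k * e t p (x + a *\<^sub>R axis i 1) + k * e t p (x - a *\<^sub>R axis i 1) - 2 * (k * e t p x) <= a\<^sup>2 * (k * Q i + j)"
proof -
 let ?x = "%u. x + u *\<^sub>R axis i 1"
 note nr = near[unfolded near_def, rule_format, OF t p x]
 have "ALL u. EX q. abs u <= abs a --> ((%v. axis i 1 \<bullet> grad (e t p) (?x u + v *\<^sub>R axis i 1)) has_real_derivative q) (at 0) & abs (q - Q i) <= j"
  using nr by blast
 then obtain q where q: "!!u. abs u <= abs a ==> ((%v. axis i 1 \<bullet> grad (e t p) (?x u + v *\<^sub>R axis i 1)) has_real_derivative q u) (at 0)"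
  "!!u. abs u <= abs a ==> abs (q u - Q i) <= j" by metis
 have "k * e t p (?x a) + k * e t p (?x (- a)) - 2 * (k * e t p (?x 0)) <= a\<^sup>2 * (k * Q i + j)"
 proof (rule second_difference_le)
  fix u assume u: "abs u <= abs a"
  have "(?x has_derivative (%d. d *\<^sub>R axis i 1)) (at u)" by (auto intro!: derivative_eq_intros)
  moreover have "(e t p has_derivative (%d. d \<bullet> grad (e t p) (?x u))) (at (?x u))" using nr[OF u] by blast
  ultimately have "((%u. e t p (?x u)) has_derivative (%d. (d *\<^sub>R axis i 1) \<bullet> grad (e t p) (?x u))) (at u)"
   by (rule has_derivative_compose)
  hence "((%u. e t p (?x u)) has_real_derivative axis i 1 \<bullet> grad (e t p) (?x u)) (at u)"
   by (simp add: has_field_derivative_def mult_commute_abs)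
  thus "((%u. k * e t p (?x u)) has_real_derivative k * (axis i 1 \<bullet> grad (e t p) (?x u))) (at u)"
   by (rule DERIV_cmult)
  have "(%v. axis i 1 \<bullet> grad (e t p) (?x u + v *\<^sub>R axis i 1)) = (%v. axis i 1 \<bullet> grad (e t p) (?x (v + u)))"
   by (simp add: algebra_simps)
  with q(1)[OF u] have "((%u. axis i 1 \<bullet> grad (e t p) (?x u)) has_real_derivative q u) (at u)"
   using DERIV_shift[of "%u. axis i 1 \<bullet> grad (e t p) (?x u)" "q u" 0 u] by simp
  thus "((%u. k * (axis i 1 \<bullet> grad (e t p) (?x u))) has_real_derivative k * q u) (at u)" by (rule DERIV_cmult)
  show "k * q u <= k * Q i + j" using q(2)[OF u] k by auto
 qed
 thus ?thesis by simp
qed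

end

lemma near_maximiser:
 fixes f :: "'a => real"
 assumes "p0 \<in> S" "!!p. p \<in> S ==> f p <= c" "0 < e"
 shows "\<exists>p\<in>S. \<forall>p'\<in>S. f p' <= f p + e"
proof -
 have bdd: "bdd_above (f ` S)" using assms(2) by (intro bdd_aboveI2)
 have "(SUP p\<in>S. f p) - e < (SUP p\<in>S. f p)" using assms(3) by simp
 then obtain p where "p \<in> S" "(SUP p\<in>S. f p) - e < f p" using less_cSUP_iff[OF _ bdd] assms(1) by blast
 thus ?thesis using cSUP_upper[OF _ bdd] by (intro bexI[of _ p] ballI) (force simp: less_diff_eq intro: order_trans less_imp_le)+
qed

context wasserstein_control
begin

text \<open>Time derivative plus controlled generator, with the derivatives of the test function
  given as constants and the coefficients taken at z0.\<close>

definition gen where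
 "gen z0 ct cr cx Q a = ct + cr \<bullet> D_x H0 (fst z0) (snd z0) - cx \<bullet> (D_rho H0 (fst z0) (snd z0) + a) + (\<Sum>i\<in>UNIV. (s $ i)\<^sup>2 * Q i) / 2"

text \<open>The quadratic term drives near-maximisers towards (t0, z0), while it changes the
  generator only by a multiple of e.\<close>

definition pen where "pen k e a t0 z0 t z = k * a t (fst z) (snd z) + e * ((t - t0)\<^sup>2 + (norm (z - z0))\<^sup>2)"

definition bd0 where "bd0 z0 = norm (b0 z0) + 1 + l"
text \<open>Collects all errors of order m * d in a step: \<open>norm cr + norm cx\<close> from the
  variation of the drift, \<open>1 + 2 * bd0 z0\<close> from that of the first derivatives,
  \<open>2 + bd0 z0\<close> from the penalty, and the last sum from the second order terms.\<close>

definition err where "err z0 cr cx = 3 + 3 * bd0 z0 + norm cr + norm cx + 2 * (\<Sum>i\<in>UNIV. (s $ i)\<^sup>2)"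

text \<open>One step of the scheme, started where the difference to the penalised test function
  is maximal up to the square of the step size.\<close>
definition step_bound where
 "step_bound r k c i t0 z0 K R G e \<longleftrightarrow> (ALL d t z v v0 a. 0 < d --> d <= r / 4 --> d * bd0 z0 <= r / 4 --> abs (t - t0) <= r / 4 --> z \<in> hyper -->
  norm (z - z0) <= r / 4 --> a \<in> cball 0 l --> v \<in> borel_measurable borel --> (ALL z. abs (v z) <= K) --> abs v0 <= K -->
  (\<forall>z'\<in>hyper. norm (z' - z0) <= r --> k * v z' - pen k c i t0 z0 (t + d) z' <= k * v0 - pen k c i t0 z0 t z + d\<^sup>2) -->
  k * (LINT y|gauss d. v (z + d *\<^sub>R (b0 z + Gm0 a) + Sg0 y)) <= k * v0 + d * (k * G a + c * e) + d\<^sup>2 * R)"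

text \<open>Near-maximality bounds v by the penalised test function plus a constant on a ball. The
  mean of this majorant over one step is computed by \<open>gauss_step_le\<close>: the drift gives
  the first order part of the generator, the second differences give the trace.\<close>

lemma step_inequality:
 assumes near: "near p t0 z0 r m ct cr cx Q" and j: "j = 1 \<or> j = (-1::real)"
  and r: "0 < r" "r <= 1 / 2" and m: "0 < m" "m <= 1"
  and cont: "!!t q. abs (t - t0) <= r ==> q \<in> simplex_int ==> continuous_on UNIV (p t q)"
  and nb: "!!z. z \<in> hyper ==> norm (z - z0) <= r ==> fst z \<in> simplex_int & norm (b0 z - b0 z0) <= m"
 shows "\<exists>R\<ge>0. step_bound r j m p t0 z0 KK R (gen z0 ct cr cx Q) (err z0 cr cx)"
proof -
 define n where "n = real CARD('n)"
 define B where "B = bd0 z0"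
 have B1: "1 <= B" using l_pos by (simp add: B_def bd0_def)
 define rh0 where "rh0 = r / 4 / (1 + smax)"
 have rh0: "0 < rh0" "smax * rh0 <= r / 4" using r smax_nn by (auto simp: rh0_def divide_simps)
 \<comment> \<open>One m is the oscillation of the second derivative, the other two are the second
   difference of the penalty m * |z - z0|^2.\<close>
 define c where "c i = (s $ i)\<^sup>2 * (j * Q i + 3 * m)" for i
 define D1 where "D1 = abs ct + norm cr + norm cx + 4"
 define R1 where "R1 = (\<Sum>i\<in>UNIV. abs (c i)) * (3 * n / rh0\<^sup>2)"
 define R2 where "R2 = 3 * n / rh0 ^ 4"
 define X1 where "X1 = D1 + abs KK + abs KK"
 have nn: "0 <= R1" "0 <= R2" "0 <= X1" by (auto simp: R1_def R2_def X1_def D1_def n_def intro!: mult_nonneg_nonneg sum_nonneg)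
 show ?thesis unfolding step_bound_def
 proof (intro exI[of _ "1 + R1 + X1 * R2"] conjI allI impI)
  show "0 <= 1 + R1 + X1 * R2" using nn by simp
  fix e t z v v0 and a :: "real^'n"
  assume e: "0 < e" "e <= r / 4" "e * bd0 z0 <= r / 4" and t: "abs (t - t0) <= r / 4" and z: "z \<in> hyper" "norm (z - z0) <= r / 4"
   and a: "a \<in> cball 0 l" and v[measurable]: "v \<in> borel_measurable borel" and vb: "ALL z. abs (v z) <= KK" and v0: "abs v0 <= KK"
   and mx: "\<forall>z'\<in>hyper. norm (z' - z0) <= r --> j * v z' - pen j m p t0 z0 (t + e) z' <= j * v0 - pen j m p t0 z0 t z + e\<^sup>2"
  have KK: "0 <= KK" using v0 by simp
  have zr: "norm (z - z0) <= r" using z(2) r by linarith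
  note zs = nb[OF z(1) zr]
  define w where "w = b0 z + Gm0 a"
  define z1 where "z1 = z + e *\<^sub>R w"
  have "norm w <= norm (b0 z) + norm (Gm0 a)" unfolding w_def by (rule norm_triangle_ineq)
  also have "norm (b0 z) <= norm (b0 z0) + 1" using zs m norm_triangle_sub[of "b0 z" "b0 z0"] by linarith
  also have "norm (Gm0 a) <= l" using a by (simp add: Gm0_def)
  finally have wB: "norm w <= B" by (simp add: B_def bd0_def)
  have dw: "norm (z1 - z) <= e * B" using e(1) wB by (simp add: z1_def)
  hence dw4: "norm (z1 - z) <= r / 4" using e(3) by (simp add: B_def)
  have z1r: "norm (z1 - z0) <= r / 2" using norm_triangle_ineq[of "z1 - z" "z - z0"] dw4 z(2) by simp
  have z1h: "z1 \<in> hyper" using tangent_hyper[OF z(1) zs[THEN conjunct1], of e a 0] by (simp add: z1_def w_def Sg0_def flip: zero_prod_def)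
  have z1s: "fst z1 \<in> simplex_int" using nb[OF z1h] z1r r by auto
  have tr: "abs (t + e - t0) <= r" "abs (t - t0) <= r" using t e(1,2) r(1) by linarith+
  have boxr: "norm ((fst z1, snd z1 + u) - z0) <= r" if "!!k. abs (u $ k) <= abs (s $ k) * rh0" for u
  proof -
   have eq: "(fst z1, snd z1 + u) - z0 = (z1 - z0) + (0, u)" by (simp add: prod_eq_iff)
   have "norm u <= r / 4" using norm_le_smax[OF that] rh0 by linarith
   hence "norm ((z1 - z0) + (0, u)) <= r / 2 + r / 4" using z1r by (intro norm_triangle_le add_mono) auto
   thus ?thesis unfolding eq using r by linarith
  qed
  define X0 where "X0 = j * v0 - pen j m p t0 z0 t z + e\<^sup>2"
  define I where "I = ct * e + cr \<bullet> (fst z1 - fst z) + cx \<bullet> (snd z1 - snd z)"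
  define E where "E i = box_var e rh0 i" for i :: 'n
  define pc where "pc = measure (gauss e) (- rbox rh0 :: (real^'n) set)"
  define P where "P = pen j m p t0 z0 (t + e) z1"
  have pc: "0 <= pc" "pc <= e\<^sup>2 * R2"
   using measure_gauss_rbox_tail[OF e(1) rh0(1), where 'n='n] by (auto simp: pc_def R2_def n_def mult_ac)
  have "(LINT y|gauss e. j * v (z1 + Sg0 y)) <= (P + X0) * (1 - pc) + (\<Sum>i\<in>UNIV. (s $ i)\<^sup>2 * (j * Q i + 3 * m) * E i) / 2 + KK * pc"
   unfolding P_def E_def
  proof (rule gauss_step_le[OF e(1) rh0(1) _ _ _ _ _ _ pc_def, where f="pen j m p t0 z0 (t + e)" and v="%z. j * v z" and z=z1 and c="%i. j * Q i + 3 * m" and N="{z'. norm (z' - z0) <= r}"])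
   show "continuous_on UNIV (%x. pen j m p t0 z0 (t + e) (fst z1, x))"
    unfolding pen_def fst_conv snd_conv by (intro continuous_intros cont[OF tr(1) z1s])
   show "(fst z1, snd z1 + u) \<in> {z'. norm (z' - z0) <= r}" if "!!k. abs (u $ k) <= abs (s $ k) * rh0" for u using boxr[OF that] by simp
   show "j * v (fst z1, x) <= pen j m p t0 z0 (t + e) (fst z1, x) + X0" if "(fst z1, x) \<in> {z'. norm (z' - z0) <= r}" for x
    using mx[rule_format, of "(fst z1, x)"] z1h that unfolding X0_def by (simp add: hyper_def)
   show "abs (j * v z') <= KK" for z' using vb[rule_format, of z'] j by auto
  next
   fix i x u assume "!!t. abs t <= abs u ==> (fst z1, x + t *\<^sub>R axis i 1) \<in> {z'. norm (z' - z0) <= r}"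
   hence "j * p (t + e) (fst z1) (x + u *\<^sub>R axis i 1) + j * p (t + e) (fst z1) (x - u *\<^sub>R axis i 1) - 2 * (j * p (t + e) (fst z1) x) <= u\<^sup>2 * (j * Q i + m)"
    by (intro near_second_difference[OF near j tr(1) z1s]) auto
   moreover have "(norm ((fst z1, x + u *\<^sub>R axis i 1) - z0))\<^sup>2 + (norm ((fst z1, x - u *\<^sub>R axis i 1) - z0))\<^sup>2 - 2 * (norm ((fst z1, x) - z0))\<^sup>2 = 2 * u\<^sup>2"
   proof -
    define g where "g = (fst z1, x) - z0"
    define h where "h = (0 :: real^'n, u *\<^sub>R axis i (1::real))"
    have gh: "(fst z1, x - u *\<^sub>R axis i 1) - z0 = g - h" "(fst z1, x + u *\<^sub>R axis i 1) - z0 = g + h" by (auto simp: g_def h_def prod_eq_iff)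
    have "(norm (g + h))\<^sup>2 + (norm (g - h))\<^sup>2 - 2 * (norm g)\<^sup>2 = 2 * (norm h)\<^sup>2"
     by (simp add: power2_norm_eq_inner inner_diff_left inner_diff_right inner_add_left inner_add_right inner_commute)
    moreover have "norm h = abs u" by (simp add: h_def)
    ultimately show ?thesis unfolding gh g_def[symmetric] by simp
   qed
   hence "m * (norm ((fst z1, x + u *\<^sub>R axis i 1) - z0))\<^sup>2 + m * (norm ((fst z1, x - u *\<^sub>R axis i 1) - z0))\<^sup>2 - 2 * (m * (norm ((fst z1, x) - z0))\<^sup>2) = u\<^sup>2 * (2 * m)"
    by algebra
   moreover have "u\<^sup>2 * (j * Q i + m) + u\<^sup>2 * (2 * m) = u\<^sup>2 * (j * Q i + 3 * m)"
    by (simp add: algebra_simps)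
   ultimately show "pen j m p t0 z0 (t + e) (fst z1, x + u *\<^sub>R axis i 1) + pen j m p t0 z0 (t + e) (fst z1, x - u *\<^sub>R axis i 1)
     - 2 * pen j m p t0 z0 (t + e) (fst z1, x) <= u\<^sup>2 * (j * Q i + 3 * m)"
    unfolding pen_def fst_conv snd_conv distrib_left by linarith
  qed measurable
  hence main: "j * (LINT y|gauss e. v (z1 + Sg0 y)) <= (P + X0) * (1 - pc) + (\<Sum>i\<in>UNIV. c i * E i) / 2 + KK * pc"
   by (simp add: c_def)
  have EE: "(\<Sum>i\<in>UNIV. c i * E i) / 2 <= e * (j * ((\<Sum>i\<in>UNIV. (s $ i)\<^sup>2 * Q i) / 2) + m * (2 * (\<Sum>i\<in>UNIV. (s $ i)\<^sup>2))) + e\<^sup>2 * R1"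
  proof -
   have "c i * E i <= c i * e + abs (c i) * (6 * n * e\<^sup>2 / rh0\<^sup>2)" for i
   proof -
    have "c i * E i = c i * e + c i * (E i - e)" by (simp add: algebra_simps)
    also have "c i * (E i - e) <= abs (c i) * abs (E i - e)" by (metis abs_ge_self abs_mult)
    also have "... <= abs (c i) * (6 * n * e\<^sup>2 / rh0\<^sup>2)"
     using integral_gauss_rbox_square(1)[OF e(1) rh0(1), of i] by (intro mult_left_mono) (auto simp: E_def n_def)
    finally show ?thesis by simp
   qed
   hence "(\<Sum>i\<in>UNIV. c i * E i) <= (\<Sum>i\<in>UNIV. c i * e + abs (c i) * (6 * n * e\<^sup>2 / rh0\<^sup>2))" by (rule sum_mono)
   also have "... = (\<Sum>i\<in>UNIV. c i) * e + 2 * (e\<^sup>2 * R1)" by (simp only: sum.distrib sum_distrib_right[symmetric]) (simp add: R1_def)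
   also have "(\<Sum>i\<in>UNIV. c i) = j * (\<Sum>i\<in>UNIV. (s $ i)\<^sup>2 * Q i) + 3 * m * (\<Sum>i\<in>UNIV. (s $ i)\<^sup>2)"
    by (simp add: c_def algebra_simps sum.distrib sum_distrib_left)
   finally have "(\<Sum>i\<in>UNIV. c i * E i) / 2 <= e * (j * ((\<Sum>i\<in>UNIV. (s $ i)\<^sup>2 * Q i) / 2)) + e * (m * (\<Sum>i\<in>UNIV. (s $ i)\<^sup>2)) * (3 / 2) + e\<^sup>2 * R1"
    by (simp add: algebra_simps add_divide_distrib)
   moreover have "0 <= e * (m * (\<Sum>i\<in>UNIV. (s $ i)\<^sup>2))" using e m by (intro mult_nonneg_nonneg sum_nonneg) auto
   ultimately show ?thesis by (simp add: algebra_simps)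
  qed
  define N where "N = e + norm (fst z1 - fst z) + norm (snd z1 - snd z)"
  have fs: "norm (fst z1 - fst z) <= e * B" "norm (snd z1 - snd z) <= e * B" using norm_fst_diff[of z1 z] norm_snd_diff[of z1 z] dw by linarith+
  have N: "N <= e * (1 + 2 * B)" "N <= 1" "0 <= N" using fs e r unfolding N_def B_def by (auto simp: algebra_simps)
  have zr2: "norm (z - z0) <= r / 2" using z(2) r by simp
  have "j * p (t + e) (fst z1) (snd z1) - j * p t (fst z) (snd z) <= j * I + m * N"
   unfolding I_def N_def by (rule near_increment[OF near j tr(2,1) less_imp_le[OF e(1)] zs[THEN conjunct1] zr2 z1s z1r])
  \<comment> \<open>The same estimate with the opposite sign bounds the increment from below; this
    controls the part of the majorant lost outside the cube.\<close>
  moreover have msg: "- j = 1 \<or> - j = -1" using j by auto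
  have "- j * p (t + e) (fst z1) (snd z1) - - j * p t (fst z) (snd z) <= - j * I + m * N"
   unfolding I_def N_def by (rule near_increment[OF near msg tr(2,1) less_imp_le[OF e(1)] zs[THEN conjunct1] zr2 z1s z1r])
  moreover have "((t + e - t0)\<^sup>2 + (norm (z1 - z0))\<^sup>2) - ((t - t0)\<^sup>2 + (norm (z - z0))\<^sup>2) <= e * (2 + B)"
  proof -
   have "(t + e - t0)\<^sup>2 - (t - t0)\<^sup>2 = e * (2 * (t - t0) + e)" by (simp add: power2_eq_square algebra_simps)
   also have "... <= e * 2"
   proof (rule mult_left_mono)
    have "t - t0 <= r / 4" using t by (rule abs_le_D1)
    moreover have "r / 4 <= 1 / 2" using r by simp
    ultimately show "2 * (t - t0) + e <= 2" using e(2) by argo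
   qed (use e in simp)
   finally have "(t + e - t0)\<^sup>2 - (t - t0)\<^sup>2 <= e * 2" .
   moreover have "(norm (z1 - z0))\<^sup>2 - (norm (z - z0))\<^sup>2 = (norm (z1 - z0) - norm (z - z0)) * (norm (z1 - z0) + norm (z - z0))"
    by (simp add: power2_eq_square algebra_simps)
   moreover have "... <= (e * B) * (norm (z1 - z0) + norm (z - z0))" using norm_triangle_ineq2[of "z1 - z0" "z - z0"] dw by (intro mult_right_mono) auto
   moreover have "... <= (e * B) * 1" using z1r z(2) r e B1 by (intro mult_left_mono) auto
   ultimately show ?thesis by (simp add: algebra_simps)
  qed
  hence "m * ((t + e - t0)\<^sup>2 + (norm (z1 - z0))\<^sup>2) - m * ((t - t0)\<^sup>2 + (norm (z - z0))\<^sup>2) <= m * (e * (2 + B))"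
   using m(1) by (metis mult_le_cancel_left_pos right_diff_distrib)
  moreover have "0 <= m * ((t + e - t0)\<^sup>2 + (norm (z1 - z0))\<^sup>2)" using m by simp
  moreover have "m * ((t - t0)\<^sup>2 + (norm (z - z0))\<^sup>2) <= 1"
  proof -
   have "abs (t - t0) <= 1 / 8" "norm (z - z0) <= 1 / 8" using t z(2) r by linarith+
   hence "\<bar>t - t0\<bar>\<^sup>2 <= (1 / 8)\<^sup>2" "(norm (z - z0))\<^sup>2 <= (1 / 8)\<^sup>2" by (intro power_mono; simp)+
   hence "(t - t0)\<^sup>2 + (norm (z - z0))\<^sup>2 <= (1 / 8)\<^sup>2 + (1 / 8)\<^sup>2" unfolding power2_abs by linarith
   also have "... <= (1::real)" by (simp add: power2_eq_square)
   finally have "(t - t0)\<^sup>2 + (norm (z - z0))\<^sup>2 <= 1" .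
   thus ?thesis using mult_mono[OF m(2), of "(t - t0)\<^sup>2 + (norm (z - z0))\<^sup>2" 1] by simp
  qed
  moreover have "m * N <= m * (e * (1 + 2 * B))" "m * N <= 1"
   using N m mult_mono[OF m(2) N(2)] by (auto intro: mult_left_mono)
  moreover have "j * I <= e * (j * (ct + cr \<bullet> D_x H0 (fst z0) (snd z0) - cx \<bullet> (D_rho H0 (fst z0) (snd z0) + a)) + m * (norm cr + norm cx))"
  proof -
   define u1 where "u1 = fst (b0 z) - fst (b0 z0)"
   define u2 where "u2 = snd (b0 z) - snd (b0 z0)"
   have u: "norm u1 <= m" "norm u2 <= m"
    using norm_fst_diff[of "b0 z" "b0 z0"] norm_snd_diff[of "b0 z" "b0 z0"] zs unfolding u1_def u2_def by linarith+
   have d: "fst z1 - fst z = e *\<^sub>R (D_x H0 (fst z0) (snd z0) + u1)" "snd z1 - snd z = e *\<^sub>R (u2 - (D_rho H0 (fst z0) (snd z0) + a))"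
    by (auto simp: z1_def w_def u1_def u2_def b0_def Gm0_def)
   have "j * I = e * (j * (ct + cr \<bullet> D_x H0 (fst z0) (snd z0) - cx \<bullet> (D_rho H0 (fst z0) (snd z0) + a)) + j * (cr \<bullet> u1 + cx \<bullet> u2))"
    unfolding I_def d by (simp add: inner_add_right inner_diff_right algebra_simps)
   moreover have "j * (cr \<bullet> u1 + cx \<bullet> u2) <= m * (norm cr + norm cx)"
   proof -
    have "abs (cr \<bullet> u1) <= norm cr * m" "abs (cx \<bullet> u2) <= norm cx * m"
     using u by (auto intro!: order_trans[OF Cauchy_Schwarz_ineq2] mult_left_mono)
    thus ?thesis using j by (auto simp: algebra_simps)
   qed
   ultimately show ?thesis using e(1) by (simp add: mult_left_mono)
  qed
  moreover have "abs I <= abs ct + norm cr + norm cx"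
  proof -
   have 1: "e <= 1" "norm (fst z1 - fst z) <= 1" "norm (snd z1 - snd z) <= 1" using fs e r by (auto simp: B_def)
   have "abs (ct * e) <= abs ct * 1" unfolding abs_mult using 1 e by (intro mult_left_mono) auto
   moreover have "abs (cr \<bullet> (fst z1 - fst z)) <= norm cr * 1" "abs (cx \<bullet> (snd z1 - snd z)) <= norm cx * 1"
    using 1 by (intro order_trans[OF Cauchy_Schwarz_ineq2] mult_left_mono norm_ge_zero; simp)+
   ultimately show ?thesis unfolding I_def by linarith
  qed
  hence "- (j * I) <= abs ct + norm cr + norm cx" using j by auto
  moreover have "e * (m * (norm cr + norm cx)) + m * (e * (1 + 2 * B)) + m * (e * (2 + B)) = e * (m * (3 + 3 * B + norm cr + norm cx))"
   by (simp add: algebra_simps)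
  ultimately have inc: "P - pen j m p t0 z0 t z <= e * (j * (ct + cr \<bullet> D_x H0 (fst z0) (snd z0) - cx \<bullet> (D_rho H0 (fst z0) (snd z0) + a))) + e * (m * (3 + 3 * B + norm cr + norm cx))"
   and low: "- D1 <= P - pen j m p t0 z0 t z" unfolding P_def pen_def D1_def distrib_left[of e] by linarith+
  have "- KK <= j * v0" using v0 j by auto
  hence "- (D1 + KK) <= P + X0" using low zero_le_power2[of e] unfolding X0_def by linarith
  hence "- (P + X0) <= D1 + KK" by simp
  from mult_right_mono[OF this pc(1)] have "- ((P + X0) * pc) <= (D1 + KK) * pc" unfolding mult_minus_left .
  hence "(P + X0) * (1 - pc) + KK * pc <= P + X0 + X1 * pc" using KK by (simp add: X1_def algebra_simps)
  moreover have "X1 * pc <= X1 * (e\<^sup>2 * R2)" using pc nn by (intro mult_left_mono)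
  moreover have "P + X0 = j * v0 + (P - pen j m p t0 z0 t z) + e\<^sup>2" by (simp add: X0_def)
  moreover have "e * (j * gen z0 ct cr cx Q a + m * err z0 cr cx) =
   e * (j * (ct + cr \<bullet> D_x H0 (fst z0) (snd z0) - cx \<bullet> (D_rho H0 (fst z0) (snd z0) + a))) + e * (m * (3 + 3 * B + norm cr + norm cx))
   + e * (j * ((\<Sum>i\<in>UNIV. (s $ i)\<^sup>2 * Q i) / 2) + m * (2 * (\<Sum>i\<in>UNIV. (s $ i)\<^sup>2)))"
   by (simp add: gen_def err_def B_def algebra_simps)
  moreover have "e\<^sup>2 * (1 + R1 + X1 * R2) = e\<^sup>2 + e\<^sup>2 * R1 + X1 * (e\<^sup>2 * R2)" by (simp add: algebra_simps)
  ultimately show "j * (LINT y|gauss e. v (z + e *\<^sub>R (b0 z + Gm0 a) + Sg0 y)) <= j * v0 + e * (j * gen z0 ct cr cx Q a + m * err z0 cr cx) + e\<^sup>2 * (1 + R1 + X1 * R2)"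
   using main EE inc unfolding z1_def w_def by linarith
 qed
qed

end

context wasserstein_control
begin

text \<open>The test function touches \<open>U\<close>, but the step is taken for the discrete
  value, which is uniformly close. The penalty forces its near-maximiser into the inner ball; there
  the discrete Bellman equation and \<open>step_inequality\<close> meet, and dividing by the step
  length gives the claim up to e.\<close>

lemma viscosity_core:
 fixes A :: "real => real^'n => real^'n => real"
 assumes A: "test_function T A" and t0: "0 < t0" "t0 < T" and z0: "fst z0 \<in> simplex_int" and w: "w = 1 \<or> w = (-1::real)" and e: "0 < e"
  and r0: "0 < r0" and mx: "!!t z. abs (t - t0) <= r0 ==> z \<in> hyper ==> norm (z - z0) <= r0 ==>
   w * (U t z - A t (fst z) (snd z)) <= w * (U t0 z0 - A t0 (fst z0) (snd z0))"
 defines "G \<equiv> gen z0 (deriv (%s. A s (fst z0) (snd z0)) t0) (grad (%r. A t0 r (snd z0)) (fst z0))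
  (grad (A t0 (fst z0)) (snd z0)) (%i. hessian (A t0 (fst z0)) (snd z0) $ i $ i)"
 shows "(w = 1 --> (\<forall>a\<in>cball 0 l. 0 <= G a + Fz (t0, z0, a) + e)) & (w = -1 --> (\<exists>a\<in>cball 0 l. G a + Fz (t0, z0, a) <= e))"
proof -
 define cr where "cr = grad (%r. A t0 r (snd z0)) (fst z0)"
 define cx where "cx = grad (A t0 (fst z0)) (snd z0)"
 \<comment> \<open>One unit is added for the oscillation of the running cost and one for the terms
   of order c.\<close>
 define C where "C = err z0 cr cx + 2"
 have bd: "1 <= bd0 z0" using l_pos by (simp add: bd0_def)
 have C: "2 <= C" using bd by (simp add: C_def err_def sum_nonneg)
 define v where "v = min 1 (e / C)"
 have v: "0 < v" "v <= 1" "v * C <= e" using e C by (auto simp: v_def min_def field_simps)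
 obtain n B where B: "0 < B" and Qn: "!!z. z \<in> hyper ==> norm (z - z0) <= B ==> z \<in> Qset n" using Qset_nhd[OF z0] by blast
 have z0h: "z0 \<in> hyper" by (rule simplex_hyper[OF z0])
 have z0Q: "z0 \<in> Qset n" using Qn[OF z0h] B by simp
 obtain L where L: "0 < L" "!!z z'. z \<in> Gset n ==> z' \<in> Gset n ==> norm (b0 z - b0 z') <= L * norm (z - z')" using Gset_bounds[of n] by blast
 have uc: "uniformly_continuous_on (Cset n) Fz" by (intro compact_uniformly_continuous costs_continuous_compact Cset)
 obtain dF where dF: "0 < dF" "!!p p'. p \<in> Cset n ==> p' \<in> Cset n ==> dist p' p < dF ==> dist (Fz p') (Fz p) < v"
  by (rule uniformly_continuous_onE[OF uc v(1)]) (rule that)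
 have "compact (Fz ` Cset n)" by (intro compact_continuous_image costs_continuous_compact Cset)
 from compact_imp_bounded[OF this] obtain BF where BF: "\<forall>y\<in>Fz ` Cset n. norm y <= BF" unfolding bounded_iff by (elim exE)
 obtain RQ where RQ: "\<forall>z\<in>Qset n. norm z <= RQ" using compact_imp_bounded[OF compact_Qset, of n] unfolding bounded_iff by (elim exE)
 define Nr where "Nr r \<longleftrightarrow> near A t0 z0 r v (deriv (%s. A s (fst z0) (snd z0)) t0) cr cx (%i. hessian (A t0 (fst z0)) (snd z0) $ i $ i)" for r
 have "\<forall>\<^sub>F r in at_right 0. Nr r" using near_exists(1)[OF A t0 z0 v(1)] by (simp add: Nr_def cr_def cx_def)
 then obtain rn where rn: "0 < rn" "!!r. 0 < r ==> r < rn ==> Nr r" unfolding eventually_at_right_field by blast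
 define r where "r = Min {rn / 2, 1 / 2, r0, B, t0 / 2, (T - t0) / 2, v / L, dF / 4}"
 have r: "0 < r" using rn(1) r0 B t0 v(1) L(1) dF(1) unfolding r_def by (subst Min_gr_iff) auto
 have "\<forall>x\<in>{rn / 2, 1 / 2, r0, B, t0 / 2, (T - t0) / 2, v / L, dF / 4}. r <= x" unfolding r_def by (intro ballI Min_le) auto
 hence rl: "r <= rn / 2" "r <= 1 / 2" "r <= r0" "r <= B" "r <= t0 / 2" "r <= (T - t0) / 2" "r <= v / L" "r <= dF / 4" by auto
 have "r < rn" using rl(1) rn(1) by linarith
 note near = rn(2)[OF r this, unfolded Nr_def]
 have t_in: "t \<in> {0<..<T}" if "abs (t - t0) <= r" for t using that rl(5,6) t0 by auto
 have inQ: "z \<in> Qset n" "fst z \<in> simplex_int" if "z \<in> hyper" "norm (z - z0) <= r" for z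
 proof -
  show "z \<in> Qset n" using Qn that rl by simp
  thus "fst z \<in> simplex_int" using Qset_simplex[of n] by (auto simp: mem_Times_iff)
 qed
 have nb: "fst z \<in> simplex_int & norm (b0 z - b0 z0) <= v" if z: "z \<in> hyper" "norm (z - z0) <= r" for z
 proof
  have "norm (b0 z - b0 z0) <= L * norm (z - z0)" using inQ[OF z] z0Q Qset_G by (intro L(2)) auto
  also have "... <= L * (v / L)" using z rl L by (intro mult_left_mono) auto
  finally show "norm (b0 z - b0 z0) <= v" using L by simp
 qed (rule inQ[OF z])
 have Fclose: "abs (Fz (t, z, a) - Fz (t0, z0, a)) <= v" "Fz (t, z, a) <= BF" if t: "abs (t - t0) <= r" and z: "z \<in> hyper" "norm (z - z0) <= r" and a: "a \<in> cball 0 l" for t z a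
 proof -
  have p: "(t, z, a) \<in> Cset n" "(t0, z0, a) \<in> Cset n" using t_in[OF t] t0 inQ[OF z] z0Q a by auto
  have "dist (t, z, a) (t0, z0, a) <= abs (t - t0) + norm (z - z0)" using norm_Pair_le[of "t - t0" "(z - z0, a - a)"] by (simp add: dist_norm)
  also have "... < dF" using t z rl dF by linarith
  finally show "abs (Fz (t, z, a) - Fz (t0, z0, a)) <= v" using dF(2)[OF p(2,1)] by (simp add: dist_real_def)
  have "norm (Fz (t, z, a)) <= BF" using BF p(1) by blast
  thus "Fz (t, z, a) <= BF" by simp
 qed
 \<comment> \<open>Comparing with the centre costs \<open>4 * ep1\<close> and near-maximality costs
   \<open>c^2\<close>; each is at most \<open>v * r^2 / 32\<close>, together
   \<open>v * (r / 4)^2\<close>.\<close>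
 define ep1 where "ep1 = v * r\<^sup>2 / 128"
 have ep1: "0 < ep1" using v r by (simp add: ep1_def)
 obtain N k where N: "0 <= N" "BF <= N" and k: "n <= k" and cl: "close ep1 n N k" using costk_close[OF ep1] by blast
 obtain L' K where "bounded_problem M \<F> W l T L' K (bG k) Gm0 Sg0 (fk N k) (gk N k)" using bpk[OF N(1)] by blast
 then interpret P: bounded_problem M \<F> W l T L' K "bG k" Gm0 Sg0 "fk N k" "gk N k" .
 define KK where "KK = K * (1 + T)"
 have vK: "abs (P.vs d m z) <= KK" if "0 < d" "real m * d <= T" for d m z
  using P.vs_bound[OF that(1), of m z] mult_left_mono[of "1 + real m * d" "1 + T" K] that P.K_nn by (simp add: KK_def)
 obtain R where R: "0 <= R" and step: "step_bound r w v A t0 z0 KK R G (err z0 cr cx)"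
  using step_inequality[OF near w r rl(2) v(1,2) near_exists(2)[OF A t0 z0 v(1) t_in] nb, of KK] unfolding G_def cr_def cx_def by blast
 \<comment> \<open>The first three bounds keep one step inside the neighbourhood, the fourth makes
   \<open>c^2\<close> small against the penalty, the last makes \<open>c * (R + 1)\<close> at most
   v.\<close>
 define de0 where "de0 = Min {1, r / 4, r / 4 / bd0 z0, v * r\<^sup>2 / 32, v / (R + 1)}"
 have de0: "0 < de0" using r bd v(1) R unfolding de0_def by (subst Min_gr_iff) auto
 have "\<forall>x\<in>{1, r / 4, r / 4 / bd0 z0, v * r\<^sup>2 / 32, v / (R + 1)}. de0 <= x" unfolding de0_def by (intro ballI Min_le) auto
 hence dela: "de0 <= 1" "de0 <= r / 4" "de0 <= r / 4 / bd0 z0" "de0 <= v * r\<^sup>2 / 32" "de0 <= v / (R + 1)" by auto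
 obtain j1 where j1: "!!j m z. j1 <= j ==> real m * ((T - t0) / 2 ^ j) <= T ==> norm z <= RQ ==>
  abs (P.vs ((T - t0) / 2 ^ j) m z - P.u (T - real m * ((T - t0) / 2 ^ j)) z) <= ep1"
  using P.vs_local_uniform[OF less_imp_le[OF t0(1)] t0(2) ep1, of RQ] by blast
 have "\<forall>\<^sub>F j in sequentially. (T - t0) / 2 ^ j < de0"
  by (rule order_tendstoD(2)[OF _ de0]) (use LIMSEQ_divide_realpow_zero[of 2 "T - t0"] in simp)
 then obtain j where j: "j1 <= j" "(T - t0) / 2 ^ j < de0" unfolding eventually_sequentially by (metis max.cobounded1 max.cobounded2)
 define c where "c = (T - t0) / 2 ^ j"
 have c: "0 < c" "c <= de0" using t0 j by (auto simp: c_def)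
 have "c <= r / 4 / bd0 z0" using c dela by linarith
 hence deb: "c * bd0 z0 <= r / 4" using bd by (simp add: pos_le_divide_eq)
 have "c <= v / (R + 1)" using c dela by linarith
 hence deR: "c * (R + 1) <= v" using R by (simp add: pos_le_divide_eq)
 have "c * c <= c * 1" using c dela by (intro mult_left_mono) auto
 hence de2: "c\<^sup>2 <= v * r\<^sup>2 / 32" using c dela unfolding power2_eq_square by linarith
 \<comment> \<open>Pairs of remaining steps and state over the neighbourhood; by the dyadic mesh the
   centre is the pair with \<open>2 ^ j\<close> steps left.\<close>
 define S where "S = {p :: nat \<times> (real^'n) \<times> (real^'n). real (fst p) * c <= T & abs (T - real (fst p) * c - t0) <= r & snd p \<in> hyper & norm (snd p - z0) <= r}"
 define Gr where "Gr p = w * P.vs c (fst p) (snd p) - pen w v A t0 z0 (T - real (fst p) * c) (snd p)" for p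
 define base where "base = w * (U t0 z0 - A t0 (fst z0) (snd z0))"
 have app: "abs (w * P.vs c (fst p) (snd p) - w * U (T - real (fst p) * c) (snd p)) <= 2 * ep1" if p: "p \<in> S" for p
 proof -
  have q: "snd p \<in> Qset n" "0 <= T - real (fst p) * c" "T - real (fst p) * c <= T" using p inQ c by (auto simp: S_def)
  have "abs (P.vs c (fst p) (snd p) - P.u (T - real (fst p) * c) (snd p)) <= ep1"
   unfolding c_def by (rule j1[OF j(1)]) (use q RQ in \<open>auto simp: c_def\<close>)
  moreover have "abs (U (T - real (fst p) * c) (snd p) - P.u (T - real (fst p) * c) (snd p)) <= ep1" by (rule U_close[OF cl N(1) q(2,3,1)])
  ultimately show ?thesis using w by auto
 qed
 have up: "Gr p <= base + 2 * ep1 - v * ((T - real (fst p) * c - t0)\<^sup>2 + (norm (snd p - z0))\<^sup>2)" if p: "p \<in> S" for p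
  using app[OF p] mx[of "T - real (fst p) * c" "snd p"] p rl(3) unfolding S_def Gr_def pen_def base_def right_diff_distrib by auto
 have pt: "real (2 ^ j) * c = T - t0" by (simp add: c_def)
 have p0: "(2 ^ j, z0) \<in> S" using t0 z0h r pt by (simp add: S_def)
 have lowb: "base - 2 * ep1 <= Gr (2 ^ j, z0)" using app[OF p0] unfolding Gr_def pen_def base_def fst_conv snd_conv pt right_diff_distrib by simp
 have "Gr p <= base + 2 * ep1" if "p \<in> S" for p
 proof -
  have "0 <= v * ((T - real (fst p) * c - t0)\<^sup>2 + (norm (snd p - z0))\<^sup>2)" using v by simp
  thus ?thesis using up[OF that] by linarith
 qed
 moreover have "0 < c\<^sup>2" using c by simp
 ultimately obtain p where p: "p \<in> S" and pmax: "!!p'. p' \<in> S ==> Gr p' <= Gr p + c\<^sup>2" using near_maximiser[OF p0] by metis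
 define m where "m = fst p"
 define z where "z = snd p"
 define t where "t = T - real m * c"
 have z: "z \<in> hyper" "norm (z - z0) <= r" "real m * c <= T" using p by (auto simp: S_def z_def m_def)
 have "v * ((t - t0)\<^sup>2 + (norm (z - z0))\<^sup>2) <= 4 * ep1 + c\<^sup>2"
  using up[OF p] lowb pmax[OF p0] unfolding t_def m_def z_def by linarith
 also have "... <= v * (r / 4)\<^sup>2" using de2 by (simp add: ep1_def power_divide)
 finally have close: "(t - t0)\<^sup>2 + (norm (z - z0))\<^sup>2 <= (r / 4)\<^sup>2" using v by simp
 hence "(t - t0)\<^sup>2 <= (r / 4)\<^sup>2" "(norm (z - z0))\<^sup>2 <= (r / 4)\<^sup>2"
  using zero_le_power2[of "t - t0"] zero_le_power2[of "norm (z - z0)"] by linarith+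
 hence tz: "abs (t - t0) <= r / 4" "norm (z - z0) <= r / 4" using r by (auto simp: abs_le_square_iff[symmetric] intro: power2_le_imp_le)
 \<comment> \<open>At least one step must be left in order to apply the recursion; the
   near-maximiser is too close to t0 < T for m = 0.\<close>
 have "m ~= 0"
 proof
  assume "m = 0"
  hence "t = T" by (simp add: t_def)
  hence "T - t0 <= r / 4" using abs_le_D1[OF tz(1)] by simp
  thus False using rl(6) t0 by argo
 qed
 then obtain m' where m': "m = Suc m'" by (cases m) auto
 have tm': "T - real m' * c = t + c" by (simp add: t_def m' algebra_simps)
 have m'T: "real m' * c <= T" using z(3) c by (simp add: m' algebra_simps)
 have tr: "abs (t - t0) <= r" "abs (t + c - t0) <= r" using tz(1) c dela r by linarith+
 have st: "w * P.Pst c (P.vs c m') z a <= w * P.vs c m z + c * (w * G a + v * err z0 cr cx) + c\<^sup>2 * R" if a: "a \<in> cball 0 l" for a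
 proof -
  have "z \<in> Gset k" using inQ(1)[OF z(1,2)] Qset_G Gset_mono[OF k] by blast
  hence eq: "P.Pst c (P.vs c m') z a = (LINT y|gauss c. P.vs c m' (z + c *\<^sub>R (b0 z + Gm0 a) + Sg0 y))"
   by (simp add: P.Pst_def P.stepf_def bG_eq)
  show ?thesis unfolding eq
  proof (rule step[unfolded step_bound_def, rule_format, OF c(1) _ deb tz(1) z(1) tz(2) a P.vs_measurable[OF c(1)]])
   show "c <= r / 4" using c dela by linarith
   show "abs (P.vs c m' z') <= KK" "abs (P.vs c m z) <= KK" for z' using vK[OF c(1) m'T] vK[OF c(1) z(3)] by auto
   fix z' assume z': "z' \<in> hyper" "norm (z' - z0) <= r"
   hence "(m', z') \<in> S" using tr m'T by (simp add: S_def tm')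
   from pmax[OF this] show "w * P.vs c m' z' - pen w v A t0 z0 (t + c) z' <= w * P.vs c m z - pen w v A t0 z0 t z + c\<^sup>2"
    unfolding Gr_def fst_conv snd_conv tm' m_def[symmetric] z_def[symmetric] t_def[symmetric] .
  qed
 qed
 have f: "fk N k (T - real (Suc m') * c, z, a) = Fz (t, z, a)" if a: "a \<in> cball 0 l" for a
 proof -
  have "fk N k (t, z, a) = min (Fz (t, z, a)) N" using t_in[OF tr(1)] inQ(1)[OF z(1,2)] Qset_mono[OF k] a by (intro fk_eq) auto
  also have "... = Fz (t, z, a)" using Fclose(2)[OF tr(1) z(1,2) a] N by simp
  finally show ?thesis by (simp add: t_def m')
 qed
 have fin: "x <= v * err z0 cr cx + c * R + c + v ==> x <= e" for x
  using v(3) deR unfolding C_def by (simp add: algebra_simps)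
 show ?thesis
 proof (intro conjI impI ballI)
  fix a assume s1: "w = 1" and a: "a \<in> cball (0::real^'n) l"
  have "P.vs c m z <= c * Fz (t, z, a) + P.Pst c (P.vs c m') z a" using P.vs_le_body[OF c(1) a, of m' z] unfolding f[OF a] m' .
  moreover have "c * (- G a - Fz (t, z, a)) <= c * (v * err z0 cr cx + c * R)"
   using calculation st[OF a] unfolding s1 by (simp add: power2_eq_square algebra_simps)
  hence "- G a - Fz (t, z, a) <= v * err z0 cr cx + c * R" using c(1) by simp
  hence "- G a - Fz (t0, z0, a) <= e" using Fclose(1)[OF tr(1) z(1,2) a] c(1) by (intro fin) auto
  thus "0 <= G a + Fz (t0, z0, a) + e" by linarith
 next
  assume s1: "w = -1"
  have "P.vs c (Suc m') z < P.vs c (Suc m') z + c\<^sup>2" using c by simp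
  then obtain a where a: "a \<in> cball 0 l" and b': "c * fk N k (T - real (Suc m') * c, z, a) + P.Pst c (P.vs c m') z a < P.vs c (Suc m') z + c\<^sup>2"
   unfolding P.vs.simps by (subst (asm) cINF_less_iff[OF P.ball_ne P.bdd_body[OF c(1)]]) blast
  have b: "c * Fz (t, z, a) + P.Pst c (P.vs c m') z a < P.vs c m z + c\<^sup>2" using b' unfolding f[OF a] m' .
  have "c * (G a + Fz (t, z, a)) <= c * (v * err z0 cr cx + c * R + c)"
   using b st[OF a] unfolding s1 by (simp add: power2_eq_square algebra_simps)
  hence "G a + Fz (t, z, a) <= v * err z0 cr cx + c * R + c" using c(1) by simp
  hence "G a + Fz (t0, z0, a) <= e" using Fclose(1)[OF tr(1) z(1,2) a] by (intro fin) auto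
  thus "\<exists>a\<in>cball 0 l. G a + Fz (t0, z0, a) <= e" using a by blast
 qed
qed

text \<open>The simplex derivative is paired only with \<open>D_x H0\<close>, which is tangent to
  the simplex, so there it can be exchanged for the Euclidean gradient.\<close>

lemma hamiltonian_eq:
 assumes p: "p \<in> simplex_int" and f: "(f has_derivative (%d. d \<bullet> cr)) (at p)"
 shows "hamiltonian H0 (diag_matrix s) l F t p x (simplex_derivative f p) q Q = (INF a\<in>cball 0 l. gen (p, x) 0 cr q (%i. Q $ i $ i) a + F t p x a)"
proof -
 have Dx: "D_x (controlled_energy H0 a) p x = D_x H0 p x" for a unfolding D_x_def[of "controlled_energy H0 a"] controlled_energy_def
  by (rule gradI) (use H0_x_derivative(1)[OF p] in \<open>auto intro!: derivative_eq_intros\<close>)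
 have Dr: "D_rho (controlled_energy H0 a) p x = D_rho H0 p x + a" for a unfolding D_rho_def[of "controlled_energy H0 a"]
 proof (rule gradI)
  have "((%r. (r, x)) has_derivative (%d. (d, 0))) (at p)" by (auto intro!: derivative_eq_intros)
  from has_derivative_compose[OF this H0_derivative[OF p]] have "((%r. H0 r x) has_derivative (%d. d \<bullet> D_rho H0 p x)) (at p)" by simp
  moreover have "(\<Sum>i\<in>UNIV. a $ i * r $ i) = r \<bullet> a" for r by (simp add: inner_vec_def mult.commute)
  ultimately show "((%r. controlled_energy H0 a r x) has_derivative (%d. d \<bullet> (D_rho H0 p x + a))) (at p)"
   unfolding controlled_energy_def by (auto intro!: derivative_eq_intros simp: inner_add_right)
 qed
 have "p \<in> simplex_P" using p rel_interior_subset by blast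
 moreover have "(\<Sum>i\<in>UNIV. D_x H0 p x $ i) = 0" using tangent p by (simp add: tangent_to_simplex_def)
 ultimately have "simplex_derivative f p \<bullet> D_x H0 p x = cr \<bullet> D_x H0 p x" by (rule simplex_derivative_inner[OF f])
 thus ?thesis unfolding hamiltonian_def Dx Dr trace_diag gen_def by simp
qed

lemma viscosity: "viscosity_solution (hamiltonian H0 (diag_matrix s) l F) T h (value_function M \<F> W (diag_matrix s) H0 l T F h)"
proof -
 let ?H = "hamiltonian H0 (diag_matrix s) l F" and ?U = "value_function M \<F> W (diag_matrix s) H0 l T F h"
 let ?D = "{0<..<T} \<times> simplex_int \<times> (UNIV :: (real^'n) set)"
 have eq: "?U t j x = U t (j, x)" if "0 < t" "t <= T" "j \<in> simplex_int" for t j x using that by (intro value_function_eq) auto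
 have "continuous_on ({0<..T} \<times> simplex_int \<times> (UNIV :: (real^'n) set)) (%(t, z). U t z)" by (rule continuous_on_subset[OF U_continuous]) auto
 hence cont: "continuous_on ({0<..T} \<times> simplex_int \<times> UNIV) (%(t, j, x). ?U t j x)" by (rule continuous_on_eq) (auto simp: eq)
 have UT: "?U T j x = h j x" if "j \<in> simplex_int" for j x using that T_pos by (simp add: eq U_T)
 \<comment> \<open>A minimum is treated as a maximum of the negated difference. The slack e
   disappears because it is arbitrary: in the subsolution case for each control, in the
   supersolution case through the lower bound of the infimum.\<close>
 have core: "(v = 1 --> 0 <= HJB_expression ?H k t j x) & (v = -1 --> HJB_expression ?H k t j x <= 0)"
  if k: "test_function T k" and loc: "local_max_on (%(t, j, x). v * (?U t j x - k t j x)) ?D (t, j, x)" and v: "v = 1 \<or> v = (-1::real)" for k t j x v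
 proof -
  let ?z = "(j, x)"
  have t: "0 < t" "t < T" and j: "j \<in> simplex_int" using loc by (auto simp: local_max_on_def)
  let ?g = "%p. case p of (t, j, x) => v * (?U t j x - k t j x)"
  obtain d where d: "0 < d" and mx0: "\<forall>p\<in>?D. p ~= (t, j, x) & dist p (t, j, x) < d --> ?g p <= ?g (t, j, x)"
   using loc[unfolded local_max_on_def eventually_at] by (elim conjE exE)
  have mx: "?g p <= ?g (t, j, x)" if "p \<in> ?D" "dist p (t, j, x) < d" for p using bspec[OF mx0 that(1)] that(2) by (cases "p = (t, j, x)") auto
  define r0 where "r0 = min (d / 4) (min (t / 2) ((T - t) / 2))"
  have r0: "0 < r0" using d t by (simp add: r0_def)
  have mx': "v * (U t' z' - k t' (fst z') (snd z')) <= v * (U t ?z - k t (fst ?z) (snd ?z))"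
   if "abs (t' - t) <= r0" "fst z' \<in> simplex_int" "norm (z' - ?z) <= r0" for t' z'
  proof -
   have "r0 <= t / 2" "r0 <= (T - t) / 2" unfolding r0_def by (rule min.coboundedI2[OF min.cobounded1], rule min.coboundedI2[OF min.cobounded2])
   moreover have "t' - t <= r0" "t - t' <= r0" using that(1) by (auto simp: abs_le_iff)
   ultimately have t': "0 < t'" "t' < T" using t by argo+
   have "dist (t', z') (t, ?z) <= abs (t' - t) + norm (z' - ?z)" using norm_Pair_le[of "t' - t" "z' - ?z"] by (simp add: dist_norm)
   also have "... < d" using that(1,3) d by (simp add: r0_def)
   finally show ?thesis using mx[of "(t', z')"] t' that(2) t j by (cases z') (auto simp: eq)
  qed
  have zz: "fst ?z \<in> simplex_int" using j by simp
  obtain n m where m: "0 < m" "!!z'. z' \<in> hyper ==> norm (z' - ?z) <= m ==> z' \<in> Qset n" using Qset_nhd[OF zz] by blast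
  define ct where "ct = deriv (%s. k s j x) t"
  define cr where "cr = grad (%r. k t r x) j"
  define cx where "cx = grad (k t j) x"
  define Q where "Q i = hessian (k t j) x $ i $ i" for i
  let ?G = "%a. gen ?z 0 cr cx Q a + F t j x a"
  have c: "(v = 1 --> (\<forall>a\<in>cball 0 l. 0 <= gen ?z ct cr cx Q a + F t j x a + e)) & (v = -1 --> (\<exists>a\<in>cball 0 l. gen ?z ct cr cx Q a + F t j x a <= e))"
   if e: "0 < e" for e using viscosity_core[OF k t zz v e, of "min r0 m"] r0 m mx' Qset_simplex[of n]
   unfolding ct_def cr_def cx_def Q_def[abs_def] fst_conv snd_conv by (fastforce simp: mem_Times_iff)
  have HJB: "HJB_expression ?H k t j x = ct + (INF a\<in>cball 0 l. ?G a)"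
   unfolding HJB_expression_def hamiltonian_eq[OF j near_exists(3)[OF k t zz zero_less_one, unfolded fst_conv snd_conv]]
   by (simp add: ct_def cr_def cx_def Q_def[abs_def])
  have g0: "gen ?z ct cr cx Q a = ct + gen ?z 0 cr cx Q a" for a by (simp add: gen_def)
  have ne: "cball 0 l ~= ({} :: (real^'n) set)" using l_pos by simp
  have "gen ?z 0 cr cx Q 0 - norm cx * l <= ?G a" if a: "a \<in> cball 0 l" for a
  proof -
   have "cx \<bullet> a <= norm cx * norm a" by (rule norm_cauchy_schwarz)
   also have "... <= norm cx * l" using a by (intro mult_left_mono) auto
   finally show ?thesis using costs_nonneg(1)[of t ?z a] a t j by (simp add: gen_def inner_add_right)
  qed
  hence bdd: "bdd_below (?G ` cball 0 l)" by (intro bdd_belowI2)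
  show ?thesis unfolding HJB
  proof (intro conjI impI)
   assume s1: "v = 1"
   have "- ct <= (INF a\<in>cball 0 l. ?G a)"
   proof (rule cINF_greatest[OF ne], rule field_le_epsilon)
    fix a and e :: real assume "a \<in> cball (0::real^'n) l" "0 < e"
    thus "- ct <= ?G a + e" using c s1 g0 by fastforce
   qed
   thus "0 <= ct + (INF a\<in>cball 0 l. ?G a)" by simp
  next
   assume s1: "v = -1"
   show "ct + (INF a\<in>cball 0 l. ?G a) <= 0"
   proof (rule field_le_epsilon)
    fix e :: real assume "0 < e"
    then obtain a where a: "a \<in> cball 0 l" "gen ?z ct cr cx Q a + F t j x a <= e" using c s1 by blast
    thus "ct + (INF a\<in>cball 0 l. ?G a) <= 0 + e" using cINF_lower[OF bdd a(1)] g0 by simp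
   qed
  qed
 qed
 have "local_max_on (%(t, j, x). 1 * (?U t j x - k t j x)) ?D p" if "local_max_on (%(t, j, x). ?U t j x - k t j x) ?D p" for k p
  using that by simp
 moreover have "local_max_on (%(t, j, x). -1 * (?U t j x - k t j x)) ?D p" if "local_min_on (%(t, j, x). ?U t j x - k t j x) ?D p" for k p
  using that unfolding local_max_on_def local_min_on_def by (auto simp: split_beta' elim: eventually_mono)
 ultimately show ?thesis unfolding viscosity_solution_def viscosity_subsolution_def viscosity_supersolution_def
  using cont UT core[of _ 1] core[of _ "-1"] by (auto simp del: mult_1 mult_minus1)
qed

end

theorem theorem3p3:
  fixes E :: "('n::finite \<times> 'n) set" and w :: "'n \<Rightarrow> 'n \<Rightarrow> real"
    and g :: "real \<Rightarrow> real \<Rightarrow> real"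
    and H0 :: "real^'n \<Rightarrow> real^'n \<Rightarrow> real"
    and M :: "'w measure" and \<F> :: "real \<Rightarrow> 'w measure" and W :: "real \<Rightarrow> 'w \<Rightarrow> real^'n"
    and s :: "real^'n" and l T C1 C2 :: real
    and F :: "real \<Rightarrow> real^'n \<Rightarrow> real^'n \<Rightarrow> real^'n \<Rightarrow> real"
    and h :: "real^'n \<Rightarrow> real^'n \<Rightarrow> real"
  assumes graph: "weighted_graph E w"
    and weight: "admissible_weight g"
    and basis: "complete_filtered_prob_space M \<F>"
    and brownian: "standard_Brownian_motion M \<F> W"
    and energy: "admissible_energy E H0"
    and tangent: "tangent_to_simplex H0"
    and "l > 0" and "T > 0"
    and costs: "admissible_costs E H0 l T F h"
    and "C1 > 0" and "C2 > 0"
    and second_derivatives: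
      "\<And>i \<rho> x. \<rho> \<in> simplex_int \<Longrightarrow> has_second_partial i (H0 \<rho>) x"
    and growth: "\<And>\<rho> x v. \<rho> \<in> simplex_int \<Longrightarrow> v \<in> cball 0 l \<Longrightarrow>
      norm (D_x (controlled_energy H0 v) \<rho> x)
        + (\<Sum>i\<in>UNIV. \<bar>second_partial i (controlled_energy H0 v \<rho>) x\<bar>)
      \<le> C1 * controlled_energy H0 v \<rho> x + C2"
  shows "viscosity_solution (hamiltonian H0 (diag_matrix s) l F) T h
           (value_function M \<F> W (diag_matrix s) H0 l T F h)"
proof -
  interpret wasserstein_control M \<F> W E w H0 s l T C1 C2 F h
    by (intro wasserstein_control.intro wasserstein_control_axioms.intro brownian_basis.intro)
      (fact assms)+
  show ?thesis by (rule viscosity)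
qed

end
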